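(* Let $p\ge1$ be an integer, let $\theta\in(-\pi,\pi)\setminus\{0\}$, and let $f(z):={}_pF_p[a_1,\ldots,a_p;b_1,\ldots,b_p;z]$ be a hypergeometric function with parameters $a_j\in\mathbb Q$ and $b_j\in\mathbb Q\setminus\mathbb Z_{\le0}$. Then $f$ has an asymptotic expansion $$f(x)\approx\sum_{\rho\in\Sigma}e^{\rho x}\sum_{\alpha\in S}\sum_{i\in T}\sum_{n=0}^\infty c_{\rho,\alpha,i,n}x^{-n-\alpha}\log(1/x)^i$$ in a large sector bisected by $\theta$, with $\Sigma\subset\{0,1\}$, with $S\subset\mathbb Q$ and $T\subset\mathbb N$ both finite, and with all coefficients $c_{\rho,\alpha,i,n}$ in $\mathbf{H}$.
   Context: Fix an embedding of $\overline{\mathbb Q}$ into $\mathbb C$. Hypergeometric series: ${}_pF_q[a_1,\ldots,a_p;b_1,\ldots,b_q;z]:=\sum_{n=0}^\infty\frac{(a_1)_n\cdots(a_p)_n}{(1)_n(b_1)_n\cdots(b_q)_n}z^n$, where $(a)_0=1$, $(a)_n=a(a+1)\cdots(a+n-1)$ for $n\ge 1$. $\mathbf{H}$ is the subring of $\mathbb C$ generated by $\overline{\mathbb Q}$, $1/\pi$ and the values $\Gamma^{(n)}(r)$, $n\ge 0$, $r\in\mathbb Q\setminus\mathbb Z_{\le0}$, where $\Gamma$ is the Euler Gamma function. Asymptotic expansion: let $\theta\in\mathbb R$, let $\Sigma\subset\mathbb C$, $S\subset\mathbb C$, $T\subset\mathbb N=\{0,1,2,\ldots\}$ be finite subsets,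 and let $c_{\rho,\alpha,i,n}\in\mathbb C$. One writes $$f(x)\approx\sum_{\rho\in\Sigma}e^{\rho x}\sum_{\alpha\in S}\sum_{i\in T}\sum_{n=0}^\infty c_{\rho,\alpha,i,n}x^{-n-\alpha}\log(1/x)^i$$ and says that the right-hand side is the asymptotic expansion of $f(x)$ in a large sector bisected by the direction $\theta$ if there exist $\varepsilon,R,B,C>0$ and, for each $\rho\in\Sigma$, a function $f_\rho$ holomorphic in $$U=\Big\{x\in\mathbb C:\ |x|\ge R,\ \theta-\frac\pi2-\varepsilon\le\arg(x)\le\theta+\frac\pi2+\varepsilon\Big\}$$ such that $f(x)=\sum_{\rho\in\Sigma}e^{\rho x}f_\rho(x)$ on $U$ and $$\Big|f_\rho(x)-\sum_{\alpha\in S}\sum_{i\in T}\sum_{n=0}^{N-1}c_{\rho,\alpha,i,n}x^{-n-\alpha}\log(1/x)^i\Big|\le C^NN!\,|x|^{B-N}$$ for any $x\in U$ and any $N\ge1$. Here $x^{-n-\alpha}$ and $\log(1/x)=-\log x$ are defined using the determination of $\arg(x)$ in the definition of $U$. It is implicitly assumed that $\Sigma,S,T$ cannot trivially be made smaller, and that for any $\alpha$ there exist $\rho$ and $i$ with $c_{\rho,\alpha,i,0}\ne0$. *)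

theory Defs
  imports "HOL-Analysis.Analysis"
begin

definition hypergeometric :: "complex list \<Rightarrow> complex list \<Rightarrow> complex \<Rightarrow> complex" where
  "hypergeometric as bs z = eval_fps (fps_hypergeo as bs 1) z"

lemma foldl_mult_eq_prod_list:
  fixes g :: "'a \<Rightarrow> 'b :: comm_monoid_mult"
  shows "foldl (\<lambda>r x. r * g x) u xs = u * (\<Prod>x\<leftarrow>xs. g x)"
  by (induction xs arbitrary: u) (simp_all add: mult.assoc)

lemma hypergeometric_altdef:
  "hypergeometric as bs z =
     (\<Sum>n. (\<Prod>a\<leftarrow>as. pochhammer a n) / (pochhammer 1 n * (\<Prod>b\<leftarrow>bs. pochhammer b n)) * z ^ n)"
  by (simp add: hypergeometric_def eval_fps_def foldl_mult_eq_prod_list mult.commute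
        flip: pochhammer_fact)

inductive_set subring_generated :: "'a :: ring_1 set \<Rightarrow> 'a set" for G where
  gen: "x \<in> G \<Longrightarrow> x \<in> subring_generated G"
| one: "1 \<in> subring_generated G"
| diff: "x \<in> subring_generated G \<Longrightarrow> y \<in> subring_generated G \<Longrightarrow> x - y \<in> subring_generated G"
| mult: "x \<in> subring_generated G \<Longrightarrow> y \<in> subring_generated G \<Longrightarrow> x * y \<in> subring_generated G"

definition H_ring :: "complex set" where
  "H_ring = subring_generated
     ({x. algebraic x} \<union> {1 / of_real pi} \<union>
      {(deriv ^^ n) Gamma r | n r. r \<in> \<rat> - \<int>\<^sub>\<le>\<^sub>0})"

(* The determination of the argument with values in ]\<theta> - pi, \<theta> + pi]. *)
definition arg_about :: "real \<Rightarrow> complex \<Rightarrow> real" where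
  "arg_about \<theta> x = \<theta> + Arg (x / cis \<theta>)"

definition log_about :: "real \<Rightarrow> complex \<Rightarrow> complex" where
  "log_about \<theta> x = Complex (ln (norm x)) (arg_about \<theta> x)"

lemma arg_about_bounds: "\<theta> - pi < arg_about \<theta> x" "arg_about \<theta> x \<le> \<theta> + pi"
  using Arg_bounded[of "x / cis \<theta>"] by (auto simp: arg_about_def)

lemma exp_log_about:
  assumes "x \<noteq> 0"
  shows "exp (log_about \<theta> x) = x"
proof -
  have "x / cis \<theta> = of_real (norm x) * cis (Arg (x / cis \<theta>))"
    using rcis_cmod_Arg[of "x / cis \<theta>"] by (simp add: rcis_def norm_divide)
  hence "x = of_real (norm x) * (cis \<theta> * cis (Arg (x / cis \<theta>)))"
    by (simp add: field_simps)
  thus ?thesis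
    using assms by (simp add: log_about_def exp_eq_polar arg_about_def cis_mult exp_of_real)
qed

definition large_sector :: "real \<Rightarrow> real \<Rightarrow> real \<Rightarrow> complex set" where
  "large_sector \<theta> \<epsilon> R =
     {x. R \<le> norm x \<and> \<theta> - pi / 2 - \<epsilon> \<le> arg_about \<theta> x \<and> arg_about \<theta> x \<le> \<theta> + pi / 2 + \<epsilon>}"

(* The term x^(-n-\<alpha>) log(1/x)^i, with the determination of log x above. *)
definition asymp_term :: "real \<Rightarrow> complex \<Rightarrow> nat \<Rightarrow> nat \<Rightarrow> complex \<Rightarrow> complex" where
  "asymp_term \<theta> \<alpha> i n x = exp ((- of_nat n - \<alpha>) * log_about \<theta> x) * (- log_about \<theta> x) ^ i"

(* The sets \<Sigma>, S, T cannot trivially be made smaller: no index carries only zero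
   coefficients, no two exponents in S differ by an integer (their series could be merged),
   and each exponent in S has a nonzero leading coefficient. *)
definition reduced_expansion ::
  "complex set \<Rightarrow> complex set \<Rightarrow> nat set \<Rightarrow> (complex \<Rightarrow> complex \<Rightarrow> nat \<Rightarrow> nat \<Rightarrow> complex) \<Rightarrow> bool" where
  "reduced_expansion \<Sigma> S T c \<longleftrightarrow>
     (\<forall>\<rho>\<in>\<Sigma>. \<exists>\<alpha>\<in>S. \<exists>i\<in>T. \<exists>n. c \<rho> \<alpha> i n \<noteq> 0) \<and>
     (\<forall>i\<in>T. \<exists>\<rho>\<in>\<Sigma>. \<exists>\<alpha>\<in>S. \<exists>n. c \<rho> \<alpha> i n \<noteq> 0) \<and>
     (\<forall>\<alpha>\<in>S. \<forall>\<beta>\<in>S. \<alpha> - \<beta> \<in> \<int> \<longrightarrow> \<alpha> = \<beta>) \<and>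
     (\<forall>\<alpha>\<in>S. \<exists>\<rho>\<in>\<Sigma>. \<exists>i\<in>T. c \<rho> \<alpha> i 0 \<noteq> 0)"

(* The bound \<epsilon> < pi/2 makes the determination of the argument on the sector unique; it loses
   no generality, as all conditions persist when \<epsilon> decreases. The sector is closed, and
   holomorphic means holomorphic on a neighbourhood of it, hence analytic_on. *)
definition has_asymp_expansion ::
  "(complex \<Rightarrow> complex) \<Rightarrow> real \<Rightarrow> complex set \<Rightarrow> complex set \<Rightarrow> nat set \<Rightarrow>
   (complex \<Rightarrow> complex \<Rightarrow> nat \<Rightarrow> nat \<Rightarrow> complex) \<Rightarrow> bool" where
  "has_asymp_expansion f \<theta> \<Sigma> S T c \<longleftrightarrow>
     finite \<Sigma> \<and> finite S \<and> finite T \<and> reduced_expansion \<Sigma> S T c \<and>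
     (\<exists>\<epsilon> R B C :: real. \<exists>F :: complex \<Rightarrow> complex \<Rightarrow> complex.
        0 < \<epsilon> \<and> \<epsilon> < pi / 2 \<and> 0 < R \<and> 0 < B \<and> 0 < C \<and>
        (\<forall>\<rho>\<in>\<Sigma>. F \<rho> analytic_on large_sector \<theta> \<epsilon> R) \<and>
        (\<forall>x\<in>large_sector \<theta> \<epsilon> R. f x = (\<Sum>\<rho>\<in>\<Sigma>. exp (\<rho> * x) * F \<rho> x)) \<and>
        (\<forall>\<rho>\<in>\<Sigma>. \<forall>x\<in>large_sector \<theta> \<epsilon> R. \<forall>N\<ge>1.
           norm (F \<rho> x - (\<Sum>\<alpha>\<in>S. \<Sum>i\<in>T. \<Sum>n<N. c \<rho> \<alpha> i n * asymp_term \<theta> \<alpha> i n x))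
             \<le> C ^ N * fact N * norm x powr (B - real N)))"

end

(* The class of functions F0 + e^x F1, where F0 and F1 have Gevrey expansions of order one in powers
   of x^(1/q) and log x with coefficients in H, is closed under f + K x g. The contiguity relations
   therefore reduce the theorem to parameters with a_j >= 2 and b_j - a_j >= 2. For these, the moments
   of a multiplicative convolution phi of beta densities are quotients of Gamma values, so that
   f(x) is a constant in H times the integral of e^(xt) phi(t) over [0, 1]. In w = - log t, phi is both a
   power w^(kappa - 1) times a function holomorphic on |Im w| < pi (behaviour at t = 1) and a sum
   of terms w^i e^(-kw/q) whose coefficients are principal parts of the Gamma quotient (behaviour at
   t = 0). Turning [0, 1] into two rays from 0 and 1 to infinity gives F0 and F1, to which Watson's
   lemma applies; rays in two directions on the same side of the real axis cover a sector of opening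
   larger than pi. Watson's uniqueness lemma finally allows to discard superfluous exponents. *)
theory Submission
  imports Defs "HOL-Complex_Analysis.Complex_Analysis" "HOL-Real_Asymp.Real_Asymp"
begin

section \<open>The ring H and germs with Taylor coefficients in H\<close>

text \<open>A ray in direction \<open>e\<close> gives a convergent integral only on the half-plane
  \<open>Re (x * e) < 0\<close>, whose opening is exactly \<pi>; this is why one direction is not
  enough. The directions have to avoid the real axis because the kernel is cut along
  \<open>t \<le> 0\<close> and \<open>t \<ge> 1\<close>; they exist because \<theta> is neither 0
  nor of modulus \<pi>. The lower bounds 2 make all kernels continuous on [0, 1] with value 0 at
  both ends, so that series and integrals converge absolutely up to the ends. The coefficients at t
  = 0 come from an expansion in \<open>w\<close>, but their arithmetic is visible only in the poles
  of the Mellin transform. Instead of inverting a transform, the proof lets one family of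
  coefficients represent the function and its transform side by side from the start. Multiple poles
  are the source of the logarithms and thus of derivatives of Gamma; 1/\<pi> comes from the
  reflection formula for 1/Gamma. Since a contiguity step multiplies by \<open>x\<close>, expansions
  live on a fixed lattice of exponents with denominator \<open>q\<close> and an arbitrary integer
  offset.\<close>

lemma H_ring_algebraic: "algebraic x \<Longrightarrow> x \<in> H_ring"
  unfolding H_ring_def by (rule subring_generated.gen) auto

lemma H_ring_inverse_pi: "1 / of_real pi \<in> H_ring"
  unfolding H_ring_def by (rule subring_generated.gen) auto

lemma H_ring_Gamma_deriv: "r \<in> \<rat> - \<int>\<^sub>\<le>\<^sub>0 \<Longrightarrow> (deriv ^^ n) Gamma r \<in> H_ring"
  unfolding H_ring_def by (rule subring_generated.gen) blast

lemma H_ring_diff: "x \<in> H_ring \<Longrightarrow> y \<in> H_ring \<Longrightarrow> x - y \<in> H_ring"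
  unfolding H_ring_def by (rule subring_generated.diff)

lemma H_ring_mult: "x \<in> H_ring \<Longrightarrow> y \<in> H_ring \<Longrightarrow> x * y \<in> H_ring"
  unfolding H_ring_def by (rule subring_generated.mult)

lemma H_ring_one: "1 \<in> H_ring"
  unfolding H_ring_def by (rule subring_generated.one)

lemma H_ring_zero: "0 \<in> H_ring"
  using H_ring_diff[OF H_ring_one H_ring_one] by simp

lemma H_ring_uminus: "x \<in> H_ring \<Longrightarrow> - x \<in> H_ring"
  using H_ring_diff[OF H_ring_zero, of x] by simp

lemma H_ring_add: "x \<in> H_ring \<Longrightarrow> y \<in> H_ring \<Longrightarrow> x + y \<in> H_ring"
  using H_ring_diff[of x "- y"] H_ring_uminus[of y] by simp

lemma H_ring_sum: "(\<And>i. i \<in> A \<Longrightarrow> f i \<in> H_ring) \<Longrightarrow> sum f A \<in> H_ring"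
  by (induction A rule: infinite_finite_induct) (auto intro: H_ring_zero H_ring_add)

lemma H_ring_power: "x \<in> H_ring \<Longrightarrow> x ^ n \<in> H_ring"
  by (induction n) (auto intro: H_ring_one H_ring_mult)

section \<open>Elements of H attached to rational numbers\<close>

lemma algebraic_Rats:
  assumes "x \<in> \<rat>" shows "algebraic (x :: complex)"
proof -
  from assms obtain a b where "b > 0" and ab: "x = of_int a / of_int b"
    by (elim Rats_cases') auto
  note ab = \<open>b > 0\<close> ab
  show ?thesis
    by (rule algebraicI[of "[:- of_int a, of_int b:]"]) (use ab in \<open>auto simp: coeff_pCons split: nat.splits\<close>)
qed

lemma H_ring_Rats: "x \<in> \<rat> \<Longrightarrow> x \<in> H_ring"
  by (intro H_ring_algebraic algebraic_Rats)

text \<open>For \<open>r = a / b\<close> this is a root of unity of order dividing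
  \<open>2 * b\<close>, hence algebraic. Such numbers arise later when a power of \<open>- x\<close>
  is rewritten as a power of \<open>x\<close>.\<close>

lemma H_ring_exp_pi_Rats:
  assumes "r \<in> \<rat>"
  shows "exp (\<i> * of_real pi * r) \<in> H_ring"
proof -
  from assms obtain a b :: int where ab: "b > 0" "r = of_int a / of_int b"
    by (elim Rats_cases') auto
  define n where "n = nat b"
  have n: "n > 0" "of_int b = (of_nat n :: complex)" using ab by (auto simp: n_def)
  have "exp (\<i> * of_real pi * r) ^ n = exp (of_nat n * (\<i> * of_real pi * r))"
    by (rule exp_of_nat_mult [symmetric])
  also have "of_nat n * (\<i> * of_real pi * r) = \<i> * of_real pi * of_int a"
    using n ab by simp
  finally have eq: "exp (\<i> * of_real pi * r) ^ n = exp (\<i> * of_real pi * of_int a)" .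
  have "exp (\<i> * of_real pi * r) ^ (2 * n) = (exp (\<i> * of_real pi * r) ^ n) ^ 2"
    by (simp add: power_mult mult.commute flip: power_mult)
  also have "\<dots> = exp (\<i> * of_real pi * of_int a) ^ 2" by (simp only: eq)
  also have "\<dots> = exp (2 * of_int a * of_real pi * \<i>)"
    by (simp add: exp_double [symmetric] mult_ac)
  also have "\<dots> = 1" by (subst exp_eq_1) auto
  finally have *: "exp (\<i> * of_real pi * r) ^ (2 * n) = 1" .
  have "algebraic (exp (\<i> * of_real pi * r))"
    by (rule algebraicI[of "monom 1 (2 * n) - 1"])
       (use n * in \<open>auto simp: poly_monom coeff_monom poly_eq_iff coeff_1 split: if_splits intro!: exI[of _ "2*n"]\<close>)
  thus ?thesis by (rule H_ring_algebraic)
qed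

lemma H_ring_ii: "\<i> \<in> H_ring"
  by (intro H_ring_algebraic) auto

lemma H_ring_Gamma_Rats: "r \<in> \<rat> - \<int>\<^sub>\<le>\<^sub>0 \<Longrightarrow> Gamma r \<in> H_ring"
  using H_ring_Gamma_deriv[of r 0] by simp

text \<open>Only 1/\<pi> is a generator; \<pi> itself is the square of Gamma(1/2). It is needed
  because passing from \<open>log (- x)\<close> to \<open>log x\<close> produces powers of
  \<open>\<i> * \<pi>\<close>.\<close>

lemma H_ring_pi: "of_real pi \<in> H_ring"
proof -
  have r: "(1/2 :: complex) \<in> \<rat> - \<int>\<^sub>\<le>\<^sub>0"
  proof -
    have "(1/2::complex) \<notin> \<int>\<^sub>\<le>\<^sub>0"
      using fraction_not_in_Ints[of 2 "1::int"] nonpos_Ints_Int by auto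
    thus ?thesis by auto
  qed
  have "Gamma (1/2 :: complex) * Gamma (1/2) = of_real pi"
    by (simp add: Gamma_one_half_complex flip: of_real_mult)
  thus ?thesis using H_ring_mult[OF H_ring_Gamma_Rats[OF r] H_ring_Gamma_Rats[OF r]] by simp
qed

lemma H_ring_sin_pi_Rats:
  assumes "r \<in> \<rat>" shows "sin (of_real pi * r) \<in> H_ring"
proof -
  have "sin (of_real pi * r) =
    (exp (\<i> * of_real pi * r) - exp (\<i> * of_real pi * (- r))) * (- \<i> * (1 / 2))"
    by (simp add: sin_exp_eq field_simps)
  also have "\<dots> \<in> H_ring"
    by (intro H_ring_mult H_ring_diff H_ring_exp_pi_Rats H_ring_uminus H_ring_ii H_ring_Rats)
       (use assms in auto)
  finally show ?thesis .
qed

text \<open>Reflection writes 1/Gamma(r) as a sine of a rational multiple of \<pi>, times 1/\<pi>,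
  times Gamma(1 - r). At positive integers Gamma(1 - r) is a pole, and the value is the inverse of a
  factorial.\<close>

lemma H_ring_rGamma_Rats:
  assumes "r \<in> \<rat>" shows "rGamma (r :: complex) \<in> H_ring"
proof (cases "1 - r \<in> \<int>\<^sub>\<le>\<^sub>0")
  case True
  then obtain n where n: "1 - r = - of_nat n" by (auto elim: nonpos_Ints_cases')
  hence r: "r = 1 + of_nat n" by (simp add: algebra_simps)
  have "rGamma r = inverse (fact n)" by (simp add: r rGamma_inverse_Gamma Gamma_fact)
  moreover have "inverse (fact n :: complex) \<in> \<rat>"
    by (metis Rats_inverse Rats_of_nat of_nat_fact)
  ultimately show ?thesis by (metis H_ring_Rats)
next
  case False
  have "rGamma r = sin (of_real pi * r) * (1 / of_real pi) * Gamma (1 - r)"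
    using rGamma_reflection_complex[of r] False
    by (auto simp: Gamma_def field_simps rGamma_eq_zero_iff)
  also have "\<dots> \<in> H_ring"
    by (intro H_ring_mult H_ring_sin_pi_Rats H_ring_inverse_pi H_ring_Gamma_Rats assms)
       (use assms False in auto)
  finally show ?thesis .
qed

section \<open>Power series over H and germs of functions\<close>

definition H_fps :: "complex fps set" where
  "H_fps = {F. \<forall>n. fps_nth F n \<in> H_ring}"

lemma H_fps_mult: "F \<in> H_fps \<Longrightarrow> G \<in> H_fps \<Longrightarrow> F * G \<in> H_fps"
  by (auto simp: H_fps_def fps_mult_nth intro!: H_ring_sum H_ring_mult)

lemma H_fps_power: "F \<in> H_fps \<Longrightarrow> F ^ n \<in> H_fps"
  by (induction n) (auto simp: H_fps_def fps_one_nth fps_mult_nth intro!: H_ring_one H_ring_zero H_ring_sum H_ring_mult)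

lemma H_fps_compose: "F \<in> H_fps \<Longrightarrow> G \<in> H_fps \<Longrightarrow> F oo G \<in> H_fps"
  using H_fps_power[of G]
  by (auto simp: H_fps_def fps_compose_nth intro!: H_ring_sum H_ring_mult)

text \<open>In the recursion for the coefficients of the inverse the only division is by the
  constant coefficient. H is merely a ring, so the inverse of that coefficient has to be
  supplied.\<close>

lemma H_fps_inverse:
  assumes "F \<in> H_fps" "inverse (fps_nth F 0) \<in> H_ring" and nz: "fps_nth F 0 \<noteq> 0"
  shows "inverse F \<in> H_fps"
proof -
  have "fps_nth (inverse F) n \<in> H_ring" for n
  proof (induction n rule: less_induct)
    case (less n)
    show ?case
    proof (cases n)
      case 0 thus ?thesis using assms by simp
    next
      case (Suc m)
      have F0: "fps_nth F 0 \<noteq> 0" 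
        using assms(2) nz by simp
      have "0 = fps_nth (F * inverse F) n"
        using inverse_mult_eq_1[OF F0] Suc by (simp add: mult.commute)
      also have "\<dots> = (\<Sum>i = 0..n. fps_nth F i * fps_nth (inverse F) (n - i))"
        by (rule fps_mult_nth)
      also have "\<dots> = fps_nth F 0 * fps_nth (inverse F) n + (\<Sum>i = 1..n. fps_nth F i * fps_nth (inverse F) (n - i))"
        by (subst sum.atLeast_Suc_atMost) auto
      finally have "fps_nth (inverse F) n = - inverse (fps_nth F 0) * (\<Sum>i = 1..n. fps_nth F i * fps_nth (inverse F) (n - i))"
        using F0 by (simp add: field_simps add_eq_0_iff2)
      also have "\<dots> \<in> H_ring"
        by (intro H_ring_mult H_ring_uminus H_ring_sum less.IH assms)
           (use assms in \<open>auto simp: H_fps_def\<close>)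
      finally show ?thesis .
    qed
  qed
  thus ?thesis by (simp add: H_fps_def)
qed

text \<open>As factorials are invertible in H, this means that \<open>f\<close> is analytic at
  \<open>z\<close> with all derivatives there in H. The formulation by power series is the one that
  is visibly stable under products and composition.\<close>

definition H_germ :: "(complex \<Rightarrow> complex) \<Rightarrow> complex \<Rightarrow> bool" where
  "H_germ f z \<longleftrightarrow> (\<exists>F\<in>H_fps. (\<lambda>h. f (z + h)) has_fps_expansion F)"

lemma H_germI: "F \<in> H_fps \<Longrightarrow> (\<lambda>h. f (z + h)) has_fps_expansion F \<Longrightarrow> H_germ f z"
  unfolding H_germ_def by (rule bexI)

lemma H_germE:
  assumes "H_germ f z"
  obtains F where "F \<in> H_fps" "(\<lambda>h. f (z + h)) has_fps_expansion F"
  using assms unfolding H_germ_def by (elim bexE)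

lemma H_germ_cong:
  assumes "H_germ f z" "eventually (\<lambda>w. f w = g w) (nhds z)"
  shows "H_germ g z"
proof -
  from assms(1) obtain F where F: "F \<in> H_fps" "(\<lambda>h. f (z + h)) has_fps_expansion F"
    unfolding H_germ_def by (elim bexE)
  have "filterlim (\<lambda>h. z + h) (nhds z) (nhds 0)"
    using tendsto_add[OF tendsto_const[of z] filterlim_ident[of "nhds 0"]] by simp
  with assms(2) have "eventually (\<lambda>h. f (z + h) = g (z + h)) (nhds 0)"
    by (rule eventually_compose_filterlim)
  from has_fps_expansion_cong[OF this refl] F show ?thesis
    unfolding H_germ_def by (intro bexI[of _ F]) simp_all
qed

lemma H_germ_shift: "H_germ (\<lambda>w. f (w + a)) z \<longleftrightarrow> H_germ f (z + a)"
  by (simp add: H_germ_def add_ac)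

lemma H_germ_const: "c \<in> H_ring \<Longrightarrow> H_germ (\<lambda>_. c) z"
  unfolding H_germ_def by (rule bexI[of _ "fps_const c"]) (auto simp: H_fps_def intro: H_ring_zero)

lemma H_germ_mult: "H_germ f z \<Longrightarrow> H_germ g z \<Longrightarrow> H_germ (\<lambda>w. f w * g w) z"
  by (elim H_germE) (rule H_germI[OF H_fps_mult has_fps_expansion_mult])

lemma H_germ_add: "H_germ f z \<Longrightarrow> H_germ g z \<Longrightarrow> H_germ (\<lambda>w. f w + g w) z"
proof (elim H_germE)
  fix F G
  assume FG: "F \<in> H_fps" "(\<lambda>h. f (z + h)) has_fps_expansion F"
    "G \<in> H_fps" "(\<lambda>h. g (z + h)) has_fps_expansion G"
  have "F + G \<in> H_fps" using FG by (auto simp: H_fps_def intro: H_ring_add)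
  thus ?thesis by (rule H_germI) (intro has_fps_expansion_add FG)
qed

lemma H_germ_power: "H_germ f z \<Longrightarrow> H_germ (\<lambda>w. f w ^ n) z"
  by (induction n) (auto intro: H_germ_mult H_germ_const H_ring_one)

lemma H_germ_ident: "z \<in> H_ring \<Longrightarrow> H_germ (\<lambda>w. w) z"
  by (rule H_germI[of "fps_const z + fps_X"])
     (auto simp: H_fps_def fps_X_nth intro!: fps_expansion_intros H_ring_add H_ring_one H_ring_zero)

lemma H_germ_inverse:
  assumes "H_germ f z" "f z \<noteq> 0" "inverse (f z) \<in> H_ring"
  shows "H_germ (\<lambda>w. inverse (f w)) z"
proof -
  from assms obtain F where F: "F \<in> H_fps" "(\<lambda>h. f (z + h)) has_fps_expansion F"
    by (elim H_germE)
  have "fps_nth F 0 = f z" using has_fps_expansion_imp_0_eq_fps_nth_0[OF F(2)] by simp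
  thus ?thesis using assms F
    by (intro H_germI[of "inverse F"] has_fps_expansion_inverse H_fps_inverse) auto
qed

lemma H_germ_compose:
  assumes "H_germ f z" "H_germ g (f z)"
  shows "H_germ (\<lambda>w. g (f w)) z"
proof -
  from assms obtain F where F: "F \<in> H_fps" "(\<lambda>h. f (z + h)) has_fps_expansion F"
    by (elim H_germE)
  from assms obtain G where G: "G \<in> H_fps" "(\<lambda>h. g (f z + h)) has_fps_expansion G"
    by (elim H_germE)
  have F0: "fps_nth F 0 = f z" using has_fps_expansion_imp_0_eq_fps_nth_0[OF F(2)] by simp
  have F': "(\<lambda>h. f (z + h) - f z) has_fps_expansion F - fps_const (f z)"
    by (intro fps_expansion_intros F)
  have "((\<lambda>h. g (f z + h)) \<circ> (\<lambda>h. f (z + h) - f z)) has_fps_expansion (G oo (F - fps_const (f z)))"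
    by (rule has_fps_expansion_compose[OF G(2) F']) (simp add: F0)
  moreover have "F - fps_const (f z) \<in> H_fps"
    using F(1) F0 by (auto simp: H_fps_def intro: H_ring_zero)
  ultimately show ?thesis using G(1)
    by (intro H_germI[of "G oo (F - fps_const (f z))"] H_fps_compose) (auto simp: o_def)
qed

lemma H_germ_analytic: "H_germ f z \<Longrightarrow> f analytic_on {z}"
  by (elim H_germE) (rule has_fps_expansion_imp_analytic)

lemma H_germ_of_derivs:
  assumes "f analytic_on {z}" "\<And>n. (deriv ^^ n) f z \<in> H_ring"
  shows "H_germ f z"
proof -
  have "(\<lambda>h. f (z + h)) has_fps_expansion fps_expansion f z"
    using analytic_at_imp_has_fps_expansion[OF assms(1)] .
  moreover have "fps_expansion f z \<in> H_fps"
    unfolding H_fps_def fps_expansion_def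
  proof (intro CollectI allI)
    fix n
    have "inverse (fact n :: complex) \<in> \<rat>"
      by (metis Rats_inverse Rats_of_nat of_nat_fact)
    thus "fps_nth (Abs_fps (\<lambda>n. (deriv ^^ n) f z / fact n)) n \<in> H_ring"
      unfolding fps_nth_Abs_fps divide_inverse by (intro H_ring_mult assms H_ring_Rats)
  qed
  ultimately show ?thesis by (intro H_germI)
qed

lemma H_germ_derivs:
  assumes "H_germ f z"
  shows "(deriv ^^ n) f z \<in> H_ring"
proof -
  from assms obtain F where F: "F \<in> H_fps" "(\<lambda>h. f (z + h)) has_fps_expansion F"
    by (elim H_germE)
  have "(\<lambda>h. f (z + h)) has_fps_expansion fps_expansion f z"
    using analytic_at_imp_has_fps_expansion[OF H_germ_analytic[OF assms]] .
  with F(2) have "F = fps_expansion f z" by (rule fps_expansion_unique_complex)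
  hence "(deriv ^^ n) f z = fact n * fps_nth F n" by (simp add: fps_expansion_def)
  moreover have "fps_nth F n \<in> H_ring" using F(1) by (simp add: H_fps_def)
  moreover have "(fact n :: complex) \<in> \<rat>" by (metis Rats_of_nat of_nat_fact)
  ultimately show ?thesis by (metis H_ring_mult H_ring_Rats)
qed

section \<open>Gamma and 1/Gamma as germs at rational points, poles included\<close>

lemma H_germ_Gamma: "r \<in> \<rat> - \<int>\<^sub>\<le>\<^sub>0 \<Longrightarrow> H_germ Gamma r"
  by (intro H_germ_of_derivs H_ring_Gamma_deriv) (auto intro!: analytic_intros)

lemma H_germ_rGamma_aux:
  assumes "r \<in> \<rat> - \<int>\<^sub>\<le>\<^sub>0" shows "H_germ rGamma (r :: complex)"
proof -
  have "H_germ (\<lambda>w. inverse (Gamma w)) r"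
    by (rule H_germ_inverse[OF H_germ_Gamma])
       (use assms H_ring_rGamma_Rats[of r] in \<open>auto simp: Gamma_eq_zero_iff rGamma_inverse_Gamma\<close>)
  thus ?thesis by (simp flip: rGamma_inverse_Gamma)
qed

text \<open>The step goes from \<open>r + 1\<close> down to \<open>r\<close> and starts at 1, the
  first regular point to the right of the poles of Gamma. It is the form of induction that fits the
  functional equation.\<close>

lemma Rats_nonpos_Ints_induct [consumes 1, case_names base step]:
  fixes r :: complex
  assumes "r \<in> \<rat>"
    and "\<And>r. r \<in> \<rat> - \<int>\<^sub>\<le>\<^sub>0 \<Longrightarrow> P r"
    and "\<And>r. r \<in> \<rat> \<Longrightarrow> r \<in> \<int>\<^sub>\<le>\<^sub>0 \<Longrightarrow> P (r + 1) \<Longrightarrow> P r"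
  shows "P r"
proof (cases "r \<in> \<int>\<^sub>\<le>\<^sub>0")
  case True
  then obtain n where n: "r = - of_nat n" by (auto elim: nonpos_Ints_cases')
  have "P (- of_nat n)"
  proof (induction n)
    case 0
    have "P 1" by (rule assms(2)) (auto simp: nonpos_Ints_def)
    thus ?case using assms(3)[of 0] by simp
  next
    case (Suc n)
    have "- of_nat (Suc n) \<in> (\<int>\<^sub>\<le>\<^sub>0 :: complex set)" by (metis nonpos_Ints_of_int of_int_minus of_int_of_nat_eq of_nat_0_le_iff neg_le_0_iff_le)
    thus ?case using assms(3)[of "- of_nat (Suc n)"] Suc by (simp add: )
  qed
  thus ?thesis using n by simp
qed (use assms in auto)

lemma H_germ_rGamma:
  assumes "r \<in> \<rat>" shows "H_germ rGamma (r :: complex)"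
  using assms
proof (induction rule: Rats_nonpos_Ints_induct)
  case (step r)
  have "H_germ (\<lambda>w. w * rGamma (w + 1)) r"
    by (intro H_germ_mult H_germ_ident H_ring_Rats) (use step in \<open>auto simp: H_germ_shift\<close>)
  thus ?case by (simp add: rGamma_plus1)
qed (auto intro: H_germ_rGamma_aux)

text \<open>The poles are simple, so the factor \<open>w - r\<close> removes them. The factor is
  kept at regular points as well, so that products of Gamma factors can be treated without knowing
  which of them has a pole. Moving one step to the left divides by \<open>w\<close>, which is
  harmless except at 0, where \<open>w * Gamma w\<close> is already
  \<open>Gamma (w + 1)\<close>.\<close>

lemma H_germ_Gamma_pole:
  assumes "r \<in> \<rat>"
  shows "\<exists>g. H_germ g r \<and> (\<exists>e>0. \<forall>w\<in>ball r e - {r}. Gamma w * (w - r) = g w)"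
  using assms
proof (induction rule: Rats_nonpos_Ints_induct)
  case (base r)
  have "H_germ (\<lambda>w. Gamma w * (w + (- r))) r"
    by (intro H_germ_mult H_germ_Gamma H_germ_add H_germ_ident H_germ_const H_ring_Rats) (use base in auto)
  thus ?case by (intro exI[of _ "\<lambda>w. Gamma w * (w + (- r))"]) (auto intro!: exI[of _ 1])
next
  case (step r)
  show ?case
  proof (cases "r = 0")
    case True
    have "H_germ (\<lambda>w. Gamma (w + 1)) r"
      by (subst H_germ_shift, rule H_germ_Gamma) (auto simp: True nonpos_Ints_def)
    moreover have "Gamma w * (w - r) = Gamma (w + 1)" if "w \<in> ball r 1 - {r}" for w
    proof -
      have "w \<notin> \<int>\<^sub>\<le>\<^sub>0"
        using that True by (auto elim!: nonpos_Ints_cases')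
      thus ?thesis using True by (simp add: Gamma_plus1 mult.commute)
    qed
    ultimately show ?thesis by (intro exI[of _ "\<lambda>w. Gamma (w + 1)"] conjI exI[of _ 1] ballI) auto
  next
    case False
    from step.IH obtain g e where g: "H_germ g (r + 1)" "e > 0"
      "\<And>w. w \<in> ball (r + 1) e - {r + 1} \<Longrightarrow> Gamma w * (w - (r + 1)) = g w" by blast
    have "H_germ (\<lambda>w. g (w + 1) * inverse w) r"
      by (intro H_germ_mult H_germ_inverse H_germ_ident H_ring_Rats)
         (use g(1) step False in \<open>auto simp: H_germ_shift\<close>)
    moreover obtain n where n: "r = - of_nat n" using step by (auto elim: nonpos_Ints_cases')
    \<comment> \<open>A radius of at most 1 keeps the other non-positive integers out of the
      punctured ball; the functional equation holds at all its points.\<close>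
    have "Gamma w * (w - r) = g (w + 1) * inverse w" if w: "w \<in> ball r (min e 1) - {r}" for w
    proof -
      have "w \<notin> \<int>\<^sub>\<le>\<^sub>0"
      proof
        assume "w \<in> \<int>\<^sub>\<le>\<^sub>0"
        then obtain m where "w = - of_nat m" by (auto elim: nonpos_Ints_cases')
        with n w have "dist (of_nat n :: complex) (of_nat m) < 1" "n \<noteq> m"
          by (auto simp: dist_norm norm_minus_commute)
        moreover have "dist (of_nat n :: complex) (of_nat m) = \<bar>real n - real m\<bar>"
          using norm_of_real[of "real n - real m", where 'a = complex] by (simp add: dist_norm)
        ultimately show False by linarith
      qed
      hence "w \<noteq> 0" "Gamma (w + 1) = w * Gamma w" by (auto simp: Gamma_plus1)
      moreover have "w + 1 \<in> ball (r + 1) e - {r + 1}" using w by (auto simp: dist_norm)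
      from g(3)[OF this] have "Gamma (w + 1) * (w - r) = g (w + 1)" by (simp add: algebra_simps)
      ultimately show ?thesis by (simp add: field_simps)
    qed
    ultimately show ?thesis using g(2)
      by (intro exI[of _ "\<lambda>w. g (w + 1) * inverse w"] conjI exI[of _ "min e 1"] ballI) auto
  qed
qed

section \<open>Contiguity relations\<close>

text \<open>How upper and lower parameters are paired does not matter for the series, but later each
  pair receives its own beta density.\<close>

definition poch_ratio :: "(real \<times> real) list \<Rightarrow> nat \<Rightarrow> real" where
  "poch_ratio ps n = (\<Prod>(a, b)\<leftarrow>ps. pochhammer a n / pochhammer b n)"

definition hyp_pairs :: "(real \<times> real) list \<Rightarrow> complex \<Rightarrow> complex" where
  "hyp_pairs ps x = (\<Sum>n. of_real (poch_ratio ps n) / fact n * x ^ n)"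

abbreviation shift_pairs :: "(real \<times> real) list \<Rightarrow> (real \<times> real) list" where
  "shift_pairs \<equiv> map (\<lambda>(a, b). (a + 1, b + 1))"

lemma poch_ratio_Nil [simp]: "poch_ratio [] n = 1"
  and poch_ratio_Cons [simp]: "poch_ratio ((a, b) # ps) n = pochhammer a n / pochhammer b n * poch_ratio ps n"
  and poch_ratio_append [simp]: "poch_ratio (ps @ rs) n = poch_ratio ps n * poch_ratio rs n"
  by (auto simp: poch_ratio_def)

lemma poch_ratio_0 [simp]: "poch_ratio ps 0 = 1"
  by (induction ps) auto

lemma poch_ratio_Suc: "poch_ratio ps (Suc n) = poch_ratio ps 1 * poch_ratio (shift_pairs ps) n"
  by (induction ps) (auto simp: pochhammer_rec)

text \<open>The quotient of consecutive factors \<open>(a + n) / (b + n)\<close> tends to 1, hence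
  is bounded, and the products grow at most geometrically. The factorial in \<open>hyp_pairs\<close>
  then gives convergence everywhere.\<close>

lemma poch_ratio_bound:
  assumes "\<forall>(a, b)\<in>set ps. b \<notin> \<int>\<^sub>\<le>\<^sub>0"
  shows "\<exists>K\<ge>1. \<forall>n. \<bar>poch_ratio ps n\<bar> \<le> K ^ n"
  using assms
proof (induction ps)
  case Nil
  show ?case by (auto intro!: exI[of _ 1])
next
  case (Cons p ps)
  obtain a b where p: "p = (a, b)" by force
  from Cons obtain K where K: "K \<ge> 1" "\<And>n. \<bar>poch_ratio ps n\<bar> \<le> K ^ n" by auto
  have b: "b + of_nat n \<noteq> 0" for n
  proof
    assume "b + of_nat n = 0"
    hence "b = - of_nat n" by linarith
    thus False using Cons.prems p by simp
  qed
  have "(\<lambda>n. (a + real n) / (b + real n)) \<longlonglongrightarrow> 1" by real_asymp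
  hence "Bseq (\<lambda>n. (a + real n) / (b + real n))" using Bseq_conv_Bfun convergent_imp_Bseq convergentI by blast
  then obtain L where L: "L > 0" "\<And>n. \<bar>(a + real n) / (b + real n)\<bar> \<le> L"
    by (auto elim!: BseqE)
  define M where "M = max L 1"
  have M: "\<bar>pochhammer a n / pochhammer b n\<bar> \<le> M ^ n" for n
  proof (induction n)
    case (Suc n)
    have "\<bar>pochhammer a (Suc n) / pochhammer b (Suc n)\<bar> =
      \<bar>pochhammer a n / pochhammer b n\<bar> * \<bar>(a + real n) / (b + real n)\<bar>"
      by (simp add: pochhammer_Suc abs_mult)
    also have "\<dots> \<le> M ^ n * M"
      using Suc L(2)[of n] by (intro mult_mono) (auto simp: M_def)
    finally show ?case by (simp add: mult.commute)
  qed auto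
  have "\<bar>poch_ratio (p # ps) n\<bar> \<le> (M * K) ^ n" for n
    using mult_mono[OF M[of n] K(2)[of n]] by (simp add: p abs_mult power_mult_distrib M_def)
  moreover have "M * K \<ge> 1" using K(1) mult_mono[of 1 M 1 K] by (simp add: M_def)
  ultimately show ?case by blast
qed

lemma hyp_pairs_sums:
  assumes "\<forall>(a, b)\<in>set ps. b \<notin> \<int>\<^sub>\<le>\<^sub>0"
  shows "(\<lambda>n. of_real (poch_ratio ps n) / fact n * x ^ n) sums hyp_pairs ps x"
proof -
  from poch_ratio_bound[OF assms] obtain K where K: "K \<ge> 1" "\<And>n. \<bar>poch_ratio ps n\<bar> \<le> K ^ n" by auto
  have "summable (\<lambda>n. norm (of_real (poch_ratio ps n) / fact n * x ^ n))"
  proof (rule summable_comparison_test')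
    show "summable (\<lambda>n. inverse (fact n) * (K * norm x) ^ n)"
      by (rule summable_exp)
    show "norm (norm (of_real (poch_ratio ps n) / fact n * x ^ n)) \<le> inverse (fact n) * (K * norm x) ^ n" for n
      using K(2)[of n] by (auto simp: norm_mult norm_divide norm_power power_mult_distrib divide_simps mult_right_mono)
  qed
  thus ?thesis unfolding hyp_pairs_def by (rule summable_sums[OF summable_norm_cancel])
qed

text \<open>At index 0 both coefficients are 1. At index \<open>Suc n\<close> the factor
  \<open>Suc n\<close> cancels one factor of the factorial, which leaves \<open>x\<close> times the
  term of index \<open>n\<close> of a third series.\<close>

lemma hyp_pairs_contiguous:
  assumes "\<forall>(a, b)\<in>set ps. b \<notin> \<int>\<^sub>\<le>\<^sub>0" "\<forall>(a, b)\<in>set rs. b \<notin> \<int>\<^sub>\<le>\<^sub>0" "\<forall>(a, b)\<in>set us. b \<notin> \<int>\<^sub>\<le>\<^sub>0"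
    and "\<And>n. poch_ratio ps (Suc n) = poch_ratio rs (Suc n) + of_nat (Suc n) * K * poch_ratio us n"
  shows "hyp_pairs ps x = hyp_pairs rs x + of_real K * (x * hyp_pairs us x)"
proof -
  let ?T = "\<lambda>ps n. of_real (poch_ratio ps n) / fact n * x ^ n"
  define D where "D n = (if n = 0 then 0 else of_real K * x * ?T us (n - 1))" for n
  have "(\<lambda>n. D (Suc n)) sums (of_real K * x * hyp_pairs us x)"
    using sums_mult[OF hyp_pairs_sums[OF assms(3), of x], of "of_real K * x"] by (simp add: D_def)
  hence D: "D sums (of_real K * x * hyp_pairs us x)"
    by (subst (asm) sums_Suc_iff) (simp add: D_def)
  have "?T ps n = ?T rs n + D n" for n
  proof (cases n)
    case (Suc m)
    show ?thesis unfolding Suc assms(4)[of m] D_def by (simp add: field_simps del: of_nat_Suc)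
  qed (simp add: D_def)
  hence "?T ps sums (hyp_pairs rs x + of_real K * x * hyp_pairs us x)"
    using sums_add[OF hyp_pairs_sums[OF assms(2)] D] by simp
  from sums_unique2[OF hyp_pairs_sums[OF assms(1)] this] show ?thesis
    by (simp add: mult.assoc)
qed

section \<open>Raising a single parameter\<close>

lemma pochhammer_Suc_lower:
  "pochhammer (a :: real) (Suc n) = pochhammer (a + 1) (Suc n) - of_nat (Suc n) * pochhammer (a + 1) n"
  unfolding pochhammer_rec[of a n] pochhammer_Suc[of "a + 1" n] by (simp add: algebra_simps)

lemma nonpos_Ints_add_one: "b \<notin> \<int>\<^sub>\<le>\<^sub>0 \<Longrightarrow> b + 1 \<notin> (\<int>\<^sub>\<le>\<^sub>0 :: real set)"
  by (metis plus_one_in_nonpos_Ints_imp)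

lemma pochhammer_nz: "b \<notin> \<int>\<^sub>\<le>\<^sub>0 \<Longrightarrow> pochhammer (b :: real) n \<noteq> 0"
  by (auto simp: pochhammer_eq_0_iff)

text \<open>The identity for \<open>pochhammer a (Suc n)\<close> shows the price of raising one
  upper parameter: \<open>x\<close> times the series in which every parameter is raised.\<close>

lemma hyp_pairs_raise_upper:
  assumes "\<forall>(a, b)\<in>set (xs @ (a, b) # ys). b \<notin> \<int>\<^sub>\<le>\<^sub>0"
  shows "hyp_pairs (xs @ (a, b) # ys) x = hyp_pairs (xs @ (a + 1, b) # ys) x +
    of_real (- (poch_ratio (xs @ ys) 1 / b)) * (x * hyp_pairs (shift_pairs (xs @ (a, b) # ys)) x)"
proof (rule hyp_pairs_contiguous)
  fix n
  have b: "b \<noteq> 0" "pochhammer (b + 1) n \<noteq> 0"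
    using assms pochhammer_nz[of "b + 1" n] by (auto dest: nonpos_Ints_add_one)
  show "poch_ratio (xs @ (a, b) # ys) (Suc n) = poch_ratio (xs @ (a + 1, b) # ys) (Suc n) +
      of_nat (Suc n) * - (poch_ratio (xs @ ys) 1 / b) * poch_ratio (shift_pairs (xs @ (a, b) # ys)) n"
    using b unfolding poch_ratio_append poch_ratio_Cons map_append list.map prod.case
      poch_ratio_Suc[of xs] poch_ratio_Suc[of ys] pochhammer_Suc_lower[of a] pochhammer_rec[of b]
    by (simp add: field_simps del: of_nat_Suc)
qed (use assms in \<open>auto dest: nonpos_Ints_add_one\<close>)

text \<open>The difference of the reciprocals of \<open>pochhammer b (Suc n)\<close> and
  \<open>pochhammer (b + 1) (Suc n)\<close> is \<open>(n + 1) / b\<close> over the latter. In the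
  correction series \<open>b\<close> is raised before the common shift, so that its gap
  \<open>b - a\<close> is one larger than in the original series.\<close>

lemma hyp_pairs_raise_lower:
  assumes "\<forall>(a, b)\<in>set (xs @ (a, b) # ys). b \<notin> \<int>\<^sub>\<le>\<^sub>0"
  shows "hyp_pairs (xs @ (a, b) # ys) x = hyp_pairs (xs @ (a, b + 1) # ys) x +
    of_real (poch_ratio (xs @ ys) 1 * a / (b * (b + 1))) * (x * hyp_pairs (shift_pairs (xs @ (a, b + 1) # ys)) x)"
proof (rule hyp_pairs_contiguous)
  fix n
  have b: "b \<noteq> 0" "b + 1 \<noteq> 0" "pochhammer (b + 1 + 1) n \<noteq> 0" "pochhammer (b + 1) n \<noteq> 0"
    using assms pochhammer_nz[of "b + 1 + 1" n] pochhammer_nz[of "b + 1" n]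
      nonpos_Ints_add_one[of b] nonpos_Ints_add_one[of "b + 1"] by auto
  have "pochhammer (b + 1) (Suc n) = (b + 1) * pochhammer (b + 1 + 1) n" by (rule pochhammer_rec)
  moreover have "pochhammer (b + 1) (Suc n) = (b + 1 + n) * pochhammer (b + 1) n"
    by (simp add: pochhammer_Suc mult.commute)
  ultimately have eq: "(b + 1 + n) * pochhammer (b + 1) n = (b + 1) * pochhammer (b + 1 + 1) n" by simp
  have "b + 1 + n \<noteq> 0" using eq b by (metis mult_eq_0_iff)
  define u v where "u = pochhammer (b + 1 + 1) n" and "v = pochhammer (b + 1) n"
  have *: "1 / pochhammer b (Suc n) = 1 / pochhammer (b + 1) (Suc n) +
      real (Suc n) / (b * ((b + 1) * pochhammer (b + 1 + 1) n))"
    unfolding pochhammer_rec[of b] pochhammer_Suc[of "b+1"]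
      eq[symmetric] using b \<open>b + 1 + n \<noteq> 0\<close> unfolding u_def[symmetric] v_def[symmetric]
    by (simp add: divide_simps)
  have "pochhammer a (Suc n) / pochhammer b (Suc n) = pochhammer a (Suc n) / pochhammer (b + 1) (Suc n) +
      real (Suc n) * a / (b * (b + 1)) * (pochhammer (a + 1) n / pochhammer (b + 1 + 1) n)"
    using arg_cong[OF *, of "\<lambda>u. pochhammer a (Suc n) * u"] pochhammer_rec[of a n] by (simp add: algebra_simps)
  thus "poch_ratio (xs @ (a, b) # ys) (Suc n) = poch_ratio (xs @ (a, b + 1) # ys) (Suc n) +
      of_nat (Suc n) * (poch_ratio (xs @ ys) 1 * a / (b * (b + 1))) * poch_ratio (shift_pairs (xs @ (a, b + 1) # ys)) n"
    unfolding poch_ratio_append poch_ratio_Cons map_append list.map prod.case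
      poch_ratio_Suc[of xs] poch_ratio_Suc[of ys]
    by (simp add: algebra_simps del: of_nat_Suc)
qed (use assms nonpos_Ints_add_one[of b] nonpos_Ints_add_one[of "b + 1"] in \<open>auto simp: add_ac dest: nonpos_Ints_add_one\<close>)

text \<open>A common denominator survives shifts by 1. All series met in the reduction therefore
  share one lattice of exponents.\<close>

definition lattice_pairs :: "nat \<Rightarrow> (real \<times> real) list \<Rightarrow> bool" where
  "lattice_pairs q ps \<longleftrightarrow> (\<forall>(a, b)\<in>set ps. a * q \<in> \<int> \<and> b * q \<in> \<int> \<and> b \<notin> \<int>\<^sub>\<le>\<^sub>0)"

lemma lattice_pairs_raise:
  assumes "lattice_pairs q (xs @ (a, b) # ys)"
  shows "lattice_pairs q (xs @ (a + 1, b) # ys)" "lattice_pairs q (xs @ (a, b + 1) # ys)"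
  using assms by (auto simp: lattice_pairs_def distrib_right dest: nonpos_Ints_add_one)

lemma lattice_pairs_shift: "lattice_pairs q ps \<Longrightarrow> lattice_pairs q (shift_pairs ps)"
  by (auto simp: lattice_pairs_def distrib_right dest: nonpos_Ints_add_one)

lemma lattice_Rats: "(x :: real) * of_nat q \<in> \<int> \<Longrightarrow> q > 0 \<Longrightarrow> x \<in> \<rat>"
  by (metis Ints_subset_Rats Rats_divide Rats_of_nat nonzero_eq_divide_eq of_nat_0_less_iff
      less_numeral_extra(3) subsetD)

lemma poch_ratio_Rats:
  "lattice_pairs q ps \<Longrightarrow> q > 0 \<Longrightarrow> poch_ratio ps 1 \<in> \<rat>"
proof (induction ps)
  case (Cons p ps)
  thus ?case
    by (cases p) (auto simp: lattice_pairs_def intro!: Rats_mult Rats_divide dest: lattice_Rats)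
qed auto

section \<open>Reduction to large parameters by induction on a defect\<close>

lemma nat_ceiling_diff_less: "x < 2 \<Longrightarrow> nat \<lceil>2 - (x + 1)\<rceil> < nat \<lceil>2 - (x :: real)\<rceil>"
  and nat_ceiling_diff_le: "nat \<lceil>2 - (x + 1)\<rceil> \<le> nat \<lceil>2 - (x :: real)\<rceil>"
  by linarith+

context
  fixes P :: "(complex \<Rightarrow> complex) \<Rightarrow> bool" and q :: nat
  assumes q: "q > 0"
    and P_step: "\<And>f g h K. P f \<Longrightarrow> P g \<Longrightarrow> K \<in> \<rat> \<Longrightarrow> (\<And>x. h x = f x + of_real K * (x * g x)) \<Longrightarrow> P h"
    and P_base: "\<And>ps. lattice_pairs q ps \<Longrightarrow> \<forall>(a, b)\<in>set ps. a \<ge> 2 \<and> b - a \<ge> 2 \<Longrightarrow> P (hyp_pairs ps)"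
begin

text \<open>Raising \<open>b\<close> in a pair with \<open>b - a < 2\<close> lowers the total
  defect. The common shift changes no gap \<open>b - a\<close>, so both series on the right have the
  smaller defect, and upper parameters never decrease.\<close>

lemma hyp_pairs_raising_lower_induct:
  assumes "lattice_pairs q ps" "\<forall>(a, b)\<in>set ps. a \<ge> 2"
  shows "P (hyp_pairs ps)"
  using assms
proof (induction "\<Sum>(a, b)\<leftarrow>ps. nat \<lceil>2 - (b - a)\<rceil>" arbitrary: ps rule: less_induct)
  case less
  show ?case
  proof (cases "\<forall>(a, b)\<in>set ps. b - a \<ge> 2")
    case True
    with less.prems show ?thesis by (intro P_base) auto
  next
    case False
    then obtain a b where ab: "(a, b) \<in> set ps" "b - a < 2" by auto
    then obtain xs ys where ps: "ps = xs @ (a, b) # ys" by (meson split_list)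
    have m: "(\<Sum>(a, b)\<leftarrow>shift_pairs zs. nat \<lceil>2 - (b - a)\<rceil>) = (\<Sum>(a, b)\<leftarrow>zs. nat \<lceil>2 - (b - a)\<rceil>)" for zs
      by (induction zs) auto
    have lt: "nat \<lceil>2 - (b + 1 - a)\<rceil> < nat \<lceil>2 - (b - a)\<rceil>"
      using nat_ceiling_diff_less[OF ab(2)] by (simp add: algebra_simps)
    have lat: "lattice_pairs q (xs @ (a, b + 1) # ys)"
      using less.prems ps lattice_pairs_raise by blast
    have 1: "P (hyp_pairs (xs @ (a, b + 1) # ys))"
      by (rule less.hyps) (use lt less.prems lat ps in auto)
    have 2: "P (hyp_pairs (shift_pairs (xs @ (a, b + 1) # ys)))"
    proof (rule less.hyps, subst m)
      show "\<forall>(a, b)\<in>set (shift_pairs (xs @ (a, b + 1) # ys)). a \<ge> 2"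
      proof -
        have "2 \<le> a'" if "(a', b') \<in> set xs \<union> set ys" for a' b'
          using less.prems(2) that by (auto simp: ps)
        thus ?thesis using less.prems(2) by (force simp: ps)
      qed
    qed (use lt lattice_pairs_shift[OF lat] ps in auto)
    have 3: "poch_ratio (xs @ ys) 1 * a / (b * (b + 1)) \<in> \<rat>"
    proof -
      have "poch_ratio (xs @ ys) 1 \<in> \<rat>"
        by (rule poch_ratio_Rats[OF _ q]) (use less.prems ps in \<open>auto simp: lattice_pairs_def\<close>)
      moreover have "a \<in> \<rat>" "b \<in> \<rat>"
        using less.prems(1) ps q by (auto simp: lattice_pairs_def intro: lattice_Rats)
      ultimately show ?thesis by (intro Rats_divide Rats_mult Rats_add) auto
    qed
    have "\<forall>(a, b)\<in>set (xs @ (a, b) # ys). b \<notin> \<int>\<^sub>\<le>\<^sub>0"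
      using less.prems(1) ps by (auto simp: lattice_pairs_def)
    from P_step[OF 1 2 3 hyp_pairs_raise_lower[OF this]] show ?thesis unfolding ps .
  qed
qed

text \<open>Upper parameters are settled before the gaps: raising \<open>a\<close> shrinks
  \<open>b - a\<close>, whereas raising \<open>b\<close> leaves \<open>a\<close> alone. A common
  shift can only lower the defect measured here, and lowers it strictly at the chosen pair.\<close>

lemma hyp_pairs_raising_induct:
  assumes "lattice_pairs q ps"
  shows "P (hyp_pairs ps)"
  using assms
proof (induction "\<Sum>(a, b)\<leftarrow>ps. nat \<lceil>2 - a\<rceil>" arbitrary: ps rule: less_induct)
  case less
  show ?case
  proof (cases "\<forall>(a, b)\<in>set ps. a \<ge> 2")
    case True
    with less.prems show ?thesis by (intro hyp_pairs_raising_lower_induct) auto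
  next
    case False
    then obtain a b where ab: "(a, b) \<in> set ps" "a < 2" by auto
    then obtain xs ys where ps: "ps = xs @ (a, b) # ys" by (meson split_list)
    have m: "(\<Sum>(a, b)\<leftarrow>shift_pairs zs. nat \<lceil>2 - a\<rceil>) \<le> (\<Sum>(a, b)\<leftarrow>zs. nat \<lceil>2 - a\<rceil>)" for zs
      by (induction zs) (auto intro!: add_mono nat_ceiling_diff_le simp del: nat_le_eq_zle diff_add_eq_diff_diff_swap)
    have lt: "nat \<lceil>2 - (a + 1)\<rceil> < nat \<lceil>2 - a\<rceil>"
      using nat_ceiling_diff_less[OF ab(2)] .
    have lat: "lattice_pairs q (xs @ (a + 1, b) # ys)"
      using less.prems ps lattice_pairs_raise by blast
    have 1: "P (hyp_pairs (xs @ (a + 1, b) # ys))"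
      by (rule less.hyps) (use lt less.prems lat ps in auto)
    have 2: "P (hyp_pairs (shift_pairs (xs @ (a, b) # ys)))"
    proof (rule less.hyps)
      show "lattice_pairs q (shift_pairs (xs @ (a, b) # ys))"
        using less.prems lattice_pairs_shift ps by blast
      show "(\<Sum>(a, b)\<leftarrow>shift_pairs (xs @ (a, b) # ys). nat \<lceil>2 - a\<rceil>) < (\<Sum>(a, b)\<leftarrow>ps. nat \<lceil>2 - a\<rceil>)"
        using lt m[of xs] m[of ys]
        unfolding ps map_append list.map sum_list.append sum_list.Cons prod.case by linarith
    qed
    have 3: "- (poch_ratio (xs @ ys) 1 / b) \<in> \<rat>"
    proof -
      have "poch_ratio (xs @ ys) 1 \<in> \<rat>"
        by (rule poch_ratio_Rats[OF _ q]) (use less.prems ps in \<open>auto simp: lattice_pairs_def\<close>)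
      moreover have "b \<in> \<rat>"
        using less.prems(1) ps q by (auto simp: lattice_pairs_def intro: lattice_Rats)
      ultimately show ?thesis by auto
    qed
    have "\<forall>(a, b)\<in>set (xs @ (a, b) # ys). b \<notin> \<int>\<^sub>\<le>\<^sub>0"
      using less.prems(1) ps by (auto simp: lattice_pairs_def)
    from P_step[OF 1 2 3 hyp_pairs_raise_upper[OF this]] show ?thesis unfolding ps .
  qed
qed

end

section \<open>Watson's uniqueness lemma\<close>

lemma arg_about_exp:
  assumes "\<bar>Im z - \<theta>\<bar> < pi"
  shows "arg_about \<theta> (exp z) = Im z"
proof -
  have "exp z / cis \<theta> = exp (z - \<i> * of_real \<theta>)"
    by (simp add: exp_diff cis_conv_exp)
  moreover have "Ln (exp (z - \<i> * of_real \<theta>)) = z - \<i> * of_real \<theta>"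
    by (rule Ln_exp) (use assms in auto)
  ultimately show ?thesis by (simp add: arg_about_def Arg_eq_Im_Ln)
qed

lemma Re_log_about [simp]: "Re (log_about \<theta> x) = ln (norm x)"
  and Im_log_about [simp]: "Im (log_about \<theta> x) = arg_about \<theta> x"
  by (simp_all add: log_about_def)

lemma large_sectorE:
  assumes "x \<in> large_sector \<theta> \<epsilon> 1"
  obtains z where "x = exp z" "log_about \<theta> x = z" "Re z \<ge> 0" "\<bar>Im z - \<theta>\<bar> \<le> pi / 2 + \<epsilon>"
proof -
  have x: "norm x \<ge> 1" "x \<noteq> 0" "\<bar>arg_about \<theta> x - \<theta>\<bar> \<le> pi / 2 + \<epsilon>"
    using assms by (auto simp: large_sector_def abs_le_iff)
  show ?thesis
    by (rule that[of "log_about \<theta> x"]) (use x in \<open>auto simp: exp_log_about\<close>)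
qed

lemma exp_in_large_sector:
  assumes "Re z \<ge> 0" "\<bar>Im z - \<theta>\<bar> \<le> pi / 2 + \<epsilon>" "\<epsilon> < pi / 2"
  shows "exp z \<in> large_sector \<theta> \<epsilon> 1"
  using arg_about_exp[of z \<theta>] assms by (auto simp: large_sector_def abs_le_iff)

text \<open>Watson's uniqueness lemma. In the coordinate \<open>\<zeta> = log x\<close> the function
  \<open>F (exp \<zeta>) * exp (M * exp (\<delta> * (\<zeta> - \<i> * \<theta>)))\<close>, with \<open>\<delta> < 1\<close> chosen such that the second factor has modulus 1
  on the horizontal sides of the half-strip, tends to zero at infinity because \<open>F\<close> decays like
  \<open>exp (- c * norm x)\<close>; the maximum principle on rectangles and \<open>M \<rightarrow> \<infinity>\<close> give the claim.\<close>

lemma gevrey_flat_imp_zero: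
  fixes F :: "complex \<Rightarrow> complex"
  assumes \<epsilon>: "0 < \<epsilon>" "\<epsilon> < pi / 2" and C: "C \<ge> 1"
    and an: "F analytic_on large_sector \<theta> \<epsilon> 1"
    and bd: "\<And>x N. x \<in> large_sector \<theta> \<epsilon> 1 \<Longrightarrow> N \<ge> 1 \<Longrightarrow> norm (F x) \<le> C ^ N * fact N * norm x powr (B - real N)"
    and x: "x \<in> large_sector \<theta> \<epsilon> 1"
  shows "F x = 0"
proof -
  define Z where "Z = {z. Re z \<ge> 0 \<and> \<bar>Im z - \<theta>\<bar> \<le> pi / 2 + \<epsilon>}"
  define D where "D = {z. Re z > 0 \<and> \<bar>Im z - \<theta>\<bar> < pi / 2 + \<epsilon>}"
  define f where "f = (\<lambda>z. F (exp z))"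
  have Zsec: "exp z \<in> large_sector \<theta> \<epsilon> 1" if "z \<in> Z" for z
    using that \<epsilon> by (intro exp_in_large_sector) (auto simp: Z_def)
  have f_an: "f analytic_on Z"
    unfolding f_def
    by (intro analytic_on_compose_gen[OF _ an, unfolded o_def] analytic_intros) (use Zsec in auto)
  \<comment> \<open>With this choice \<open>C * c = 1 / 2\<close>, which makes the series in the
    derivation of the exponential decay geometric.\<close>
  define c where "c = 1 / (2 * C)"
  have c: "c > 0" using C by (simp add: c_def)
  \<comment> \<open>Large enough that \<open>B - N0 \<le> 0\<close>. The resulting constant bound
    \<open>K\<close> replaces the missing case \<open>N = 0\<close> of the hypothesis in the
    summation below.\<close>
  define N0 where "N0 = nat \<lceil>B\<rceil> + 1"
  define K where "K = C ^ N0 * fact N0"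
  have K: "K \<ge> 0" using C by (simp add: K_def)
  have FK: "norm (F x) \<le> K" if "x \<in> large_sector \<theta> \<epsilon> 1" for x
  proof -
    have "B - real N0 \<le> 0" by (simp add: N0_def) linarith
    moreover have "norm x \<ge> 1" using that by (simp add: large_sector_def)
    ultimately have "norm x powr (B - real N0) \<le> 1"
      using powr_mono[of "B - real N0" 0 "norm x"] by (auto split: if_splits)
    hence "C ^ N0 * fact N0 * norm x powr (B - real N0) \<le> K * 1"
      unfolding K_def using C by (intro mult_left_mono) auto
    with bd[OF that, of N0] show ?thesis by (simp add: N0_def)
  qed
  \<comment> \<open>The bound of index \<open>N\<close> is multiplied by
    \<open>(c * norm x) ^ N / fact N\<close> and summed over \<open>N\<close>: the left-hand sides
    add up to the exponential series, the right-hand sides to a geometric one.\<close>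
  have decay: "norm (F x) \<le> (K + norm x powr B) * exp (- c * norm x)" if "x \<in> large_sector \<theta> \<epsilon> 1" for x
  proof -
    have x1: "norm x \<ge> 1" using that by (simp add: large_sector_def)
    have s1: "(\<lambda>n. norm (F x) * ((c * norm x) ^ n /\<^sub>R fact n)) sums (norm (F x) * exp (c * norm x))"
      by (intro sums_mult exp_converges)
    have "(\<lambda>n. (1/2::real) ^ n) sums (1 / (1 - 1/2))" by (rule geometric_sums) simp
    hence "(\<lambda>n. (1/2::real) ^ Suc n) sums (1 / (1 - 1/2) - 1)"
      by (subst sums_Suc_iff) simp
    hence s2: "(\<lambda>n. norm x powr B * (1/2) ^ Suc n) sums (norm x powr B * 1)"
      by (intro sums_mult) simp
    have s1': "(\<lambda>n. norm (F x) * ((c * norm x) ^ Suc n /\<^sub>R fact (Suc n))) sums (norm (F x) * exp (c * norm x) - norm (F x))"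
      using s1 by (subst sums_Suc_iff) simp
    have "norm (F x) * ((c * norm x) ^ Suc n /\<^sub>R fact (Suc n)) \<le> norm x powr B * (1/2) ^ Suc n" for n
    proof -
      have "norm (F x) * ((c * norm x) ^ Suc n /\<^sub>R fact (Suc n)) \<le>
        (C ^ Suc n * fact (Suc n) * norm x powr (B - real (Suc n))) * ((c * norm x) ^ Suc n /\<^sub>R fact (Suc n))"
        using c by (intro mult_right_mono bd that) auto
      also have "\<dots> = norm x powr (B - real (Suc n)) * norm x ^ Suc n * (C * c) ^ Suc n"
        by (simp add: power_mult_distrib field_simps del: power_Suc fact_Suc of_nat_Suc)
      also have "norm x powr (B - real (Suc n)) * norm x ^ Suc n = norm x powr B"
        unfolding powr_diff using x1 by (subst powr_realpow) (auto simp del: power_Suc of_nat_Suc)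
      also have "C * c = 1/2" using C by (simp add: c_def)
      finally show ?thesis .
    qed
    hence "norm (F x) * exp (c * norm x) - norm (F x) \<le> norm x powr B * 1"
      by (rule sums_le[OF _ s1' s2])
    hence "norm (F x) * exp (c * norm x) \<le> K + norm x powr B" using FK[OF that] by simp
    thus ?thesis by (simp add: exp_minus field_simps)
  qed
  \<comment> \<open>\<open>\<delta> < 1\<close> expresses that the sector is wider than a
    half-plane.\<close>
  define \<delta> where "\<delta> = (pi / 2) / (pi / 2 + \<epsilon>)"
  have \<delta>: "\<delta> > 0" "\<delta> < 1" using \<epsilon> by (auto simp: \<delta>_def field_simps add_pos_pos)
  have axis: "f (Complex s \<theta>) = 0" if s: "s > 0" for s
  proof -
    have main: "norm (f (Complex s \<theta>)) \<le> (K + 1) * exp (M * (1 - exp (\<delta> * s)))" if M: "M \<ge> 0" for M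
    proof -
      define G where "G = (\<lambda>z. f z * exp (of_real M * exp (of_real \<delta> * (z - \<i> * of_real \<theta>))))"
      \<comment> \<open>On the far vertical side the decay \<open>exp (- c * exp r)\<close> wins
        over the growth \<open>exp (M * exp (\<delta> * r))\<close> because
        \<open>\<delta> < 1\<close>. How far out the side must lie depends on
        \<open>M\<close>.\<close>
      have ev: "eventually (\<lambda>r. (K + exp r powr B) * exp (- c * exp r) * exp (M * exp (\<delta> * r)) < 1) at_top"
      proof -
        define b where "b = max B 0"
        have "((\<lambda>r::real. r * exp (- r)) \<longlongrightarrow> 0) at_top" by real_asymp
        moreover have "((\<lambda>r. exp (- ((1 - \<delta>) * r))) \<longlongrightarrow> 0) at_top"
        proof -
          have "((\<lambda>r. exp (- (y * r))) \<longlongrightarrow> 0) at_top" if "y > 0" for y :: real using that by real_asymp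
          thus ?thesis using \<delta> by simp
        qed
        ultimately have "((\<lambda>r. b * (r * exp (- r)) + M * exp (- ((1 - \<delta>) * r))) \<longlongrightarrow> b * 0 + M * 0) at_top"
          by (intro tendsto_intros)
        hence "eventually (\<lambda>r. b * (r * exp (- r)) + M * exp (- ((1 - \<delta>) * r)) < c / 2) at_top"
          using c by (intro order_tendstoD(2)) auto
        moreover have "((\<lambda>r. (K + 1) * exp (- (c / 2) * exp r)) \<longlongrightarrow> 0) at_top"
        proof -
          have "((\<lambda>r. (K + 1) * exp (- y * exp r)) \<longlongrightarrow> 0) at_top" if "y > 0" for y :: real
            using that by real_asymp
          from this[of "c / 2"] show ?thesis using c by simp
        qed
        hence "eventually (\<lambda>r. (K + 1) * exp (- (c / 2) * exp r) < 1) at_top"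
          by (rule order_tendstoD) simp
        moreover have "eventually (\<lambda>r. r \<ge> (0::real)) at_top" by (rule eventually_ge_at_top)
        ultimately show ?thesis
        proof eventually_elim
          case (elim r)
          have "K + exp r powr B \<le> K * exp (b * r) + exp (b * r)"
            using elim(3) K by (intro add_mono mult_left_mono[of 1 _ K, simplified])
                (auto simp: b_def exp_powr_real mult.commute[of r] intro!: mult_right_mono)
          also have "\<dots> = (K + 1) * exp (b * r)" by (simp add: algebra_simps)
          finally have "(K + exp r powr B) * exp (- c * exp r) * exp (M * exp (\<delta> * r)) \<le>
            (K + 1) * exp (b * r) * exp (- c * exp r) * exp (M * exp (\<delta> * r))"
            by (intro mult_right_mono) auto
          also have "\<dots> = (K + 1) * exp (b * r - c * exp r + M * exp (\<delta> * r))"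
            by (simp add: exp_add exp_diff exp_minus divide_simps)
          also have "b * r - c * exp r + M * exp (\<delta> * r) =
              exp r * (b * (r * exp (- r)) + M * exp (- ((1 - \<delta>) * r)) - c)"
            by (simp add: algebra_simps exp_diff exp_minus exp_add)
          also have "(K + 1) * exp \<dots> \<le> (K + 1) * exp (exp r * (- (c / 2)))"
          proof -
            have "b * (r * exp (- r)) + M * exp (- ((1 - \<delta>) * r)) - c \<le> - (c / 2)"
              using elim(1) by simp
            hence "exp r * (b * (r * exp (- r)) + M * exp (- ((1 - \<delta>) * r)) - c) \<le> exp r * (- (c / 2))"
              by (rule mult_left_mono) auto
            thus ?thesis using K by (intro mult_left_mono) auto
          qed
          also have "\<dots> < 1" using elim(2) by (simp add: mult_ac)
          finally show ?case .
        qed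
      qed
      from eventually_happens'[OF trivial_limit_at_top_linorder eventually_conj[OF ev eventually_gt_at_top[of s]]]
      obtain r where r: "(K + exp r powr B) * exp (- c * exp r) * exp (M * exp (\<delta> * r)) < 1" "r > s"
        by blast
      define Q where "Q = cbox (Complex 0 (\<theta> - (pi / 2 + \<epsilon>))) (Complex r (\<theta> + (pi / 2 + \<epsilon>)))"
      have QZ: "Q \<subseteq> Z" by (auto simp: Q_def Z_def in_cbox_complex_iff abs_le_iff)
      have G_an: "G analytic_on Q" unfolding G_def
        by (intro analytic_intros analytic_on_subset[OF f_an QZ])
      have nE: "norm (exp (of_real M * exp (of_real \<delta> * (z - \<i> * of_real \<theta>)))) =
          exp (M * (exp (\<delta> * Re z) * cos (\<delta> * (Im z - \<theta>))))" for z
        by (simp add: Re_exp)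
      have fr: "norm (G z) \<le> (K + 1) * exp M" if z: "z \<in> frontier Q" for z
      proof -
        have zQ: "z \<in> Q" using z by (simp add: Q_def frontier_cbox)
        hence zZ: "z \<in> Z" using QZ by auto
        have M1: "exp M \<ge> 1" using M by simp
        have "Re z = 0 \<or> Re z = r \<or> Im z = \<theta> + (pi / 2 + \<epsilon>) \<or> Im z = \<theta> - (pi / 2 + \<epsilon>)"
          using z unfolding Q_def frontier_cbox
          by (auto simp: in_cbox_complex_iff in_box_complex_iff)
        moreover have ?thesis if "Re z = 0"
        proof -
          have "M * (exp (\<delta> * Re z) * cos (\<delta> * (Im z - \<theta>))) \<le> M * (exp (\<delta> * Re z) * 1)"
            using M by (intro mult_left_mono) auto
          hence "norm (G z) \<le> K * exp M"
            unfolding G_def norm_mult nE using FK[OF Zsec[OF zZ]] K that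
            by (intro mult_mono) (auto simp: f_def)
          also have "\<dots> \<le> (K + 1) * exp M" by (intro mult_right_mono) auto
          finally show ?thesis .
        qed
        moreover have ?thesis if "Re z = r"
        proof -
          have "M * (exp (\<delta> * Re z) * cos (\<delta> * (Im z - \<theta>))) \<le> M * (exp (\<delta> * r) * 1)"
            using M that by (auto intro!: mult_left_mono)
          moreover have "norm (f z) \<le> (K + exp r powr B) * exp (- c * exp r)"
            using decay[OF Zsec[OF zZ]] that by (simp add: f_def)
          ultimately have "norm (G z) \<le> (K + exp r powr B) * exp (- c * exp r) * exp (M * exp (\<delta> * r))"
            unfolding G_def norm_mult nE using K by (intro mult_mono) auto
          also have "\<dots> \<le> 1" using r by simp
          also have "\<dots> \<le> (K + 1) * exp M" using M1 K mult_mono[of 1 "K + 1" 1 "exp M"] by auto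
          finally show ?thesis .
        qed
        moreover have ?thesis if "Im z = \<theta> + (pi / 2 + \<epsilon>) \<or> Im z = \<theta> - (pi / 2 + \<epsilon>)"
        proof -
          have "\<delta> * (pi / 2 + \<epsilon>) = pi / 2" using \<epsilon> by (simp add: \<delta>_def field_simps add_nonneg_eq_0_iff)
          moreover have "Im z - \<theta> = pi / 2 + \<epsilon> \<or> Im z - \<theta> = - (pi / 2 + \<epsilon>)" using that by auto
          ultimately have "\<delta> * (Im z - \<theta>) = pi / 2 \<or> \<delta> * (Im z - \<theta>) = - (pi / 2)"
            by (metis mult_minus_right)
          hence "cos (\<delta> * (Im z - \<theta>)) = 0"
            by (elim disjE) (simp_all only: cos_pi_half cos_minus)
          hence "norm (G z) = norm (f z)" unfolding G_def norm_mult nE by simp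
          also have "\<dots> \<le> K" using FK[OF Zsec[OF zZ]] by (simp add: f_def)
          also have "\<dots> \<le> (K + 1) * exp M" using M1 K mult_mono[of K "K + 1" 1 "exp M"] by auto
          finally show ?thesis .
        qed
        ultimately show ?thesis by blast
      qed
      have "norm (G (Complex s \<theta>)) \<le> (K + 1) * exp M"
      proof (rule maximum_modulus_frontier[of G Q])
        show "G holomorphic_on interior Q"
          by (rule holomorphic_on_subset[OF analytic_imp_holomorphic[OF G_an] interior_subset])
        show "continuous_on (closure Q) G"
          using holomorphic_on_imp_continuous_on[OF analytic_imp_holomorphic[OF G_an]] by (simp add: Q_def)
        show "bounded Q" by (simp add: Q_def)
        show "Complex s \<theta> \<in> Q" using s r(2) \<epsilon> pi_gt_zero by (auto simp: Q_def in_cbox_complex_iff)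
      qed (fact fr)
      also have "norm (G (Complex s \<theta>)) = norm (f (Complex s \<theta>)) * exp (M * exp (\<delta> * s))"
        unfolding G_def norm_mult nE by simp
      finally show ?thesis by (simp add: exp_diff right_diff_distrib field_simps)
    qed
    have "((\<lambda>M. (K + 1) * exp (M * (1 - exp (\<delta> * s)))) \<longlongrightarrow> 0) at_top"
    proof -
      have neg: "1 - exp (\<delta> * s) < 0" using \<delta> s by simp
      have "((\<lambda>M. (K + 1) * exp (M * - y)) \<longlongrightarrow> 0) at_top" if "y > 0" for y :: real
        using that by real_asymp
      from this[of "exp (\<delta> * s) - 1"] neg show ?thesis by simp
    qed
    hence "norm (f (Complex s \<theta>)) \<le> 0"
      by (rule tendsto_lowerbound) (auto intro!: eventually_mono[OF eventually_ge_at_top[of 0]] main)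
    thus ?thesis by simp
  qed
  have D_open: "open D" unfolding D_def
    by (intro open_Collect_conj open_Collect_less continuous_intros)
  have D_convex: "convex D"
  proof -
    have "D = {z. Re z > 0} \<inter> {z. Im z < \<theta> + (pi / 2 + \<epsilon>)} \<inter> {z. Im z > \<theta> - (pi / 2 + \<epsilon>)}"
      by (auto simp: D_def abs_less_iff)
    thus ?thesis
      by (auto intro!: convex_Int convex_halfspace_Re_gt convex_halfspace_Im_lt convex_halfspace_Im_gt)
  qed
  have DZ: "D \<subseteq> Z" by (auto simp: D_def Z_def)
  have f0: "f z = 0" if z: "z \<in> D" for z
  proof (rule analytic_continuation[of f D "(\<lambda>s. Complex s \<theta>) ` {0<..}" "Complex 1 \<theta>"])
    show "f holomorphic_on D"
      by (rule analytic_imp_holomorphic[OF analytic_on_subset[OF f_an DZ]])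
    show "Complex 1 \<theta> islimpt (\<lambda>s. Complex s \<theta>) ` {0<..}"
    proof (rule islimptI)
      fix T :: "complex set" assume T: "Complex 1 \<theta> \<in> T" "open T"
      then obtain e where e: "e > 0" "ball (Complex 1 \<theta>) e \<subseteq> T" by (meson openE)
      have "Complex (1 + e / 2) \<theta> \<in> ball (Complex 1 \<theta>) e"
        using e(1) by (simp add: dist_norm cmod_def)
      thus "\<exists>y\<in>(\<lambda>s. Complex s \<theta>) ` {0<..}. y \<in> T \<and> y \<noteq> Complex 1 \<theta>"
        using e by (intro bexI[of _ "Complex (1 + e / 2) \<theta>"]) auto
    qed
  qed (use z axis D_open convex_connected[OF D_convex] \<epsilon> in \<open>auto simp: D_def\<close>)
  obtain z where z: "x = exp z" "z \<in> Z"
    using x by (elim large_sectorE) (auto simp: Z_def)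
  \<comment> \<open>Vanishing is known in the open half-strip only. A point of the closed half-strip
    is approached along the segment towards the interior point
    \<open>Complex 1 \<theta>\<close>.\<close>
  define y where "y = (\<lambda>n::nat. z + of_real (1 / real (n + 2)) * (Complex 1 \<theta> - z))"
  have yD: "y n \<in> D" for n
  proof -
    define t where "t = 1 / real (n + 2)"
    have t: "t > 0" "t < 1" by (auto simp: t_def)
    have y_eq: "y n = z + of_real t * (Complex 1 \<theta> - z)" by (simp only: y_def t_def)
    have "Re (y n) = (1 - t) * Re z + t" "Im (y n) - \<theta> = (1 - t) * (Im z - \<theta>)"
      unfolding y_eq by (simp_all add: algebra_simps)
    moreover have "(1 - t) * Re z + t > 0"
      using t z(2) by (intro add_nonneg_pos mult_nonneg_nonneg) (auto simp: Z_def)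
    moreover have "\<bar>(1 - t) * (Im z - \<theta>)\<bar> < pi / 2 + \<epsilon>"
    proof -
      have "\<bar>(1 - t) * (Im z - \<theta>)\<bar> \<le> (1 - t) * (pi / 2 + \<epsilon>)"
        using t z(2) by (auto simp: abs_mult Z_def intro!: mult_left_mono)
      also have "\<dots> < 1 * (pi / 2 + \<epsilon>)"
        using t \<epsilon> pi_gt_zero by (intro mult_strict_right_mono) (auto intro: add_pos_pos)
      finally show ?thesis by simp
    qed
    ultimately show ?thesis by (simp add: D_def)
  qed
  have "(\<lambda>n. 1 / real (n + 2)) \<longlonglongrightarrow> 0" by real_asymp
  hence "y \<longlonglongrightarrow> z + of_real 0 * (Complex 1 \<theta> - z)"
    unfolding y_def by (intro tendsto_intros)
  hence "y \<longlonglongrightarrow> z" by simp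
  moreover have "isCont f z"
    using f_an z(2) by (meson analytic_at_imp_isCont analytic_on_analytic_at)
  ultimately have "(\<lambda>n. f (y n)) \<longlonglongrightarrow> f z" by (rule isCont_tendsto_compose[rotated])
  hence "(\<lambda>n. 0) \<longlonglongrightarrow> f z" using f0[OF yD] by simp
  hence "f z = 0" using LIMSEQ_unique tendsto_const by blast
  thus ?thesis using z by (simp add: f_def)
qed

section \<open>Gevrey expansions\<close>

lemma fact_add_le: "fact (N + K) \<le> (fact N * fact K * 2 ^ (N + K) :: real)"
proof -
  have "real ((N + K) choose N) \<le> real (2 ^ (N + K))"
    by (intro of_nat_mono binomial_le_pow2)
  moreover have "fact (N + K) = (fact N * fact K * real ((N + K) choose N) :: real)"
    using binomial_fact_lemma[of N "N + K"] by (metis le_add1 add_diff_cancel_left' of_nat_fact of_nat_mult)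
  ultimately show ?thesis by (simp add: mult_left_mono)
qed

lemma powr_mono_base1: "1 \<le> x \<Longrightarrow> a \<le> b \<Longrightarrow> x powr a \<le> x powr (b::real)"
  by (rule powr_mono) auto

section \<open>Functions with a Gevrey expansion on a fixed sector\<close>

locale sector =
  fixes \<theta> \<epsilon> :: real and q :: nat
  assumes \<epsilon>: "0 < \<epsilon>" "\<epsilon> < pi / 2" and q: "q > 0"
begin

definition sec where "sec = large_sector \<theta> \<epsilon> 1"

text \<open>The monomial \<open>x^(m - k/q) * log(1/x)^i\<close>: all exponents lie on the lattice generated by \<open>1/q\<close>.\<close>

definition lterm :: "nat \<Rightarrow> nat \<Rightarrow> nat \<Rightarrow> complex \<Rightarrow> complex" where
  "lterm m i k x = exp ((of_nat m - of_nat k / of_nat q) * log_about \<theta> x) * (- log_about \<theta> x) ^ i"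

text \<open>The index \<open>k\<close> counts steps of size \<open>1/q\<close>, so that
  \<open>q * N\<close> terms go down by \<open>N\<close> powers of \<open>x\<close>, and
  \<open>fact (k div q)\<close> is growth of Gevrey order one. \<open>m\<close> is an integer
  offset, \<open>I\<close> bounds the powers of the logarithm, and \<open>B\<close> absorbs every
  loss of a fixed power of \<open>x\<close>. The coefficients are bounded along with the remainders,
  because moving the truncation point by a fixed amount has to be paid for by single terms.\<close>

definition gevrey_exp :: "nat \<Rightarrow> nat \<Rightarrow> (nat \<Rightarrow> nat \<Rightarrow> complex) \<Rightarrow> real \<Rightarrow> real \<Rightarrow> (complex \<Rightarrow> complex) \<Rightarrow> bool" where
  "gevrey_exp m I c B C F \<longleftrightarrow> F analytic_on sec \<and> C \<ge> 1 \<and> B \<ge> 0 \<and>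
     (\<forall>i k. c i k \<in> H_ring) \<and> (\<forall>i k. norm (c i k) \<le> C ^ (k + 1) * fact (k div q)) \<and>
     (\<forall>i\<ge>I. \<forall>k. c i k = 0) \<and>
     (\<forall>x\<in>sec. \<forall>N\<ge>1. norm (F x - (\<Sum>i<I. \<Sum>k<q * N. c i k * lterm m i k x))
        \<le> C ^ N * fact N * norm x powr (B - real N))"

definition log_const :: real where "log_const = 1 + \<bar>\<theta>\<bar> + pi"

lemma norm_log_about_le:
  assumes "x \<in> sec" shows "norm (log_about \<theta> x) \<le> log_const * norm x"
proof -
  have x: "norm x \<ge> 1" using assms by (simp add: sec_def large_sector_def)
  have "norm (log_about \<theta> x) \<le> \<bar>ln (norm x)\<bar> + \<bar>arg_about \<theta> x\<bar>"
    using cmod_le[of "log_about \<theta> x"] by simp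
  also have "\<dots> \<le> norm x + (\<bar>\<theta>\<bar> + pi) * norm x"
  proof (rule add_mono)
    show "\<bar>ln (norm x)\<bar> \<le> norm x" using x ln_bound[of "norm x"] by fastforce
    have "\<bar>arg_about \<theta> x\<bar> \<le> (\<bar>\<theta>\<bar> + pi) * 1" using arg_about_bounds[of \<theta> x] by (simp add: abs_if)
    also have "\<dots> \<le> (\<bar>\<theta>\<bar> + pi) * norm x" using x by (intro mult_left_mono) auto
    finally show "\<bar>arg_about \<theta> x\<bar> \<le> (\<bar>\<theta>\<bar> + pi) * norm x" .
  qed
  finally show ?thesis by (simp add: log_const_def algebra_simps)
qed

lemma log_const_ge1: "log_const \<ge> 1" by (simp add: log_const_def)

lemma sec_norm: "x \<in> sec \<Longrightarrow> norm x \<ge> 1" by (simp add: sec_def large_sector_def)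

text \<open>Every logarithm is estimated by a whole factor \<open>norm x\<close>. This is wasteful,
  but the loss is a fixed power and disappears in the constant \<open>B\<close>.\<close>

lemma norm_lterm_le:
  assumes "x \<in> sec" "i \<le> I"
  shows "norm (lterm m i k x) \<le> log_const ^ I * norm x powr (real I + real m - real (k div q))"
proof -
  have x: "norm x \<ge> 1" using assms by (simp add: sec_norm)
  have eq: "(of_nat m - of_nat k / of_nat q :: complex) = of_real (real m - real k / real q)" by simp
  have "Re ((of_nat m - of_nat k / of_nat q) * log_about \<theta> x) = (real m - real k / real q) * ln (norm x)"
    unfolding eq by (simp del: of_real_diff of_real_divide)
  hence "norm (lterm m i k x) = norm x powr (real m - real k / real q) * norm (log_about \<theta> x) ^ i"
    using x by (auto simp: lterm_def norm_mult norm_power powr_def)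
  also have "\<dots> \<le> norm x powr (real m - real (k div q)) * (log_const * norm x) ^ I"
  proof (intro mult_mono powr_mono_base1)
    show "real m - real k / real q \<le> real m - real (k div q)"
    proof -
      have "real (k div q * q) \<le> real k" by (intro of_nat_mono div_times_less_eq_dividend)
      thus ?thesis using q by (simp add: pos_le_divide_eq)
    qed
    have "norm (log_about \<theta> x) ^ i \<le> (log_const * norm x) ^ i"
      by (intro power_mono norm_log_about_le assms) auto
    also have "\<dots> \<le> (log_const * norm x) ^ I"
      using x log_const_ge1 mult_mono[of 1 log_const 1 "norm x"] by (intro power_increasing assms) auto
    finally show "norm (log_about \<theta> x) ^ i \<le> (log_const * norm x) ^ I" .
  qed (use x in auto)
  also have "\<dots> = log_const ^ I * norm x powr (real I + real m - real (k div q))"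
  proof -
    have xp: "norm x > 0" using x by linarith
    show ?thesis using xp by (simp add: power_mult_distrib powr_add powr_diff powr_realpow[OF xp])
  qed
  finally show ?thesis .
qed

lemma gevrey_exp_bound:
  assumes "gevrey_exp m I c B C F"
  shows "\<exists>D\<ge>1. \<forall>x\<in>sec. norm (F x) \<le> D * norm x powr (B + real I + real m)"
proof -
  note g = assms[unfolded gevrey_exp_def]
  define D where "D = C + (\<Sum>i<I. \<Sum>k<q * 1. norm (c i k) * log_const ^ I)"
  have D: "D \<ge> 1" unfolding D_def using g log_const_ge1
    by (intro add_increasing2 sum_nonneg mult_nonneg_nonneg zero_le_power) auto
  have "norm (F x) \<le> D * norm x powr (B + real I + real m)" if x: "x \<in> sec" for x
  proof -
    have x1: "norm x \<ge> 1" by (rule sec_norm[OF x])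
    have "norm (F x) \<le> norm (F x - (\<Sum>i<I. \<Sum>k<q * 1. c i k * lterm m i k x)) + norm (\<Sum>i<I. \<Sum>k<q * 1. c i k * lterm m i k x)"
      using norm_triangle_ineq[of "F x - (\<Sum>i<I. \<Sum>k<q * 1. c i k * lterm m i k x)" "\<Sum>i<I. \<Sum>k<q * 1. c i k * lterm m i k x"] by simp
    also have "norm (F x - (\<Sum>i<I. \<Sum>k<q * 1. c i k * lterm m i k x)) \<le> C ^ 1 * fact 1 * norm x powr (B - real 1)"
      using g x by blast
    also have "\<dots> \<le> C * norm x powr (B + real I + real m)"
      using g x1 by (auto intro!: mult_left_mono powr_mono_base1)
    also have "norm (\<Sum>i<I. \<Sum>k<q * 1. c i k * lterm m i k x) \<le>
        (\<Sum>i<I. \<Sum>k<q * 1. norm (c i k) * log_const ^ I * norm x powr (B + real I + real m))"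
    proof (intro sum_norm_le)
      fix i k assume ik: "i \<in> {..<I}" "k \<in> {..<q * 1}"
      have "norm (c i k * lterm m i k x) \<le> norm (c i k) * (log_const ^ I * norm x powr (real I + real m - real (k div q)))"
        unfolding norm_mult by (intro mult_left_mono norm_lterm_le x) (use ik in auto)
      also have "\<dots> \<le> norm (c i k) * (log_const ^ I * norm x powr (B + real I + real m))"
        using g x1 log_const_ge1 by (intro mult_left_mono powr_mono_base1) auto
      finally show "norm (c i k * lterm m i k x) \<le> norm (c i k) * log_const ^ I * norm x powr (B + real I + real m)"
        by (simp add: mult_ac)
    qed
    finally show ?thesis by (simp add: D_def algebra_simps sum_distrib_left sum_distrib_right)
  qed
  with D show ?thesis by (intro exI[of _ D] conjI ballI)
qed

lemma gevrey_exp_mono: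
  assumes "gevrey_exp m I c B C F" "I \<le> I'" "B \<le> B'" "C \<le> C'"
  shows "gevrey_exp m I' c B' C' F"
proof -
  note g = assms(1)[unfolded gevrey_exp_def]
  show ?thesis unfolding gevrey_exp_def
  proof (intro conjI allI impI ballI)
    fix i k
    have "norm (c i k) \<le> C ^ (k + 1) * fact (k div q)" using g by blast
    also have "\<dots> \<le> C' ^ (k + 1) * fact (k div q)"
      using g assms by (intro mult_right_mono power_mono) auto
    finally show "norm (c i k) \<le> C' ^ (k + 1) * fact (k div q)" .
  next
    fix x N assume x: "x \<in> sec" and N: "(1::nat) \<le> N"
    have "(\<Sum>i<I'. \<Sum>k<q * N. c i k * lterm m i k x) = (\<Sum>i<I. \<Sum>k<q * N. c i k * lterm m i k x)"
      using g assms by (intro sum.mono_neutral_right) auto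
    hence "norm (F x - (\<Sum>i<I'. \<Sum>k<q * N. c i k * lterm m i k x)) \<le> C ^ N * fact N * norm x powr (B - real N)"
      using g x N by auto
    also have "\<dots> \<le> C' ^ N * fact N * norm x powr (B' - real N)"
      using g assms sec_norm[OF x] by (intro mult_mono power_mono powr_mono_base1) auto
    finally show "norm (F x - (\<Sum>i<I'. \<Sum>k<q * N. c i k * lterm m i k x)) \<le> C' ^ N * fact N * norm x powr (B' - real N)" .
  qed (use g assms in auto)
qed

lemma power_add_le_add_power:
  fixes a b :: real
  assumes "a \<ge> 0" "b \<ge> 0" "N \<ge> 1"
  shows "a ^ N + b ^ N \<le> (a + b) ^ N"
  using assms(3)
proof (induction N rule: dec_induct)
  case (step n)
  have "a ^ Suc n + b ^ Suc n \<le> (a + b) * (a ^ n + b ^ n)"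
    using assms by (simp add: algebra_simps)
  also have "\<dots> \<le> (a + b) * (a + b) ^ n" using assms step by (intro mult_left_mono) auto
  finally show ?case by simp
qed auto

lemma gevrey_exp_add:
  assumes "gevrey_exp m I c B C F" "gevrey_exp m I c' B C F'"
  shows "gevrey_exp m I (\<lambda>i k. c i k + c' i k) B (C + C) (\<lambda>x. F x + F' x)"
proof -
  note g = assms(1)[unfolded gevrey_exp_def] and g' = assms(2)[unfolded gevrey_exp_def]
  have C2: "C ^ n + C ^ n \<le> (C + C) ^ n" if "n \<ge> 1" for n
    using power_add_le_add_power[of C C n] g that by auto
  show ?thesis unfolding gevrey_exp_def
  proof (intro conjI allI impI ballI)
    fix i k
    have "norm (c i k + c' i k) \<le> C ^ (k + 1) * fact (k div q) + C ^ (k + 1) * fact (k div q)"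
      using g g' by (intro norm_triangle_mono) auto
    also have "\<dots> = (C ^ (k + 1) + C ^ (k + 1)) * fact (k div q)" by (simp add: algebra_simps)
    also have "\<dots> \<le> (C + C) ^ (k + 1) * fact (k div q)" by (intro mult_right_mono C2) auto
    finally show "norm (c i k + c' i k) \<le> (C + C) ^ (k + 1) * fact (k div q)" .
  next
    fix x N assume x: "x \<in> sec" and N: "(1::nat) \<le> N"
    have "norm (F x + F' x - (\<Sum>i<I. \<Sum>k<q * N. (c i k + c' i k) * lterm m i k x)) =
        norm ((F x - (\<Sum>i<I. \<Sum>k<q * N. c i k * lterm m i k x)) + (F' x - (\<Sum>i<I. \<Sum>k<q * N. c' i k * lterm m i k x)))"
      by (simp add: algebra_simps sum.distrib)
    also have "\<dots> \<le> C ^ N * fact N * norm x powr (B - real N) + C ^ N * fact N * norm x powr (B - real N)"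
      using g g' x N by (intro norm_triangle_mono) auto
    also have "\<dots> = (C ^ N + C ^ N) * (fact N * norm x powr (B - real N))" by (simp add: algebra_simps)
    also have "\<dots> \<le> (C + C) ^ N * (fact N * norm x powr (B - real N))" by (intro mult_right_mono C2 N) auto
    finally show "norm (F x + F' x - (\<Sum>i<I. \<Sum>k<q * N. (c i k + c' i k) * lterm m i k x)) \<le> (C + C) ^ N * fact N * norm x powr (B - real N)"
      by (simp add: mult_ac)
  qed (use g g' in \<open>auto intro!: analytic_intros H_ring_add\<close>)
qed

lemma gevrey_exp_cmult:
  assumes "gevrey_exp m I c B C F" "a \<in> H_ring"
  shows "gevrey_exp m I (\<lambda>i k. a * c i k) B (max 1 (norm a) * C) (\<lambda>x. a * F x)"
proof -
  note g = assms(1)[unfolded gevrey_exp_def]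
  define A where "A = max 1 (norm a)"
  have A: "A \<ge> 1" "norm a \<le> A" by (auto simp: A_def)
  have aC: "norm a * (C ^ n * y) \<le> (A * C) ^ n * y" if "n \<ge> 1" "y \<ge> 0" for n y
  proof -
    have "norm a \<le> A ^ n" using A power_increasing[of 1 n A] that by auto
    hence "norm a * (C ^ n * y) \<le> A ^ n * (C ^ n * y)" using g that by (intro mult_right_mono) auto
    thus ?thesis by (simp add: power_mult_distrib mult_ac)
  qed
  show ?thesis unfolding gevrey_exp_def A_def[symmetric]
  proof (intro conjI allI impI ballI)
    fix i k
    have "norm (a * c i k) \<le> norm a * (C ^ (k + 1) * fact (k div q))"
      unfolding norm_mult using g by (intro mult_left_mono) auto
    also have "\<dots> \<le> (A * C) ^ (k + 1) * fact (k div q)" by (intro aC) auto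
    finally show "norm (a * c i k) \<le> (A * C) ^ (k + 1) * fact (k div q)" .
  next
    fix x N assume x: "x \<in> sec" and N: "(1::nat) \<le> N"
    have "norm (a * F x - (\<Sum>i<I. \<Sum>k<q * N. a * c i k * lterm m i k x)) =
        norm a * norm (F x - (\<Sum>i<I. \<Sum>k<q * N. c i k * lterm m i k x))"
      unfolding norm_mult[symmetric] by (simp add: algebra_simps sum_distrib_left)
    also have "\<dots> \<le> norm a * (C ^ N * (fact N * norm x powr (B - real N)))"
      using g x N by (intro mult_left_mono) (auto simp: mult_ac)
    also have "\<dots> \<le> (A * C) ^ N * (fact N * norm x powr (B - real N))" by (intro aC N) auto
    finally show "norm (a * F x - (\<Sum>i<I. \<Sum>k<q * N. a * c i k * lterm m i k x)) \<le> (A * C) ^ N * fact N * norm x powr (B - real N)"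
      by (simp add: mult_ac)
  next
    show "A * C \<ge> 1" using A g mult_mono[of 1 A 1 C] by auto
  qed (use g assms(2) in \<open>auto intro!: analytic_intros H_ring_mult\<close>)
qed

lemma gevrey_exp_mult_ident:
  assumes "gevrey_exp m I c B C F"
  shows "gevrey_exp (Suc m) I c (B + 1) C (\<lambda>x. x * F x)"
proof -
  note g = assms(1)[unfolded gevrey_exp_def]
  show ?thesis unfolding gevrey_exp_def
  proof (intro conjI allI impI ballI)
    fix x N assume x: "x \<in> sec" and N: "(1::nat) \<le> N"
    have x1: "norm x \<ge> 1" "x \<noteq> 0" using sec_norm[OF x] by auto
    have "lterm (Suc m) i k x = x * lterm m i k x" for i k
      using exp_log_about[OF x1(2), of \<theta>]
      by (simp add: lterm_def exp_add ring_distribs exp_diff)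
    hence "norm (x * F x - (\<Sum>i<I. \<Sum>k<q * N. c i k * lterm (Suc m) i k x)) =
        norm x * norm (F x - (\<Sum>i<I. \<Sum>k<q * N. c i k * lterm m i k x))"
      unfolding norm_mult[symmetric] by (simp add: algebra_simps sum_distrib_left)
    also have "\<dots> \<le> norm x * (C ^ N * fact N * norm x powr (B - real N))"
      using g x N by (intro mult_left_mono) auto
    also have "\<dots> = C ^ N * fact N * norm x powr (B + 1 - real N)"
      using x1 by (simp add: powr_add powr_diff)
    finally show "norm (x * F x - (\<Sum>i<I. \<Sum>k<q * N. c i k * lterm (Suc m) i k x)) \<le> C ^ N * fact N * norm x powr (B + 1 - real N)" .
  qed (use g in \<open>auto intro!: analytic_intros\<close>)
qed

text \<open>Expansions can be added only with equal offsets \<open>m\<close>. Raising the offset by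
  \<open>d\<close> puts \<open>q * d\<close> zeros in front of the coefficients; for
  \<open>N \<le> d\<close> the truncated sum is then empty, and the estimate must come from the
  growth of \<open>F\<close> itself. This dictates \<open>B'\<close>.\<close>

lemma gevrey_exp_shift:
  assumes "gevrey_exp m I c B C F"
  shows "\<exists>c' B' C'. gevrey_exp (m + d) I c' B' C' F"
proof -
  note g = assms(1)[unfolded gevrey_exp_def]
  from gevrey_exp_bound[OF assms] obtain D where D: "D \<ge> 1"
    "\<And>x. x \<in> sec \<Longrightarrow> norm (F x) \<le> D * norm x powr (B + real I + real m)" by blast
  define c' where "c' = (\<lambda>i k. if k \<ge> q * d then c i (k - q * d) else 0)"
  define B' where "B' = B + real I + real m + real d"
  define C' where "C' = max C D"
  have lt: "lterm (m + d) i (k + q * d) x = lterm m i k x" for i k x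
    using q by (simp add: lterm_def field_simps)
  have "gevrey_exp (m + d) I c' B' C' F" unfolding gevrey_exp_def
  proof (intro conjI allI impI ballI)
    fix i k
    show "norm (c' i k) \<le> C' ^ (k + 1) * fact (k div q)"
    proof (cases "k \<ge> q * d")
      case True
      have "norm (c' i k) \<le> C ^ (k - q * d + 1) * fact ((k - q * d) div q)" using g True by (auto simp: c'_def)
      also have "\<dots> \<le> C ^ (k + 1) * fact (k div q)"
        using g by (intro mult_mono power_increasing fact_mono div_le_mono) auto
      also have "\<dots> \<le> C' ^ (k + 1) * fact (k div q)"
        using g by (intro mult_right_mono power_mono) (auto simp: C'_def)
      finally show ?thesis .
    next
      case False
      thus ?thesis using g by (auto simp: c'_def C'_def)
    qed
  next
    fix x N assume x: "x \<in> sec" and N: "(1::nat) \<le> N"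
    have x1: "norm x \<ge> 1" using sec_norm[OF x] .
    show "norm (F x - (\<Sum>i<I. \<Sum>k<q * N. c' i k * lterm (m + d) i k x)) \<le> C' ^ N * fact N * norm x powr (B' - real N)"
    proof (cases "N \<le> d")
      case True
      hence le: "q * N \<le> q * d" by simp
      have "c' i k = 0" if "k < q * N" for i k using less_le_trans[OF that le] by (simp add: c'_def)
      hence "norm (F x - (\<Sum>i<I. \<Sum>k<q * N. c' i k * lterm (m + d) i k x)) = norm (F x)" by simp
      also have "\<dots> \<le> D * 1 * norm x powr (B + real I + real m)" using D(2)[OF x] by simp
      also have "\<dots> \<le> C' ^ N * fact N * norm x powr (B' - real N)"
      proof (intro mult_mono powr_mono_base1 x1)
        have "D \<le> C' ^ 1" by (simp add: C'_def)
        also have "\<dots> \<le> C' ^ N" using g N by (intro power_increasing) (auto simp: C'_def)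
        finally show "D \<le> C' ^ N" .
      qed (use True D g in \<open>auto simp: B'_def C'_def\<close>)
      finally show ?thesis .
    next
      case False
      define M where "M = N - d"
      have M: "M \<ge> 1" "N = M + d" using False by (auto simp: M_def)
      have "(\<Sum>k<q * N. c' i k * lterm (m + d) i k x) = (\<Sum>k<q * M. c i k * lterm m i k x)" for i
      proof -
        have "(\<Sum>k<q * N. c' i k * lterm (m + d) i k x) = (\<Sum>k\<in>{q * d..<q * M + q * d}. c' i k * lterm (m + d) i k x)"
          by (intro sum.mono_neutral_right) (auto simp: c'_def M algebra_simps)
        also have "\<dots> = (\<Sum>k\<in>{0..<q * M}. c' i (k + q * d) * lterm (m + d) i (k + q * d) x)"
          using sum.shift_bounds_nat_ivl[of "\<lambda>k. c' i k * lterm (m + d) i k x" 0 "q * d" "q * M"] by simp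
        also have "\<dots> = (\<Sum>k<q * M. c i k * lterm m i k x)"
          unfolding lt by (simp add: c'_def atLeast0LessThan)
        finally show ?thesis .
      qed
      hence "norm (F x - (\<Sum>i<I. \<Sum>k<q * N. c' i k * lterm (m + d) i k x)) =
          norm (F x - (\<Sum>i<I. \<Sum>k<q * M. c i k * lterm m i k x))" by simp
      also have "\<dots> \<le> C ^ M * fact M * norm x powr (B - real M)" using g x M by auto
      also have "\<dots> \<le> C' ^ N * fact N * norm x powr (B' - real N)"
      proof (intro mult_mono powr_mono_base1 x1 fact_mono)
        have "C ^ M \<le> C' ^ M" using g by (intro power_mono) (auto simp: C'_def)
        also have "\<dots> \<le> C' ^ N" using g M by (intro power_increasing) (auto simp: C'_def)
        finally show "C ^ M \<le> C' ^ N" .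
      qed (use M D g in \<open>auto simp: B'_def C'_def\<close>)
      finally show ?thesis .
    qed
  qed (use g in \<open>auto simp: B'_def C'_def c'_def intro: H_ring_zero\<close>)
  thus ?thesis by blast
qed

definition gevrey :: "(complex \<Rightarrow> complex) \<Rightarrow> bool" where
  "gevrey F \<longleftrightarrow> (\<exists>m I c B C. gevrey_exp m I c B C F)"

lemma gevrey_common:
  assumes "gevrey F" "gevrey G"
  obtains m I c d B C where "gevrey_exp m I c B C F" "gevrey_exp m I d B C G"
proof -
  from assms obtain m1 I1 c1 B1 C1 m2 I2 c2 B2 C2
    where "gevrey_exp m1 I1 c1 B1 C1 F" "gevrey_exp m2 I2 c2 B2 C2 G"
    unfolding gevrey_def by metis
  from gevrey_exp_shift[OF this(1), of m2] gevrey_exp_shift[OF this(2), of m1]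
  obtain c B1 C1 d B2 C2 where
    *: "gevrey_exp (m1 + m2) I1 c B1 C1 F" "gevrey_exp (m1 + m2) I2 d B2 C2 G"
    by (metis add.commute)
  show ?thesis
    by (rule that[of "m1 + m2" "max I1 I2" c "max B1 B2" "max C1 C2" d])
       (auto intro: gevrey_exp_mono[OF *(1)] gevrey_exp_mono[OF *(2)])
qed

lemma gevrey_add: "gevrey F \<Longrightarrow> gevrey G \<Longrightarrow> gevrey (\<lambda>x. F x + G x)"
  by (erule (1) gevrey_common) (use gevrey_exp_add gevrey_def in blast)

lemma gevrey_cmult: "gevrey F \<Longrightarrow> a \<in> H_ring \<Longrightarrow> gevrey (\<lambda>x. a * F x)"
  unfolding gevrey_def by (blast intro: gevrey_exp_cmult)

lemma gevrey_mult_ident: "gevrey F \<Longrightarrow> gevrey (\<lambda>x. x * F x)"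
  unfolding gevrey_def by (blast intro: gevrey_exp_mult_ident)

definition expandable :: "(complex \<Rightarrow> complex) \<Rightarrow> bool" where
  "expandable f \<longleftrightarrow> (\<exists>F0 F1. gevrey F0 \<and> gevrey F1 \<and> (\<forall>x\<in>sec. f x = F0 x + exp x * F1 x))"

lemma expandable_step:
  assumes "expandable f" "expandable g" "K \<in> H_ring" "\<And>x. h x = f x + K * (x * g x)"
  shows "expandable h"
proof -
  from assms(1,2) obtain F0 F1 G0 G1 where *: "gevrey F0" "gevrey F1" "gevrey G0" "gevrey G1"
    "\<And>x. x \<in> sec \<Longrightarrow> f x = F0 x + exp x * F1 x" "\<And>x. x \<in> sec \<Longrightarrow> g x = G0 x + exp x * G1 x"
    unfolding expandable_def by metis
  show ?thesis unfolding expandable_def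
  proof (intro exI conjI ballI)
    show "gevrey (\<lambda>x. F0 x + K * (x * G0 x))"
      by (rule gevrey_add[OF *(1) gevrey_cmult[OF gevrey_mult_ident[OF *(3)] assms(3)]])
    show "gevrey (\<lambda>x. F1 x + K * (x * G1 x))"
      by (rule gevrey_add[OF *(2) gevrey_cmult[OF gevrey_mult_ident[OF *(4)] assms(3)]])
    fix x assume "x \<in> sec"
    thus "h x = F0 x + K * (x * G0 x) + exp x * (F1 x + K * (x * G1 x))"
      by (simp add: *(5,6) assms(4)) (simp add: algebra_simps)
  qed
qed

end

section \<open>From a pair of Gevrey expansions to a reduced asymptotic expansion\<close>

lemma sum_mod_div_reindex:
  fixes g :: "nat \<Rightarrow> complex"
  assumes "q > 0"
  shows "(\<Sum>k<q * N. g k) = (\<Sum>j<q. \<Sum>n<N. g (j + q * n))"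
proof -
  have "(\<Sum>j<q. \<Sum>n<N. g (j + q * n)) = (\<Sum>(j, n)\<in>{..<q} \<times> {..<N}. g (j + q * n))"
    by (simp add: sum.cartesian_product)
  also have "\<dots> = (\<Sum>k<q * N. g k)"
  proof (rule sum.reindex_bij_witness[where j = "\<lambda>(j, n). j + q * n" and i = "\<lambda>k. (k mod q, k div q)"])
    fix a assume a: "a \<in> {..<q} \<times> {..<N}"
    then obtain j n where jn: "a = (j, n)" "j < q" "n < N" by auto
    have "j + q * n < q + q * n" using jn by simp
    also have "\<dots> = q * Suc n" by simp
    also have "\<dots> \<le> q * N" using jn by (intro mult_le_mono2) auto
    finally show "(case a of (j, n) \<Rightarrow> j + q * n) \<in> {..<q * N}" using jn by simp
  qed (use assms in \<open>auto simp: less_mult_imp_div_less mult.commute\<close>)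
  finally show ?thesis ..
qed

context sector
begin

lemma lterm_eq_asymp_term:
  assumes "\<alpha> = of_nat k / of_nat q - of_nat m"
  shows "asymp_term \<theta> \<alpha> i n x = lterm m i (k + q * n) x"
proof -
  have "- of_nat n - \<alpha> = of_nat m - of_nat (k + q * n) / of_nat q"
    using q assms by (simp add: field_simps)
  thus ?thesis by (simp only: asymp_term_def lterm_def)
qed

text \<open>Dropping the leading zero coefficients of one of the series changes its truncations only by terms
  of the size of the admissible error.\<close>

lemma truncation_shift_bound:
  assumes g: "gevrey_exp m I c B C F" and i: "i < I" and j: "j < q" and kK: "k \<le> K"
    and z: "\<And>n. n < k \<Longrightarrow> c i (j + q * n) = 0" and x: "x \<in> sec" and N: "N \<ge> 1"
  shows "norm ((\<Sum>n<N. c i (j + q * (k + n)) * lterm m i (j + q * (k + n)) x) - (\<Sum>n<N. c i (j + q * n) * lterm m i (j + q * n) x))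
    \<le> (real K * (C ^ (q * (K + 1)) * fact K * 2 ^ K * log_const ^ I) * (2 * C ^ q)) ^ N * fact N * norm x powr (real I + real m - real N)
      \<or> k = 0"
proof (cases "k = 0")
  case False
  note g = g[unfolded gevrey_exp_def]
  define t where "t = (\<lambda>n. c i (j + q * n) * lterm m i (j + q * n) x)"
  define E where "E = C ^ (q * (K + 1)) * fact K * 2 ^ K * log_const ^ I"
  have K1: "K \<ge> 1" using False kK by linarith
  have C: "C \<ge> 1" using g by blast
  have E1: "E \<ge> 1" unfolding E_def using C log_const_ge1
    by (intro mult_ge1_I one_le_power fact_ge_1) auto
  have C2: "2 * C ^ q \<ge> 1" using C one_le_power[of C q] by linarith
  \<comment> \<open>The window of summation moves from [0, N) to [k, k + N). It loses only zeros and
    gains the \<open>k\<close> terms from index \<open>N\<close> on.\<close>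
  have "(\<Sum>n<N. t (k + n)) = (\<Sum>n\<in>{k..<N + k}. t n)"
    using sum.shift_bounds_nat_ivl[of t 0 k N] by (simp add: atLeast0LessThan add.commute)
  also have "\<dots> = (\<Sum>n<N + k. t n)"
    by (intro sum.mono_neutral_left) (auto simp: t_def z)
  also have "\<dots> = (\<Sum>n<N. t n) + (\<Sum>n\<in>{N..<N + k}. t n)"
    by (subst sum.atLeastLessThan_concat[of 0 N "N + k" t, symmetric, unfolded atLeast0LessThan]) auto
  finally have eq: "(\<Sum>n<N. t (k + n)) - (\<Sum>n<N. t n) = (\<Sum>n\<in>{N..<N + k}. t n)" by simp
  have "norm (\<Sum>n\<in>{N..<N + k}. t n) \<le> (\<Sum>n\<in>{N..<N + k}. E * (2 * C ^ q) ^ N * fact N * norm x powr (real I + real m - real N))"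
  proof (rule sum_norm_le)
    fix n assume n: "n \<in> {N..<N + k}"
    have nK: "n \<le> N + K" using n kK by auto
    have d: "(j + q * n) div q = n" using j by simp
    have "norm (c i (j + q * n)) \<le> C ^ (j + q * n + 1) * fact ((j + q * n) div q)" using g by blast
    hence "norm (t n) \<le> (C ^ (j + q * n + 1) * fact n) * (log_const ^ I * norm x powr (real I + real m - real n))"
      unfolding t_def norm_mult using norm_lterm_le[OF x, of i I m "j + q * n"] i C
      unfolding d by (intro mult_mono) auto
    also have "\<dots> \<le> (C ^ (q * (K + 1) + q * N) * (fact N * fact K * 2 ^ (N + K))) * (log_const ^ I * norm x powr (real I + real m - real N))"
    proof (intro mult_mono power_increasing powr_mono_base1 sec_norm[OF x])
      have "q * n \<le> q * (N + K)" using nK by simp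
      thus "j + q * n + 1 \<le> q * (K + 1) + q * N" using j by (simp add: algebra_simps)
      have "fact n \<le> (fact (N + K) :: real)" using nK by (intro fact_mono) auto
      also have "\<dots> \<le> fact N * fact K * 2 ^ (N + K)" by (rule fact_add_le)
      finally show "(fact n :: real) \<le> fact N * fact K * 2 ^ (N + K)" .
    qed (use n C log_const_ge1 in auto)
    also have "\<dots> = E * (2 * C ^ q) ^ N * fact N * norm x powr (real I + real m - real N)"
      unfolding E_def power_add power_mult[of C q N] power_mult_distrib by (simp add: mult_ac)
    finally show "norm (t n) \<le> E * (2 * C ^ q) ^ N * fact N * norm x powr (real I + real m - real N)" .
  qed
  also have "\<dots> = real k * (E * (2 * C ^ q) ^ N * fact N * norm x powr (real I + real m - real N))"
    by simp
  also have "\<dots> \<le> real K * (E * (2 * C ^ q) ^ N * fact N * norm x powr (real I + real m - real N))"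
    using kK E1 C by (intro mult_right_mono) auto
  also have "\<dots> = real K * E * (2 * C ^ q) ^ N * fact N * norm x powr (real I + real m - real N)"
    by (simp add: mult_ac)
  also have "\<dots> \<le> (real K * E) ^ N * (2 * C ^ q) ^ N * fact N * norm x powr (real I + real m - real N)"
  proof (intro mult_right_mono)
    have "1 \<le> real K * E" using K1 E1 mult_mono[of 1 "real K" 1 E] by simp
    from power_increasing[OF N this] show "real K * E \<le> (real K * E) ^ N" by simp
  qed (use C in auto)
  finally have "norm ((\<Sum>n<N. t (k + n)) - (\<Sum>n<N. t n)) \<le>
      (real K * E) ^ N * (2 * C ^ q) ^ N * fact N * norm x powr (real I + real m - real N)"
    unfolding eq .
  thus ?thesis unfolding t_def E_def by (simp add: power_mult_distrib)
qed simp

text \<open>What has to be achieved is minimality. Writing \<open>k = j + q * n\<close> sorts the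
  exponents into classes modulo the integers; each class \<open>j\<close> that occurs contributes a
  single exponent, placed at its first nonzero coefficient. An exponential whose coefficients all
  vanish is dropped, which is legitimate because its factor is flat and hence zero on the
  sector.\<close>

theorem expandable_imp_asymp_expansion:
  assumes "expandable f"
  shows "\<exists>\<Sigma> S T c. has_asymp_expansion f \<theta> \<Sigma> S T c \<and> \<Sigma> \<subseteq> {0, 1} \<and> S \<subseteq> \<rat> \<and> finite S \<and> finite T \<and>
    (\<forall>\<rho>\<in>\<Sigma>. \<forall>\<alpha>\<in>S. \<forall>i\<in>T. \<forall>n. c \<rho> \<alpha> i n \<in> H_ring)"
proof -
  from assms obtain F0 F1 where F01: "gevrey F0" "gevrey F1"
    and f: "\<And>x. x \<in> sec \<Longrightarrow> f x = F0 x + exp x * F1 x"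
    unfolding expandable_def by metis
  from gevrey_common[OF F01] obtain m I c0 c1 B C
    where g01: "gevrey_exp m I c0 B C F0" "gevrey_exp m I c1 B C F1" by metis
  define F where "F = (\<lambda>\<rho>::complex. if \<rho> = 0 then F0 else F1)"
  define c where "c = (\<lambda>\<rho>::complex. if \<rho> = 0 then c0 else c1)"
  have g: "gevrey_exp m I (c \<rho>) B C (F \<rho>)" for \<rho> using g01 by (simp add: c_def F_def)
  have C: "C \<ge> 1" and B: "B \<ge> 0" using g01 by (auto simp: gevrey_exp_def)
  define \<Sigma> where "\<Sigma> = {\<rho>\<in>{0, 1}. \<exists>i k. c \<rho> i k \<noteq> 0}"
  define T where "T = {i. i < I \<and> (\<exists>\<rho>\<in>{0, 1}. \<exists>k. c \<rho> i k \<noteq> 0)}"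
  define nz where "nz = (\<lambda>j n. \<exists>\<rho>\<in>{0, 1}. \<exists>i. c \<rho> i (j + q * n) \<noteq> 0)"
  define J where "J = {j. j < q \<and> (\<exists>n. nz j n)}"
  \<comment> \<open>The start of class \<open>j\<close> is common to all \<rho> and
    \<open>i\<close>, since the exponents in \<open>S\<close> depend on neither. A single series may
    therefore still begin with zeros.\<close>
  define s where "s = (\<lambda>j. LEAST n. nz j n)"
  define A where "A = (\<lambda>j. of_nat (j + q * s j) / of_nat q - of_nat m :: complex)"
  define S where "S = A ` J"
  define cc where "cc = (\<lambda>\<rho> \<alpha> i n. c \<rho> i (inv_into J A \<alpha> + q * (s (inv_into J A \<alpha>) + n)))"
  have ciI: "i < I" if "c \<rho> i k \<noteq> 0" for \<rho> i k
    using that g[of \<rho>] unfolding gevrey_exp_def by (meson not_less)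
  have fin: "finite \<Sigma>" "finite T" "finite J" "finite S"
    unfolding \<Sigma>_def T_def J_def S_def by auto
  have s1: "nz j (s j)" if "j \<in> J" for j
    unfolding s_def using that by (auto simp: J_def intro: LeastI)
  have s2: "\<not> nz j n" if "n < s j" for j n
    using that not_less_Least unfolding s_def by blast
  have A_Ints: "j = j'" if "j \<in> J" "j' \<in> J" "A j - A j' \<in> \<int>" for j j'
  proof -
    from that(3) obtain z where z: "A j - A j' = of_int z" by (elim Ints_cases)
    moreover have "of_nat q * (A j - A j') = of_nat (j + q * s j) - of_nat (j' + q * s j')"
      using q by (simp add: A_def right_diff_distrib del: of_nat_add of_nat_mult)
    ultimately have "(of_nat (j + q * s j) - of_nat (j' + q * s j') :: complex) = of_nat q * of_int z"
      by simp
    hence "of_int (int (j + q * s j) - int (j' + q * s j')) = (of_int (int q * z) :: complex)"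
      by simp
    hence "int (j + q * s j) - int (j' + q * s j') = int q * z" by (simp only: of_int_eq_iff)
    hence "int j = int j' + int q * (z + int (s j') - int (s j))" by (simp add: algebra_simps)
    hence "int j mod int q = int j' mod int q" by simp
    thus ?thesis using that by (simp add: J_def)
  qed
  have inj: "inj_on A J" using A_Ints by (auto intro!: inj_onI)
  have cc: "cc \<rho> (A j) i n = c \<rho> i (j + q * (s j + n))" if "j \<in> J" for \<rho> j i n
    using that inj by (simp add: cc_def)
  have ex_cc: "\<exists>j\<in>J. \<exists>n. cc \<rho> (A j) i n = c \<rho> i k" if "c \<rho> i k \<noteq> 0" "\<rho> \<in> {0, 1}" for \<rho> i k
  proof -
    have k: "k = k mod q + q * (k div q)" by simp
    have nz: "nz (k mod q) (k div q)" using that k by (auto simp: nz_def)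
    hence j: "k mod q \<in> J" using q by (auto simp: J_def)
    have "s (k mod q) \<le> k div q" using nz s2 not_less by blast
    hence "cc \<rho> (A (k mod q)) i (k div q - s (k mod q)) = c \<rho> i k"
      using cc[OF j] k by simp
    thus ?thesis using j by blast
  qed
  have sub: "\<Sigma> \<subseteq> {0, 1}" by (auto simp: \<Sigma>_def)
  have red: "reduced_expansion \<Sigma> S T cc"
    unfolding reduced_expansion_def
  proof (intro conjI ballI impI)
    fix \<rho> assume "\<rho> \<in> \<Sigma>"
    then obtain i k where ik: "c \<rho> i k \<noteq> 0" "\<rho> \<in> {0, 1}" by (auto simp: \<Sigma>_def)
    hence "i \<in> T" using ciI[OF ik(1)] unfolding T_def by blast
    moreover obtain j n where "j \<in> J" "cc \<rho> (A j) i n = c \<rho> i k" using ex_cc[OF ik] by blast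
    ultimately show "\<exists>\<alpha>\<in>S. \<exists>i\<in>T. \<exists>n. cc \<rho> \<alpha> i n \<noteq> 0" using ik(1)
      unfolding S_def by (intro bexI[of _ "A j"] bexI[of _ i] exI[of _ n]) auto
  next
    fix i assume "i \<in> T"
    then obtain \<rho> k where rk: "c \<rho> i k \<noteq> 0" "\<rho> \<in> {0, 1}" unfolding T_def by blast
    hence "\<rho> \<in> \<Sigma>" unfolding \<Sigma>_def by blast
    moreover obtain j n where "j \<in> J" "cc \<rho> (A j) i n = c \<rho> i k" using ex_cc[OF rk] by blast
    ultimately show "\<exists>\<rho>\<in>\<Sigma>. \<exists>\<alpha>\<in>S. \<exists>n. cc \<rho> \<alpha> i n \<noteq> 0" using rk(1)
      unfolding S_def by (intro bexI[of _ \<rho>] bexI[of _ "A j"] exI[of _ n]) auto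
  next
    fix \<alpha> \<beta> assume "\<alpha> \<in> S" "\<beta> \<in> S" "\<alpha> - \<beta> \<in> \<int>"
    thus "\<alpha> = \<beta>" using A_Ints by (auto simp: S_def)
  next
    fix \<alpha> assume "\<alpha> \<in> S"
    then obtain j where j: "j \<in> J" "\<alpha> = A j" by (auto simp: S_def)
    from s1[OF j(1)] obtain \<rho> i where ri: "\<rho> \<in> {0, 1}" "c \<rho> i (j + q * s j) \<noteq> 0" by (auto simp: nz_def)
    hence "\<rho> \<in> \<Sigma>" "i \<in> T" using ciI[OF ri(2)] unfolding \<Sigma>_def T_def by blast+
    moreover have "cc \<rho> \<alpha> i 0 \<noteq> 0" using ri cc[OF j(1)] j by simp
    ultimately show "\<exists>\<rho>\<in>\<Sigma>. \<exists>i\<in>T. cc \<rho> \<alpha> i 0 \<noteq> 0" by blast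
  qed
  \<comment> \<open>With all coefficients zero the remainder estimate bounds \<open>F \<rho>\<close>
    itself, for every \<open>N\<close>, and Watson's uniqueness lemma applies.\<close>
  have F_zero: "F \<rho> x = 0" if "\<rho> \<in> {0, 1} - \<Sigma>" "x \<in> sec" for \<rho> x
  proof -
    have c0: "c \<rho> i k = 0" for i k using that by (auto simp: \<Sigma>_def)
    note g' = g[of \<rho>, unfolded gevrey_exp_def]
    show ?thesis
    proof (rule gevrey_flat_imp_zero[OF \<epsilon> C, of "F \<rho>" \<theta> B])
      show "F \<rho> analytic_on large_sector \<theta> \<epsilon> 1" using g' by (simp add: sec_def)
      show "x \<in> large_sector \<theta> \<epsilon> 1" using that by (simp add: sec_def)
      fix x N assume "x \<in> large_sector \<theta> \<epsilon> 1" "(N::nat) \<ge> 1"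
      hence "norm (F \<rho> x - (\<Sum>i<I. \<Sum>k<q * N. c \<rho> i k * lterm m i k x)) \<le> C ^ N * fact N * norm x powr (B - real N)"
        using g' by (auto simp: sec_def)
      thus "norm (F \<rho> x) \<le> C ^ N * fact N * norm x powr (B - real N)" by (simp add: c0)
    qed
  qed
  \<comment> \<open>A bound for all starting indices at once, so that one constant \<open>E\<close>
    serves every class and every power of the logarithm.\<close>
  define K where "K = (\<Sum>j\<in>J. s j) + 1"
  have sK: "s j \<le> K" if "j \<in> J" for j
    unfolding K_def using member_le_sum[of j J s] that fin by auto
  define E where "E = real K * (C ^ (q * (K + 1)) * fact K * 2 ^ K * log_const ^ I) * (2 * C ^ q)"
  define B' where "B' = B + real I + real m + 1"
  define C' where "C' = C + (real I * real q + 1) * E"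
  have E: "E \<ge> 0" unfolding E_def using C log_const_ge1
    by (intro mult_nonneg_nonneg) auto
  have bound: "norm (F \<rho> x - (\<Sum>\<alpha>\<in>S. \<Sum>i\<in>T. \<Sum>n<N. cc \<rho> \<alpha> i n * asymp_term \<theta> \<alpha> i n x)) \<le>
      C' ^ N * fact N * norm x powr (B' - real N)"
    if \<rho>: "\<rho> \<in> {0, 1}" and x: "x \<in> sec" and N: "N \<ge> 1" for \<rho> x N
  proof -
    define Y where "Y = fact N * norm x powr (B' - real N)"
    have Y: "Y \<ge> 0" by (simp add: Y_def)
    have x1: "norm x \<ge> 1" using sec_norm[OF x] .
    define t where "t = (\<lambda>i k. c \<rho> i k * lterm m i k x)"
    have S1: "(\<Sum>\<alpha>\<in>S. \<Sum>i\<in>T. \<Sum>n<N. cc \<rho> \<alpha> i n * asymp_term \<theta> \<alpha> i n x) =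
        (\<Sum>j\<in>J. \<Sum>i\<in>T. \<Sum>n<N. t i (j + q * (s j + n)))"
      unfolding S_def using inj
      by (subst sum.reindex) (auto intro!: sum.cong simp: cc t_def lterm_eq_asymp_term[OF A_def[unfolded atomize_eq, THEN fun_cong]] algebra_simps)
    have "(\<Sum>i<I. \<Sum>k<q * N. t i k) = (\<Sum>i\<in>T. \<Sum>k<q * N. t i k)"
      using \<rho> by (intro sum.mono_neutral_right) (auto simp: T_def t_def)
    also have "\<dots> = (\<Sum>i\<in>T. \<Sum>j<q. \<Sum>n<N. t i (j + q * n))"
      by (simp only: sum_mod_div_reindex[OF q])
    also have "\<dots> = (\<Sum>i\<in>T. \<Sum>j\<in>J. \<Sum>n<N. t i (j + q * n))"
    proof (rule sum.cong[OF refl], rule sum.mono_neutral_right; (intro ballI sum.neutral)?)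
      fix i j n assume "j \<in> {..<q} - J"
      hence "\<not> nz j n" by (auto simp: J_def)
      thus "t i (j + q * n) = 0" using \<rho> by (auto simp: nz_def t_def)
    qed (auto simp: J_def)
    also have "\<dots> = (\<Sum>j\<in>J. \<Sum>i\<in>T. \<Sum>n<N. t i (j + q * n))" by (rule sum.swap)
    finally have S2: "(\<Sum>i<I. \<Sum>k<q * N. t i k) = (\<Sum>j\<in>J. \<Sum>i\<in>T. \<Sum>n<N. t i (j + q * n))" .
    have "norm ((\<Sum>j\<in>J. \<Sum>i\<in>T. \<Sum>n<N. t i (j + q * (s j + n))) - (\<Sum>j\<in>J. \<Sum>i\<in>T. \<Sum>n<N. t i (j + q * n)))
        = norm (\<Sum>j\<in>J. \<Sum>i\<in>T. (\<Sum>n<N. t i (j + q * (s j + n))) - (\<Sum>n<N. t i (j + q * n)))"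
      by (simp add: sum_subtractf)
    also have "\<dots> \<le> (\<Sum>j\<in>J. \<Sum>i\<in>T. E ^ N * Y)"
    proof (intro sum_norm_le)
      fix j i assume ji: "j \<in> J" "i \<in> T"
      have z: "c \<rho> i (j + q * n) = 0" if "n < s j" for n using s2[OF that] \<rho> by (auto simp: nz_def)
      have "norm ((\<Sum>n<N. t i (j + q * (s j + n))) - (\<Sum>n<N. t i (j + q * n))) \<le> E ^ N * fact N * norm x powr (real I + real m - real N) \<or> s j = 0"
        unfolding t_def E_def
        by (rule truncation_shift_bound[OF g[of \<rho>] _ _ sK z x N]) (use ji in \<open>auto simp: T_def J_def\<close>)
      moreover have "E ^ N * fact N * norm x powr (real I + real m - real N) \<le> E ^ N * Y"
        unfolding Y_def mult.assoc using B E x1 by (intro mult_left_mono powr_mono_base1) (auto simp: B'_def)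
      moreover have "0 \<le> E ^ N * Y" using E Y by simp
      ultimately show "norm ((\<Sum>n<N. t i (j + q * (s j + n))) - (\<Sum>n<N. t i (j + q * n))) \<le> E ^ N * Y"
        by auto
    qed
    also have "\<dots> = real (card J) * real (card T) * (E ^ N * Y)" by simp
    also have "\<dots> \<le> real q * real I * (E ^ N * Y)"
    proof (intro mult_right_mono mult_mono of_nat_mono)
      show "card J \<le> q" using card_mono[of "{..<q}" J] by (auto simp: J_def)
      show "card T \<le> I" using card_mono[of "{..<I}" T] by (auto simp: T_def)
    qed (use E Y in auto)
    also have "\<dots> \<le> ((real I * real q + 1) * E) ^ N * Y"
    proof -
      have "real q * real I \<le> (real I * real q + 1) ^ 1" by (simp add: mult.commute)
      also have "\<dots> \<le> (real I * real q + 1) ^ N" using N by (intro power_increasing) auto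
      finally have "real q * real I * (E ^ N * Y) \<le> (real I * real q + 1) ^ N * (E ^ N * Y)"
        using E Y by (intro mult_right_mono) auto
      thus ?thesis by (simp add: power_mult_distrib mult_ac)
    qed
    finally have d: "norm ((\<Sum>j\<in>J. \<Sum>i\<in>T. \<Sum>n<N. t i (j + q * (s j + n))) - (\<Sum>j\<in>J. \<Sum>i\<in>T. \<Sum>n<N. t i (j + q * n)))
        \<le> ((real I * real q + 1) * E) ^ N * Y" .
    have "norm (F \<rho> x - (\<Sum>i<I. \<Sum>k<q * N. t i k)) \<le> C ^ N * fact N * norm x powr (B - real N)"
      using g[of \<rho>] x N unfolding gevrey_exp_def t_def by blast
    also have "\<dots> \<le> C ^ N * Y" unfolding Y_def mult.assoc
      using C x1 by (intro mult_left_mono powr_mono_base1) (auto simp: B'_def)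
    finally have e: "norm (F \<rho> x - (\<Sum>j\<in>J. \<Sum>i\<in>T. \<Sum>n<N. t i (j + q * n))) \<le> C ^ N * Y" unfolding S2 .
    have "norm (F \<rho> x - (\<Sum>j\<in>J. \<Sum>i\<in>T. \<Sum>n<N. t i (j + q * (s j + n)))) \<le> C ^ N * Y + ((real I * real q + 1) * E) ^ N * Y"
      using norm_triangle_ineq4[of "F \<rho> x - (\<Sum>j\<in>J. \<Sum>i\<in>T. \<Sum>n<N. t i (j + q * n))"
        "(\<Sum>j\<in>J. \<Sum>i\<in>T. \<Sum>n<N. t i (j + q * (s j + n))) - (\<Sum>j\<in>J. \<Sum>i\<in>T. \<Sum>n<N. t i (j + q * n))"] d e by simp
    also have "\<dots> = (C ^ N + ((real I * real q + 1) * E) ^ N) * Y" by (simp add: algebra_simps)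
    also have "\<dots> \<le> C' ^ N * Y" unfolding C'_def
      using C E N Y by (intro mult_right_mono power_add_le_add_power) auto
    finally show ?thesis unfolding S1 Y_def by (simp add: mult_ac)
  qed
  have "has_asymp_expansion f \<theta> \<Sigma> S T cc" unfolding has_asymp_expansion_def
  proof (intro conjI fin red, rule exI[of _ \<epsilon>], rule exI[of _ "1::real"], rule exI[of _ B'],
      rule exI[of _ C'], rule exI[of _ F], intro conjI ballI allI impI)
    show "F \<rho> analytic_on large_sector \<theta> \<epsilon> 1" for \<rho> using g[of \<rho>] by (simp add: gevrey_exp_def sec_def)
    show "0 < B'" using B by (simp add: B'_def)
    show "0 < C'" using C E by (simp add: C'_def add_pos_nonneg)
    show "f x = (\<Sum>\<rho>\<in>\<Sigma>. exp (\<rho> * x) * F \<rho> x)" if "x \<in> large_sector \<theta> \<epsilon> 1" for x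
    proof -
      have x: "x \<in> sec" using that by (simp add: sec_def)
      have "(\<Sum>\<rho>\<in>\<Sigma>. exp (\<rho> * x) * F \<rho> x) = (\<Sum>\<rho>\<in>{0, 1}. exp (\<rho> * x) * F \<rho> x)"
        using F_zero[OF _ x] sub by (intro sum.mono_neutral_left) auto
      also have "\<dots> = f x" using f[OF x] by (simp add: F_def)
      finally show ?thesis ..
    qed
    show "norm (F \<rho> x - (\<Sum>\<alpha>\<in>S. \<Sum>i\<in>T. \<Sum>n<N. cc \<rho> \<alpha> i n * asymp_term \<theta> \<alpha> i n x))
        \<le> C' ^ N * fact N * norm x powr (B' - real N)"
      if "\<rho> \<in> \<Sigma>" "x \<in> large_sector \<theta> \<epsilon> 1" "N \<ge> 1" for \<rho> x N
      by (rule bound) (use that sub in \<open>auto simp: sec_def\<close>)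
  qed (use \<epsilon> in auto)
  moreover have "S \<subseteq> \<rat>" by (auto simp: S_def A_def intro!: Rats_diff Rats_divide)
  moreover have "cc \<rho> \<alpha> i n \<in> H_ring" for \<rho> \<alpha> i n
    using g[of \<rho>] by (simp add: gevrey_exp_def cc_def)
  ultimately show ?thesis using sub fin by blast
qed

end

section \<open>Convolution of exponential series\<close>

text \<open>The Weierstrass test for unordered sums. An arbitrary index type is needed since the
  series below run over pairs and over pairs of pairs.\<close>

lemma has_integral_infsum:
  fixes f :: "'j \<Rightarrow> real \<Rightarrow> complex"
  assumes cont: "\<And>j. continuous_on {a..b} (f j)"
    and bd: "\<And>j t. t \<in> {a..b} \<Longrightarrow> norm (f j t) \<le> M j" and M: "M summable_on UNIV"
  shows "((\<lambda>t. \<Sum>\<^sub>\<infinity>j. f j t) has_integral (\<Sum>\<^sub>\<infinity>j. integral {a..b} (f j))) {a..b}"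
    and "continuous_on {a..b} (\<lambda>t. \<Sum>\<^sub>\<infinity>j. f j t)"
proof -
  have u: "uniform_limit {a..b} (\<lambda>X t. \<Sum>j\<in>X. f j t) (\<lambda>t. \<Sum>\<^sub>\<infinity>j. f j t) (finite_subsets_at_top UNIV)"
    by (rule Weierstrass_m_test_general[OF bd M])
  obtain I J where IJ: "\<And>X. ((\<lambda>t. \<Sum>j\<in>X. f j t) has_integral I X) {a..b}"
    "((\<lambda>t. \<Sum>\<^sub>\<infinity>j. f j t) has_integral J) {a..b}" "(I \<longlongrightarrow> J) (finite_subsets_at_top UNIV)"
    by (rule uniform_limit_integral[OF u]) (auto intro!: continuous_intros cont)
  have "eventually (\<lambda>X. I X = (\<Sum>j\<in>X. integral {a..b} (f j))) (finite_subsets_at_top UNIV)"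
  proof (rule eventually_finite_subsets_at_top_weakI)
    fix X :: "'j set" assume "finite X"
    hence "((\<lambda>t. \<Sum>j\<in>X. f j t) has_integral (\<Sum>j\<in>X. integral {a..b} (f j))) {a..b}"
      by (intro has_integral_sum integrable_integral integrable_continuous_interval cont)
    with IJ(1) show "I X = (\<Sum>j\<in>X. integral {a..b} (f j))" by (rule has_integral_unique)
  qed
  with IJ(3) have "((\<lambda>j. integral {a..b} (f j)) has_sum J) UNIV"
    unfolding has_sum_def using tendsto_cong by blast
  hence "J = (\<Sum>\<^sub>\<infinity>j. integral {a..b} (f j))" by (simp add: infsumI)
  with IJ(2) show "((\<lambda>t. \<Sum>\<^sub>\<infinity>j. f j t) has_integral (\<Sum>\<^sub>\<infinity>j. integral {a..b} (f j))) {a..b}" by simp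
  show "continuous_on {a..b} (\<lambda>t. \<Sum>\<^sub>\<infinity>j. f j t)"
    by (rule uniform_limit_theorem[OF _ u]) (auto intro!: always_eventually continuous_intros cont)
qed

lemma infsum_single:
  fixes g :: "'a \<Rightarrow> 'b :: {comm_monoid_add, t2_space}"
  assumes "\<And>p. p \<noteq> p0 \<Longrightarrow> g p = 0"
  shows "(\<Sum>\<^sub>\<infinity>p. g p) = g p0" "g summable_on UNIV"
proof -
  have "(g has_sum g p0) UNIV"
    using has_sum_cong_neutral[of "{p0}" UNIV g g "g p0"] has_sum_finite[of "{p0}" g] assms by auto
  thus "(\<Sum>\<^sub>\<infinity>p. g p) = g p0" "g summable_on UNIV" by (auto simp: infsumI summable_on_def)
qed

lemma abs_summable_on_times:
  fixes c :: "'a \<Rightarrow> complex" and d :: "'b \<Rightarrow> complex"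
  assumes "(\<lambda>x. norm (c x)) summable_on A" "(\<lambda>y. norm (d y)) summable_on B"
  shows "(\<lambda>z. norm (c (fst z) * d (snd z))) summable_on A \<times> B"
proof (rule iffD2[OF Infinite_Sum.abs_summable_on_Sigma_iff[where f = "\<lambda>z. c (fst z) * d (snd z)" and A = A and B = "\<lambda>_. B"]],
    intro conjI ballI)
  show "(\<lambda>y. norm (c (fst (x, y)) * d (snd (x, y)))) summable_on B" for x
    using assms(2) by (simp add: norm_mult summable_on_cmult_right)
  show "(\<lambda>x. norm (\<Sum>\<^sub>\<infinity>y\<in>B. norm (c (fst (x, y)) * d (snd (x, y))))) summable_on A"
    using assms(1) by (simp add: norm_mult infsum_cmult_right' abs_mult infsum_nonneg summable_on_cmult_left)
qed

lemma infsum_times: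
  fixes c :: "'a \<Rightarrow> complex" and d :: "'b \<Rightarrow> complex"
  assumes "(\<lambda>x. norm (c x)) summable_on A" "(\<lambda>y. norm (d y)) summable_on B"
  shows "(\<Sum>\<^sub>\<infinity>z\<in>A \<times> B. c (fst z) * d (snd z)) = infsum c A * infsum d B"
proof -
  have "(\<lambda>z. c (fst z) * d (snd z)) summable_on A \<times> B"
    by (rule Infinite_Sum.abs_summable_summable[OF abs_summable_on_times[OF assms]])
  from infsum_Sigma_banach[OF this] show ?thesis
    by (simp add: infsum_cmult_right' infsum_cmult_left')
qed

text \<open>The two families of functions represented simultaneously: the index \<open>(True, w)\<close> evaluates
  \<open>w^i * exp (-k*w/q)\<close> and the index \<open>(False, s)\<close> its Laplace transform.\<close>

definition exp_monom :: "nat \<Rightarrow> bool \<times> real \<Rightarrow> nat \<times> nat \<Rightarrow> complex" where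
  "exp_monom q z p = (let x = snd z; i = fst p; k = snd p in
     of_real (if fst z then x ^ i * exp (- (real k / real q * x)) else fact i / (x + real k / real q) ^ Suc i))"

lemma exp_monom_True: "exp_monom q (True, w) (i, k) = of_real (w ^ i * exp (- (real k / real q * w)))"
  and exp_monom_False: "exp_monom q (False, s) (i, k) = of_real (fact i / (s + real k / real q) ^ Suc i)"
  by (simp_all add: exp_monom_def)

lemma norm_exp_monom_le:
  assumes "snd z \<ge> 0" "snd z > 0 \<or> fst z" "i < I"
  shows "norm (exp_monom q z (i, k)) \<le> (\<Sum>i<I. snd z ^ i + fact i / snd z ^ Suc i)"
proof -
  obtain b x where z: "z = (b, x)" by force
  have x: "x \<ge> 0" using assms z by simp
  have "norm (exp_monom q z (i, k)) \<le> x ^ i + fact i / x ^ Suc i"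
  proof (cases b)
    case True
    have "x ^ i * exp (- (real k / real q * x)) \<le> x ^ i * 1"
      using x by (intro mult_left_mono) auto
    moreover have zT: "z = (True, x)" using z True by simp
    have "norm (exp_monom q z (i, k)) = x ^ i * exp (- (real k / real q * x))"
      unfolding zT exp_monom_True norm_of_real using x by simp
    ultimately show ?thesis using x by (auto intro!: add_increasing2)
  next
    case False
    hence x: "x > 0" using assms z by simp
    have "fact i / (x + real k / real q) ^ Suc i \<le> fact i / x ^ Suc i"
      using x by (intro divide_left_mono power_mono mult_pos_pos zero_less_power add_pos_nonneg) auto
    moreover have "0 \<le> fact i / (x + real k / real q) ^ Suc i" using x by auto
    moreover have zF: "z = (False, x)" using z False by simp
    ultimately have "norm (exp_monom q z (i, k)) \<le> fact i / x ^ Suc i"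
      unfolding zF exp_monom_False norm_of_real by linarith
    thus ?thesis using x by (auto intro!: add_increasing)
  qed
  also have "\<dots> \<le> (\<Sum>i<I. x ^ i + fact i / x ^ Suc i)"
    using assms(3) x by (intro member_le_sum) auto
  finally show ?thesis by (simp add: z)
qed

text \<open>Without \<open>k = 0\<close> the function tends to 0 as w tends to infinity, that is as
  t = exp(-w) tends to 0, and the transform has no pole at \<open>s = 0\<close>. Absolute
  summability permits every rearrangement that follows.\<close>

definition exp_series_coeffs :: "nat \<Rightarrow> (nat \<times> nat \<Rightarrow> complex) \<Rightarrow> bool" where
  "exp_series_coeffs I c \<longleftrightarrow> (\<forall>i k. i \<ge> I \<or> k = 0 \<longrightarrow> c (i, k) = 0) \<and> (\<lambda>p. norm (c p)) summable_on UNIV"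

lemma exp_series_summable:
  assumes c: "exp_series_coeffs I c" and z: "snd z \<ge> 0" "snd z > 0 \<or> fst z"
  shows "norm (c p * exp_monom q z p) \<le> norm (c p) * (\<Sum>i<I. snd z ^ i + fact i / snd z ^ Suc i)"
    and "(\<lambda>p. norm (c p * exp_monom q z p)) summable_on UNIV"
proof -
  show *: "norm (c p * exp_monom q z p) \<le> norm (c p) * (\<Sum>i<I. snd z ^ i + fact i / snd z ^ Suc i)" for p
  proof (cases "c p = 0")
    case False
    hence "fst p < I" using c unfolding exp_series_coeffs_def by (metis not_less prod.collapse)
    thus ?thesis unfolding norm_mult using norm_exp_monom_le[OF z, of "fst p" I q "snd p"]
      by (intro mult_left_mono) auto
  qed auto
  have "(\<lambda>p. norm (c p) * (\<Sum>i<I. snd z ^ i + fact i / snd z ^ Suc i)) summable_on UNIV"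
    using c by (intro summable_on_cmult_left) (auto simp: exp_series_coeffs_def)
  thus "(\<lambda>p. norm (c p * exp_monom q z p)) summable_on UNIV"
    by (rule summable_on_comparison_test) (use * in auto)
qed

text \<open>One family \<open>c\<close> has to serve for the function and for its transform. What
  the poles of the transform reveal about \<open>c\<close> is thereby known for the function,
  without inverting or even applying a Laplace integral. The bound \<open>K\<close> on the sum of
  the norms makes infinite superpositions possible.\<close>

definition exp_rep :: "nat \<Rightarrow> nat \<Rightarrow> real \<Rightarrow> (bool \<times> real \<Rightarrow> complex) \<Rightarrow> bool" where
  "exp_rep q I K f \<longleftrightarrow> (\<exists>c. exp_series_coeffs I c \<and> (\<Sum>\<^sub>\<infinity>p. norm (c p)) \<le> K \<and>
     (\<forall>z. snd z > 0 \<longrightarrow> f z = (\<Sum>\<^sub>\<infinity>p. c p * exp_monom q z p)))"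

lemma exp_rep_cong: "exp_rep q I K f \<Longrightarrow> (\<And>z. snd z > 0 \<Longrightarrow> f z = g z) \<Longrightarrow> exp_rep q I K g"
  unfolding exp_rep_def by metis

lemma exp_rep_mono: "exp_rep q I K f \<Longrightarrow> I \<le> I' \<Longrightarrow> K \<le> K' \<Longrightarrow> exp_rep q I' K' f"
  unfolding exp_rep_def exp_series_coeffs_def by (meson order_trans)

lemma exp_rep_monom: "i < I \<Longrightarrow> k \<ge> 1 \<Longrightarrow> exp_rep q I 1 (\<lambda>z. exp_monom q z (i, k))"
  unfolding exp_rep_def
proof (intro exI conjI allI impI)
  let ?c = "\<lambda>p. if p = (i, k) then 1 else 0 :: complex"
  assume "i < I" "k \<ge> 1"
  thus "exp_series_coeffs I ?c"
    using infsum_single(2)[of "(i, k)" "\<lambda>p. norm (?c p)"] by (auto simp: exp_series_coeffs_def)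
  show "(\<Sum>\<^sub>\<infinity>p. norm (?c p)) \<le> 1"
    using infsum_single(1)[of "(i, k)" "\<lambda>p. norm (?c p)"] by simp
  show "exp_monom q z (i, k) = (\<Sum>\<^sub>\<infinity>p. ?c p * exp_monom q z p)" for z
    using infsum_single(1)[of "(i, k)" "\<lambda>p. ?c p * exp_monom q z p"] by simp
qed

text \<open>Completeness of the space of absolutely summable families: if the norms of the summands
  are summable, coefficients may be added index by index, and two applications of Fubini for sums
  give the bound and the representation.\<close>

lemma exp_rep_infsum:
  fixes f :: "'j \<Rightarrow> bool \<times> real \<Rightarrow> complex"
  assumes f: "\<And>j. exp_rep q I (K j) (f j)" and K: "K summable_on UNIV"
  shows "exp_rep q I (infsum K UNIV) (\<lambda>z. \<Sum>\<^sub>\<infinity>j. f j z)"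
proof -
  from f obtain c where c: "\<And>j. exp_series_coeffs I (c j)" "\<And>j. (\<Sum>\<^sub>\<infinity>p. norm (c j p)) \<le> K j"
    "\<And>j z. snd z > 0 \<Longrightarrow> f j z = (\<Sum>\<^sub>\<infinity>p. c j p * exp_monom q z p)"
    unfolding exp_rep_def by metis
  have cs: "(\<lambda>p. norm (c j p)) summable_on UNIV" for j using c(1) by (simp add: exp_series_coeffs_def)
  have s1: "(\<lambda>j. \<Sum>\<^sub>\<infinity>p. norm (c j p)) summable_on UNIV"
    by (rule summable_on_comparison_test[OF K]) (auto intro!: c infsum_nonneg)
  have jp: "(\<lambda>x. norm (c (fst x) (snd x))) summable_on UNIV \<times> UNIV"
    using iffD2[OF Infinite_Sum.abs_summable_on_Sigma_iff[where f = "\<lambda>x. c (fst x) (snd x)" and A = UNIV and B = "\<lambda>_. UNIV"]] cs s1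
    by (auto simp: infsum_nonneg)
  have bij: "bij_betw prod.swap (UNIV \<times> UNIV) (UNIV \<times> UNIV)" by (auto intro!: bij_betwI[of _ _ _ prod.swap])
  have pj: "(\<lambda>x. norm (c (snd x) (fst x))) summable_on UNIV \<times> UNIV"
    using summable_on_reindex_bij_betw[OF bij, of "\<lambda>x. norm (c (snd x) (fst x))"] jp
    by simp
  define d where "d = (\<lambda>p. \<Sum>\<^sub>\<infinity>j. c j p)"
  have s2: "(\<lambda>j. norm (c j p)) summable_on UNIV" "(\<lambda>p. \<Sum>\<^sub>\<infinity>j. norm (c j p)) summable_on UNIV" for p
    using iffD1[OF Infinite_Sum.abs_summable_on_Sigma_iff[where f = "\<lambda>x. c (snd x) (fst x)" and A = UNIV and B = "\<lambda>_. UNIV"]] pj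
    by (cases p; auto simp: infsum_nonneg)+
  have nd: "norm (d p) \<le> (\<Sum>\<^sub>\<infinity>j. norm (c j p))" for p
    unfolding d_def by (rule norm_infsum_bound[OF s2(1)])
  have ds: "(\<lambda>p. norm (d p)) summable_on UNIV"
    by (rule summable_on_comparison_test[OF s2(2)]) (use nd in auto)
  show ?thesis unfolding exp_rep_def
  proof (intro exI[of _ d] conjI allI impI)
    show "exp_series_coeffs I d"
      using c(1) ds by (auto simp: exp_series_coeffs_def d_def)
    have "(\<Sum>\<^sub>\<infinity>p. norm (d p)) \<le> (\<Sum>\<^sub>\<infinity>p. \<Sum>\<^sub>\<infinity>j. norm (c j p))"
      by (intro infsum_mono ds s2 nd)
    also have "\<dots> = (\<Sum>\<^sub>\<infinity>j. \<Sum>\<^sub>\<infinity>p. norm (c j p))"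
      by (rule infsum_swap_banach) (use pj in \<open>simp add: case_prod_unfold\<close>)
    also have "\<dots> \<le> infsum K UNIV" by (intro infsum_mono s1 K c)
    finally show "(\<Sum>\<^sub>\<infinity>p. norm (d p)) \<le> infsum K UNIV" .
    fix z :: "bool \<times> real" assume z: "snd z > 0"
    define D where "D = (\<Sum>i<I. snd z ^ i + fact i / snd z ^ Suc i)"
    have "(\<lambda>x. norm (c (snd x) (fst x) * exp_monom q z (fst x))) summable_on UNIV \<times> UNIV"
    proof (rule summable_on_comparison_test[OF summable_on_cmult_left[OF pj, of D]])
      fix x :: "(nat \<times> nat) \<times> 'j"
      show "norm (c (snd x) (fst x) * exp_monom q z (fst x)) \<le> norm (c (snd x) (fst x)) * D"
        using exp_series_summable(1)[OF c(1), of z "snd x" "fst x" q] z by (simp add: D_def)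
    qed auto
    hence sw: "(\<lambda>(p, j). c j p * exp_monom q z p) summable_on UNIV \<times> UNIV"
      using Infinite_Sum.abs_summable_summable[of "\<lambda>(p, j). c j p * exp_monom q z p"] by (simp add: case_prod_unfold)
    have "(\<Sum>\<^sub>\<infinity>j. f j z) = (\<Sum>\<^sub>\<infinity>j. \<Sum>\<^sub>\<infinity>p. c j p * exp_monom q z p)" using c(3)[OF z] by simp
    also have "\<dots> = (\<Sum>\<^sub>\<infinity>p. \<Sum>\<^sub>\<infinity>j. c j p * exp_monom q z p)"
      by (rule infsum_swap_banach[symmetric]) (use sw in auto)
    also have "\<dots> = (\<Sum>\<^sub>\<infinity>p. d p * exp_monom q z p)" by (simp add: infsum_cmult_left' d_def)
    finally show "(\<Sum>\<^sub>\<infinity>j. f j z) = (\<Sum>\<^sub>\<infinity>p. d p * exp_monom q z p)" .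
  qed
qed

lemma exp_rep_cmult:
  assumes "exp_rep q I K f" shows "exp_rep q I (norm a * K) (\<lambda>z. a * f z)"
proof -
  from assms obtain c where c: "exp_series_coeffs I c" "(\<Sum>\<^sub>\<infinity>p. norm (c p)) \<le> K"
    "\<And>z. snd z > 0 \<Longrightarrow> f z = (\<Sum>\<^sub>\<infinity>p. c p * exp_monom q z p)"
    unfolding exp_rep_def by metis
  show ?thesis unfolding exp_rep_def
    by (rule exI[of _ "\<lambda>p. a * c p"])
       (use c in \<open>auto simp: exp_series_coeffs_def norm_mult infsum_cmult_right' mult.assoc
          intro!: summable_on_cmult_right mult_left_mono\<close>)
qed

lemma exp_rep_add:
  assumes "exp_rep q I K f" "exp_rep q I L g" shows "exp_rep q I (K + L) (\<lambda>z. f z + g z)"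
proof -
  define F where "F = (\<lambda>b. if b then f else g)"
  define N where "N = (\<lambda>b. if b then K else L)"
  have "exp_rep q I (infsum N UNIV) (\<lambda>z. \<Sum>\<^sub>\<infinity>b. F b z)"
    by (rule exp_rep_infsum) (use assms in \<open>auto simp: F_def N_def\<close>)
  thus ?thesis by (simp add: UNIV_bool F_def N_def add.commute)
qed

text \<open>For functions this is convolution over [0, w], rescaled to the unit interval; for
  transforms it is the product. The second factor carries no power of w because a beta density is a
  series of pure exponentials.\<close>

definition monom_conv :: "nat \<Rightarrow> nat \<Rightarrow> nat \<Rightarrow> nat \<Rightarrow> bool \<times> real \<Rightarrow> complex" where
  "monom_conv q i k m z = (if fst z
     then integral {0..1} (\<lambda>t. of_real (snd z) * exp_monom q (True, (1 - t) * snd z) (i, k) * exp_monom q (True, t * snd z) (0, m))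
     else exp_monom q z (i, k) * exp_monom q z (0, m))"

lemma monom_conv_True:
  "monom_conv q i k m (True, w) = of_real (w *
     integral {0..1} (\<lambda>t. ((1 - t) * w) ^ i * exp (- (real k / real q * ((1 - t) * w)) - real m / real q * (t * w))))"
proof -
  have "monom_conv q i k m (True, w) = integral {0..1} (\<lambda>t. complex_of_real (w * (((1 - t) * w) ^ i *
      exp (- (real k / real q * ((1 - t) * w)) - real m / real q * (t * w)))))"
    unfolding monom_conv_def
    by (auto simp: exp_monom_True exp_diff exp_minus divide_inverse mult_ac intro!: integral_cong)
  also have "\<dots> = of_real (integral {0..1} (\<lambda>t. w * (((1 - t) * w) ^ i *
      exp (- (real k / real q * ((1 - t) * w)) - real m / real q * (t * w)))))"
    by (rule integral_unique[OF has_integral_of_real[OF integrable_integral]])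
       (intro integrable_continuous_interval continuous_intros)
  finally show ?thesis by simp
qed

text \<open>Both identities are the fundamental theorem applied to \<open>G\<close> itself. For
  \<open>Suc i\<close> the boundary value at \<open>t = 1\<close> vanishes, for 0 it does not, which
  is why there are two formulas.\<close>

lemma monom_conv_integral:
  fixes la mu w :: real
  defines "G \<equiv> (\<lambda>i t. ((1 - t) * w) ^ i * exp (- (la * ((1 - t) * w)) - mu * (t * w)))"
  shows "real (Suc i) * (w * integral {0..1} (G i)) + (mu - la) * (w * integral {0..1} (G (Suc i))) = w ^ Suc i * exp (- (la * w))"
    and "(mu - la) * (w * integral {0..1} (G 0)) = exp (- (la * w)) - exp (- (mu * w))"
proof -
  have int: "(G i has_integral integral {0..1} (G i)) {0..1}" for i
    unfolding G_def by (intro integrable_integral integrable_continuous_interval continuous_intros)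
  have "((\<lambda>t. - (real (Suc i) * w) * G i t + (la - mu) * w * G (Suc i) t) has_integral G (Suc i) 1 - G (Suc i) 0) {0..1}"
  proof (rule fundamental_theorem_of_calculus)
    fix t :: real
    show "(G (Suc i) has_vector_derivative - (real (Suc i) * w) * G i t + (la - mu) * w * G (Suc i) t) (at t within {0..1})"
      unfolding G_def has_real_derivative_iff_has_vector_derivative[symmetric]
      by (auto intro!: derivative_eq_intros simp: algebra_simps simp del: power_Suc of_nat_Suc)
  qed auto
  moreover have "((\<lambda>t. - (real (Suc i) * w) * G i t + (la - mu) * w * G (Suc i) t) has_integral
      - (real (Suc i) * w) * integral {0..1} (G i) + (la - mu) * w * integral {0..1} (G (Suc i))) {0..1}"
    by (intro has_integral_add has_integral_mult_right int)
  ultimately have "- (real (Suc i) * w) * integral {0..1} (G i) + (la - mu) * w * integral {0..1} (G (Suc i)) = G (Suc i) 1 - G (Suc i) 0"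
    by (rule has_integral_unique[rotated])
  moreover have "G (Suc i) 1 - G (Suc i) 0 = - (w ^ Suc i * exp (- (la * w)))" by (simp add: G_def)
  ultimately show "real (Suc i) * (w * integral {0..1} (G i)) + (mu - la) * (w * integral {0..1} (G (Suc i))) = w ^ Suc i * exp (- (la * w))"
    by (simp add: algebra_simps)
  have "((\<lambda>t. (la - mu) * w * G 0 t) has_integral G 0 1 - G 0 0) {0..1}"
  proof (rule fundamental_theorem_of_calculus)
    fix t :: real
    show "(G 0 has_vector_derivative (la - mu) * w * G 0 t) (at t within {0..1})"
      unfolding G_def has_real_derivative_iff_has_vector_derivative[symmetric]
      by (auto intro!: derivative_eq_intros simp: algebra_simps)
  qed auto
  moreover have "((\<lambda>t. (la - mu) * w * G 0 t) has_integral (la - mu) * w * integral {0..1} (G 0)) {0..1}"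
    by (intro has_integral_mult_right int)
  ultimately have "(la - mu) * w * integral {0..1} (G 0) = G 0 1 - G 0 0"
    by (rule has_integral_unique[rotated])
  thus "(mu - la) * (w * integral {0..1} (G 0)) = exp (- (la * w)) - exp (- (mu * w))"
    by (simp add: G_def algebra_simps)
qed

text \<open>Partial fractions, on the level of the functions and of their Laplace transforms at once.\<close>

lemma monom_conv_resonant:
  assumes "snd z > 0" "q > 0"
  shows "monom_conv q i k k z = inverse (of_nat (Suc i)) * exp_monom q z (Suc i, k)"
proof (cases "fst z")
  case True
  then obtain w where z: "z = (True, w)" by (cases z) auto
  have "real (Suc i) * (w * integral {0..1} (\<lambda>t. ((1 - t) * w) ^ i * exp (- (real k / real q * ((1 - t) * w)) - real k / real q * (t * w))))
      = w ^ Suc i * exp (- (real k / real q * w))"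
    using monom_conv_integral(1)[of i w "real k / real q" "real k / real q"] by simp
  hence "monom_conv q i k k z = of_real (inverse (real (Suc i)) * (w ^ Suc i * exp (- (real k / real q * w))))"
    unfolding z monom_conv_True by (subst of_real_eq_iff) (simp add: field_simps del: of_nat_Suc power_Suc)
  thus ?thesis by (simp add: z exp_monom_True del: of_nat_Suc power_Suc)
next
  case False
  then obtain s where z: "z = (False, s)" by (cases z) auto
  define X where "X = s + real k / real q"
  have "X > 0" using assms by (auto simp: X_def z intro: add_pos_nonneg)
  hence "fact i / X ^ Suc i * (fact 0 / X ^ Suc 0) = inverse (real (Suc i)) * (fact (Suc i) / X ^ Suc (Suc i))"
    by (simp add: field_simps del: of_nat_Suc)
  from arg_cong[OF this, of complex_of_real] show ?thesis
    unfolding monom_conv_def by (simp add: z exp_monom_False X_def del: of_nat_Suc power_Suc fact_Suc)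
qed

text \<open>Integration by parts for functions and
  \<open>1 / (X * Y) = (1 / X - 1 / Y) / (Y - X)\<close> for transforms lead to the same recursion
  in \<open>i\<close>. This coincidence is what allows both sides to share their
  coefficients.\<close>

lemma monom_conv_nonresonant:
  assumes "snd z > 0" "q > 0" "k \<noteq> m"
  defines "\<delta> \<equiv> of_real (real m / real q - real k / real q) :: complex"
  shows "monom_conv q 0 k m z = inverse \<delta> * (exp_monom q z (0, k) + (-1) * exp_monom q z (0, m))"
    and "monom_conv q (Suc i) k m z = inverse \<delta> * (exp_monom q z (Suc i, k) + (- of_nat (Suc i)) * monom_conv q i k m z)"
proof -
  define d where "d = real m / real q - real k / real q"
  have d: "d \<noteq> 0" "\<delta> = of_real d" using assms by (auto simp: d_def \<delta>_def divide_simps)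
  have goal0: "monom_conv q 0 k m z = inverse \<delta> * (exp_monom q z (0, k) + (-1) * exp_monom q z (0, m)) \<longleftrightarrow>
      \<delta> * monom_conv q 0 k m z = exp_monom q z (0, k) - exp_monom q z (0, m)"
    using d by (auto simp: field_simps)
  have goal1: "monom_conv q (Suc i) k m z = inverse \<delta> * (exp_monom q z (Suc i, k) + (- of_nat (Suc i)) * monom_conv q i k m z) \<longleftrightarrow>
      of_nat (Suc i) * monom_conv q i k m z + \<delta> * monom_conv q (Suc i) k m z = exp_monom q z (Suc i, k)"
    using d by (auto simp: field_simps simp del: of_nat_Suc)
  have "\<delta> * monom_conv q 0 k m z = exp_monom q z (0, k) - exp_monom q z (0, m) \<and>
    of_nat (Suc i) * monom_conv q i k m z + \<delta> * monom_conv q (Suc i) k m z = exp_monom q z (Suc i, k)"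
  proof (cases "fst z")
    case True
    then obtain w where z: "z = (True, w)" by (cases z) auto
    note I1 = monom_conv_integral(1)[where i = i and w = w and la = "real k / real q" and mu = "real m / real q"]
    note I2 = monom_conv_integral(2)[where w = w and la = "real k / real q" and mu = "real m / real q"]
    from arg_cong[OF I1, of complex_of_real] arg_cong[OF I2, of complex_of_real] show ?thesis
      unfolding z monom_conv_True exp_monom_True d(2) d_def of_real_add of_real_mult of_real_diff of_real_of_nat_eq
      by simp
  next
    case False
    then obtain s where z: "z = (False, s)" by (cases z) auto
    define X where "X = s + real k / real q"
    define Y where "Y = s + real m / real q"
    have XY: "X > 0" "Y > 0" "d = Y - X" using assms by (auto simp: X_def Y_def d_def z intro: add_pos_nonneg)
    have "d * (fact 0 / X ^ Suc 0 * (fact 0 / Y ^ Suc 0)) = fact 0 / X ^ Suc 0 - fact 0 / Y ^ Suc 0"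
      using XY by (simp add: field_simps)
    moreover have "real (Suc i) * (fact i / X ^ Suc i * (fact 0 / Y ^ Suc 0)) + d * (fact (Suc i) / X ^ Suc (Suc i) * (fact 0 / Y ^ Suc 0)) =
        fact (Suc i) / X ^ Suc (Suc i)"
    proof -
      define F where "F = (fact (Suc i) :: real)"
      have F: "real (Suc i) * fact i = F" by (simp add: F_def)
      have "real (Suc i) * (fact i / X ^ Suc i * (fact 0 / Y ^ Suc 0)) = F / (X ^ Suc i * Y)"
        by (simp add: F[symmetric])
      also have "\<dots> + d * (F / X ^ Suc (Suc i) * (fact 0 / Y ^ Suc 0)) = F / X ^ Suc (Suc i)"
        using XY by (simp add: divide_simps) (simp add: algebra_simps)
      finally show ?thesis unfolding F_def .
    qed
    ultimately show ?thesis
      unfolding d(2) z monom_conv_def exp_monom_False X_def[symmetric] Y_def[symmetric] fst_conv if_False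
      by (metis (no_types, lifting) of_real_add of_real_mult of_real_diff of_real_of_nat_eq)
  qed
  thus "monom_conv q 0 k m z = inverse \<delta> * (exp_monom q z (0, k) + (-1) * exp_monom q z (0, m))"
    "monom_conv q (Suc i) k m z = inverse \<delta> * (exp_monom q z (Suc i, k) + (- of_nat (Suc i)) * monom_conv q i k m z)"
    unfolding goal0 goal1 by auto
qed

fun conv_const :: "nat \<Rightarrow> nat \<Rightarrow> real" where
  "conv_const q 0 = 2 * real q + 1"
| "conv_const q (Suc i) = real q * (1 + real (Suc i) * conv_const q i) + 1"

lemma conv_const_nonneg: "conv_const q i \<ge> 0"
  by (induction i) auto

text \<open>Different exponents of the lattice differ by at least \<open>1/q\<close>, so no small
  denominators occur and the constant depends on \<open>q\<close> and \<open>i\<close> alone.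
  Independence of \<open>k\<close> and \<open>m\<close> is what makes the double series in
  \<open>exp_rep_conv\<close> summable.\<close>

lemma exp_rep_monom_conv:
  assumes q: "q > 0" and km: "k \<ge> 1" "m \<ge> 1"
  shows "exp_rep q (i + 2) (conv_const q i) (monom_conv q i k m)"
proof (cases "k = m")
  case True
  have "exp_rep q (i + 2) (norm (inverse (of_nat (Suc i)) :: complex) * 1) (\<lambda>z. inverse (of_nat (Suc i)) * exp_monom q z (Suc i, k))"
    by (intro exp_rep_cmult exp_rep_monom km) auto
  hence "exp_rep q (i + 2) (norm (inverse (of_nat (Suc i)) :: complex) * 1) (monom_conv q i k k)"
    by (rule exp_rep_cong) (use monom_conv_resonant q in auto)
  thus ?thesis unfolding True
  proof (rule exp_rep_mono)
    have "norm (inverse (of_nat (Suc i)) :: complex) = inverse (real (Suc i))"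
      by (simp only: norm_inverse norm_of_nat)
    hence "norm (inverse (of_nat (Suc i)) :: complex) * 1 \<le> 1" by (simp add: inverse_le_1_iff)
    also have "1 \<le> conv_const q i" by (cases i) (auto simp: conv_const_nonneg)
    finally show "norm (inverse (of_nat (Suc i)) :: complex) * 1 \<le> conv_const q i" .
  qed auto
next
  case False
  define \<delta> where "\<delta> = (of_real (real m / real q - real k / real q) :: complex)"
  have \<delta>: "norm (inverse \<delta>) \<le> real q"
  proof -
    have "\<bar>real_of_int (int m - int k)\<bar> \<ge> 1" using False by linarith
    hence "\<bar>(real m - real k) / real q\<bar> \<ge> 1 / real q"
      using q by (simp add: abs_divide divide_right_mono)
    hence "norm \<delta> \<ge> 1 / real q" unfolding \<delta>_def by (simp add: diff_divide_distrib del: of_real_diff)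
    moreover have "1 / real q > 0" using q by simp
    ultimately have "inverse (norm \<delta>) \<le> inverse (1 / real q)" by (intro le_imp_inverse_le)
    thus ?thesis by (simp add: norm_inverse)
  qed
  note nr = monom_conv_nonresonant[OF _ q False, folded \<delta>_def]
  show ?thesis
  proof (induction i)
    case 0
    have "exp_rep q (0 + 2) (norm (inverse \<delta>) * (1 + norm (-1 :: complex) * 1))
        (\<lambda>z. inverse \<delta> * (exp_monom q z (0, k) + (-1) * exp_monom q z (0, m)))"
      by (intro exp_rep_cmult exp_rep_add exp_rep_monom km) auto
    hence "exp_rep q (0 + 2) (norm (inverse \<delta>) * (1 + norm (-1 :: complex) * 1)) (monom_conv q 0 k m)"
      by (rule exp_rep_cong) (use nr in auto)
    thus ?case by (rule exp_rep_mono) (use \<delta> in auto)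
  next
    case (Suc i)
    have "exp_rep q (Suc i + 2) (norm (inverse \<delta>) * (1 + norm (- of_nat (Suc i) :: complex) * conv_const q i))
        (\<lambda>z. inverse \<delta> * (exp_monom q z (Suc i, k) + (- of_nat (Suc i)) * monom_conv q i k m z))"
      by (intro exp_rep_cmult exp_rep_add exp_rep_monom km exp_rep_mono[OF Suc]) auto
    hence "exp_rep q (Suc i + 2) (norm (inverse \<delta>) * (1 + norm (- of_nat (Suc i) :: complex) * conv_const q i)) (monom_conv q (Suc i) k m)"
      by (rule exp_rep_cong) (use nr in auto)
    thus ?case
    proof (rule exp_rep_mono)
      have "norm (inverse \<delta>) * (1 + norm (- of_nat (Suc i) :: complex) * conv_const q i) \<le> real q * (1 + real (Suc i) * conv_const q i)"
        using \<delta> conv_const_nonneg[of q i] by (intro mult_mono) (auto simp del: of_nat_Suc)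
      thus "norm (inverse \<delta>) * (1 + norm (- of_nat (Suc i) :: complex) * conv_const q i) \<le> conv_const q (Suc i)" by simp
    qed auto
  qed
qed

lemma norm_exp_monom_True_le:
  assumes "0 \<le> x" "x \<le> y" "1 \<le> y" "i < I"
  shows "norm (exp_monom q (True, x) (i, k)) \<le> y ^ I"
proof -
  have "norm (exp_monom q (True, x) (i, k)) = x ^ i * exp (- (real k / real q * x))"
    unfolding exp_monom_True norm_of_real using assms by simp
  also have "\<dots> \<le> x ^ i * 1" using assms by (intro mult_left_mono) auto
  also have "\<dots> \<le> y ^ i" using assms by (auto intro: power_mono)
  also have "\<dots> \<le> y ^ I" using assms by (intro power_increasing) auto
  finally show ?thesis .
qed

definition exp_conv :: "(bool \<times> real \<Rightarrow> complex) \<Rightarrow> (bool \<times> real \<Rightarrow> complex) \<Rightarrow> bool \<times> real \<Rightarrow> complex" where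
  "exp_conv f g z = (if fst z
     then integral {0..1} (\<lambda>t. of_real (snd z) * f (True, (1 - t) * snd z) * g (True, t * snd z)) else f z * g z)"

text \<open>Both series are inserted and convolved term by term. The degree in w rises by at most
  one, the increase being caused by coinciding exponents.\<close>

lemma exp_rep_conv:
  assumes q: "q > 0" and f: "exp_rep q I K f" and g: "exp_rep q 1 L g"
  shows "\<exists>K'. exp_rep q (I + 1) K' (exp_conv f g)"
proof -
  from f obtain c where c: "exp_series_coeffs I c" "\<And>z. snd z > 0 \<Longrightarrow> f z = (\<Sum>\<^sub>\<infinity>p. c p * exp_monom q z p)"
    unfolding exp_rep_def by metis
  from g obtain d where d: "exp_series_coeffs 1 d" "\<And>z. snd z > 0 \<Longrightarrow> g z = (\<Sum>\<^sub>\<infinity>p. d p * exp_monom q z p)"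
    unfolding exp_rep_def by metis
  define F where "F = (\<lambda>j z. (c (fst j) * d (snd j)) * monom_conv q (fst (fst j)) (snd (fst j)) (snd (snd j)) z)"
  define D where "D = (\<Sum>i<I. conv_const q i)"
  define M where "M = (\<lambda>j. norm (c (fst j) * d (snd j)) * D)"
  have cd: "(\<lambda>j. norm (c (fst j) * d (snd j))) summable_on UNIV \<times> UNIV"
    by (rule abs_summable_on_times) (use c(1) d(1) in \<open>auto simp: exp_series_coeffs_def\<close>)
  have nz: "fst p < I" "snd p \<ge> 1" if "c p \<noteq> 0" for p
    using that c(1) unfolding exp_series_coeffs_def by (metis not_less prod.collapse less_one)+
  have nz': "fst p = 0" "snd p \<ge> 1" if "d p \<noteq> 0" for p
    using that d(1) unfolding exp_series_coeffs_def by (metis not_less prod.collapse less_one)+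
  have "exp_rep q (I + 1) (M j) (F j)" for j
  proof (cases "c (fst j) * d (snd j) = 0")
    case True
    \<comment> \<open>A vanishing coefficient says nothing about its indices, which may then violate
      the conditions of \<open>exp_rep_monom_conv\<close>. The zero function is represented as 0
      times a monomial instead.\<close>
    have "exp_rep q (I + 1) (norm (0 :: complex) * 1) (\<lambda>z. 0 * exp_monom q z (0, 1))"
      by (intro exp_rep_cmult exp_rep_monom) auto
    thus ?thesis unfolding F_def M_def True by simp
  next
    case False
    hence *: "fst (fst j) < I" "snd (fst j) \<ge> 1" "snd (snd j) \<ge> 1" using nz nz' by auto
    have "exp_rep q (I + 1) D (monom_conv q (fst (fst j)) (snd (fst j)) (snd (snd j)))"
    proof (rule exp_rep_mono[OF exp_rep_monom_conv[OF q *(2,3)]])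
      show "conv_const q (fst (fst j)) \<le> D" unfolding D_def
        using * by (intro member_le_sum conv_const_nonneg) auto
    qed (use * in auto)
    from exp_rep_cmult[OF this] show ?thesis unfolding F_def M_def .
  qed
  moreover have "M summable_on UNIV" unfolding M_def using cd by (intro summable_on_cmult_left) simp
  ultimately have "exp_rep q (I + 1) (infsum M UNIV) (\<lambda>z. \<Sum>\<^sub>\<infinity>j. F j z)"
    by (rule exp_rep_infsum)
  moreover have "(\<Sum>\<^sub>\<infinity>j. F j z) = exp_conv f g z" if z: "snd z > 0" for z
  proof (cases "fst z")
    case False
    have "(\<Sum>\<^sub>\<infinity>j. F j z) = (\<Sum>\<^sub>\<infinity>j\<in>UNIV \<times> UNIV. (c (fst j) * exp_monom q z (fst j)) * (d (snd j) * exp_monom q z (snd j)))"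
    proof (rule infsum_cong_neutral)
      fix j assume "j \<in> (UNIV :: ((nat \<times> nat) \<times> nat \<times> nat) set) \<inter> UNIV \<times> UNIV"
      show "F j z = (c (fst j) * exp_monom q z (fst j)) * (d (snd j) * exp_monom q z (snd j))"
        using False nz'(1)[of "snd j"]
        by (cases "d (snd j) = 0"; cases j) (auto simp: F_def monom_conv_def)
    qed auto
    also have "\<dots> = f z * g z"
      by (subst infsum_times) (use z exp_series_summable(2)[OF c(1)] exp_series_summable(2)[OF d(1)] c(2) d(2) in auto)
    finally show ?thesis using False by (simp add: exp_conv_def)
  next
    case True
    then obtain w where zw: "z = (True, w)" "w > 0" using z by (cases z) auto
    define h where "h = (\<lambda>j t. (c (fst j) * d (snd j)) * (of_real w * exp_monom q (True, (1 - t) * w) (fst j) * exp_monom q (True, t * w) (0, snd (snd j))))"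
    define y where "y = max 1 w"
    have cont: "continuous_on {0..1} (h j)" for j
      unfolding h_def using q by (cases "fst j") (auto simp: exp_monom_True intro!: continuous_intros)
    have bd: "norm (h j t) \<le> norm (c (fst j) * d (snd j)) * (w * y ^ I * y ^ 1)" if t: "t \<in> {0..1}" for j t
    proof (cases "c (fst j) = 0")
      case False
      have "(1 - t) * w \<le> 1 * w" "t * w \<le> 1 * w" using t zw by (intro mult_right_mono; auto)+
      moreover have "w \<le> y" "1 \<le> y" by (auto simp: y_def)
      ultimately have "(1 - t) * w \<le> y" "t * w \<le> y" "1 \<le> y" "0 \<le> (1 - t) * w" "0 \<le> t * w"
        using t zw mult_nonneg_nonneg[of "1 - t" w] mult_nonneg_nonneg[of t w] by (linarith | simp)+
      hence "norm (exp_monom q (True, (1 - t) * w) (fst j)) \<le> y ^ I" "norm (exp_monom q (True, t * w) (0, snd (snd j))) \<le> y ^ 1" "y \<ge> 0"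
        using norm_exp_monom_True_le[of "(1 - t) * w" y "fst (fst j)" I q "snd (fst j)"]
          norm_exp_monom_True_le[of "t * w" y 0 1 q "snd (snd j)"] nz(1)[OF False] by auto
      thus ?thesis unfolding h_def norm_mult using zw by (intro mult_left_mono mult_mono) auto
    qed (auto simp: h_def)
    have sM: "(\<lambda>j. norm (c (fst j) * d (snd j)) * (w * y ^ I * y ^ 1)) summable_on UNIV"
      using cd by (intro summable_on_cmult_left) simp
    note HI = has_integral_infsum(1)[of 0 1 h, OF cont bd sM]
    \<comment> \<open>The representations of \<open>f\<close> and \<open>g\<close> hold for positive
      arguments only, so the two end points of the interval are left out.\<close>
    have "((\<lambda>t. of_real w * f (True, (1 - t) * w) * g (True, t * w)) has_integral (\<Sum>\<^sub>\<infinity>j. integral {0..1} (h j))) {0..1}"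
    proof (rule has_integral_spike_finite[OF _ _ HI, of "{0, 1}"])
      fix t :: real assume "t \<in> {0..1} - {0, 1}"
      hence t: "(1 - t) * w > 0" "t * w > 0" using zw by auto
      have "(\<Sum>\<^sub>\<infinity>j. h j t) = (\<Sum>\<^sub>\<infinity>j. of_real w * ((c (fst j) * exp_monom q (True, (1 - t) * w) (fst j)) * (d (snd j) * exp_monom q (True, t * w) (snd j))))"
      proof (rule infsum_cong)
        fix j :: "(nat \<times> nat) \<times> nat \<times> nat"
        show "h j t = of_real w * ((c (fst j) * exp_monom q (True, (1 - t) * w) (fst j)) * (d (snd j) * exp_monom q (True, t * w) (snd j)))"
          using nz'(1)[of "snd j"] by (cases "d (snd j) = 0"; cases j) (auto simp: h_def)
      qed
      also have "\<dots> = of_real w * (\<Sum>\<^sub>\<infinity>j\<in>UNIV \<times> UNIV. (c (fst j) * exp_monom q (True, (1 - t) * w) (fst j)) * (d (snd j) * exp_monom q (True, t * w) (snd j)))"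
        by (simp add: infsum_cmult_right')
      also have "\<dots> = of_real w * (f (True, (1 - t) * w) * g (True, t * w))"
        by (subst infsum_times) (use t exp_series_summable(2)[OF c(1)] exp_series_summable(2)[OF d(1)] c(2) d(2) in auto)
      finally show "of_real w * f (True, (1 - t) * w) * g (True, t * w) = (\<Sum>\<^sub>\<infinity>j. h j t)" by simp
    qed auto
    moreover have "integral {0..1} (h j) = F j z" for j
    proof -
      have "integral {0..1} (h j) = (c (fst j) * d (snd j)) * integral {0..1} (\<lambda>t. of_real w * exp_monom q (True, (1 - t) * w) (fst j) * exp_monom q (True, t * w) (0, snd (snd j)))"
        unfolding h_def by (rule integral_mult_right)
      thus ?thesis by (simp add: F_def monom_conv_def zw)
    qed
    ultimately show ?thesis by (simp add: exp_conv_def zw integral_unique)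
  qed
  ultimately have "exp_rep q (I + 1) (infsum M UNIV) (exp_conv f g)" by (rule exp_rep_cong)
  thus ?thesis by (rule exI)
qed

section \<open>The beta density as an exponential series\<close>

lemma summable_gbinomial:
  fixes z :: real
  assumes "z > 0" shows "summable (\<lambda>n. \<bar>z gchoose n\<bar>)"
proof -
  have "Bseq (\<lambda>n. (z gchoose n) / ((-1)^n / exp ((z+1) * of_real (ln (real n)))))"
    using gbinomial_asymptotic[of z] by (intro convergent_imp_Bseq) (auto simp: convergent_def)
  then obtain L where L: "L > 0" "\<And>n. \<bar>(z gchoose n) / ((-1)^n / exp ((z+1) * of_real (ln (real n))))\<bar> \<le> L"
    by (auto elim!: BseqE)
  \<comment> \<open>Binomial coefficients decay like \<open>n powr (- (z + 1))\<close>, which is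
    summable for \<open>z > 0\<close>; in the application
    \<open>z = b - a - 1 \<ge> 1\<close>.\<close>
  have bd: "\<bar>z gchoose n\<bar> \<le> L * real n powr (- (z + 1))" if "n \<ge> 1" for n
  proof -
    define X where "X = (z + 1) * ln (real n)"
    have "\<bar>z gchoose n\<bar> * exp X \<le> L" using L(2)[of n] by (simp add: abs_mult power_abs X_def)
    hence "\<bar>z gchoose n\<bar> * exp X * exp (- X) \<le> L * exp (- X)" by (intro mult_right_mono) auto
    also have "\<bar>z gchoose n\<bar> * exp X * exp (- X) = \<bar>z gchoose n\<bar>" by (simp add: exp_minus)
    also have "exp (- X) = real n powr (- (z + 1))" using that by (simp add: powr_def X_def algebra_simps)
    finally show ?thesis .
  qed
  have "summable (\<lambda>n. L * real n powr (- (z + 1)))"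
    using assms by (intro summable_mult) (auto simp: summable_real_powr_iff)
  thus ?thesis
    by (rule summable_comparison_test'[of _ 1]) (use bd in simp)
qed

text \<open>In t = exp(-w) the first branch is the density
  \<open>t powr (a - 1) * (1 - t) powr (b - a - 1) / Gamma (b - a)\<close>, and the second is its
  Mellin transform. At \<open>s = n + 1\<close> the latter is the moment
  \<open>Gamma (a + n) / Gamma (b + n)\<close>.\<close>

definition beta_kernel :: "real \<Rightarrow> real \<Rightarrow> bool \<times> real \<Rightarrow> complex" where
  "beta_kernel a b z = of_real (if fst z
     then exp (- ((a - 1) * snd z)) * (1 - exp (- snd z)) powr (b - a - 1) / Gamma (b - a)
     else Gamma (a - 1 + snd z) / Gamma (b - 1 + snd z))"

text \<open>The binomial series of \<open>(1 - exp (- w)) powr (b - a - 1)\<close> yields the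
  exponentials. Integrating the same series term by term against \<open>t powr (s - 1)\<close>
  yields simple fractions on one side and a Beta integral on the other.\<close>

lemma exp_rep_beta_kernel:
  assumes q: "q > 0" and a: "a * real q \<in> \<int>" "a \<ge> 2" and ba: "b - a \<ge> 2"
  shows "\<exists>K. exp_rep q 1 K (beta_kernel a b)"
proof -
  define \<beta> where "\<beta> = b - a"
  have \<beta>: "\<beta> \<ge> 2" "Gamma \<beta> > 0" using ba by (auto simp: \<beta>_def intro!: Gamma_real_pos)
  define e where "e = (\<lambda>n. ((\<beta> - 1) gchoose n) * (-1) ^ n / Gamma \<beta>)"
  have e: "summable (\<lambda>n. \<bar>e n\<bar>)"
    using summable_mult2[OF summable_gbinomial[of "\<beta> - 1"], of "inverse \<bar>Gamma \<beta>\<bar>"] \<beta>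
    by (simp add: e_def abs_mult power_abs divide_inverse)
  \<comment> \<open>The first exponent \<open>a - 1\<close> has index \<open>k0\<close> in the
    lattice; \<open>a \<ge> 2\<close> keeps \<open>k0\<close> away from the excluded index
    0.\<close>
  obtain k0 where k0: "real k0 = (a - 1) * real q" "k0 \<ge> 1"
  proof -
    have "(a - 1) * real q \<in> \<int>" using a by (simp add: left_diff_distrib)
    then obtain z where z: "(a - 1) * real q = of_int z" by (elim Ints_cases)
    have "(a - 1) * real q \<ge> 1 * 1" using a q by (intro mult_mono) auto
    hence "z \<ge> 1" using z by simp
    thus ?thesis using z by (intro that[of "nat z"]) auto
  qed
  have kq: "real (k0 + q * n) / real q = a - 1 + real n" for n
    using k0 q by (simp add: field_simps)
  have s: "(\<lambda>n. \<bar>e n\<bar>) summable_on UNIV"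
    using e by (intro norm_summable_imp_summable_on) auto
  have "exp_rep q 1 (infsum (\<lambda>n. norm (complex_of_real (e n)) * 1) UNIV) (\<lambda>z. \<Sum>\<^sub>\<infinity>n. of_real (e n) * exp_monom q z (0, k0 + q * n))"
    by (rule exp_rep_infsum[OF exp_rep_cmult[OF exp_rep_monom]]) (use k0 s in auto)
  moreover have "(\<Sum>\<^sub>\<infinity>n. of_real (e n) * exp_monom q z (0, k0 + q * n)) = beta_kernel a b z" if z: "snd z > 0" for z
  proof (cases "fst z")
    case True
    then obtain w where zw: "z = (True, w)" "w > 0" using z by (cases z) auto
    have "(\<lambda>n. ((\<beta> - 1) gchoose n) * (- exp (- w)) ^ n) sums (1 + (- exp (- w))) powr (\<beta> - 1)"
      by (rule gen_binomial_real) (use zw in auto)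
    note S = sums_mult[OF this, of "exp (- ((a - 1) * w)) / Gamma \<beta>"]
    have eq: "e n * exp (- ((a - 1 + real n) * w)) = exp (- ((a - 1) * w)) / Gamma \<beta> * (((\<beta> - 1) gchoose n) * (- exp (- w)) ^ n)" for n
    proof -
      have "exp (- w) ^ n = exp (- (real n * w))" by (simp add: exp_of_nat_mult[symmetric])
      moreover have "(- exp (- w)) ^ n = (-1) ^ n * exp (- w) ^ n" by (metis mult_minus1 power_mult_distrib)
      moreover have "exp (- ((a - 1 + real n) * w)) = exp (- ((a - 1) * w)) * exp (- (real n * w))"
        by (simp add: exp_add[symmetric] algebra_simps)
      ultimately show ?thesis by (simp add: e_def)
    qed
    have "(\<lambda>n. e n * exp (- ((a - 1 + real n) * w))) sums (exp (- ((a - 1) * w)) * (1 - exp (- w)) powr (\<beta> - 1) / Gamma \<beta>)"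
      unfolding eq using S by simp
    from sums_of_real[OF this, where 'a = complex]
    have 1: "(\<lambda>n. complex_of_real (e n * exp (- ((a - 1 + real n) * w)))) sums beta_kernel a b z"
      unfolding beta_kernel_def zw \<beta>_def by simp
    have "summable (\<lambda>n. norm (complex_of_real (e n * exp (- ((a - 1 + real n) * w)))))"
    proof (rule summable_comparison_test'[OF e, of 0])
      fix n
      have "exp (- ((a - 1 + real n) * w)) \<le> 1" using a zw by simp
      from mult_left_mono[OF this, of "\<bar>e n\<bar>"]
      show "norm (norm (complex_of_real (e n * exp (- ((a - 1 + real n) * w))))) \<le> \<bar>e n\<bar>"
        unfolding norm_of_real by (simp add: abs_mult)
    qed
    from norm_summable_imp_has_sum[OF this 1] have "(\<Sum>\<^sub>\<infinity>n. complex_of_real (e n * exp (- ((a - 1 + real n) * w)))) = beta_kernel a b z"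
      by (rule infsumI)
    thus ?thesis unfolding zw exp_monom_True kq by simp
  next
    case False
    then obtain s where zs: "z = (False, s)" "s > 0" using z by (cases z) auto
    \<comment> \<open>The exponent of t in the product of \<open>t powr (s - 1)\<close> and
      \<open>t powr (a - 1)\<close>; it is positive because \<open>a \<ge> 2\<close>.\<close>
    define y where "y = s + a - 2"
    have y: "y > 0" using zs a by (simp add: y_def)
    define h where "h = (\<lambda>n t. complex_of_real (e n * (t ^ n * t powr y)))"
    have cont: "continuous_on {0..1} (h n)" for n
      unfolding h_def using y by (auto intro!: continuous_intros continuous_on_powr')
    have bd: "norm (h n t) \<le> \<bar>e n\<bar>" if "t \<in> {0..1}" for n t
    proof -
      have "t ^ n * t powr y \<le> 1 * 1"
        using that y powr_mono2[of y t 1] by (intro mult_mono power_le_one) auto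
      hence "\<bar>e n\<bar> * (t ^ n * t powr y) \<le> \<bar>e n\<bar> * 1" by (intro mult_left_mono) auto
      thus ?thesis using that unfolding h_def norm_of_real by (simp add: abs_mult)
    qed
    note HI = has_integral_infsum(1)[of 0 1 h, OF cont bd s]
    have "((\<lambda>t. complex_of_real (t powr (y + 1 - 1) * (1 - t) powr (\<beta> - 1) / Gamma \<beta>)) has_integral (\<Sum>\<^sub>\<infinity>n. integral {0..1} (h n))) {0..1}"
    proof (rule has_integral_spike_finite[OF _ _ HI, of "{1}"])
      fix t :: real assume "t \<in> {0..1} - {1}"
      hence t: "0 \<le> t" "t < 1" by auto
      have "(\<lambda>n. ((\<beta> - 1) gchoose n) * (- t) ^ n) sums (1 + (- t)) powr (\<beta> - 1)"
        by (rule gen_binomial_real) (use t in auto)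
      from sums_mult[OF this, of "t powr y / Gamma \<beta>"]
      have "(\<lambda>n. e n * (t ^ n * t powr y)) sums (t powr (y + 1 - 1) * (1 - t) powr (\<beta> - 1) / Gamma \<beta>)"
        by (simp add: e_def power_minus[of t] mult_ac)
      from sums_of_real[OF this, where 'a = complex]
      have 1: "(\<lambda>n. h n t) sums complex_of_real (t powr (y + 1 - 1) * (1 - t) powr (\<beta> - 1) / Gamma \<beta>)"
        unfolding h_def .
      have "summable (\<lambda>n. norm (h n t))"
        by (rule summable_comparison_test'[OF e]) (use bd[of t] t in auto)
      from norm_summable_imp_has_sum[OF this 1] show
        "complex_of_real (t powr (y + 1 - 1) * (1 - t) powr (\<beta> - 1) / Gamma \<beta>) = (\<Sum>\<^sub>\<infinity>n. h n t)"
        by (simp add: infsumI)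
    qed auto
    moreover have "((\<lambda>t. complex_of_real (t powr (y + 1 - 1) * (1 - t) powr (\<beta> - 1) / Gamma \<beta>)) has_integral of_real (Beta (y + 1) \<beta> / Gamma \<beta>)) {0..1}"
      using has_integral_divide[OF has_integral_Beta_real[of "y + 1" \<beta>], of "Gamma \<beta>"] y \<beta>
      by (intro has_integral_of_real) auto
    ultimately have "(\<Sum>\<^sub>\<infinity>n. integral {0..1} (h n)) = of_real (Beta (y + 1) \<beta> / Gamma \<beta>)"
      by (rule has_integral_unique)
    also have "Beta (y + 1) \<beta> / Gamma \<beta> = Gamma (a - 1 + s) / Gamma (b - 1 + s)"
    proof -
      have "Gamma (b - a) \<noteq> 0" using \<beta>(2) unfolding \<beta>_def by linarith
      thus ?thesis by (simp add: Beta_def y_def \<beta>_def algebra_simps)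
    qed
    finally have "(\<Sum>\<^sub>\<infinity>n. integral {0..1} (h n)) = beta_kernel a b z" by (simp add: beta_kernel_def zs)
    moreover have "integral {0..1} (h n) = of_real (e n) * exp_monom q z (0, k0 + q * n)" for n
    proof -
      have "((\<lambda>t. t powr (y + real n)) has_integral (1 powr (y + real n + 1) / (y + real n + 1))) {0..1}"
        using y by (intro has_integral_powr_from_0) auto
      moreover have "t ^ n * t powr y = t powr (y + real n)" if "t \<in> {0..1}" for t
        using that y by (cases "t = 0") (auto simp: powr_add powr_realpow)
      ultimately have "((\<lambda>t. t ^ n * t powr y) has_integral (1 / (y + real n + 1))) {0..1}"
        using has_integral_cong[of "{0..1}" "\<lambda>t. t ^ n * t powr y" "\<lambda>t. t powr (y + real n)"] by simp
      hence "(h n has_integral complex_of_real (e n * (1 / (y + real n + 1)))) {0..1}"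
        unfolding h_def by (intro has_integral_of_real has_integral_mult_right)
      moreover have eqs: "s + (a - 1 + real n) = y + real n + 1" by (simp add: y_def)
      have "exp_monom q z (0, k0 + q * n) = of_real (1 / (y + real n + 1))"
        unfolding zs exp_monom_False kq eqs by simp
      ultimately show ?thesis by (simp only: integral_unique of_real_mult)
    qed
    ultimately show ?thesis by simp
  qed
  ultimately have "exp_rep q 1 (infsum (\<lambda>n. norm (complex_of_real (e n)) * 1) UNIV) (beta_kernel a b)"
    by (rule exp_rep_cong)
  thus ?thesis by (rule exI)
qed

section \<open>The kernels near the origin\<close>

definition strip :: "complex set" where "strip = {w. \<bar>Im w\<bar> < pi}"

lemma strip_open: "open strip" and strip_convex: "convex strip" and strip_0: "0 \<in> strip"
  and strip_of_real: "of_real x \<in> strip"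
proof -
  have eq: "strip = {w. Im w < pi} \<inter> {w. Im w > - pi}" by (auto simp: strip_def abs_less_iff)
  show "open strip" unfolding eq by (intro open_Int open_halfspace_Im_lt open_halfspace_Im_gt)
  show "convex strip" unfolding eq by (intro convex_Int convex_halfspace_Im_lt convex_halfspace_Im_gt)
qed (auto simp: strip_def)

lemma strip_scale: "w \<in> strip \<Longrightarrow> 0 \<le> t \<Longrightarrow> t \<le> 1 \<Longrightarrow> of_real t * w \<in> strip"
proof -
  assume *: "w \<in> strip" "0 \<le> t" "t \<le> 1"
  have "\<bar>t * Im w\<bar> \<le> 1 * \<bar>Im w\<bar>" unfolding abs_mult using * by (intro mult_right_mono) auto
  thus ?thesis using * by (simp add: strip_def)
qed

lemma ball_pi_strip: "ball 0 pi \<subseteq> strip"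
  by (auto simp: strip_def intro: le_less_trans[OF abs_Im_le_cmod])

text \<open>The entire function left over when the zero of \<open>1 - exp (- w)\<close> at the
  origin is divided out. On the strip it has a holomorphic logarithm, which
  \<open>1 - exp (- w)\<close> lacks near 0.\<close>

definition expq :: "complex \<Rightarrow> complex" where
  "expq w = (if w = 0 then 1 else (1 - exp (- w)) / w)"

lemma expq_holomorphic: "expq holomorphic_on UNIV"
proof -
  define f where "f = (\<lambda>w::complex. 1 - exp (- w))"
  have "(\<lambda>w. if w = 0 then deriv f 0 else (f w - f 0) / (w - 0)) holomorphic_on UNIV"
    by (rule pole_lemma_open) (auto simp: f_def intro!: holomorphic_intros)
  moreover have d: "deriv f 0 = 1" unfolding f_def
    by (rule DERIV_imp_deriv) (auto intro!: derivative_eq_intros)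
  have "(\<lambda>w. if w = 0 then deriv f 0 else (f w - f 0) / (w - 0)) = expq"
    by (rule ext) (simp only: expq_def d, simp add: f_def)
  ultimately show ?thesis by metis
qed

lemma expq_mult: "expq w * w = 1 - exp (- w)"
  by (simp add: expq_def)

lemma expq_upper:
  assumes "0 < Im w" "Im w < pi"
  shows "Im (1 - exp (- w)) > 0"
proof -
  have "Im (1 - exp (- w)) = exp (- Re w) * sin (Im w)" by (simp add: Im_exp)
  also have "\<dots> > 0" using assms by (intro mult_pos_pos sin_gt_zero) auto
  finally show ?thesis .
qed

lemma expq_lower:
  assumes "- pi < Im w" "Im w < 0"
  shows "Im (1 - exp (- w)) < 0"
proof -
  have "Im (1 - exp (- w)) = exp (- Re w) * - sin (- Im w)" by (simp add: Im_exp)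
  also have "\<dots> < 0" using assms by (intro mult_pos_neg) (auto intro!: sin_gt_zero simp del: sin_minus)
  finally show ?thesis .
qed

lemma expq_of_real: "expq (of_real x) = of_real (if x = 0 then 1 else (1 - exp (- x)) / x)"
  by (simp add: expq_def exp_of_real flip: of_real_minus)

lemma expq_of_real_pos: "(if x = 0 then 1 else (1 - exp (- x)) / x) > (0::real)"
  by (cases "x = 0"; cases "x > 0") (auto simp: divide_pos_pos divide_neg_neg)

text \<open>Both \<open>1 - exp (- w)\<close> and \<open>w\<close> lie in the same open half-plane, so that their quotient avoids the
  branch cut of the logarithm and the logarithm of the quotient is the difference of the logarithms.\<close>

lemma expq_not_nonpos:
  assumes "w \<in> strip" shows "expq w \<notin> \<real>\<^sub>\<le>\<^sub>0"
proof (cases "Im w = 0")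
  case True
  hence "w = of_real (Re w)" by (simp add: complex_eq_iff)
  thus ?thesis using expq_of_real[of "Re w"] expq_of_real_pos[of "Re w"]
    by (metis nonpos_Reals_of_real_iff not_less)
next
  case False
  show ?thesis
  proof
    assume "expq w \<in> \<real>\<^sub>\<le>\<^sub>0"
    then obtain r where r: "expq w = of_real r" "r \<le> 0" by (elim nonpos_Reals_cases)
    hence "Im (1 - exp (- w)) = r * Im w" using expq_mult[of w] by (metis Im_complex_of_real Re_complex_of_real
      add.right_neutral mult_zero_left times_complex.sel(2))
    thus False using expq_upper[of w] expq_lower[of w] False assms r
      by (cases "Im w > 0") (auto simp: strip_def abs_less_iff zero_less_mult_iff mult_less_0_iff)
  qed
qed

lemma Ln_expq:
  assumes "w \<in> strip" "w \<noteq> 0" "w \<notin> \<real> \<or> Re w > 0"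
  shows "Ln (1 - exp (- w)) = Ln (expq w) + Ln w"
proof -
  have w0: "w \<noteq> 0" using assms by auto
  have q0: "expq w \<noteq> 0" using expq_not_nonpos[OF assms(1)] by auto
  have e: "1 - exp (- w) = expq w * w" by (simp add: expq_mult)
  have e0: "1 - exp (- w) \<noteq> 0" using e w0 q0 by simp
  have "Ln (expq w) = Ln (1 - exp (- w)) - Ln w"
  proof (rule Ln_unique)
    show "exp (Ln (1 - exp (- w)) - Ln w) = expq w" using e e0 w0 by (simp add: exp_diff)
    have "\<bar>Im (Ln (1 - exp (- w))) - Im (Ln w)\<bar> < pi"
    proof (cases "Im w = 0")
      case True
      hence w: "w = of_real (Re w)" "Re w > 0" using assms by (auto simp: complex_eq_iff complex_is_Real_iff)
      have "1 - exp (- w) = of_real (1 - exp (- Re w))" by (subst w(1)) (simp add: exp_of_real flip: of_real_minus)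
      moreover have "1 - exp (- Re w) > 0" using w by simp
      ultimately have "Im (Ln (1 - exp (- w))) = 0" by (metis Im_complex_of_real Ln_of_real)
      moreover have "Im (Ln w) = 0" using w by (metis Im_complex_of_real Ln_of_real)
      ultimately show ?thesis by simp
    next
      case False
      show ?thesis
      proof (cases "Im w > 0")
        case True
        hence "Im (1 - exp (- w)) > 0" using assms expq_upper by (auto simp: strip_def)
        hence "0 < Im (Ln (1 - exp (- w)))" "Im (Ln (1 - exp (- w))) < pi" "0 < Im (Ln w)" "Im (Ln w) < pi"
          using True e0 w0 Im_Ln_pos_lt[of w] Im_Ln_pos_lt[of "1 - exp (- w)"] by auto
        thus ?thesis by (simp add: abs_less_iff)
      next
        case F: False
        hence "Im (1 - exp (- w)) < 0" using assms expq_lower False by (auto simp: strip_def)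
        moreover have "Im (Ln u) < 0 \<and> - pi < Im (Ln u)" if "Im u < 0" for u
        proof -
          have u: "u \<noteq> 0" using that by auto
          have "\<not> 0 \<le> Im (Ln u)" using Im_Ln_pos_le[OF u] that Im_Ln_le_pi[OF u] by auto
          thus ?thesis using mpi_less_Im_Ln[OF u] by auto
        qed
        ultimately have "Im (Ln (1 - exp (- w))) < 0" "- pi < Im (Ln (1 - exp (- w)))" "Im (Ln w) < 0" "- pi < Im (Ln w)"
          using F False by auto
        thus ?thesis by (simp add: abs_less_iff)
      qed
    qed
    thus "- pi < Im (Ln (1 - exp (- w)) - Ln w)" "Im (Ln (1 - exp (- w)) - Ln w) \<le> pi"
      by (auto simp: abs_less_iff)
  qed
  thus ?thesis by simp
qed

lemma norm_expq_le: "norm (expq w) \<le> exp (norm w)"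
proof (cases "w = 0")
  case False
  have "norm (exp (- w) - exp 0) \<le> exp (norm w) * norm (- w - 0)"
  proof (rule field_differentiable_bound[of "cball 0 (norm w)"])
    show "(exp has_field_derivative exp z) (at z within cball 0 (norm w))" for z :: complex
      by (rule DERIV_subset[OF DERIV_exp]) auto
    show "norm (exp z) \<le> exp (norm w)" if "z \<in> cball 0 (norm w)" for z :: complex
      using that norm_exp[of z] by (auto intro: order_trans)
  qed auto
  thus ?thesis using False by (simp add: expq_def norm_divide divide_simps norm_minus_commute)
qed (simp add: expq_def)

section \<open>Germs of the elementary functions occurring in a beta density\<close>

lemma H_germ_exp: "H_germ exp 0"
proof (rule H_germ_of_derivs)
  fix n
  have "(deriv ^^ n) exp = (exp :: complex \<Rightarrow> complex)"
  proof (induction n)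
    case (Suc n)
    have "deriv exp = (exp :: complex \<Rightarrow> complex)" by (intro ext DERIV_imp_deriv DERIV_exp)
    thus ?case using Suc by simp
  qed auto
  thus "(deriv ^^ n) exp (0::complex) \<in> H_ring" by (simp add: H_ring_one)
qed (auto intro!: analytic_intros)

lemma H_germ_uminus: "H_germ f z \<Longrightarrow> H_germ (\<lambda>w. - f w) z"
  using H_germ_mult[OF H_germ_const[OF H_ring_uminus[OF H_ring_one]], of f z] by simp

lemma H_germ_Ln: "H_germ Ln 1"
proof (rule H_germ_of_derivs)
  show "Ln analytic_on {1}" by (auto intro!: analytic_intros)
  have inv: "H_germ (\<lambda>w. inverse w) 1"
    by (intro H_germ_inverse H_germ_ident) (auto intro: H_ring_one)
  fix n
  show "(deriv ^^ n) Ln 1 \<in> H_ring"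
  proof (cases n)
    case (Suc m)
    have ev: "eventually (\<lambda>w. deriv Ln w = inverse w) (nhds (1::complex))"
      unfolding eventually_nhds
      by (rule exI[of _ "- \<real>\<^sub>\<le>\<^sub>0"]) (auto intro!: DERIV_imp_deriv derivative_eq_intros simp: divide_inverse)
    have "H_germ (deriv Ln) 1"
      by (rule H_germ_cong[OF inv]) (use ev in \<open>simp add: eq_commute\<close>)
    from H_germ_derivs[OF this, of m] show ?thesis by (simp add: Suc funpow_swap1)
  qed (auto intro: H_ring_zero)
qed

text \<open>In \<open>expq w * w = 1 - exp (- w)\<close> the factor \<open>w\<close> merely shifts
  the coefficients of the right-hand side, so no division in H is required.\<close>

lemma H_germ_expq: "H_germ expq 0"
proof -
  have "H_germ (\<lambda>w. 1 + - exp (- w)) 0"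
    by (intro H_germ_add H_germ_const H_ring_one H_germ_uminus H_germ_compose[of "\<lambda>w. - w" 0 exp])
       (auto intro!: H_germ_uminus H_germ_ident H_ring_zero H_germ_exp)
  then obtain F where F: "F \<in> H_fps" "(\<lambda>h. 1 + - exp (- (0 + h))) has_fps_expansion F" by (elim H_germE)
  have an: "expq analytic_on {0}" using expq_holomorphic by (simp add: analytic_at holomorphic_on_subset) (meson UNIV_I open_UNIV)
  hence ex: "(\<lambda>h. expq (0 + h)) has_fps_expansion fps_expansion expq 0"
    by (rule analytic_at_imp_has_fps_expansion)
  have "(\<lambda>h. expq (0 + h) * h) has_fps_expansion fps_expansion expq 0 * fps_X"
    by (intro fps_expansion_intros ex)
  hence "(\<lambda>h. 1 + - exp (- (0 + h))) has_fps_expansion fps_expansion expq 0 * fps_X"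
    by (simp add: expq_mult)
  with F(2) have "F = fps_expansion expq 0 * fps_X" by (rule fps_expansion_unique_complex)
  hence "fps_nth (fps_expansion expq 0) n = fps_nth F (Suc n)" for n by simp
  hence "fps_expansion expq 0 \<in> H_fps" using F(1) by (simp add: H_fps_def)
  thus ?thesis using ex by (rule H_germI)
qed

lemma H_germ_Ln_expq: "H_germ (\<lambda>w. Ln (expq w)) 0"
  by (rule H_germ_compose[OF H_germ_expq]) (simp add: expq_def H_germ_Ln)

text \<open>The beta density in the variable w without its power \<open>w powr (b - a - 1)\<close>.
  Writing it with \<open>Ln (expq w)\<close> makes it single-valued on the whole strip.\<close>

definition kernel_germ :: "real \<Rightarrow> real \<Rightarrow> complex \<Rightarrow> complex" where
  "kernel_germ a b w = exp (- (of_real (a - 1) * w) + of_real (b - a - 1) * Ln (expq w)) * rGamma (of_real (b - a))"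

lemma kernel_germ_holomorphic: "kernel_germ a b holomorphic_on strip"
  unfolding kernel_germ_def[abs_def]
  by (intro holomorphic_intros holomorphic_on_subset[OF expq_holomorphic]) (use expq_not_nonpos in auto)

lemma kernel_germ_H_germ:
  assumes "a \<in> \<rat>" "b \<in> \<rat>"
  shows "H_germ (kernel_germ a b) 0"
proof -
  have r: "complex_of_real x \<in> \<rat>" if "x \<in> \<rat>" for x using that by (auto elim!: Rats_cases')
  have "H_germ (\<lambda>w. - (of_real (a - 1) * w) + of_real (b - a - 1) * Ln (expq w)) 0"
    by (intro H_germ_add H_germ_uminus H_germ_mult H_germ_const H_germ_ident H_germ_Ln_expq H_ring_Rats H_ring_zero r) (use assms in auto)
  hence "H_germ (\<lambda>w. exp (- (of_real (a - 1) * w) + of_real (b - a - 1) * Ln (expq w))) 0"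
    by (rule H_germ_compose) (simp add: expq_def H_germ_exp)
  moreover have "H_germ (\<lambda>w. rGamma (of_real (b - a))) 0"
    by (intro H_germ_const H_ring_rGamma_Rats r Rats_diff assms)
  ultimately show ?thesis unfolding kernel_germ_def[abs_def] by (rule H_germ_mult)
qed

text \<open>Exponential growth in w is polynomial growth in t = exp(-w) and in its inverse, which is
  what the Laplace integrals along the rays tolerate.\<close>

lemma kernel_germ_bound:
  assumes "b - a \<ge> 2"
  shows "\<exists>K\<ge>0. \<forall>w\<in>strip. norm (kernel_germ a b w) \<le> K * exp (K * norm w)"
proof -
  define K where "K = \<bar>a - 1\<bar> + (b - a - 1) + norm (rGamma (of_real (b - a)) :: complex)"
  have "norm (kernel_germ a b w) \<le> K * exp (K * norm w)" if w: "w \<in> strip" for w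
  proof -
    have "Re (Ln (expq w)) \<le> norm w"
    proof -
      have "expq w \<noteq> 0" using expq_not_nonpos[OF w] by auto
      hence "Re (Ln (expq w)) = ln (norm (expq w))" by simp
      also have "\<dots> \<le> ln (exp (norm w))" using \<open>expq w \<noteq> 0\<close> norm_expq_le[of w] by (subst ln_le_cancel_iff) auto
      finally show ?thesis by simp
    qed
    hence "(b - a - 1) * Re (Ln (expq w)) \<le> (b - a - 1) * norm w" using assms by (intro mult_left_mono) auto
    moreover have "- ((a - 1) * Re w) \<le> \<bar>a - 1\<bar> * norm w"
    proof -
      have "- ((a - 1) * Re w) \<le> \<bar>a - 1\<bar> * \<bar>Re w\<bar>" by (simp flip: abs_mult)
      also have "\<dots> \<le> \<bar>a - 1\<bar> * norm w" by (intro mult_left_mono abs_Re_le_cmod) auto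
      finally show ?thesis .
    qed
    moreover have "(\<bar>a - 1\<bar> + (b - a - 1)) * norm w \<le> K * norm w" by (intro mult_right_mono) (auto simp: K_def)
    ultimately have "Re (- (of_real (a - 1) * w) + of_real (b - a - 1) * Ln (expq w)) \<le> K * norm w"
      by (simp add: distrib_right)
    hence "norm (kernel_germ a b w) \<le> exp (K * norm w) * norm (rGamma (of_real (b - a)) :: complex)"
      unfolding kernel_germ_def norm_mult norm_exp_eq_Re by (intro mult_right_mono) auto
    also have "\<dots> \<le> exp (K * norm w) * K" using assms by (intro mult_left_mono) (auto simp: K_def)
    finally show ?thesis by (simp add: mult.commute)
  qed
  moreover have "K \<ge> 0" using assms by (simp add: K_def)
  ultimately show ?thesis by blast
qed

lemma beta_kernel_eq_germ:
  assumes "w > 0"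
  shows "beta_kernel a b (True, w) = of_real w powr of_real (b - a - 1) * kernel_germ a b (of_real w)"
proof -
  define y where "y = b - a - 1"
  define e where "e = (1 - exp (- w)) / w"
  have e: "e > 0" using assms by (simp add: e_def)
  have "expq (of_real w) = of_real e" using assms expq_of_real[of w] by (simp add: e_def)
  hence "kernel_germ a b (of_real w) = exp (of_real (- ((a - 1) * w) + y * ln e)) * rGamma (of_real (b - a))"
    using e by (simp add: kernel_germ_def y_def Ln_of_real)
  also have "exp (complex_of_real (- ((a - 1) * w) + y * ln e)) = of_real (exp (- ((a - 1) * w)) * e powr y)"
    by (subst exp_of_real, subst of_real_eq_iff)
       (use e in \<open>simp add: powr_def exp_diff exp_minus divide_inverse mult.commute\<close>)
  also have "rGamma (complex_of_real (b - a)) = of_real (inverse (Gamma (b - a)))"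
    by (metis rGamma_complex_of_real rGamma_inverse_Gamma)
  also have "complex_of_real w powr of_real (b - a - 1) * (of_real (exp (- ((a - 1) * w)) * e powr y) * of_real (inverse (Gamma (b - a)))) =
      of_real (w powr y * (exp (- ((a - 1) * w)) * e powr y) * inverse (Gamma (b - a)))"
    using assms by (simp add: powr_of_real y_def mult.assoc del: of_real_diff)
  also have "w powr y * (exp (- ((a - 1) * w)) * e powr y) = exp (- ((a - 1) * w)) * (1 - exp (- w)) powr y"
    using assms e powr_mult[of e w y] by (simp add: e_def mult_ac)
  finally show ?thesis by (simp add: beta_kernel_def y_def divide_inverse mult_ac)
qed

text \<open>Rescaling [0, w] to [0, 1] in the convolution of
  \<open>w powr (\<kappa> - 1) * g w\<close> with \<open>w powr (\<beta> - 1) * h w\<close> pulls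
  out \<open>w powr (\<kappa> + \<beta> - 1)\<close>. The remaining integral is defined for complex
  w because the strip is star-shaped about 0.\<close>

definition germ_conv :: "real \<Rightarrow> real \<Rightarrow> (complex \<Rightarrow> complex) \<Rightarrow> (complex \<Rightarrow> complex) \<Rightarrow> complex \<Rightarrow> complex" where
  "germ_conv \<kappa> \<beta> g h w = integral {0..1} (\<lambda>t. of_real ((1 - t) powr (\<kappa> - 1) * t powr (\<beta> - 1)) *
     (g (of_real (1 - t) * w) * h (of_real t * w)))"

lemma weight_continuous:
  assumes "\<kappa> \<ge> 2" "\<beta> \<ge> 2"
  shows "continuous_on {0..1} (\<lambda>t::real. (1 - t) powr (\<kappa> - 1) * t powr (\<beta> - 1))"
  using assms by (intro continuous_intros continuous_on_powr') auto

lemma weight_le_1: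
  assumes "\<kappa> \<ge> 2" "\<beta> \<ge> 2" "t \<in> {0..1}"
  shows "0 \<le> (1 - t) powr (\<kappa> - 1) * t powr (\<beta> - 1)" "(1 - t) powr (\<kappa> - 1) * t powr (\<beta> - 1) \<le> (1::real)"
proof -
  have "(1 - t) powr (\<kappa> - 1) * t powr (\<beta> - 1) \<le> 1 * 1"
    using assms powr_mono2[of "\<kappa> - 1" "1 - t" 1] powr_mono2[of "\<beta> - 1" t 1] by (intro mult_mono) auto
  thus "(1 - t) powr (\<kappa> - 1) * t powr (\<beta> - 1) \<le> 1" by simp
qed auto

lemma germ_conv_integrand_continuous:
  assumes "g holomorphic_on strip" "h holomorphic_on strip" "\<kappa> \<ge> 2" "\<beta> \<ge> 2" "w \<in> strip"
  shows "continuous_on {0..1} (\<lambda>t. of_real ((1 - t) powr (\<kappa> - 1) * t powr (\<beta> - 1)) *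
     (g (of_real (1 - t) * w) * h (of_real t * w)))"
proof -
  have g: "continuous_on strip g" and h: "continuous_on strip h"
    using assms holomorphic_on_imp_continuous_on by auto
  show ?thesis
    by (intro continuous_on_mult continuous_on_of_real weight_continuous assms
        continuous_on_compose2[OF g] continuous_on_compose2[OF h])
       (use strip_scale[OF assms(5)] in \<open>auto intro!: continuous_intros simp del: of_real_diff\<close>)
qed

lemma germ_conv_holomorphic:
  assumes "g holomorphic_on strip" "h holomorphic_on strip" "\<kappa> \<ge> 2" "\<beta> \<ge> 2"
  shows "germ_conv \<kappa> \<beta> g h holomorphic_on strip"
proof -
  define W where "W = (\<lambda>t. complex_of_real ((1 - t) powr (\<kappa> - 1) * t powr (\<beta> - 1)))"
  have sc: "of_real (1 - t) * x \<in> strip" "of_real t * x \<in> strip" if "x \<in> strip" "t \<in> {0..1}" for x t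
    using that strip_scale[of x t] strip_scale[of x "1 - t"] by auto
  have g: "continuous_on strip g" "continuous_on strip (deriv g)"
    "\<And>x. x \<in> strip \<Longrightarrow> (g has_field_derivative deriv g x) (at x)"
    using assms(1) strip_open by (auto intro: holomorphic_on_imp_continuous_on holomorphic_deriv holomorphic_derivI)
  have h: "continuous_on strip h" "continuous_on strip (deriv h)"
    "\<And>x. x \<in> strip \<Longrightarrow> (h has_field_derivative deriv h x) (at x)"
    using assms(2) strip_open by (auto intro: holomorphic_on_imp_continuous_on holomorphic_deriv holomorphic_derivI)
  have W: "continuous_on {0..1} W" unfolding W_def by (intro continuous_on_of_real weight_continuous assms)
  have "(\<lambda>x. integral (cbox 0 1) (\<lambda>t. W t * (g (of_real (1 - t) * x) * h (of_real t * x)))) holomorphic_on strip"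
  proof (rule leibniz_rule_holomorphic[where fx = "\<lambda>x t. W t * (g (of_real (1 - t) * x) * (deriv h (of_real t * x) * of_real t) +
      (deriv g (of_real (1 - t) * x) * of_real (1 - t)) * h (of_real t * x))"])
    fix x and t :: real assume xt: "x \<in> strip" "t \<in> cbox 0 1"
    have s: "of_real (1 - t) * x \<in> strip" "of_real t * x \<in> strip" using sc xt by auto
    have dg: "((\<lambda>x. g (of_real (1 - t) * x)) has_field_derivative deriv g (of_real (1 - t) * x) * of_real (1 - t)) (at x within strip)"
      by (rule DERIV_chain2[where f = g and g = "\<lambda>x. of_real (1 - t) * x", OF g(3)[OF s(1)]]) (auto intro!: derivative_eq_intros)
    have dh: "((\<lambda>x. h (of_real t * x)) has_field_derivative deriv h (of_real t * x) * of_real t) (at x within strip)"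
      by (rule DERIV_chain2[where f = h and g = "\<lambda>x. of_real t * x", OF h(3)[OF s(2)]]) (auto intro!: derivative_eq_intros)
    show "((\<lambda>x. W t * (g (of_real (1 - t) * x) * h (of_real t * x))) has_field_derivative
        W t * (g (of_real (1 - t) * x) * (deriv h (of_real t * x) * of_real t) +
      (deriv g (of_real (1 - t) * x) * of_real (1 - t)) * h (of_real t * x))) (at x within strip)"
      using DERIV_mult'[OF dg dh] by (intro DERIV_cmult)
  next
    fix x assume "x \<in> strip"
    thus "(\<lambda>t. W t * (g (of_real (1 - t) * x) * h (of_real t * x))) integrable_on cbox 0 1"
      unfolding W_def by (intro integrable_continuous germ_conv_integrand_continuous[OF assms, unfolded cbox_interval[symmetric]])
  next
    have W2: "continuous_on (strip \<times> cbox 0 1) (\<lambda>x. W (snd x))"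
      by (rule continuous_on_compose2[OF W]) (auto intro!: continuous_intros)
    have c1: "continuous_on (strip \<times> cbox 0 1) (\<lambda>x. u (of_real (1 - snd x) * fst x))"
      and c2: "continuous_on (strip \<times> cbox 0 1) (\<lambda>x. u (of_real (snd x) * fst x))" if "continuous_on strip u" for u :: "complex \<Rightarrow> complex"
      by (rule continuous_on_compose2[OF that]; use sc in \<open>force intro!: continuous_intros\<close>)+
    show "continuous_on (strip \<times> cbox 0 1) (\<lambda>(x, t). W t * (g (of_real (1 - t) * x) * (deriv h (of_real t * x) * of_real t) +
      (deriv g (of_real (1 - t) * x) * of_real (1 - t)) * h (of_real t * x)))"
      unfolding case_prod_unfold by (intro continuous_intros W2 c1 c2 g h)
  qed (rule strip_convex)
  thus ?thesis unfolding germ_conv_def[abs_def] W_def by (simp only: cbox_interval)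
qed

lemma germ_conv_bound:
  assumes hol: "g holomorphic_on strip" "h holomorphic_on strip" and \<kappa>: "\<kappa> \<ge> 2" "\<beta> \<ge> 2"
    and K: "K \<ge> 0" "\<And>w. w \<in> strip \<Longrightarrow> norm (g w) \<le> K * exp (K * norm w)"
    and L: "L \<ge> 0" "\<And>w. w \<in> strip \<Longrightarrow> norm (h w) \<le> L * exp (L * norm w)"
    and w: "w \<in> strip"
  shows "norm (germ_conv \<kappa> \<beta> g h w) \<le> (K * L + K + L) * exp ((K * L + K + L) * norm w)"
proof -
  have "norm (germ_conv \<kappa> \<beta> g h w) \<le> K * exp (K * norm w) * (L * exp (L * norm w)) * (1 - 0)"
    unfolding germ_conv_def
  proof (rule integral_bound)
    fix t :: real assume t: "t \<in> {0..1}"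
    have a: "norm (g (of_real s * w)) \<le> K * exp (K * norm w)" "norm (h (of_real s * w)) \<le> L * exp (L * norm w)"
      if "0 \<le> s" "s \<le> 1" for s
    proof -
      have s: "of_real s * w \<in> strip" using strip_scale[OF w that] .
      have "norm (of_real s * w) \<le> norm w" using that by (simp add: norm_mult mult_left_le_one_le)
      hence e: "K * exp (K * norm (of_real s * w)) \<le> K * exp (K * norm w)" "L * exp (L * norm (of_real s * w)) \<le> L * exp (L * norm w)"
        using K(1) L(1) by (auto intro!: mult_left_mono)
      show "norm (g (of_real s * w)) \<le> K * exp (K * norm w)" using K(2)[OF s] e(1) by (rule order_trans)
      show "norm (h (of_real s * w)) \<le> L * exp (L * norm w)" using L(2)[OF s] e(2) by (rule order_trans)
    qed
    have "norm (of_real ((1 - t) powr (\<kappa> - 1) * t powr (\<beta> - 1)) * (g (of_real (1 - t) * w) * h (of_real t * w))) \<le>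
      1 * (K * exp (K * norm w) * (L * exp (L * norm w)))"
      unfolding norm_mult[of "of_real _"] norm_mult[of "g _"] norm_of_real
      using weight_le_1[OF \<kappa> t] a[of t] a[of "1 - t"] t K(1) L(1) by (intro mult_mono) auto
    thus "norm (of_real ((1 - t) powr (\<kappa> - 1) * t powr (\<beta> - 1)) * (g (of_real (1 - t) * w) * h (of_real t * w))) \<le>
      K * exp (K * norm w) * (L * exp (L * norm w))" by simp
  qed (use germ_conv_integrand_continuous[OF hol \<kappa> w] in auto)
  also have "\<dots> = (K * L) * exp ((K + L) * norm w)" by (simp add: exp_add distrib_right)
  also have "\<dots> \<le> (K * L + K + L) * exp ((K * L + K + L) * norm w)"
    using K(1) L(1) by (intro mult_mono) (auto intro!: mult_right_mono)
  finally show ?thesis .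
qed

text \<open>Integrating the Cauchy product of the two Taylor series term by term multiplies the
  summand of index \<open>i\<close> by a Beta value at \<open>\<kappa> + i\<close> and
  \<open>\<beta> + (n - i)\<close>. Such values lie in H because the arguments are rational and
  positive.\<close>

lemma H_germ_germ_conv:
  assumes hol: "g holomorphic_on strip" "h holomorphic_on strip" and \<kappa>: "\<kappa> \<ge> 2" "\<beta> \<ge> 2" "\<kappa> \<in> \<rat>" "\<beta> \<in> \<rat>"
    and H: "H_germ g 0" "H_germ h 0"
  shows "H_germ (germ_conv \<kappa> \<beta> g h) 0"
proof -
  obtain G where G: "G \<in> H_fps" "(\<lambda>x. g (0 + x)) has_fps_expansion G" using H(1) by (rule H_germE)
  obtain E where E: "E \<in> H_fps" "(\<lambda>x. h (0 + x)) has_fps_expansion E" using H(2) by (rule H_germE)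
  have Gs: "(\<lambda>n. fps_nth G n * z ^ n) sums g z" and Es: "(\<lambda>n. fps_nth E n * z ^ n) sums h z" if "norm z < pi" for z
    using has_fps_expansion_imp_sums_complex[of g G pi z] has_fps_expansion_imp_sums_complex[of h E pi z] G(2) E(2) that
      holomorphic_on_subset[OF hol(1) ball_pi_strip] holomorphic_on_subset[OF hol(2) ball_pi_strip] by (auto simp: ball_def eball_def)
  define c where "c = (\<lambda>n. \<Sum>i\<le>n. fps_nth G i * fps_nth E (n - i) * of_real (Beta (\<kappa> + real i) (\<beta> + real (n - i))))"
  have r: "complex_of_real x \<in> \<rat>" if "x \<in> \<rat>" for x using that by (auto elim!: Rats_cases')
  have Gam: "Gamma (complex_of_real x) \<in> H_ring" if "x \<in> \<rat>" "x > 0" for x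
    using that by (intro H_ring_Gamma_Rats DiffI r) (auto simp: of_real_in_nonpos_Ints_iff)
  have B: "complex_of_real (Beta x y) \<in> H_ring" if "x \<in> \<rat>" "x > 0" "y \<in> \<rat>" "y > 0" for x y
  proof -
    have "complex_of_real (Beta x y) = Gamma (of_real x) * Gamma (of_real y) * rGamma (of_real (x + y))"
      by (subst Beta_complex_of_real[symmetric]) (simp add: Beta_altdef)
    also have "\<dots> \<in> H_ring" using that by (intro H_ring_mult Gam H_ring_rGamma_Rats r Rats_add)
    finally show ?thesis .
  qed
  have "Abs_fps c \<in> H_fps"
    unfolding H_fps_def c_def using G(1) E(1) \<kappa>
    by (auto simp: H_fps_def intro!: H_ring_sum H_ring_mult B Rats_add)
  moreover have "germ_conv \<kappa> \<beta> g h has_fps_expansion Abs_fps c"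
  proof (rule has_fps_expansionI)
    have "(\<lambda>n. fps_nth (Abs_fps c) n * w ^ n) sums germ_conv \<kappa> \<beta> g h w" if w: "norm w < pi" for w
    proof -
      define W where "W = (\<lambda>t. (1 - t) powr (\<kappa> - 1) * t powr (\<beta> - 1))"
      define P where "P = (\<lambda>n t. \<Sum>i\<le>n. (fps_nth G i * (of_real (1 - t) * w) ^ i) * (fps_nth E (n - i) * (of_real t * w) ^ (n - i)))"
      define f where "f = (\<lambda>n t. of_real (W t) * P n t)"
      \<comment> \<open>The Cauchy product of the absolute values at \<open>w\<close> dominates
        \<open>f n t\<close> for all \<open>t\<close>, since \<open>(1 - t) * w\<close> and
        \<open>t * w\<close> are no larger than \<open>w\<close>.\<close>
      define M where "M = (\<lambda>n. \<Sum>i\<le>n. norm (fps_nth G i * w ^ i) * norm (fps_nth E (n - i) * w ^ (n - i)))"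
      have as: "summable (\<lambda>n. norm (fps_nth G n * z ^ n))" "summable (\<lambda>n. norm (fps_nth E n * z ^ n))" if z: "norm z < pi" for z
      proof -
        obtain y :: real where y: "norm z < y" "y < pi" using dense[OF z] by blast
        have "y > 0" using y(1) norm_ge_zero[of z] by linarith
        hence yn: "norm (complex_of_real y) = y" by simp
        show "summable (\<lambda>n. norm (fps_nth G n * z ^ n))" "summable (\<lambda>n. norm (fps_nth E n * z ^ n))"
          by (rule powser_insidea[OF sums_summable[OF Gs[of "of_real y"]]] powser_insidea[OF sums_summable[OF Es[of "of_real y"]]]; use y yn in simp)+
      qed
      have M: "summable M" unfolding M_def
        using summable_Cauchy_product[of "\<lambda>n. norm (fps_nth G n * w ^ n)" "\<lambda>n. norm (fps_nth E n * w ^ n)"] as[OF w] by simp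
      have Mon: "M summable_on UNIV"
        using M by (intro norm_summable_imp_summable_on) (auto simp: M_def sum_nonneg)
      have cont: "continuous_on {0..1} (f n)" for n
        unfolding f_def P_def W_def by (intro continuous_on_mult continuous_on_of_real weight_continuous \<kappa>) (intro continuous_intros)
      have bd: "norm (f n t) \<le> M n" if t: "t \<in> {0..1}" for n t
      proof -
        have le: "norm (a * (of_real s * w) ^ i) \<le> norm (a * w ^ i)" if "0 \<le> s" "s \<le> 1" for a s i
          using that mult_right_mono[of "s ^ i" 1 "norm (a * w ^ i)"] power_le_one[of s i]
          by (simp add: norm_mult norm_power power_mult_distrib mult_ac)
        have "norm (P n t) \<le> M n" unfolding P_def M_def
          by (intro sum_norm_le, subst norm_mult, intro mult_mono le) (use t in auto)
        hence "norm (f n t) \<le> 1 * M n" unfolding f_def norm_mult norm_of_real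
          using weight_le_1[OF \<kappa>(1,2) t] by (intro mult_mono) (auto simp: W_def)
        thus ?thesis by simp
      qed
      note HI = has_integral_infsum(1)[of 0 1 f, OF cont bd Mon]
      have sm: "summable (\<lambda>n. norm (f n t))" if "t \<in> {0..1}" for t
        by (rule summable_comparison_test'[OF M, of 0]) (use bd[OF that] in auto)
      have inf_eq: "(\<Sum>\<^sub>\<infinity>n. f n t) = of_real (W t) * (g (of_real (1 - t) * w) * h (of_real t * w))" if t: "t \<in> {0..1}" for t
      proof -
        have nn: "norm (of_real s * w) < pi" if "0 \<le> s" "s \<le> 1" for s
          using that w mult_left_le_one_le[of "norm w" s] by (simp add: norm_mult)
        have n1: "norm (of_real (1 - t) * w) < pi" "norm (of_real t * w) < pi" using nn[of t] nn[of "1 - t"] t by auto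
        have "(\<lambda>n. P n t) sums ((\<Sum>n. fps_nth G n * (of_real (1 - t) * w) ^ n) * (\<Sum>n. fps_nth E n * (of_real t * w) ^ n))"
          unfolding P_def by (rule Cauchy_product_sums) (use as n1 in auto)
        also have "(\<Sum>n. fps_nth G n * (of_real (1 - t) * w) ^ n) = g (of_real (1 - t) * w)"
          using Gs[OF n1(1)] by (simp add: sums_iff)
        also have "(\<Sum>n. fps_nth E n * (of_real t * w) ^ n) = h (of_real t * w)"
          using Es[OF n1(2)] by (simp add: sums_iff)
        finally have "(\<lambda>n. f n t) sums (of_real (W t) * (g (of_real (1 - t) * w) * h (of_real t * w)))"
          unfolding f_def by (intro sums_mult)
        from norm_summable_imp_has_sum[OF sm[OF t] this] show ?thesis by (rule infsumI)
      qed
      have "germ_conv \<kappa> \<beta> g h w = (\<Sum>\<^sub>\<infinity>n. integral {0..1} (f n))"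
        using integral_unique[OF has_integral_eq[OF inf_eq HI]] by (simp only: germ_conv_def W_def)
      moreover have int: "integral {0..1} (f n) = c n * w ^ n" for n
      proof (rule integral_unique)
        have B1: "((\<lambda>t. W t * ((1 - t) ^ i * t ^ j)) has_integral Beta (\<kappa> + real i) (\<beta> + real j)) {0..1}" for i j
        proof -
          have hi: "((\<lambda>t. t powr (\<beta> + real j - 1) * (1 - t) powr (\<kappa> + real i - 1)) has_integral Beta (\<beta> + real j) (\<kappa> + real i)) {0..1}"
            using \<kappa> by (intro has_integral_Beta_real) auto
          have eq: "t powr (\<beta> + real j - 1) * (1 - t) powr (\<kappa> + real i - 1) = W t * ((1 - t) ^ i * t ^ j)" if "t \<in> {0..1}" for t
          proof -
            have p: "x powr (u + real k - 1) = x powr (u - 1) * x ^ k" if "x \<ge> 0" "u \<ge> 2" for x u k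
              using that by (cases "x = 0") (auto simp: powr_realpow[symmetric] powr_add[symmetric] algebra_simps)
            show ?thesis using that \<kappa> by (simp add: p W_def)
          qed
          from has_integral_eq[OF eq hi] show ?thesis by (simp add: Beta_commute)
        qed
        have "((\<lambda>t. \<Sum>i\<le>n. (fps_nth G i * fps_nth E (n - i) * w ^ n) * of_real (W t * ((1 - t) ^ i * t ^ (n - i)))) has_integral
          (\<Sum>i\<le>n. (fps_nth G i * fps_nth E (n - i) * w ^ n) * of_real (Beta (\<kappa> + real i) (\<beta> + real (n - i))))) {0..1}"
          by (intro has_integral_sum has_integral_mult_right has_integral_of_real B1) auto
        moreover have "(\<lambda>t. \<Sum>i\<le>n. (fps_nth G i * fps_nth E (n - i) * w ^ n) * of_real (W t * ((1 - t) ^ i * t ^ (n - i)))) = f n"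
        proof
          fix t
          have "w ^ n = w ^ i * w ^ (n - i)" if "i \<le> n" for i using that by (simp flip: power_add)
          thus "(\<Sum>i\<le>n. (fps_nth G i * fps_nth E (n - i) * w ^ n) * of_real (W t * ((1 - t) ^ i * t ^ (n - i)))) = f n t"
            unfolding f_def P_def sum_distrib_left by (intro sum.cong) (auto simp: power_mult_distrib mult_ac)
        qed
        moreover have "(\<Sum>i\<le>n. (fps_nth G i * fps_nth E (n - i) * w ^ n) * of_real (Beta (\<kappa> + real i) (\<beta> + real (n - i)))) = c n * w ^ n"
          unfolding c_def sum_distrib_right by (intro sum.cong) (auto simp: mult_ac)
        ultimately show "(f n has_integral c n * w ^ n) {0..1}" by simp
      qed
      moreover have "summable (\<lambda>n. norm (c n * w ^ n))"
      proof (rule summable_comparison_test'[OF M, of 0])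
        fix n
        have "norm (integral {0..1} (f n)) \<le> M n * (1 - 0)"
          by (rule integral_bound) (use cont bd in auto)
        thus "norm (norm (c n * w ^ n)) \<le> M n" by (simp add: int)
      qed
      hence "(\<lambda>n. c n * w ^ n) summable_on UNIV" "summable (\<lambda>n. c n * w ^ n)"
        by (auto intro: norm_summable_imp_summable_on summable_norm_cancel)
      hence "(\<lambda>n. c n * w ^ n) sums (\<Sum>\<^sub>\<infinity>n. c n * w ^ n)"
        by (intro has_sum_imp_sums has_sum_infsum)
      ultimately show ?thesis by simp
    qed
    moreover have "eventually (\<lambda>w::complex. norm w < pi) (nhds 0)"
      by (rule eventually_mono[OF eventually_nhds_in_open[of "ball 0 pi"]]) auto
    ultimately show "\<forall>\<^sub>F w in nhds 0. (\<lambda>n. fps_nth (Abs_fps c) n * w ^ n) sums germ_conv \<kappa> \<beta> g h w"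
      by (rule eventually_mono[rotated]) blast
  qed
  ultimately show ?thesis by (intro H_germI[of "Abs_fps c"]) auto
qed

text \<open>Two descriptions of one kernel: a power times a holomorphic germ, suited to w = 0, and
  an exponential series, suited to w at infinity. The last clause ties them together. In the
  application \<open>\<kappa>\<close> is the sum of the gaps \<open>b - a\<close>.\<close>

definition borel_data :: "nat \<Rightarrow> real \<Rightarrow> (complex \<Rightarrow> complex) \<Rightarrow> (bool \<times> real \<Rightarrow> complex) \<Rightarrow> nat \<Rightarrow> bool" where
  "borel_data q \<kappa> g f I \<longleftrightarrow> \<kappa> \<ge> 2 \<and> \<kappa> * real q \<in> \<int> \<and> g holomorphic_on strip \<and>
     (\<exists>K\<ge>0. \<forall>w\<in>strip. norm (g w) \<le> K * exp (K * norm w)) \<and> H_germ g 0 \<and> (\<exists>K. exp_rep q I K f) \<and>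
     (\<forall>w>0. f (True, w) = of_real w powr of_real (\<kappa> - 1) * g (of_real w))"

lemma borel_data_conv:
  assumes q: "q > 0" and f: "borel_data q \<kappa> g f I" and k: "borel_data q \<beta> h k 1"
  shows "borel_data q (\<kappa> + \<beta>) (germ_conv \<kappa> \<beta> g h) (exp_conv f k) (I + 1)"
proof -
  note f = f[unfolded borel_data_def] and k = k[unfolded borel_data_def]
  have hol: "g holomorphic_on strip" "h holomorphic_on strip" and \<kappa>: "\<kappa> \<ge> 2" "\<beta> \<ge> 2" using f k by auto
  have rat: "\<kappa> \<in> \<rat>" "\<beta> \<in> \<rat>"
    using f k q by (metis Ints_subset_Rats Rats_divide Rats_of_nat nonzero_mult_div_cancel_right of_nat_0_eq_iff not_gr_zero subsetD)+
  obtain K where K: "K \<ge> 0" "\<And>w. w \<in> strip \<Longrightarrow> norm (g w) \<le> K * exp (K * norm w)" using f by blast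
  obtain L where L: "L \<ge> 0" "\<And>w. w \<in> strip \<Longrightarrow> norm (h w) \<le> L * exp (L * norm w)" using k by blast
  show ?thesis unfolding borel_data_def
  proof (intro conjI allI impI)
    show "\<exists>K\<ge>0. \<forall>w\<in>strip. norm (germ_conv \<kappa> \<beta> g h w) \<le> K * exp (K * norm w)"
      using germ_conv_bound[OF hol \<kappa> K L] K(1) L(1) by (intro exI[of _ "K * L + K + L"]) auto
    show "H_germ (germ_conv \<kappa> \<beta> g h) 0" using f k by (intro H_germ_germ_conv hol \<kappa> rat) auto
    show "\<exists>K. exp_rep q (I + 1) K (exp_conv f k)" using f k exp_rep_conv[OF q] by metis
    fix w :: real assume w: "w > 0"
    have "exp_conv f k (True, w) = integral {0..1} (\<lambda>t. of_real w powr of_real (\<kappa> + \<beta> - 1) * (of_real ((1 - t) powr (\<kappa> - 1) * t powr (\<beta> - 1)) *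
        (g (of_real (1 - t) * of_real w) * h (of_real t * of_real w))))"
      unfolding exp_conv_def fst_conv snd_conv if_True
    proof (rule integral_spike[of "{0, 1}"])
      fix t :: real assume "t \<in> {0..1} - {0, 1}"
      hence t: "0 < t" "t < 1" by auto
      have "w * (((1 - t) * w) powr (\<kappa> - 1) * (t * w) powr (\<beta> - 1)) = w powr (\<kappa> + \<beta> - 1) * ((1 - t) powr (\<kappa> - 1) * t powr (\<beta> - 1))"
      proof -
        have "w powr (\<kappa> + \<beta> - 1) = w powr 1 * w powr (\<kappa> - 1) * w powr (\<beta> - 1)"
          unfolding powr_add[symmetric] by (simp add: algebra_simps)
        thus ?thesis using t w by (simp add: powr_mult mult_ac)
      qed
      hence eq: "complex_of_real w * (of_real (((1 - t) * w) powr (\<kappa> - 1)) * of_real ((t * w) powr (\<beta> - 1))) =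
          of_real (w powr (\<kappa> + \<beta> - 1)) * of_real ((1 - t) powr (\<kappa> - 1) * t powr (\<beta> - 1))"
        by (metis of_real_mult)
      have 1: "f (True, (1 - t) * w) = of_real (((1 - t) * w) powr (\<kappa> - 1)) * g (of_real (1 - t) * of_real w)"
        using f t w by (simp add: powr_of_real del: of_real_diff of_real_mult add: of_real_mult[symmetric])
      have 2: "k (True, t * w) = of_real ((t * w) powr (\<beta> - 1)) * h (of_real t * of_real w)"
        using k t w by (simp add: powr_of_real del: of_real_diff of_real_mult add: of_real_mult[symmetric])
      have 3: "complex_of_real w powr of_real (\<kappa> + \<beta> - 1) = of_real (w powr (\<kappa> + \<beta> - 1))"
        using w by (intro powr_of_real) auto
      show "of_real w powr of_real (\<kappa> + \<beta> - 1) * (of_real ((1 - t) powr (\<kappa> - 1) * t powr (\<beta> - 1)) *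
        (g (of_real (1 - t) * of_real w) * h (of_real t * of_real w))) = of_real w * f (True, (1 - t) * w) * k (True, t * w)"
      proof -
        define u v where "u = g (of_real (1 - t) * of_real w)" and "v = h (of_real t * of_real w)"
        have "of_real (w powr (\<kappa> + \<beta> - 1)) * (of_real ((1 - t) powr (\<kappa> - 1) * t powr (\<beta> - 1)) * (u * v)) =
            (of_real (w powr (\<kappa> + \<beta> - 1)) * of_real ((1 - t) powr (\<kappa> - 1) * t powr (\<beta> - 1))) * (u * v)"
          by (simp only: mult.assoc)
        also have "\<dots> = complex_of_real w * (of_real (((1 - t) * w) powr (\<kappa> - 1)) * of_real ((t * w) powr (\<beta> - 1))) * (u * v)"
          by (simp only: eq)
        also have "\<dots> = of_real w * (of_real (((1 - t) * w) powr (\<kappa> - 1)) * u) * (of_real ((t * w) powr (\<beta> - 1)) * v)"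
          by (simp only: mult_ac)
        finally show ?thesis unfolding 1 2 3 u_def v_def .
      qed
    qed auto
    thus "exp_conv f k (True, w) = of_real w powr of_real (\<kappa> + \<beta> - 1) * germ_conv \<kappa> \<beta> g h (of_real w)"
      by (simp add: germ_conv_def)
  qed (use f k \<kappa> germ_conv_holomorphic[OF hol \<kappa>] in \<open>auto simp: distrib_right\<close>)
qed

lemma borel_data_beta_kernel:
  assumes q: "q > 0" and a: "a * real q \<in> \<int>" "a \<ge> 2" and b: "b * real q \<in> \<int>" "b - a \<ge> 2"
  shows "borel_data q (b - a) (kernel_germ a b) (beta_kernel a b) 1"
proof -
  have rat: "a \<in> \<rat>" "b \<in> \<rat>"
    using a b q by (metis Ints_subset_Rats Rats_divide Rats_of_nat nonzero_mult_div_cancel_right of_nat_0_eq_iff not_gr_zero subsetD)+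
  show ?thesis unfolding borel_data_def
    using kernel_germ_bound[OF b(2)] kernel_germ_holomorphic kernel_germ_H_germ[OF rat] exp_rep_beta_kernel[OF q a b(2)] a b
    by (auto simp: beta_kernel_eq_germ left_diff_distrib)
qed

lemma beta_kernel_False: "beta_kernel a b (False, s) = of_real (Gamma (a - 1 + s) / Gamma (b - 1 + s))"
  by (simp add: beta_kernel_def)

text \<open>One convolution per pair multiplies the transform by one Gamma quotient. The empty
  product would be the transform of a point mass at w = 0 and not of a function, hence the
  restriction to nonempty lists.\<close>

lemma ex_borel_data:
  assumes q: "q > 0" and "ps \<noteq> []"
    and "\<forall>(a, b)\<in>set ps. a * real q \<in> \<int> \<and> b * real q \<in> \<int> \<and> a \<ge> 2 \<and> b - a \<ge> 2"
  shows "\<exists>\<kappa> g f I. borel_data q \<kappa> g f I \<and> (\<forall>s>0. f (False, s) = of_real (\<Prod>(a, b)\<leftarrow>ps. Gamma (a - 1 + s) / Gamma (b - 1 + s)))"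
  using assms(2,3)
proof (induction ps rule: list_nonempty_induct)
  case (single p)
  obtain a b where p: "p = (a, b)" by force
  with single borel_data_beta_kernel[OF q, of a b] show ?case
    by (intro exI[of _ "b - a"] exI[of _ "kernel_germ a b"] exI[of _ "beta_kernel a b"] exI[of _ 1]) (auto simp: beta_kernel_False)
next
  case (cons p ps)
  obtain a b where p: "p = (a, b)" by force
  from cons obtain \<kappa> g f I where f: "borel_data q \<kappa> g f I"
    "\<And>s. s > 0 \<Longrightarrow> f (False, s) = of_real (\<Prod>(a, b)\<leftarrow>ps. Gamma (a - 1 + s) / Gamma (b - 1 + s))" by auto
  have "borel_data q (b - a) (kernel_germ a b) (beta_kernel a b) 1"
    using cons.prems p by (intro borel_data_beta_kernel q) auto
  from borel_data_conv[OF q f(1) this] show ?case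
    by (intro exI conjI allI impI, assumption) (auto simp: exp_conv_def f(2) p beta_kernel_False mult.commute)
qed

section \<open>Coefficients as principal parts of Gamma quotients\<close>

definition laplace_term :: "nat \<Rightarrow> (nat \<times> nat \<Rightarrow> complex) \<Rightarrow> complex \<Rightarrow> nat \<times> nat \<Rightarrow> complex" where
  "laplace_term q c s p = c p * (fact (fst p) / (s + of_nat (snd p) / of_nat q) ^ Suc (fst p))"

lemma laplace_series_holomorphic:
  assumes c: "exp_series_coeffs I c" and r: "r > 0"
    and far: "\<And>w p. w \<in> cball z \<rho> \<Longrightarrow> c p \<noteq> 0 \<Longrightarrow> norm (w + of_nat (snd p) / of_nat q) \<ge> r"
  shows "(\<lambda>w. \<Sum>\<^sub>\<infinity>p. laplace_term q c w p) holomorphic_on ball z \<rho>"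
proof -
  define D where "D = (\<Sum>i<I. fact i / r ^ Suc i)"
  have bd: "norm (laplace_term q c w p) \<le> norm (c p) * D" if w: "w \<in> cball z \<rho>" for w p
  proof (cases "c p = 0")
    case False
    have i: "fst p < I" using False c unfolding exp_series_coeffs_def by (metis not_less prod.collapse)
    have "norm (fact (fst p) / (w + of_nat (snd p) / of_nat q) ^ Suc (fst p)) \<le> fact (fst p) / r ^ Suc (fst p)"
      unfolding norm_divide norm_power norm_fact using far[OF w False] r
      by (intro divide_left_mono power_mono mult_pos_pos zero_less_power) auto
    also have "\<dots> \<le> D" unfolding D_def using i r by (intro member_le_sum) auto
    finally show ?thesis unfolding laplace_term_def norm_mult by (intro mult_left_mono) auto
  qed (simp add: laplace_term_def)
  have sm: "(\<lambda>p. norm (c p) * D) summable_on UNIV"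
    using c by (intro summable_on_cmult_left) (simp add: exp_series_coeffs_def)
  have lim: "uniform_limit (cball z \<rho>) (\<lambda>X w. \<Sum>p\<in>X. laplace_term q c w p) (\<lambda>w. \<Sum>\<^sub>\<infinity>p. laplace_term q c w p) (finite_subsets_at_top UNIV)"
    by (rule Weierstrass_m_test_general[OF bd sm])
  have hol: "(\<lambda>w. \<Sum>p\<in>X. laplace_term q c w p) holomorphic_on cball z \<rho>" for X
  proof (intro holomorphic_on_sum)
    fix p
    show "(\<lambda>w. laplace_term q c w p) holomorphic_on cball z \<rho>"
    proof (cases "c p = 0")
      case False
      thus ?thesis unfolding laplace_term_def using far[OF _ False] r
        by (intro holomorphic_intros) fastforce
    qed (simp add: laplace_term_def)
  qed
  show ?thesis
    using holomorphic_uniform_limit[OF _ lim]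
    by (auto intro!: always_eventually holomorphic_on_imp_continuous_on hol holomorphic_on_subset[OF hol ball_subset_cball])
qed

definition poles :: "nat \<Rightarrow> complex set" where
  "poles q = range (\<lambda>k. - (of_nat k / of_nat q))"

lemma poles_iff: "q > 0 \<Longrightarrow> s \<in> poles q \<longleftrightarrow> of_nat q * s \<in> \<int>\<^sub>\<le>\<^sub>0"
proof
  assume q: "q > 0" and "of_nat q * s \<in> \<int>\<^sub>\<le>\<^sub>0"
  then obtain n where "of_nat q * s = - of_nat n" by (auto elim: nonpos_Ints_cases')
  hence "s = - (of_nat n / of_nat q)" using q by (simp add: field_simps)
  thus "s \<in> poles q" by (auto simp: poles_def)
qed (auto simp: poles_def)

lemma closed_poles: "q > 0 \<Longrightarrow> closed (poles q)"
proof -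
  assume q: "q > 0"
  have eq: "poles q = (\<lambda>s. of_nat q * s) -` \<int>\<^sub>\<le>\<^sub>0" using poles_iff[OF q] by auto
  have "(\<int>\<^sub>\<le>\<^sub>0 :: complex set) = of_int ` {..0}" by (auto simp: nonpos_Ints_def)
  hence "closed (\<int>\<^sub>\<le>\<^sub>0 :: complex set)" by (metis closed_of_int_image)
  thus ?thesis unfolding eq by (intro closed_vimage continuous_intros)
qed

lemma poles_dist:
  fixes w :: complex
  assumes q: "q > 0" and "k \<noteq> k0" "dist w (- (of_nat k0 / of_nat q)) \<le> 1 / (2 * real q)"
  shows "norm (w + of_nat k / of_nat q) \<ge> 1 / (2 * real q)"
proof -
  have "\<bar>real k - real k0\<bar> \<ge> 1" using assms(2) by linarith
  hence "1 / real q \<le> \<bar>real k - real k0\<bar> / real q" using q by (intro divide_right_mono) auto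
  also have "\<bar>real k - real k0\<bar> / real q = norm (complex_of_real ((real k - real k0) / real q))"
    unfolding norm_of_real using q by simp
  also have "complex_of_real ((real k - real k0) / real q) = (w + of_nat k / of_nat q) - (w - - (of_nat k0 / of_nat q))"
    by (simp add: diff_divide_distrib)
  also have "norm \<dots> \<le> norm (w + of_nat k / of_nat q) + norm (w - - (of_nat k0 / of_nat q))"
    by (rule norm_triangle_ineq4)
  finally show ?thesis using assms(3) by (simp add: dist_norm field_simps)
qed

definition gamma_quot :: "(real \<times> real) list \<Rightarrow> complex \<Rightarrow> complex" where
  "gamma_quot ps s = (\<Prod>(a, b)\<leftarrow>ps. Gamma (of_real (a - 1) + s) * rGamma (of_real (b - 1) + s))"

lemma gamma_quot_of_real:
  "complex_of_real (\<Prod>(a, b)\<leftarrow>ps. Gamma (a - 1 + s) / Gamma (b - 1 + s)) = gamma_quot ps (of_real s)"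
proof (induction ps)
  case (Cons p ps)
  have "complex_of_real (Gamma (a - 1 + s) / Gamma (b - 1 + s)) = Gamma (of_real (a - 1) + of_real s) * rGamma (of_real (b - 1) + of_real s)" for a b
    unfolding of_real_add[symmetric] Gamma_complex_of_real rGamma_complex_of_real rGamma_inverse_Gamma
    by (simp add: divide_inverse)
  note fac = this
  obtain a b where p: "p = (a, b)" by force
  show ?case unfolding p list.map prod_list.Cons prod.case of_real_mult fac
    using Cons by (simp add: gamma_quot_def)
qed (simp add: gamma_quot_def)

lemma gamma_quot_holomorphic:
  assumes q: "q > 0" and ps: "\<forall>(a, b)\<in>set ps. a * real q \<in> \<int> \<and> a \<ge> 1"
  shows "gamma_quot ps holomorphic_on - poles q"
  using ps
proof (induction ps)
  case (Cons p ps)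
  obtain a b where p: "p = (a, b)" by force
  have "of_real (a - 1) + s \<notin> \<int>\<^sub>\<le>\<^sub>0" if s: "s \<notin> poles q" for s
  proof
    assume "of_real (a - 1) + s \<in> \<int>\<^sub>\<le>\<^sub>0"
    then obtain n where n: "of_real (a - 1) + s = - of_nat n" by (auto elim: nonpos_Ints_cases')
    obtain z where z: "a * real q = of_int z" using Cons.prems p by (auto elim: Ints_cases)
    have "complex_of_real (a * real q) = of_int z" unfolding z by simp
    moreover have s_eq: "s = - of_nat n - of_real (a - 1)" using n by (metis add_diff_cancel_left')
    have "of_nat q * s = - (of_nat (n * q)) - complex_of_real (a * real q) + of_nat q"
      unfolding s_eq by (simp add: algebra_simps)
    ultimately have "of_nat q * s = - (of_nat (n * q)) - of_int z + of_nat q" by simp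
    also have "\<dots> = of_int (int q - int (n * q) - z)" by simp
    also have "\<dots> \<in> \<int>\<^sub>\<le>\<^sub>0"
    proof (rule nonpos_Ints_of_int)
      have "1 * real q \<le> a * real q" using Cons.prems p by (intro mult_right_mono) auto
      hence "int q \<le> z" unfolding z by (metis mult_1 of_int_le_iff of_int_of_nat_eq)
      moreover have "int (n * q) \<ge> 0" by (rule of_nat_0_le_iff)
      ultimately show "int q - int (n * q) - z \<le> 0" by linarith
    qed
    finally show False using s poles_iff[OF q] by blast
  qed
  moreover have "gamma_quot ps holomorphic_on - poles q" using Cons by auto
  ultimately show ?case
    unfolding p gamma_quot_def[abs_def] by (auto intro!: holomorphic_intros simp: gamma_quot_def)
qed (simp add: gamma_quot_def[abs_def])

text \<open>Each Gamma factor has at most a simple pole at \<open>s0\<close> and each 1/Gamma factor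
  has none, so the number of pairs bounds the order of the pole.\<close>

lemma gamma_quot_germ:
  assumes ps: "\<forall>(a, b)\<in>set ps. a \<in> \<rat> \<and> b \<in> \<rat>" and s0: "s0 \<in> \<rat>"
  shows "\<exists>g. H_germ g s0 \<and> (\<exists>e>0. \<forall>s\<in>ball s0 e - {s0}. gamma_quot ps s * (s - s0) ^ length ps = g s)"
  using ps
proof (induction ps)
  case Nil
  have "H_germ (\<lambda>_. 1) s0" by (intro H_germ_const H_ring_one)
  thus ?case by (intro exI[of _ "\<lambda>_. 1"] conjI exI[of _ 1]) (auto simp: gamma_quot_def)
next
  case (Cons p ps)
  obtain a b where p: "p = (a, b)" by force
  have r: "complex_of_real x \<in> \<rat>" if "x \<in> \<rat>" for x using that by (auto elim!: Rats_cases')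
  from Cons obtain g e where g: "H_germ g s0" "e > 0" "\<And>s. s \<in> ball s0 e - {s0} \<Longrightarrow> gamma_quot ps s * (s - s0) ^ length ps = g s"
    by auto
  have "of_real (a - 1) + s0 \<in> \<rat>" using Cons.prems p s0 by (intro Rats_add r Rats_diff) auto
  from H_germ_Gamma_pole[OF this] obtain G d where G: "H_germ G (of_real (a - 1) + s0)" "d > 0"
    "\<And>w. w \<in> ball (of_real (a - 1) + s0) d - {of_real (a - 1) + s0} \<Longrightarrow> Gamma w * (w - (of_real (a - 1) + s0)) = G w" by blast
  have "H_germ (\<lambda>s. G (s + of_real (a - 1)) * rGamma (s + of_real (b - 1)) * g s) s0"
    using G(1) Cons.prems p s0
    by (intro H_germ_mult g) (auto simp: H_germ_shift add.commute intro!: H_germ_rGamma Rats_add r simp del: of_real_diff)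
  moreover have "gamma_quot (p # ps) s * (s - s0) ^ length (p # ps) = G (s + of_real (a - 1)) * rGamma (s + of_real (b - 1)) * g s"
    if s: "s \<in> ball s0 (min e d) - {s0}" for s
  proof -
    have "of_real (a - 1) + s \<in> ball (of_real (a - 1) + s0) d - {of_real (a - 1) + s0}" using s by (auto simp: dist_norm)
    from G(3)[OF this] have "Gamma (of_real (a - 1) + s) * (s - s0) = G (s + of_real (a - 1))" by (simp add: add.commute)
    moreover have "gamma_quot ps s * (s - s0) ^ length ps = g s" using s by (intro g) auto
    ultimately show ?thesis by (simp add: p gamma_quot_def add.commute flip: \<open>_ = g s\<close>)
  qed
  ultimately show ?case using g(2) G(2)
    by (intro exI[of _ "\<lambda>s. G (s + of_real (a - 1)) * rGamma (s + of_real (b - 1)) * g s"] conjI exI[of _ "min e d"] ballI) auto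
qed

lemma analytic_eq_at:
  fixes f g :: "complex \<Rightarrow> complex"
  assumes "f analytic_on {z}" "g analytic_on {z}" "e > 0" "\<And>w. w \<in> ball z e - {z} \<Longrightarrow> f w = g w"
  shows "eventually (\<lambda>w. f w = g w) (nhds z)"
proof -
  have ev: "eventually (\<lambda>w. f w = g w) (at z)"
    unfolding eventually_at using assms(3,4) by (intro exI[of _ e]) (auto simp: dist_commute)
  have "f \<midarrow>z\<rightarrow> f z" "g \<midarrow>z\<rightarrow> g z"
    using assms(1,2) analytic_at_imp_isCont by (auto simp: isCont_def)
  hence "f \<midarrow>z\<rightarrow> g z" using ev by (metis (mono_tags, lifting) tendsto_cong)
  with \<open>f \<midarrow>z\<rightarrow> f z\<close> have "f z = g z" by (metis LIM_unique)
  with ev show ?thesis by (simp add: eventually_nhds_conv_at)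
qed

text \<open>The coefficients are read off from the principal parts of the Gamma quotient at its poles.\<close>

lemma exp_series_coeffs_H_ring:
  assumes q: "q > 0" and c: "exp_series_coeffs I c"
    and ps: "\<forall>(a, b)\<in>set ps. a * real q \<in> \<int> \<and> b * real q \<in> \<int> \<and> a \<ge> 1"
    and eq: "\<And>s. s > 0 \<Longrightarrow> (\<Sum>\<^sub>\<infinity>p. c p * exp_monom q (False, s) p) = of_real (\<Prod>(a, b)\<leftarrow>ps. Gamma (a - 1 + s) / Gamma (b - 1 + s))"
  shows "c (i, k0) \<in> H_ring"
proof (cases "i < I")
  case False
  thus ?thesis using c by (auto simp: exp_series_coeffs_def H_ring_zero)
next
  case True
  define S where "S = (\<lambda>s. \<Sum>\<^sub>\<infinity>p. laplace_term q c s p)"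
  define U where "U = - poles q"
  have U: "open U" unfolding U_def using closed_poles[OF q] by auto
  have conn: "connected U"
  proof -
    have "connected (UNIV - poles q)"
      by (rule connected_open_diff_countable) (auto simp: poles_def)
    thus ?thesis by (simp add: U_def Compl_eq_Diff_UNIV)
  qed
  have S_hol: "S holomorphic_on U"
  proof (rule analytic_imp_holomorphic, unfold analytic_on_def, intro ballI)
    fix z assume z: "z \<in> U"
    then obtain e where e: "e > 0" "ball z e \<subseteq> U" using U by (meson openE)
    have "S holomorphic_on ball z (e / 2)" unfolding S_def
    proof (rule laplace_series_holomorphic[OF c, of "e / 2"])
      fix w p assume w: "w \<in> cball z (e / 2)"
      have "- (of_nat (snd p) / of_nat q) \<in> poles q" unfolding poles_def by (rule rangeI)
      hence "- (of_nat (snd p) / of_nat q) \<notin> ball z e" using e(2) by (auto simp: U_def)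
      hence "e \<le> dist z (- (of_nat (snd p) / of_nat q))" by simp
      also have "\<dots> \<le> dist z w + dist w (- (of_nat (snd p) / of_nat q))" by (rule dist_triangle)
      finally show "e / 2 \<le> norm (w + of_nat (snd p) / of_nat q)" using w by (simp add: dist_norm)
    qed (use e in auto)
    thus "\<exists>e>0. S holomorphic_on ball z e" using e by (intro exI[of _ "e / 2"]) auto
  qed
  have pos: "complex_of_real s \<in> U" if "s > 0" for s
  proof -
    have "complex_of_real s \<noteq> - (of_nat k / of_nat q)" for k
    proof
      assume "complex_of_real s = - (of_nat k / of_nat q)"
      from arg_cong[OF this, of Re] have "s = - (real k / real q)" by simp
      moreover have "real k / real q \<ge> 0" by simp
      ultimately show False using that by linarith
    qed
    thus ?thesis by (auto simp: U_def poles_def)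
  qed
  \<comment> \<open>Both sides agree for positive \<open>s\<close>. The complement of the countable
    set of poles is connected, so the identity theorem carries the equality to punctured
    neighbourhoods of every pole.\<close>
  have SN: "S s = gamma_quot ps s" if "s \<in> U" for s
  proof -
    have "S s - gamma_quot ps s = 0"
    proof (rule analytic_continuation[of "\<lambda>s. S s - gamma_quot ps s" U "of_real ` {0<..}" 1])
      show "(\<lambda>s. S s - gamma_quot ps s) holomorphic_on U"
        unfolding U_def using S_hol gamma_quot_holomorphic[OF q, of ps] ps by (intro holomorphic_intros) (auto simp: U_def)
      show "(1::complex) islimpt of_real ` {0<..}"
      proof (rule islimptI)
        fix T :: "complex set" assume T: "1 \<in> T" "open T"
        then obtain e where e: "e > 0" "ball 1 e \<subseteq> T" by (meson openE)
        have "complex_of_real (1 + e / 2) \<in> ball 1 e" using e(1) by (simp add: dist_norm)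
        thus "\<exists>y\<in>complex_of_real ` {0<..}. y \<in> T \<and> y \<noteq> 1"
          using e by (intro bexI[of _ "of_real (1 + e / 2)"]) (auto simp: complex_eq_iff)
      qed
      fix z assume "z \<in> complex_of_real ` {0<..}"
      then obtain s where s: "z = of_real s" "s > 0" by auto
      have "S z = (\<Sum>\<^sub>\<infinity>p. c p * exp_monom q (False, s) p)"
        unfolding S_def laplace_term_def s by (intro infsum_cong) (auto simp: exp_monom_def)
      thus "S z - gamma_quot ps z = 0" unfolding eq[OF s(2)] gamma_quot_of_real s by simp
    qed (use U conn that pos in \<open>auto simp: of_real_def[symmetric] intro: pos[of 1, simplified]\<close>)
    thus ?thesis by simp
  qed
  define s0 where "s0 = - (of_nat k0 / of_nat q :: complex)"
  \<comment> \<open>The terms with index \<open>k0\<close> carry the whole pole at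
    \<open>s0\<close>; the other poles stay at distance at least \<open>1 / (2 * q)\<close>, and the
    remaining series \<open>A\<close> is holomorphic there.\<close>
  define d where "d = (\<lambda>p. if snd p = k0 then 0 else c p)"
  have dc: "exp_series_coeffs I d"
  proof -
    have "(\<lambda>p. norm (d p)) summable_on UNIV"
      by (rule summable_on_comparison_test[of "\<lambda>p. norm (c p)"]) (use c in \<open>auto simp: exp_series_coeffs_def d_def\<close>)
    thus ?thesis using c by (auto simp: exp_series_coeffs_def d_def)
  qed
  define A where "A = (\<lambda>s. \<Sum>\<^sub>\<infinity>p. laplace_term q d s p)"
  have "A holomorphic_on ball s0 (1 / (2 * real q))" unfolding A_def
  proof (rule laplace_series_holomorphic[OF dc, of "1 / (2 * real q)"])
    show "1 / (2 * real q) > 0" using q by simp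
    fix w p assume "w \<in> cball s0 (1 / (2 * real q))" "d p \<noteq> 0"
    thus "1 / (2 * real q) \<le> norm (w + of_nat (snd p) / of_nat q)"
      by (intro poles_dist[OF q, of _ k0]) (auto simp: d_def s0_def dist_commute split: if_splits)
  qed
  hence A_an: "A analytic_on {s0}" using q by (auto simp: analytic_at intro!: exI[of _ "ball s0 (1 / (2 * real q))"])
  have near: "s \<in> U" if "s \<in> ball s0 (1 / (2 * real q)) - {s0}" for s
  proof -
    have "s \<noteq> - (of_nat k / of_nat q)" for k
    proof
      assume s: "s = - (of_nat k / of_nat q)"
      have "k \<noteq> k0" using that s by (auto simp: s0_def)
      from poles_dist[OF q this, of s] that have "1 / (2 * real q) \<le> norm (s + of_nat k / of_nat q)"
        by (auto simp: s0_def dist_commute)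
      thus False using q by (simp add: s)
    qed
    thus ?thesis by (auto simp: U_def poles_def)
  qed
  have split: "S s = (\<Sum>i<I. c (i, k0) * (fact i / (s - s0) ^ Suc i)) + A s" if s: "s \<in> ball s0 (1 / (2 * real q)) - {s0}" for s
  proof -
    define e where "e = (\<lambda>p. if snd p = k0 then laplace_term q c s p else 0)"
    have ds: "(\<lambda>p. laplace_term q d s p) summable_on UNIV"
    proof -
      have bd: "norm (laplace_term q d s p) \<le> norm (d p) * (\<Sum>i<I. fact i / (1 / (2 * real q)) ^ Suc i)" for p
      proof (cases "d p = 0")
        case False
        have i: "fst p < I" using False dc unfolding exp_series_coeffs_def by (metis not_less prod.collapse)
        have "norm (s + of_nat (snd p) / of_nat q) \<ge> 1 / (2 * real q)"
          by (rule poles_dist[OF q, of _ k0]) (use s False in \<open>auto simp: d_def s0_def dist_commute split: if_splits\<close>)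
        hence "norm (fact (fst p) / (s + of_nat (snd p) / of_nat q) ^ Suc (fst p)) \<le> fact (fst p) / (1 / (2 * real q)) ^ Suc (fst p)"
          unfolding norm_divide norm_power norm_fact using q
          by (intro divide_left_mono power_mono mult_pos_pos zero_less_power) (auto intro: less_le_trans[of 0 "1 / (2 * real q)"])
        also have "\<dots> \<le> (\<Sum>i<I. fact i / (1 / (2 * real q)) ^ Suc i)" using i by (intro member_le_sum) auto
        finally show ?thesis unfolding laplace_term_def norm_mult by (intro mult_left_mono) auto
      qed (simp add: laplace_term_def)
      have sm: "(\<lambda>p. norm (d p) * (\<Sum>i<I. fact i / (1 / (2 * real q)) ^ Suc i)) summable_on UNIV"
        using dc by (intro summable_on_cmult_left) (simp add: exp_series_coeffs_def)
      have "(\<lambda>p. norm (laplace_term q d s p)) summable_on UNIV"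
        by (rule summable_on_comparison_test[OF sm]) (use bd in simp_all)
      thus ?thesis by (rule Infinite_Sum.abs_summable_summable)
    qed
    have "(e has_sum (\<Sum>p\<in>(\<lambda>i. (i, k0)) ` {..<I}. e p)) UNIV"
    proof (subst has_sum_cong_neutral[of "(\<lambda>i. (i, k0)) ` {..<I}" _ e e])
      fix p assume p: "p \<in> UNIV - (\<lambda>i. (i, k0)) ` {..<I}"
      show "e p = 0"
      proof (cases "snd p = k0")
        case True
        hence "p = (fst p, k0)" by (cases p) auto
        hence "fst p \<ge> I" using p by (metis DiffD2 imageI lessThan_iff not_less)
        hence "c p = 0" using c by (cases p) (auto simp: exp_series_coeffs_def)
        thus ?thesis by (simp add: e_def laplace_term_def)
      qed (simp add: e_def)
    qed auto
    also have "(\<Sum>p\<in>(\<lambda>i. (i, k0)) ` {..<I}. e p) = (\<Sum>i<I. c (i, k0) * (fact i / (s - s0) ^ Suc i))"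
      by (subst sum.reindex) (auto simp: inj_on_def e_def laplace_term_def s0_def)
    finally have es: "(e has_sum (\<Sum>i<I. c (i, k0) * (fact i / (s - s0) ^ Suc i))) UNIV" .
    have "S s = (\<Sum>\<^sub>\<infinity>p. e p + laplace_term q d s p)"
      unfolding S_def by (intro infsum_cong) (auto simp: e_def d_def laplace_term_def)
    also have "\<dots> = (\<Sum>\<^sub>\<infinity>p. e p) + A s"
      unfolding A_def by (intro infsum_add ds) (use es in \<open>auto simp: summable_on_def\<close>)
    finally show ?thesis using es by (simp add: infsumI)
  qed
  have rat: "x \<in> \<rat>" if "x * real q \<in> \<int>" for x :: real
    using that q by (metis Ints_subset_Rats Rats_divide Rats_of_nat nonzero_mult_div_cancel_right of_nat_0_eq_iff not_gr_zero subsetD)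
  have "s0 \<in> \<rat>" by (auto simp: s0_def)
  moreover have "\<forall>(a, b)\<in>set ps. a \<in> \<rat> \<and> b \<in> \<rat>" using ps rat by auto
  ultimately obtain g e where g: "H_germ g s0" "e > 0" "\<And>s. s \<in> ball s0 e - {s0} \<Longrightarrow> gamma_quot ps s * (s - s0) ^ length ps = g s"
    using gamma_quot_germ by metis
  \<comment> \<open>This power of \<open>s - s0\<close> clears the pole in both descriptions. The
    contribution of \<open>A\<close> starts in degree \<open>K\<close>, whereas
    \<open>c (i, k0)\<close> sits in the lower degree \<open>K - Suc i\<close> and can be read
    off.\<close>
  define K where "K = length ps + I"
  define L where "L = (\<lambda>s. (\<Sum>i<I. c (i, k0) * fact i * (s - s0) ^ (K - Suc i)) + (s - s0) ^ K * A s)"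
  have g2: "H_germ (\<lambda>s. g s * (s + (- s0)) ^ I) s0"
    by (intro H_germ_mult g H_germ_power H_germ_add H_germ_ident H_germ_const H_ring_Rats Rats_minus_iff[THEN iffD2] \<open>s0 \<in> \<rat>\<close>)
  have "eventually (\<lambda>s. L s = g s * (s + (- s0)) ^ I) (nhds s0)"
  proof (rule analytic_eq_at[where e = "min e (1 / (2 * real q))"])
    show "L analytic_on {s0}" unfolding L_def by (intro analytic_intros A_an)
    show "(\<lambda>s. g s * (s + (- s0)) ^ I) analytic_on {s0}" by (rule H_germ_analytic[OF g2])
    show "0 < min e (1 / (2 * real q))" using g(2) q by simp
    fix s assume s: "s \<in> ball s0 (min e (1 / (2 * real q))) - {s0}"
    have 1: "gamma_quot ps s * (s - s0) ^ length ps = g s" and 2: "s \<in> ball s0 (1 / (2 * real q)) - {s0}" using s g(3) by auto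
    have "(s - s0) ^ K * (c (i, k0) * (fact i / (s - s0) ^ Suc i)) = c (i, k0) * fact i * (s - s0) ^ (K - Suc i)" if "i < I" for i
    proof -
      have "K = (K - Suc i) + Suc i" using that by (simp add: K_def)
      hence "(s - s0) ^ K = (s - s0) ^ (K - Suc i) * (s - s0) ^ Suc i" by (metis power_add)
      thus ?thesis using s by simp
    qed
    hence "L s = (s - s0) ^ K * S s"
      unfolding L_def split[OF 2] distrib_left sum_distrib_left by (intro arg_cong2[of _ _ _ _ "(+)"] sum.cong) auto
    also have "\<dots> = (gamma_quot ps s * (s - s0) ^ length ps) * (s - s0) ^ I"
      using SN[OF near[OF 2]] by (simp add: K_def power_add)
    finally show "L s = g s * (s + (- s0)) ^ I" unfolding 1 by simp
  qed
  hence "eventually (\<lambda>s. g s * (s + (- s0)) ^ I = L s) (nhds s0)" by (simp add: eq_commute)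
  from H_germ_cong[OF g2 this] obtain F where F: "F \<in> H_fps" "(\<lambda>h. L (s0 + h)) has_fps_expansion F" by (rule H_germE)
  have "(\<lambda>h. A (s0 + h)) has_fps_expansion fps_expansion A s0" by (rule analytic_at_imp_has_fps_expansion[OF A_an])
  hence "(\<lambda>h. (\<Sum>i<I. c (i, k0) * fact i * h ^ (K - Suc i)) + h ^ K * A (s0 + h)) has_fps_expansion
    (\<Sum>i<I. fps_const (c (i, k0) * fact i) * fps_X ^ (K - Suc i)) + fps_X ^ K * fps_expansion A s0"
    by (intro fps_expansion_intros)
  hence "(\<lambda>h. L (s0 + h)) has_fps_expansion
    (\<Sum>i<I. fps_const (c (i, k0) * fact i) * fps_X ^ (K - Suc i)) + fps_X ^ K * fps_expansion A s0"
    by (simp add: L_def)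
  with F(2) have "F = (\<Sum>i<I. fps_const (c (i, k0) * fact i) * fps_X ^ (K - Suc i)) + fps_X ^ K * fps_expansion A s0"
    by (rule fps_expansion_unique_complex)
  moreover have "K - Suc i < K" using True by (simp add: K_def)
  ultimately have "fps_nth F (K - Suc i) = (\<Sum>j<I. c (j, k0) * fact j * (if K - Suc i = K - Suc j then 1 else 0))"
    by (simp add: fps_sum_nth fps_X_power_mult_nth fps_X_power_nth)
  also have "\<dots> = (\<Sum>j<I. if j = i then c (j, k0) * fact j else 0)"
  proof (rule sum.cong)
    fix j assume "j \<in> {..<I}"
    hence "K - Suc i = K - Suc j \<longleftrightarrow> j = i" using True by (auto simp: K_def)
    thus "c (j, k0) * fact j * (if K - Suc i = K - Suc j then 1 else 0) = (if j = i then c (j, k0) * fact j else 0)"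
      by simp
  qed simp
  also have "\<dots> = c (i, k0) * fact i" using True by simp
  finally have "c (i, k0) = fps_nth F (K - Suc i) * inverse (fact i)" by simp
  moreover have "inverse (fact i :: complex) \<in> \<rat>" by (metis Rats_inverse Rats_of_nat of_nat_fact)
  ultimately show ?thesis using F(1) by (metis (no_types, lifting) H_fps_def H_ring_Rats H_ring_mult mem_Collect_eq)
qed

section \<open>Laplace transforms and Watson's lemma\<close>

lemma half_line_integral:
  fixes f :: "real \<Rightarrow> complex"
  assumes cont: "continuous_on {c..} f" and \<delta>: "\<delta> > 0" and bd: "\<And>r. r \<ge> c \<Longrightarrow> norm (f r) \<le> M * exp (- \<delta> * r)"
  shows "f integrable_on {c..}" "norm (integral {c..} f) \<le> M * exp (- \<delta> * c) / \<delta>"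
proof -
  define g where "g = (\<lambda>n::nat. \<lambda>r. if r \<in> {c..c + real n} then f r else 0)"
  have HI: "((\<lambda>r. M * exp (- \<delta> * r)) has_integral M * (exp (- \<delta> * c) / \<delta>)) {c..}"
    by (intro has_integral_mult_right has_integral_exp_minus_to_infinity \<delta>)
  have gi: "g n integrable_on {c..}" for n
  proof -
    have "f integrable_on {c..c + real n}"
      by (intro integrable_continuous_interval continuous_on_subset[OF cont]) auto
    hence "(\<lambda>r. if r \<in> {c..c + real n} then f r else 0) integrable_on UNIV"
      by (simp only: integrable_restrict_UNIV)
    moreover have "(\<lambda>r. if r \<in> {c..} then g n r else 0) = (\<lambda>r. if r \<in> {c..c + real n} then f r else 0)"
      by (auto simp: g_def)
    ultimately show ?thesis by (metis integrable_restrict_UNIV)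
  qed
  have le: "norm (g n r) \<le> M * exp (- \<delta> * r)" if "r \<in> {c..}" for n r
    using bd[of r] that order_trans[OF norm_ge_zero bd[of r]] by (auto simp: g_def)
  have lim: "(\<lambda>n. g n r) \<longlonglongrightarrow> f r" if "r \<in> {c..}" for r
  proof (rule tendsto_eventually)
    obtain N :: nat where "r - c \<le> real N" using real_arch_simple by blast
    hence "\<forall>n\<ge>N. g n r = f r" using that by (auto simp: g_def)
    thus "\<forall>\<^sub>F n in sequentially. g n r = f r" by (auto simp: eventually_sequentially)
  qed
  show int: "f integrable_on {c..}"
    by (rule dominated_convergence(1)[OF gi _ le lim]) (use HI in auto)
  have "norm (integral {c..} f) \<le> integral {c..} (\<lambda>r. M * exp (- \<delta> * r))"
    by (rule integral_norm_bound_integral[OF int]) (use HI bd in auto)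
  also have "\<dots> = M * exp (- \<delta> * c) / \<delta>" by (simp only: integral_unique[OF HI] times_divide_eq_right)
  finally show "norm (integral {c..} f) \<le> M * exp (- \<delta> * c) / \<delta>" .
qed

lemma power_le_fact_exp:
  assumes "x \<ge> (0::real)" shows "x ^ n \<le> fact n * exp x"
  using sum_le_suminf[OF summable_exp_generic[of x], of "{n}"] assms
  by (simp add: exp_def field_simps)

lemma power_le_exp_scaled:
  assumes "x \<ge> (0::real)" "\<delta> > 0" shows "x ^ n \<le> fact n / \<delta> ^ n * exp (\<delta> * x)"
  using power_le_fact_exp[of "\<delta> * x" n] assms by (simp add: power_mult_distrib field_simps)

section \<open>Laplace transforms of continuous functions of polynomial growth\<close>

definition poly_growth :: "(real \<Rightarrow> complex) \<Rightarrow> bool" where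
  "poly_growth g \<longleftrightarrow> continuous_on {0..} g \<and> (\<exists>C\<ge>0. \<exists>K. \<forall>r\<ge>0. norm (g r) \<le> C * (1 + r) ^ K)"

definition lap :: "(real \<Rightarrow> complex) \<Rightarrow> complex \<Rightarrow> complex" where
  "lap g z = integral {0..} (\<lambda>r. exp (- z * of_real r) * g r)"

lemma poly_growth_exp:
  assumes "poly_growth g" "\<delta> > 0"
  shows "\<exists>M\<ge>0. \<forall>r\<ge>0. norm (g r) \<le> M * exp (\<delta> * r)"
proof -
  from assms(1) obtain C K where C: "C \<ge> 0" "\<And>r. r \<ge> 0 \<Longrightarrow> norm (g r) \<le> C * (1 + r) ^ K"
    unfolding poly_growth_def by blast
  have "norm (g r) \<le> (C * (fact K / \<delta> ^ K * exp \<delta>)) * exp (\<delta> * r)" if r: "r \<ge> 0" for r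
  proof -
    have "norm (g r) \<le> C * (1 + r) ^ K" using C(2)[OF r] .
    also have "\<dots> \<le> C * (fact K / \<delta> ^ K * exp (\<delta> * (1 + r)))"
      using C(1) r assms(2) by (intro mult_left_mono power_le_exp_scaled) auto
    also have "\<dots> = (C * (fact K / \<delta> ^ K * exp \<delta>)) * exp (\<delta> * r)" by (simp add: exp_add distrib_left)
    finally show ?thesis .
  qed
  moreover have "C * (fact K / \<delta> ^ K * exp \<delta>) \<ge> 0" using C(1) assms(2) by simp
  ultimately show ?thesis by blast
qed

lemma lap_integrand:
  assumes g: "poly_growth g" and z: "Re z \<ge> 2 * \<delta>" "\<delta> > 0"
    and M: "\<And>r. r \<ge> 0 \<Longrightarrow> norm (g r) \<le> M * exp (\<delta> * r)"
  shows "continuous_on {0..} (\<lambda>r. exp (- z * of_real r) * g r)"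
    and "r \<ge> 0 \<Longrightarrow> norm (exp (- z * of_real r) * g r) \<le> M * exp (- \<delta> * r)"
proof -
  show "continuous_on {0..} (\<lambda>r. exp (- z * of_real r) * g r)"
    using g by (intro continuous_intros) (auto simp: poly_growth_def)
  assume r: "r \<ge> 0"
  have M0: "M \<ge> 0" using M[of 0] by (metis exp_zero mult.right_neutral mult_zero_right norm_ge_zero order_trans order_refl)
  have "norm (exp (- z * of_real r) * g r) \<le> exp (- (2 * \<delta>) * r) * (M * exp (\<delta> * r))"
    unfolding norm_mult norm_exp_eq_Re using z r M[OF r] by (intro mult_mono) (auto intro!: mult_right_mono)
  also have "\<dots> = M * exp (- \<delta> * r)" by (simp add: exp_add[symmetric])
  finally show "norm (exp (- z * of_real r) * g r) \<le> M * exp (- \<delta> * r)" .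
qed

lemma lap_integrable:
  assumes g: "poly_growth g" and z: "Re z > 0"
  shows "(\<lambda>r. exp (- z * of_real r) * g r) integrable_on {0..}"
proof -
  obtain M where M: "\<And>r. r \<ge> 0 \<Longrightarrow> norm (g r) \<le> M * exp ((Re z / 2) * r)"
    using poly_growth_exp[OF g, of "Re z / 2"] z by auto
  have z': "Re z \<ge> 2 * (Re z / 2)" "Re z / 2 > 0" using z by auto
  show ?thesis
    by (rule half_line_integral(1)[OF lap_integrand(1)[OF g z' M] z'(2) lap_integrand(2)[OF g z' M]]) auto
qed

text \<open>The integrals over [0, n] are holomorphic by differentiation under the integral. Where
  \<open>Re z\<close> is bounded below by a positive number the tails are uniformly small, so the
  limit is holomorphic too.\<close>

lemma lap_holomorphic:
  assumes g: "poly_growth g"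
  shows "lap g holomorphic_on {z. Re z > 0}"
proof (rule holomorphic_uniform_sequence[where f = "\<lambda>n z. integral (cbox 0 (real n)) (\<lambda>r. exp (- z * of_real r) * g r)"])
  have gc: "continuous_on {0..} g" using g by (simp add: poly_growth_def)
  show "open {z::complex. Re z > 0}" by (rule open_halfspace_Re_gt)
  show "(\<lambda>z. integral (cbox 0 (real n)) (\<lambda>r. exp (- z * of_real r) * g r)) holomorphic_on {z. Re z > 0}" for n
  proof (rule leibniz_rule_holomorphic[where fx = "\<lambda>z r. exp (- z * of_real r) * (- of_real r) * g r"])
    show "((\<lambda>z. exp (- z * of_real r) * g r) has_field_derivative exp (- z * of_real r) * (- of_real r) * g r) (at z within {z. Re z > 0})" for z r
      by (auto intro!: derivative_eq_intros)
    show "(\<lambda>r. exp (- z * of_real r) * g r) integrable_on cbox 0 (real n)" for z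
      by (intro integrable_continuous continuous_intros continuous_on_subset[OF gc]) auto
    have "continuous_on ({z. Re z > 0} \<times> cbox 0 (real n)) (\<lambda>x. g (snd x))"
      by (rule continuous_on_compose2[OF gc]) (auto intro!: continuous_intros)
    thus "continuous_on ({z. Re z > 0} \<times> cbox 0 (real n)) (\<lambda>(z, r). exp (- z * of_real r) * (- of_real r) * g r)"
      unfolding case_prod_unfold by (intro continuous_intros)
  qed (rule convex_halfspace_Re_gt)
  fix z0 :: complex assume "z0 \<in> {z. Re z > 0}"
  define \<delta> where "\<delta> = Re z0 / 4"
  have \<delta>: "\<delta> > 0" using \<open>z0 \<in> _\<close> by (simp add: \<delta>_def)
  obtain M where M: "M \<ge> 0" "\<And>r. r \<ge> 0 \<Longrightarrow> norm (g r) \<le> M * exp (\<delta> * r)" using poly_growth_exp[OF g \<delta>] by blast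
  have ball: "Re z \<ge> 2 * \<delta>" if "z \<in> cball z0 (2 * \<delta>)" for z
    using that abs_Re_le_cmod[of "z0 - z"] by (auto simp: dist_norm \<delta>_def)
  show "\<exists>d>0. cball z0 d \<subseteq> {z. Re z > 0} \<and>
    uniform_limit (cball z0 d) (\<lambda>n z. integral (cbox 0 (real n)) (\<lambda>r. exp (- z * of_real r) * g r)) (lap g) sequentially"
  proof (intro exI[of _ "2 * \<delta>"] conjI)
    show "cball z0 (2 * \<delta>) \<subseteq> {z. Re z > 0}" using ball \<delta> by force
    show "uniform_limit (cball z0 (2 * \<delta>)) (\<lambda>n z. integral (cbox 0 (real n)) (\<lambda>r. exp (- z * of_real r) * g r)) (lap g) sequentially"
    proof (rule uniform_limitI)
      fix e :: real assume e: "e > 0"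
      have "(\<lambda>n. M * exp (- \<delta> * real n) / \<delta>) \<longlonglongrightarrow> 0" using \<delta> by real_asymp
      hence "eventually (\<lambda>n. M * exp (- \<delta> * real n) / \<delta> < e) sequentially" using e by (rule order_tendstoD)
      thus "\<forall>\<^sub>F n in sequentially. \<forall>z\<in>cball z0 (2 * \<delta>). dist (integral (cbox 0 (real n)) (\<lambda>r. exp (- z * of_real r) * g r)) (lap g z) < e"
      proof eventually_elim
        case (elim n)
        show ?case
        proof
          fix z assume z: "z \<in> cball z0 (2 * \<delta>)"
          define f where "f = (\<lambda>r. exp (- z * of_real r) * g r)"
          note F = lap_integrand[OF g ball[OF z] \<delta> M(2), folded f_def]
          have fn: "continuous_on {real n..} f" by (rule continuous_on_subset[OF F(1)]) auto
          have fb: "norm (f r) \<le> M * exp (- \<delta> * r)" if "r \<ge> real n" for r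
            unfolding f_def by (rule lap_integrand(2)[OF g ball[OF z] \<delta> M(2)]) (use that in auto)
          note T = half_line_integral[OF fn \<delta> fb]
          have "(f has_integral integral {0..real n} f + integral {real n..} f) ({0..real n} \<union> {real n..})"
          proof (rule has_integral_Un)
            show "(f has_integral integral {0..real n} f) {0..real n}"
              by (intro integrable_integral integrable_continuous_interval continuous_on_subset[OF F(1)]) auto
            show "(f has_integral integral {real n..} f) {real n..}" using T(1) by (rule integrable_integral)
            have "{0..real n} \<inter> {real n..} \<subseteq> {real n}" by auto
            thus "negligible ({0..real n} \<inter> {real n..})" by (rule negligible_subset[rotated]) simp
          qed
          moreover have "{0..real n} \<union> {real n..} = {0..}" by auto
          ultimately have "lap g z = integral {0..real n} f + integral {real n..} f"
            unfolding lap_def f_def by (simp add: integral_unique)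
          hence "dist (integral (cbox 0 (real n)) f) (lap g z) = norm (integral {real n..} f)"
            by (simp add: dist_norm)
          also have "\<dots> < e" using T(2) elim by simp
          finally show "dist (integral (cbox 0 (real n)) (\<lambda>r. exp (- z * of_real r) * g r)) (lap g z) < e" unfolding f_def .
        qed
      qed
    qed
  qed (use \<delta> in auto)
qed

lemma lap_add: "poly_growth f \<Longrightarrow> poly_growth g \<Longrightarrow> Re z > 0 \<Longrightarrow> lap (\<lambda>r. f r + g r) z = lap f z + lap g z"
  unfolding lap_def distrib_left by (intro integral_add lap_integrable)

lemma lap_cmult: "lap (\<lambda>r. c * g r) z = c * lap g z"
proof -
  have "(\<lambda>r. exp (- z * of_real r) * (c * g r)) = (\<lambda>r. c * (exp (- z * of_real r) * g r))" by (simp add: mult_ac)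
  thus ?thesis unfolding lap_def by (simp only: integral_mult_right)
qed

lemma poly_growth_cmult: "poly_growth g \<Longrightarrow> poly_growth (\<lambda>r. c * g r)"
proof -
  assume g: "poly_growth g"
  then obtain C K where C: "C \<ge> 0" "\<And>r. r \<ge> 0 \<Longrightarrow> norm (g r) \<le> C * (1 + r) ^ K"
    unfolding poly_growth_def by blast
  have "norm (c * g r) \<le> (norm c * C) * (1 + r) ^ K" if "r \<ge> 0" for r
    unfolding norm_mult mult.assoc using C(2)[OF that] by (intro mult_left_mono) auto
  moreover have "norm c * C \<ge> 0" using C(1) by simp
  moreover have "continuous_on {0..} (\<lambda>r. c * g r)" using g by (intro continuous_intros) (simp add: poly_growth_def)
  ultimately show ?thesis unfolding poly_growth_def by blast
qed

lemma poly_growth_add: "poly_growth f \<Longrightarrow> poly_growth g \<Longrightarrow> poly_growth (\<lambda>r. f r + g r)"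
proof -
  assume f: "poly_growth f" and g: "poly_growth g"
  from f obtain C K where C: "C \<ge> 0" "\<And>r. r \<ge> 0 \<Longrightarrow> norm (f r) \<le> C * (1 + r) ^ K"
    unfolding poly_growth_def by blast
  from g obtain D L where D: "D \<ge> 0" "\<And>r. r \<ge> 0 \<Longrightarrow> norm (g r) \<le> D * (1 + r) ^ L"
    unfolding poly_growth_def by blast
  have "norm (f r + g r) \<le> (C + D) * (1 + r) ^ (K + L)" if r: "r \<ge> 0" for r
  proof -
    have "norm (f r + g r) \<le> C * (1 + r) ^ K + D * (1 + r) ^ L"
      using C(2)[OF r] D(2)[OF r] by (rule norm_triangle_mono)
    also have "\<dots> \<le> C * (1 + r) ^ (K + L) + D * (1 + r) ^ (K + L)"
      using C(1) D(1) r by (intro add_mono mult_left_mono power_increasing) auto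
    finally show ?thesis by (simp add: algebra_simps)
  qed
  moreover have "C + D \<ge> 0" using C(1) D(1) by simp
  moreover have "continuous_on {0..} (\<lambda>r. f r + g r)" using f g by (intro continuous_intros) (auto simp: poly_growth_def)
  ultimately show ?thesis unfolding poly_growth_def by blast
qed

lemma poly_growth_sum: "finite A \<Longrightarrow> (\<And>i. i \<in> A \<Longrightarrow> poly_growth (f i)) \<Longrightarrow> poly_growth (\<lambda>r. \<Sum>i\<in>A. f i r)"
proof (induction A rule: finite_induct)
  case empty
  show ?case by (auto simp: poly_growth_def intro!: exI[of _ "0::real"])
qed (auto intro: poly_growth_add)

lemma lap_sum:
  "finite A \<Longrightarrow> (\<And>i. i \<in> A \<Longrightarrow> poly_growth (f i)) \<Longrightarrow> Re z > 0 \<Longrightarrow> lap (\<lambda>r. \<Sum>i\<in>A. f i r) z = (\<Sum>i\<in>A. lap (f i) z)"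
proof (induction A rule: finite_induct)
  case empty
  show ?case by (simp add: lap_def)
qed (simp add: lap_add poly_growth_sum)

text \<open>With \<open>a = \<delta> * norm z\<close> the decay \<open>exp (- a * r)\<close> is
  shared out: the rate \<open>a / 2\<close> pays for \<open>r ^ m\<close> and produces the factorial
  and the power of z, the rate \<open>a / 4\<close> pays for \<open>(1 + r) ^ K\<close>, and the
  last \<open>a / 4\<close> is integrated.\<close>

lemma norm_lap_le:
  assumes g: "poly_growth g" and D: "D \<ge> 0" and bd: "\<And>r. r \<ge> 0 \<Longrightarrow> norm (g r) \<le> D * r ^ m * (1 + r) ^ K"
    and \<delta>: "0 < \<delta>" "\<delta> \<le> 1" and z: "Re z \<ge> \<delta> * norm z" "norm z \<ge> 1"
  shows "norm (lap g z) \<le> D * (fact K * (4 / \<delta>) ^ K * exp 1) * (fact m * (4 / \<delta>) ^ Suc m) * norm z powr (- real (Suc m))"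
proof -
  define a where "a = \<delta> * norm z"
  have "norm z > 0" using z(2) by linarith
  hence a: "a > 0" "a \<ge> \<delta>" using \<delta> z by (auto simp: a_def mult_le_cancel_left1)
  define E where "E = D * (fact K * (4 / \<delta>) ^ K * exp 1) * (fact m * (2 / a) ^ m)"
  have E: "norm (exp (- z * of_real r) * g r) \<le> E * exp (- (a / 4) * r)" if r: "r \<ge> 0" for r
  proof -
    have "r ^ m \<le> fact m / (a / 2) ^ m * exp ((a / 2) * r)" using a r by (intro power_le_exp_scaled) auto
    hence 1: "r ^ m \<le> (fact m * (2 / a) ^ m) * exp ((a / 2) * r)" by (simp add: power_divide)
    \<comment> \<open>The rate \<open>\<delta> / 4\<close> is used here and enlarged to
      \<open>a / 4\<close> only afterwards, in order that the constant does not depend on z.\<close>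
    have "(1 + r) ^ K \<le> fact K / (\<delta> / 4) ^ K * exp ((\<delta> / 4) * (1 + r))" using \<delta> r by (intro power_le_exp_scaled) auto
    also have "\<dots> \<le> fact K / (\<delta> / 4) ^ K * exp (1 + (a / 4) * r)"
    proof (intro mult_left_mono)
      have "\<delta> * r \<le> a * r" using a r by (intro mult_right_mono) auto
      thus "exp (\<delta> / 4 * (1 + r)) \<le> exp (1 + a / 4 * r)" using \<delta> by (simp add: algebra_simps)
    qed (use \<delta> in auto)
    also have "\<dots> = (fact K * (4 / \<delta>) ^ K * exp 1) * exp ((a / 4) * r)" by (simp add: exp_add power_divide)
    finally have 2: "(1 + r) ^ K \<le> (fact K * (4 / \<delta>) ^ K * exp 1) * exp ((a / 4) * r)" .
    have "norm (exp (- z * of_real r) * g r) \<le> exp (- a * r) * (D * r ^ m * (1 + r) ^ K)"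
      unfolding norm_mult norm_exp_eq_Re using z(1) r bd[OF r] by (intro mult_mono) (auto simp: a_def intro!: mult_right_mono)
    also have "\<dots> \<le> exp (- a * r) * (D * ((fact m * (2 / a) ^ m) * exp ((a / 2) * r)) * ((fact K * (4 / \<delta>) ^ K * exp 1) * exp ((a / 4) * r)))"
      using 1 2 D r a \<delta> by (intro mult_left_mono mult_mono) auto
    also have "\<dots> = E * (exp (- a * r) * exp ((a / 2) * r) * exp ((a / 4) * r))" by (simp add: E_def mult_ac)
    also have "exp (- a * r) * exp ((a / 2) * r) * exp ((a / 4) * r) = exp (- (a / 4) * r)"
      by (simp add: exp_add[symmetric])
    finally show ?thesis .
  qed
  have "norm (lap g z) \<le> E * exp (- (a / 4) * 0) / (a / 4)"
    unfolding lap_def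
    by (rule half_line_integral(2)[OF _ _ E]) (use a g in \<open>auto simp: poly_growth_def intro!: continuous_intros\<close>)
  also have "\<dots> = D * (fact K * (4 / \<delta>) ^ K * exp 1) * fact m * ((2 / a) ^ m * (4 / a))" by (simp add: E_def)
  also have "\<dots> \<le> D * (fact K * (4 / \<delta>) ^ K * exp 1) * fact m * ((4 / a) ^ m * (4 / a))"
    using a D \<delta> by (intro mult_left_mono mult_right_mono power_mono divide_right_mono) auto
  also have "(4 / a) ^ m * (4 / a) = (4 / \<delta>) ^ Suc m * norm z powr (- real (Suc m))"
  proof -
    have nz: "norm z > 0" using z(2) by linarith
    have "(4 / a) ^ m * (4 / a) = (4 / \<delta> * inverse (norm z)) ^ Suc m" by (simp add: a_def field_simps)
    also have "\<dots> = (4 / \<delta>) ^ Suc m * inverse (norm z ^ Suc m)" by (simp only: power_mult_distrib power_inverse)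
    also have "inverse (norm z ^ Suc m) = norm z powr (- real (Suc m))"
      unfolding powr_minus powr_realpow[OF nz] ..
    finally show ?thesis .
  qed
  finally show ?thesis by (simp add: mult_ac)
qed

section \<open>Laplace transforms of powers with logarithms\<close>

lemma log_power_bound:
  fixes s T :: real
  assumes s: "0 < s" "s \<le> 1" and T: "T \<ge> 0"
  shows "\<exists>C\<ge>1. \<forall>r>0. r powr s * (\<bar>ln r\<bar> + T) ^ j \<le> C * (1 + r) ^ (j + 1)"
proof -
  \<comment> \<open>Near 0 each of the \<open>j\<close> logarithms may cost a factor
    \<open>r powr (- \<sigma>)\<close>; together they cost less than \<open>r powr s\<close>
    provides.\<close>
  define \<sigma> where "\<sigma> = s / real (j + 1)"
  have \<sigma>: "\<sigma> > 0" using s by (simp add: \<sigma>_def)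
  define C where "C = (T + 1 / \<sigma>) ^ j + (1 + T) ^ j"
  have "r powr s * (\<bar>ln r\<bar> + T) ^ j \<le> C * (1 + r) ^ (j + 1)" if r: "r > 0" for r
  proof (cases "r \<le> 1")
    case True
    have "ln (1 / r) \<le> (1 / r) powr \<sigma> / \<sigma>" using True r \<sigma> by (intro ln_powr_bound) auto
    hence 1: "\<bar>ln r\<bar> \<le> (1 / \<sigma>) * r powr (- \<sigma>)" using True r by (simp add: ln_div powr_minus_divide powr_divide abs_of_nonpos mult.commute[of \<sigma>])
    have "1 \<le> r powr (- \<sigma>)" using True r \<sigma> powr_mono'[of "- \<sigma>" 0 r] by auto
    hence "T \<le> T * r powr (- \<sigma>)" using T mult_left_mono[of 1 "r powr (- \<sigma>)" T] by simp
    with 1 have "\<bar>ln r\<bar> + T \<le> (T + 1 / \<sigma>) * r powr (- \<sigma>)" by (simp add: distrib_right)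
    hence "(\<bar>ln r\<bar> + T) ^ j \<le> ((T + 1 / \<sigma>) * r powr (- \<sigma>)) ^ j" using T by (intro power_mono) auto
    also have "\<dots> = (T + 1 / \<sigma>) ^ j * r powr (- (\<sigma> * real j))"
      using r by (simp add: power_mult_distrib powr_power mult.commute[of "real j"])
    finally have "r powr s * (\<bar>ln r\<bar> + T) ^ j \<le> r powr s * ((T + 1 / \<sigma>) ^ j * r powr (- (\<sigma> * real j)))"
      by (intro mult_left_mono) auto
    also have "\<dots> = (T + 1 / \<sigma>) ^ j * r powr (s - \<sigma> * real j)" using r by (simp add: powr_add[symmetric] mult_ac)
    also have "\<dots> \<le> (T + 1 / \<sigma>) ^ j * 1"
    proof (intro mult_left_mono)
      have "\<sigma> * real j \<le> s" using s by (simp add: \<sigma>_def field_simps)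
      thus "r powr (s - \<sigma> * real j) \<le> 1" using True r by (intro powr_le1) auto
    qed (use T \<sigma> in auto)
    also have "\<dots> \<le> C * (1 + r) ^ (j + 1)"
      unfolding C_def using T \<sigma> r by (intro mult_mono one_le_power) auto
    finally show ?thesis .
  next
    case False
    hence r1: "r > 1" by simp
    have "r powr s \<le> r powr 1" using r1 s by (intro powr_mono) auto
    hence 1: "r powr s \<le> 1 + r" using r1 by simp
    have "\<bar>ln r\<bar> \<le> r" using r1 ln_bound[of r] by simp
    moreover have "T \<le> T * r" using r1 T mult_left_mono[of 1 r T] by simp
    ultimately have "\<bar>ln r\<bar> + T \<le> (1 + T) * (1 + r)" using r1 T by (simp add: algebra_simps)
    hence "(\<bar>ln r\<bar> + T) ^ j \<le> ((1 + T) * (1 + r)) ^ j" using T by (intro power_mono) auto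
    with 1 have "r powr s * (\<bar>ln r\<bar> + T) ^ j \<le> (1 + r) * ((1 + T) * (1 + r)) ^ j"
      using r1 T by (intro mult_mono) auto
    also have "\<dots> = (1 + T) ^ j * (1 + r) ^ (j + 1)" by (simp add: power_mult_distrib)
    also have "\<dots> \<le> C * (1 + r) ^ (j + 1)" unfolding C_def using T \<sigma> r by (intro mult_right_mono) auto
    finally show ?thesis .
  qed
  moreover have "C \<ge> 1"
  proof -
    have "(1 + T) ^ j \<ge> 1" using T by (intro one_le_power) auto
    moreover have "(T + 1 / \<sigma>) ^ j \<ge> 0" using T \<sigma> by auto
    ultimately show ?thesis by (simp add: C_def)
  qed
  ultimately show ?thesis by blast
qed

text \<open>For y = r * cis \<tau> this is the value of y^s * (log y)^i with the determination log y
  = ln r + i * \<tau>. The value 0 at \<open>r = 0\<close> is the limit when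
  \<open>Re s > 0\<close>, which makes the function continuous on the closed half-line.\<close>

definition pterm :: "real \<Rightarrow> complex \<Rightarrow> nat \<Rightarrow> real \<Rightarrow> complex" where
  "pterm \<tau> s i r = (if r \<le> 0 then 0 else exp (s * Complex (ln r) \<tau>) * Complex (ln r) \<tau> ^ i)"

lemma norm_pterm_le:
  assumes "r > 0"
  shows "norm (pterm \<tau> s i r) \<le> exp (- (Im s * \<tau>)) * r powr Re s * (\<bar>ln r\<bar> + \<bar>\<tau>\<bar>) ^ i"
proof -
  have "norm (Complex (ln r) \<tau>) \<le> \<bar>ln r\<bar> + \<bar>\<tau>\<bar>" using cmod_le[of "Complex (ln r) \<tau>"] by simp
  hence "norm (Complex (ln r) \<tau>) ^ i \<le> (\<bar>ln r\<bar> + \<bar>\<tau>\<bar>) ^ i" by (intro power_mono) auto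
  moreover have "norm (exp (s * Complex (ln r) \<tau>)) = exp (- (Im s * \<tau>)) * r powr Re s"
    using assms by (simp add: powr_def exp_diff exp_minus divide_inverse mult.commute)
  ultimately show ?thesis using assms unfolding pterm_def by (simp add: norm_mult norm_power mult_left_mono)
qed

lemma poly_growth_pterm:
  assumes s: "Re s > 0" shows "poly_growth (pterm \<tau> s i)"
proof -
  define \<sigma> where "\<sigma> = min 1 (Re s / 2)"
  have \<sigma>: "0 < \<sigma>" "\<sigma> \<le> 1" "\<sigma> < Re s" using s by (auto simp: \<sigma>_def)
  obtain C where C: "C \<ge> 1" "\<And>r. r > 0 \<Longrightarrow> r powr \<sigma> * (\<bar>ln r\<bar> + \<bar>\<tau>\<bar>) ^ i \<le> C * (1 + r) ^ (i + 1)"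
    using log_power_bound[OF \<sigma>(1,2), of "\<bar>\<tau>\<bar>" i] by auto
  define E where "E = exp (- (Im s * \<tau>))"
  have bd: "norm (pterm \<tau> s i r) \<le> E * C * (1 + r) ^ (i + 1) * r powr (Re s - \<sigma>)" if r: "r > 0" for r
  proof -
    have "norm (pterm \<tau> s i r) \<le> E * r powr Re s * (\<bar>ln r\<bar> + \<bar>\<tau>\<bar>) ^ i"
      unfolding E_def by (rule norm_pterm_le[OF r])
    also have "r powr Re s = r powr \<sigma> * r powr (Re s - \<sigma>)" by (simp add: powr_add[symmetric])
    also have "E * (r powr \<sigma> * r powr (Re s - \<sigma>)) * (\<bar>ln r\<bar> + \<bar>\<tau>\<bar>) ^ i = E * (r powr \<sigma> * (\<bar>ln r\<bar> + \<bar>\<tau>\<bar>) ^ i) * r powr (Re s - \<sigma>)"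
      by (simp add: mult_ac)
    also have "\<dots> \<le> E * (C * (1 + r) ^ (i + 1)) * r powr (Re s - \<sigma>)"
      using C(2)[OF r] by (intro mult_right_mono mult_left_mono) (auto simp: E_def)
    finally show ?thesis by (simp add: mult_ac)
  qed
  have "continuous (at r within {0..}) (pterm \<tau> s i)" if r: "r \<ge> 0" for r
  proof (cases "r = 0")
    case True
    have "((\<lambda>r. E * C * (1 + r) ^ (i + 1) * r powr (Re s - \<sigma>)) \<longlongrightarrow> E * C * (1 + 0) ^ (i + 1) * 0) (at 0 within {0..})"
    proof (intro tendsto_intros)
      have "continuous_on {0..} (\<lambda>r::real. r powr (Re s - \<sigma>))" using \<sigma> by (intro continuous_on_powr') (auto intro!: continuous_intros)
      from this[unfolded continuous_on_def, rule_format, of 0]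
      show "((\<lambda>r::real. r powr (Re s - \<sigma>)) \<longlongrightarrow> 0) (at 0 within {0..})" using \<sigma> by simp
    qed
    hence "(pterm \<tau> s i \<longlongrightarrow> 0) (at 0 within {0..})"
      by (intro Lim_null_comparison[of "pterm \<tau> s i" "\<lambda>r. E * C * (1 + r) ^ (i + 1) * r powr (Re s - \<sigma>)"])
         (unfold eventually_at_filter, intro always_eventually allI impI bd, auto)
    thus ?thesis using True by (simp add: continuous_within pterm_def)
  next
    case False
    have ev: "eventually (\<lambda>x. pterm \<tau> s i x = exp (s * (of_real (ln x) + \<i> * of_real \<tau>)) * (of_real (ln x) + \<i> * of_real \<tau>) ^ i) (nhds r)"
      using eventually_nhds_in_open[of "{0<..}" r] False r
      by (auto simp: pterm_def Complex_eq elim!: eventually_mono)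
    have "isCont (\<lambda>x. exp (s * (of_real (ln x) + \<i> * of_real \<tau>)) * (of_real (ln x) + \<i> * of_real \<tau>) ^ i) r"
      using False r by (intro continuous_intros) auto
    hence "isCont (pterm \<tau> s i) r" using isCont_cong[OF ev] by simp
    thus ?thesis by (rule continuous_at_imp_continuous_at_within)
  qed
  hence "continuous_on {0..} (pterm \<tau> s i)" by (simp add: continuous_on_eq_continuous_within)
  moreover have "norm (pterm \<tau> s i r) \<le> (E * C) * (1 + r) ^ (i + 1 + nat \<lceil>Re s\<rceil>)" if r: "r \<ge> 0" for r
  proof (cases "r = 0")
    case True
    thus ?thesis using C by (simp add: pterm_def E_def)
  next
    case False
    have "r powr (Re s - \<sigma>) \<le> (1 + r) powr (Re s - \<sigma>)" using r \<sigma> by (intro powr_mono2) auto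
    also have "\<dots> \<le> (1 + r) powr real (nat \<lceil>Re s\<rceil>)" using r \<sigma> by (intro powr_mono) linarith+
    also have "\<dots> = (1 + r) ^ nat \<lceil>Re s\<rceil>" using r by (intro powr_realpow) auto
    finally have "E * C * (1 + r) ^ (i + 1) * r powr (Re s - \<sigma>) \<le> E * C * (1 + r) ^ (i + 1) * (1 + r) ^ nat \<lceil>Re s\<rceil>"
      using r C by (intro mult_left_mono) (auto simp: E_def)
    with bd[of r] False r show ?thesis by (simp add: power_add mult_ac)
  qed
  moreover have "E * C \<ge> 0" using C by (simp add: E_def)
  ultimately show ?thesis unfolding poly_growth_def by blast
qed

lemma lap_pterm_real:
  assumes s: "Re s > 0" and x: "x > 0"
  shows "lap (pterm 0 s 0) (of_real x) = Gamma (s + 1) * exp (- (s + 1) * Ln (of_real x))"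
proof -
  define f where "f = (\<lambda>t. complex_of_real t powr (s + 1 - 1) / of_real (exp t))"
  have "f absolutely_integrable_on {0<..}" unfolding f_def
    by (rule absolutely_integrable_Gamma_integral') (use s in auto)
  moreover have "integral {0<..} f = Gamma (s + 1)"
    unfolding f_def by (rule integral_unique[OF Gamma_integral_complex']) (use s in auto)
  moreover have "(\<lambda>r. x * r) ` {0<..} = {0<..}"
  proof safe
    fix r :: real assume "r > 0"
    thus "r \<in> (\<lambda>r. x * r) ` {0<..}" using x by (intro image_eqI[of _ _ "r / x"]) auto
  qed (use x in auto)
  ultimately have "integral {0<..} (\<lambda>r. \<bar>x\<bar> *\<^sub>R f (x * r)) = Gamma (s + 1)"
    using has_absolute_integral_change_of_variables_real[of "{0<..}" "\<lambda>r. x * r" "\<lambda>_. x" f "Gamma (s + 1)"] x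
    by (auto intro!: derivative_eq_intros simp: inj_on_def)
  also have "integral {0<..} (\<lambda>r. \<bar>x\<bar> *\<^sub>R f (x * r)) = integral {0<..} (\<lambda>r. exp ((s + 1) * Ln (of_real x)) * (exp (- of_real x * of_real r) * pterm 0 s 0 r))"
  proof (rule integral_cong)
    fix r :: real assume "r \<in> {0<..}"
    hence r: "r > 0" by simp
    have "f (x * r) = exp (s * (of_real (ln x) + of_real (ln r))) * exp (- (of_real x * of_real r))"
      using r x by (simp add: f_def powr_def Ln_of_real ln_mult exp_minus divide_inverse exp_of_real flip: of_real_mult)
    moreover have "pterm 0 s 0 r = exp (s * of_real (ln r))" using r by (simp add: pterm_def complex_of_real_def)
    moreover have "exp ((s + 1) * Ln (of_real x)) = of_real x * exp (s * of_real (ln x))"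
      using x by (simp add: Ln_of_real distrib_right exp_add exp_of_real)
    ultimately show "\<bar>x\<bar> *\<^sub>R f (x * r) = exp ((s + 1) * Ln (of_real x)) * (exp (- of_real x * of_real r) * pterm 0 s 0 r)"
      using x by (simp add: scaleR_conv_of_real distrib_left exp_add mult_ac)
  qed
  also have "\<dots> = exp ((s + 1) * Ln (of_real x)) * integral {0<..} (\<lambda>r. exp (- of_real x * of_real r) * pterm 0 s 0 r)"
    by (rule integral_mult_right)
  also have "integral {0<..} (\<lambda>r. exp (- of_real x * of_real r) * pterm 0 s 0 r) = lap (pterm 0 s 0) (of_real x)"
    unfolding lap_def
  proof (rule integral_spike_set)
    show "negligible {r \<in> {0<..} - {0..}. exp (- of_real x * of_real r) * pterm 0 s 0 r \<noteq> 0}"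
      by (rule negligible_subset[of "{}"]) auto
    show "negligible {r \<in> {0..} - {0<..}. exp (- of_real x * of_real r) * pterm 0 s 0 r \<noteq> 0}"
      by (rule negligible_subset[of "{0}"]) auto
  qed
  finally have G: "Gamma (s + 1) = exp ((s + 1) * Ln (of_real x)) * lap (pterm 0 s 0) (of_real x)" ..
  have PQ: "exp ((s + 1) * Ln (of_real x)) * exp (- (s + 1) * Ln (of_real x)) = 1"
    by (simp add: exp_add[symmetric] algebra_simps)
  have "Gamma (s + 1) * exp (- (s + 1) * Ln (of_real x)) =
      lap (pterm 0 s 0) (of_real x) * (exp ((s + 1) * Ln (of_real x)) * exp (- (s + 1) * Ln (of_real x)))"
    unfolding G by (simp only: mult_ac)
  thus ?thesis by (simp only: PQ mult_1_right)
qed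

text \<open>For positive z this is the Gamma integral after a change of scale; the identity theorem
  extends it to the half-plane. In the absence of logarithms \<tau> enters only through a constant
  factor.\<close>

lemma lap_pterm_0:
  assumes s: "Re s > 0" and z: "Re z > 0"
  shows "lap (pterm \<tau> s 0) z = exp (\<i> * of_real \<tau> * s) * (Gamma (s + 1) * exp (- (s + 1) * Ln z))"
proof -
  have "lap (pterm 0 s 0) z - Gamma (s + 1) * exp (- (s + 1) * Ln z) = 0"
  proof (rule analytic_continuation[of "\<lambda>z. lap (pterm 0 s 0) z - Gamma (s + 1) * exp (- (s + 1) * Ln z)" "{z. Re z > 0}" "of_real ` {0<..}" 1])
    show "(\<lambda>z. lap (pterm 0 s 0) z - Gamma (s + 1) * exp (- (s + 1) * Ln z)) holomorphic_on {z. Re z > 0}"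
      by (intro holomorphic_intros lap_holomorphic poly_growth_pterm s) (auto simp: complex_nonpos_Reals_iff)
    show "(1::complex) islimpt of_real ` {0<..}"
    proof (rule islimptI)
      fix T :: "complex set" assume T: "1 \<in> T" "open T"
      then obtain e where e: "e > 0" "ball 1 e \<subseteq> T" by (meson openE)
      have "complex_of_real (1 + e / 2) \<in> ball 1 e" using e(1) by (simp add: dist_norm)
      thus "\<exists>y\<in>complex_of_real ` {0<..}. y \<in> T \<and> y \<noteq> 1"
        using e by (intro bexI[of _ "of_real (1 + e / 2)"]) (auto simp: complex_eq_iff)
    qed
    show "connected {z::complex. Re z > 0}" by (intro convex_connected convex_halfspace_Re_gt)
  qed (use z lap_pterm_real[OF s] in \<open>auto simp: open_halfspace_Re_gt\<close>)
  moreover have "pterm \<tau> s 0 = (\<lambda>r. exp (\<i> * of_real \<tau> * s) * pterm 0 s 0 r)"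
  proof
    fix r
    have "Complex (ln r) \<tau> = Complex (ln r) 0 + \<i> * of_real \<tau>" by (simp add: complex_eq_iff)
    thus "pterm \<tau> s 0 r = exp (\<i> * of_real \<tau> * s) * pterm 0 s 0 r"
      by (simp add: pterm_def distrib_left exp_add mult_ac)
  qed
  ultimately show ?thesis by (simp add: lap_cmult)
qed

text \<open>The logarithmic terms are the Taylor coefficients in \<open>h\<close> of the Laplace transform of \<open>r^(\<gamma> + h)\<close>.\<close>

lemma lap_pterm_sums:
  assumes \<gamma>: "\<gamma> > 0" and z: "Re z > 0" and h: "norm h < \<gamma>"
  shows "(\<lambda>i. lap (pterm \<tau> (of_real \<gamma>) i) z / fact i * h ^ i) sums lap (pterm \<tau> (of_real \<gamma> + h) 0) z"
proof -
  define \<eta> where "\<eta> = norm h"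
  \<comment> \<open>A dominating function for all partial sums, based on \<open>exp (\<eta> *
    \<bar>ln r\<bar>) \<le> r powr \<eta> + r powr (- \<eta>)\<close>. Since
    \<open>\<eta> < \<gamma>\<close>, both resulting exponents \<open>\<gamma> + \<eta>\<close> and
    \<open>\<gamma> - \<eta>\<close> are positive.\<close>
  define D where "D = (\<lambda>r. exp (\<eta> * \<bar>\<tau>\<bar>) * Re (exp (- of_real (Re z) * of_real r) * (pterm 0 (of_real (\<gamma> + \<eta>)) 0 r + pterm 0 (of_real (\<gamma> - \<eta>)) 0 r)))"
  define f where "f = (\<lambda>n r. \<Sum>i<n. h ^ i / fact i * (exp (- z * of_real r) * pterm \<tau> (of_real \<gamma>) i r))"
  define g where "g = (\<lambda>r. exp (- z * of_real r) * pterm \<tau> (of_real \<gamma> + h) 0 r)"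
  have pg: "poly_growth (pterm \<tau> (of_real \<gamma>) i)" for i by (rule poly_growth_pterm) (use \<gamma> in auto)
  have fi: "f n integrable_on {0..}" for n
    unfolding f_def by (intro integrable_sum integrable_on_mult_right lap_integrable[OF pg z]) auto
  have Di: "D integrable_on {0..}"
  proof -
    have "(\<lambda>r. exp (- of_real (Re z) * of_real r) * (pterm 0 (of_real (\<gamma> + \<eta>)) 0 r + pterm 0 (of_real (\<gamma> - \<eta>)) 0 r)) integrable_on {0..}"
      by (intro lap_integrable poly_growth_add poly_growth_pterm) (use \<gamma> z h in \<open>auto simp: \<eta>_def add_pos_nonneg\<close>)
    from integrable_linear[OF this bounded_linear_Re] show ?thesis
      unfolding D_def o_def by (rule integrable_on_mult_right)
  qed
  have tr: "h ^ i / fact i * (exp (- z * of_real r) * pterm \<tau> (of_real \<gamma>) i r) =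
      exp (- z * of_real r) * exp (of_real \<gamma> * Complex (ln r) \<tau>) * ((h * Complex (ln r) \<tau>) ^ i /\<^sub>R fact i)" if "r > 0" for i r
    using that by (simp add: pterm_def power_mult_distrib scaleR_conv_of_real divide_inverse mult_ac)
  have bd: "norm (f n r) \<le> D r" if r: "r \<in> {0..}" for n r
  proof (cases "r = 0")
    case False
    hence r: "r > 0" using r by simp
    define lg where "lg = Complex (ln r) \<tau>"
    have "norm (f n r) \<le> (\<Sum>i<n. norm (exp (- z * of_real r) * exp (of_real \<gamma> * lg)) * ((\<eta> * norm lg) ^ i /\<^sub>R fact i))"
      unfolding f_def by (rule sum_norm_le, subst tr[OF r])
        (simp add: norm_mult norm_power power_mult_distrib lg_def \<eta>_def mult_ac divide_inverse)
    also have "\<dots> = norm (exp (- z * of_real r) * exp (of_real \<gamma> * lg)) * (\<Sum>i<n. (\<eta> * norm lg) ^ i /\<^sub>R fact i)"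
      by (simp only: sum_distrib_left)
    also have "\<dots> \<le> norm (exp (- z * of_real r) * exp (of_real \<gamma> * lg)) * exp (\<eta> * norm lg)"
    proof (intro mult_left_mono)
      show "(\<Sum>i<n. (\<eta> * norm lg) ^ i /\<^sub>R fact i) \<le> exp (\<eta> * norm lg)"
        using sum_le_suminf[OF summable_exp_generic[of "\<eta> * norm lg"], of "{..<n}"] by (simp add: exp_def \<eta>_def)
    qed auto
    also have "\<dots> \<le> norm (exp (- z * of_real r) * exp (of_real \<gamma> * lg)) * (exp (\<eta> * \<bar>\<tau>\<bar>) * (r powr \<eta> + r powr (- \<eta>)))"
    proof (intro mult_left_mono)
      have "norm lg \<le> \<bar>ln r\<bar> + \<bar>\<tau>\<bar>" using cmod_le[of lg] by (simp add: lg_def)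
      hence "exp (\<eta> * norm lg) \<le> exp (\<eta> * (\<bar>ln r\<bar> + \<bar>\<tau>\<bar>))" by (auto simp: \<eta>_def intro!: mult_left_mono)
      also have "\<dots> = exp (\<eta> * \<bar>\<tau>\<bar>) * exp (\<eta> * \<bar>ln r\<bar>)" by (simp add: distrib_left exp_add)
      also have "exp (\<eta> * \<bar>ln r\<bar>) \<le> r powr \<eta> + r powr (- \<eta>)"
        using r by (cases "ln r \<ge> 0") (auto simp: powr_def)
      finally show "exp (\<eta> * norm lg) \<le> exp (\<eta> * \<bar>\<tau>\<bar>) * (r powr \<eta> + r powr (- \<eta>))" by simp
    qed auto
    also have "norm (exp (- z * of_real r) * exp (of_real \<gamma> * lg)) = exp (- (Re z * r)) * r powr \<gamma>"
      using r by (simp add: norm_mult lg_def powr_def)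
    also have "exp (- (Re z * r)) * r powr \<gamma> * (exp (\<eta> * \<bar>\<tau>\<bar>) * (r powr \<eta> + r powr (- \<eta>))) =
        exp (\<eta> * \<bar>\<tau>\<bar>) * (exp (- (Re z * r)) * (r powr (\<gamma> + \<eta>) + r powr (\<gamma> - \<eta>)))"
      by (simp add: powr_add powr_diff powr_minus divide_inverse algebra_simps)
    also have "\<dots> = D r"
    proof -
      have P: "pterm 0 (of_real a) 0 r = of_real (r powr a)" for a
        using r by (simp add: pterm_def powr_def complex_of_real_def[symmetric] flip: of_real_mult exp_of_real)
      have E: "exp (- complex_of_real (Re z) * of_real r) = of_real (exp (- (Re z * r)))"
        by (simp flip: of_real_mult of_real_minus exp_of_real)
      show ?thesis unfolding D_def P E of_real_add[symmetric] of_real_mult[symmetric] Re_complex_of_real ..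
    qed
    finally show ?thesis .
  qed (auto simp: f_def D_def pterm_def)
  have lim: "(\<lambda>n. f n r) \<longlonglongrightarrow> g r" if r: "r \<in> {0..}" for r
  proof (cases "r = 0")
    case False
    hence r: "r > 0" using r by simp
    have "(\<lambda>i. exp (- z * of_real r) * exp (of_real \<gamma> * Complex (ln r) \<tau>) * ((h * Complex (ln r) \<tau>) ^ i /\<^sub>R fact i)) sums
      (exp (- z * of_real r) * exp (of_real \<gamma> * Complex (ln r) \<tau>) * exp (h * Complex (ln r) \<tau>))"
      by (intro sums_mult exp_converges)
    also have "exp (- z * of_real r) * exp (of_real \<gamma> * Complex (ln r) \<tau>) * exp (h * Complex (ln r) \<tau>) = g r"
      using r by (simp add: g_def pterm_def distrib_right exp_add mult.assoc)
    finally show ?thesis unfolding sums_def f_def tr[OF r] .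
  qed (simp add: f_def g_def pterm_def)
  have "(\<lambda>n. integral {0..} (f n)) \<longlonglongrightarrow> integral {0..} g"
    by (rule dominated_convergence(2)[OF fi Di bd lim])
  moreover have "integral {0..} (f n) = (\<Sum>i<n. lap (pterm \<tau> (of_real \<gamma>) i) z / fact i * h ^ i)" for n
  proof -
    have "integral {0..} (f n) = (\<Sum>i<n. integral {0..} (\<lambda>r. h ^ i / fact i * (exp (- z * of_real r) * pterm \<tau> (of_real \<gamma>) i r)))"
      unfolding f_def by (intro integral_sum integrable_on_mult_right lap_integrable[OF pg z]) auto
    also have "\<dots> = (\<Sum>i<n. lap (pterm \<tau> (of_real \<gamma>) i) z / fact i * h ^ i)"
      by (simp only: integral_mult_right) (simp add: lap_def mult_ac)
    finally show ?thesis .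
  qed
  ultimately show ?thesis unfolding sums_def lap_def[of "pterm \<tau> (of_real \<gamma> + h) 0"] g_def[symmetric] by simp
qed

text \<open>As a function of h the transform of r^(\<gamma> + h) is, up to a constant,
  Gamma(\<gamma> + 1 + h) * exp(-\<Lambda> * h), so its Taylor coefficients are a Cauchy product of
  those of Gamma and of an exponential. The factor \<open>exp (\<i> * \<tau>)\<close> is the one
  from dy = cis \<tau> dr on the ray y = r * cis \<tau>.\<close>

lemma lap_pterm:
  fixes \<gamma> \<tau> :: real and z :: complex
  assumes \<gamma>: "\<gamma> > 0" and z: "Re z > 0"
  defines "\<Lambda> \<equiv> Ln z - \<i> * of_real \<tau>"
  shows "exp (\<i> * of_real \<tau>) * lap (pterm \<tau> (of_real \<gamma>) i) z = fact i * exp (- (of_real \<gamma> + 1) * \<Lambda>) *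
    (\<Sum>j\<le>i. (deriv ^^ j) Gamma (of_real \<gamma> + 1) / fact j * ((- \<Lambda>) ^ (i - j) / fact (i - j)))"
proof -
  define F where "F = Abs_fps (\<lambda>i. lap (pterm \<tau> (of_real \<gamma>) i) z / fact i)"
  have F: "(\<lambda>h. lap (pterm \<tau> (of_real \<gamma> + h) 0) z) has_fps_expansion F"
  proof (rule has_fps_expansionI)
    have "eventually (\<lambda>h::complex. norm h < \<gamma>) (nhds 0)"
      by (rule eventually_mono[OF eventually_nhds_in_open[of "ball 0 \<gamma>"]]) (use \<gamma> in auto)
    thus "\<forall>\<^sub>F h in nhds 0. (\<lambda>n. fps_nth F n * h ^ n) sums lap (pterm \<tau> (of_real \<gamma> + h) 0) z"
      by eventually_elim (use lap_pterm_sums[OF \<gamma> z] in \<open>simp add: F_def\<close>)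
  qed
  have an: "Gamma analytic_on {complex_of_real \<gamma> + 1}"
  proof -
    have "complex_of_real (\<gamma> + 1) \<notin> \<int>\<^sub>\<le>\<^sub>0"
      unfolding of_real_in_nonpos_Ints_iff using \<gamma> by auto
    thus ?thesis by (intro analytic_intros) simp
  qed
  define G where "G = fps_expansion Gamma (complex_of_real \<gamma> + 1)"
  have G: "(\<lambda>h. Gamma (of_real \<gamma> + 1 + h)) has_fps_expansion G"
    unfolding G_def by (rule analytic_at_imp_has_fps_expansion[OF an])
  define Q where "Q = fps_const (exp (- (of_real \<gamma> + 1) * \<Lambda>) * exp (- \<i> * of_real \<tau>)) * (G * fps_exp (- \<Lambda>))"
  have Q: "(\<lambda>h. (exp (- (of_real \<gamma> + 1) * \<Lambda>) * exp (- \<i> * of_real \<tau>)) * (Gamma (of_real \<gamma> + 1 + h) * exp (- \<Lambda> * h))) has_fps_expansion Q"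
    unfolding Q_def by (intro fps_expansion_intros G)
  have "eventually (\<lambda>h. lap (pterm \<tau> (of_real \<gamma> + h) 0) z =
      (exp (- (of_real \<gamma> + 1) * \<Lambda>) * exp (- \<i> * of_real \<tau>)) * (Gamma (of_real \<gamma> + 1 + h) * exp (- \<Lambda> * h))) (nhds 0)"
  proof (rule eventually_mono[OF eventually_nhds_in_open[of "ball 0 \<gamma>"]])
    fix h :: complex assume "h \<in> ball 0 \<gamma>"
    hence "Re (of_real \<gamma> + h) > 0" using abs_Re_le_cmod[of h] by simp
    from lap_pterm_0[OF this z, of \<tau>] have "lap (pterm \<tau> (of_real \<gamma> + h) 0) z =
      (exp (\<i> * of_real \<tau> * (of_real \<gamma> + h)) * exp (- (of_real \<gamma> + h + 1) * Ln z)) * Gamma (of_real \<gamma> + 1 + h)"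
      by (simp add: add_ac mult_ac)
    also have "exp (\<i> * of_real \<tau> * (of_real \<gamma> + h)) * exp (- (of_real \<gamma> + h + 1) * Ln z) =
      exp (- (of_real \<gamma> + 1) * \<Lambda>) * exp (- \<i> * of_real \<tau>) * exp (- \<Lambda> * h)"
      unfolding exp_add[symmetric] \<Lambda>_def by (simp add: algebra_simps)
    finally show "lap (pterm \<tau> (of_real \<gamma> + h) 0) z =
      (exp (- (of_real \<gamma> + 1) * \<Lambda>) * exp (- \<i> * of_real \<tau>)) * (Gamma (of_real \<gamma> + 1 + h) * exp (- \<Lambda> * h))"
      by (simp add: mult_ac)
  qed (use \<gamma> in auto)
  from fps_expansion_unique_complex[OF F iffD2[OF has_fps_expansion_cong[OF this refl] Q]] have "F = Q" .
  hence "fps_nth F i = fps_nth Q i" by simp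
  hence d: "lap (pterm \<tau> (of_real \<gamma>) i) z / fact i = exp (- (of_real \<gamma> + 1) * \<Lambda>) * exp (- \<i> * of_real \<tau>) *
    (\<Sum>j\<le>i. (deriv ^^ j) Gamma (of_real \<gamma> + 1) / fact j * ((- \<Lambda>) ^ (i - j) / fact (i - j)))"
    unfolding Q_def fps_mult_left_const_nth fps_mult_nth[of G]
    by (simp add: F_def G_def fps_expansion_def atLeast0AtMost)
  have "lap (pterm \<tau> (of_real \<gamma>) i) z = fact i * (lap (pterm \<tau> (of_real \<gamma>) i) z / fact i)" by simp
  hence eq: "lap (pterm \<tau> (of_real \<gamma>) i) z = fact i * (exp (- (of_real \<gamma> + 1) * \<Lambda>) * exp (- \<i> * of_real \<tau>) *
    (\<Sum>j\<le>i. (deriv ^^ j) Gamma (of_real \<gamma> + 1) / fact j * ((- \<Lambda>) ^ (i - j) / fact (i - j))))"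
    unfolding d .
  have PQ: "exp (\<i> * of_real \<tau>) * exp (- \<i> * of_real \<tau>) = (1::complex)" by (simp add: exp_add[symmetric])
  have "exp (\<i> * of_real \<tau>) * lap (pterm \<tau> (of_real \<gamma>) i) z = fact i * exp (- (of_real \<gamma> + 1) * \<Lambda>) *
    (\<Sum>j\<le>i. (deriv ^^ j) Gamma (of_real \<gamma> + 1) / fact j * ((- \<Lambda>) ^ (i - j) / fact (i - j))) *
    (exp (\<i> * of_real \<tau>) * exp (- \<i> * of_real \<tau>))"
    unfolding eq by (simp only: mult_ac)
  thus ?thesis by (simp only: PQ mult_1_right)
qed

section \<open>Watson's lemma for exponents in a lattice\<close>

lemma pterm_lattice_bound:
  assumes q: "q > 0"
  shows "\<exists>C\<ge>1. (\<forall>i<I. \<forall>r>0. r powr (1 / real q) * (\<bar>ln r\<bar> + \<bar>\<tau>\<bar>) ^ i \<le> C * (1 + r) ^ (i + 1)) \<and>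
     (\<forall>i<I. \<forall>k\<ge>1. \<forall>r\<ge>0. norm (pterm \<tau> (of_real (real k / real q)) i r) \<le> C * r ^ (k div q - 1) * (1 + r) ^ (I + 3))"
proof -
  have "\<exists>C\<ge>1. \<forall>r>0. r powr (1 / real q) * (\<bar>ln r\<bar> + \<bar>\<tau>\<bar>) ^ i \<le> C * (1 + r) ^ (i + 1)" for i
    by (rule log_power_bound) (use q in auto)
  then obtain Ci where Ci: "\<And>i. Ci i \<ge> 1" "\<And>i r. r > 0 \<Longrightarrow> r powr (1 / real q) * (\<bar>ln r\<bar> + \<bar>\<tau>\<bar>) ^ i \<le> Ci i * (1 + r) ^ (i + 1)"
    by metis
  define C where "C = 1 + (\<Sum>i<I. Ci i)"
  have CiC: "Ci i \<le> C" if "i < I" for i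
    unfolding C_def using member_le_sum[of i "{..<I}" Ci] that Ci(1) by (simp add: order_trans[OF zero_le_one])
  have C1: "C \<ge> 1" unfolding C_def using Ci(1) by (simp add: sum_nonneg order_trans[OF zero_le_one])
  have b1: "r powr (1 / real q) * (\<bar>ln r\<bar> + \<bar>\<tau>\<bar>) ^ i \<le> C * (1 + r) ^ (i + 1)" if "i < I" "r > 0" for i r
  proof -
    have "Ci i * (1 + r) ^ (i + 1) \<le> C * (1 + r) ^ (i + 1)" using that CiC[OF that(1)] by (intro mult_right_mono) auto
    with Ci(2)[OF that(2), of i] show ?thesis by simp
  qed
  have b2: "norm (pterm \<tau> (of_real (real k / real q)) i r) \<le> C * r ^ (k div q - 1) * (1 + r) ^ (I + 3)"
    if i: "i < I" and k: "k \<ge> 1" and r: "r \<ge> 0" for i k r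
  proof (cases "r = 0")
    case True
    thus ?thesis using C1 by (simp add: pterm_def)
  next
    case False
    hence r: "r > 0" using r by simp
    \<comment> \<open>The exponent \<open>k / q\<close> is split into \<open>1 / q\<close>, which
      pays for the logarithms, the integer \<open>m\<close>, and a rest \<open>e\<close>. Natural
      subtraction gives \<open>m = 0\<close> for \<open>k < q\<close>; in all cases \<open>e\<close>
      lies between 0 and 2, which makes the bound uniform in \<open>k\<close>.\<close>
    define m where "m = k div q - 1"
    define e where "e = real k / real q - 1 / real q - real m"
    have "real (k div q) \<le> real k / real q" "real k / real q < real (k div q) + 1"
    proof -
      have "real (k div q * q) \<le> real k" by (intro of_nat_mono div_times_less_eq_dividend)
      thus "real (k div q) \<le> real k / real q" using q by (simp add: pos_le_divide_eq)
      have "real k < real ((k div q + 1) * q)" using q by (intro of_nat_less_iff[THEN iffD2]) (metis Suc_eq_plus1 dividend_less_times_div mult.commute mult_Suc_right add.commute)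
      thus "real k / real q < real (k div q) + 1" using q by (simp add: pos_divide_less_eq algebra_simps)
    qed
    moreover have "0 < 1 / real q" "1 / real q \<le> 1" "1 / real q \<le> real k / real q"
      using q k by (auto simp: divide_right_mono)
    moreover have "real m = 0 \<and> real (k div q) = 0 \<or> real m = real (k div q) - 1" unfolding m_def by (cases "k div q = 0") (auto simp: of_nat_diff Suc_le_eq)
    ultimately have e: "0 \<le> e" "e \<le> 2" unfolding e_def by argo+
    have "norm (pterm \<tau> (of_real (real k / real q)) i r) \<le> r powr (real k / real q) * (\<bar>ln r\<bar> + \<bar>\<tau>\<bar>) ^ i"
      using norm_pterm_le[OF r, of \<tau> "of_real (real k / real q)" i] by (simp del: of_real_divide)
    also have "r powr (real k / real q) = r powr (1 / real q) * (r powr real m * r powr e)"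
      unfolding powr_add[symmetric] by (simp add: e_def)
    also have "r powr real m = r ^ m" using r by (rule powr_realpow)
    also have "r powr (1 / real q) * (r ^ m * r powr e) * (\<bar>ln r\<bar> + \<bar>\<tau>\<bar>) ^ i = (r powr (1 / real q) * (\<bar>ln r\<bar> + \<bar>\<tau>\<bar>) ^ i) * (r ^ m * r powr e)"
      by (simp only: mult_ac)
    also have "\<dots> \<le> (C * (1 + r) ^ (i + 1)) * (r ^ m * (1 + r) ^ 2)"
    proof (rule mult_mono[OF b1[OF i r] mult_left_mono])
      have "r powr e \<le> (1 + r) powr e" using r e by (intro powr_mono2) auto
      also have "\<dots> \<le> (1 + r) powr real 2" using r e by (intro powr_mono) auto
      also have "\<dots> = (1 + r) ^ 2" using r by (intro powr_realpow) auto
      finally show "r powr e \<le> (1 + r) ^ 2" .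
    qed (use r C1 in auto)
    also have "\<dots> = C * r ^ m * (1 + r) ^ (i + 3)" by (simp add: power_add mult_ac power2_eq_square power3_eq_cube)
    also have "\<dots> \<le> C * r ^ m * (1 + r) ^ (I + 3)"
      using r i C1 by (intro mult_left_mono power_increasing) auto
    finally show ?thesis unfolding m_def .
  qed
  from C1 b1 b2 show ?thesis by blast
qed

lemma poly_growth_lattice_sum:
  assumes q: "q > 0"
  shows "poly_growth (\<lambda>r. \<Sum>i<I. \<Sum>k\<in>{1..<n}. c i k * pterm \<tau> (of_real (real k / real q)) i r)"
  by (intro poly_growth_sum poly_growth_cmult poly_growth_pterm) (use q in \<open>auto simp del: of_real_divide\<close>)

lemma lap_lattice_sum:
  assumes q: "q > 0" and c0: "\<And>i. c i 0 = 0" and z: "Re z > 0"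
  shows "lap (\<lambda>r. \<Sum>i<I. \<Sum>k\<in>{1..<n}. c i k * pterm \<tau> (of_real (real k / real q)) i r) z =
    (\<Sum>i<I. \<Sum>k<n. c i k * lap (pterm \<tau> (of_real (real k / real q)) i) z)"
proof -
  have pg: "poly_growth (\<lambda>r. c i k * pterm \<tau> (of_real (real k / real q)) i r)" if "k \<ge> 1" for i k
    by (intro poly_growth_cmult poly_growth_pterm) (use q that in \<open>auto simp del: of_real_divide\<close>)
  have "lap (\<lambda>r. \<Sum>i<I. \<Sum>k\<in>{1..<n}. c i k * pterm \<tau> (of_real (real k / real q)) i r) z =
    (\<Sum>i<I. \<Sum>k\<in>{1..<n}. lap (\<lambda>r. c i k * pterm \<tau> (of_real (real k / real q)) i r) z)"
    using z by (subst lap_sum) (auto intro!: sum.cong lap_sum poly_growth_sum pg simp del: of_real_divide)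
  also have "\<dots> = (\<Sum>i<I. \<Sum>k\<in>{1..<n}. c i k * lap (pterm \<tau> (of_real (real k / real q)) i) z)"
    by (simp only: lap_cmult)
  also have "\<dots> = (\<Sum>i<I. \<Sum>k<n. c i k * lap (pterm \<tau> (of_real (real k / real q)) i) z)"
  proof (rule sum.cong[OF refl])
    fix i assume "i \<in> {..<I}"
    show "(\<Sum>k\<in>{1..<n}. c i k * lap (pterm \<tau> (of_real (real k / real q)) i) z) = (\<Sum>k<n. c i k * lap (pterm \<tau> (of_real (real k / real q)) i) z)"
      by (rule sum.mono_neutral_left) (auto simp: c0 Suc_le_eq)
  qed
  finally show ?thesis .
qed

text \<open>For \<open>r \<le> r0\<close> the remainder is the tail of a geometric series; for
  \<open>r > r0\<close> function and partial sum are estimated separately, with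
  \<open>(r / r0) ^ (N - 1) \<ge> 1\<close> to spare. The power is \<open>N - 1\<close> and not
  \<open>N\<close> because part of the exponent is spent on logarithms; nothing is lost, as the
  Laplace transform of \<open>r ^ (N - 1)\<close> has the size of
  \<open>fact (N - 1) * norm z powr (- N)\<close>.\<close>

lemma watson_remainder:
  assumes q: "q > 0" and pg: "poly_growth \<psi>" and \<psi>0: "\<psi> 0 = 0"
    and c0: "\<And>i. c i 0 = 0" and c: "\<And>i k. norm (c i k) \<le> D * A ^ k" and D: "D \<ge> 0" and A: "A \<ge> 1"
    and r0: "0 < r0" "r0 < 1" "A * r0 powr (1 / real q) \<le> 1 / 2"
    and expand: "\<And>r. 0 < r \<Longrightarrow> r \<le> r0 \<Longrightarrow> \<psi> r = (\<Sum>i<I. \<Sum>k. c i k * pterm \<tau> (of_real (real k / real q)) i r)"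
  shows "\<exists>E\<ge>0. \<exists>A1\<ge>1. \<exists>K. \<forall>N\<ge>1. \<forall>r\<ge>0.
    norm (\<psi> r - (\<Sum>i<I. \<Sum>k\<in>{1..<q * N}. c i k * pterm \<tau> (of_real (real k / real q)) i r)) \<le> E * A1 ^ N * r ^ (N - 1) * (1 + r) ^ K"
proof -
  obtain Cb where Cb: "Cb \<ge> 1" "\<And>i r. i < I \<Longrightarrow> r > 0 \<Longrightarrow> r powr (1 / real q) * (\<bar>ln r\<bar> + \<bar>\<tau>\<bar>) ^ i \<le> Cb * (1 + r) ^ (i + 1)"
    "\<And>i k r. i < I \<Longrightarrow> k \<ge> 1 \<Longrightarrow> r \<ge> 0 \<Longrightarrow> norm (pterm \<tau> (of_real (real k / real q)) i r) \<le> Cb * r ^ (k div q - 1) * (1 + r) ^ (I + 3)"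
    using pterm_lattice_bound[OF q, of I \<tau>] by metis
  obtain C2 K2 where C2: "C2 \<ge> 0" "\<And>r. r \<ge> 0 \<Longrightarrow> norm (\<psi> r) \<le> C2 * (1 + r) ^ K2"
    using pg unfolding poly_growth_def by blast
  define E where "E = C2 + real I * (real q * D * Cb) + real I * (D * Cb * 2 ^ (I + 1) * A * 2)"
  \<comment> \<open>\<open>A ^ q\<close> is the growth of the coefficients over one unit of the
    exponent, \<open>1 / r0\<close> comes from large \<open>r\<close>, and \<open>2 ^ N\<close>
    absorbs the factor \<open>N\<close> in the number \<open>q * N\<close> of terms.\<close>
  define A1 where "A1 = 2 * A ^ q / r0"
  define K where "K = K2 + I + 3"
  have Aq: "A ^ q \<ge> 1" using A by (rule one_le_power)
  have A1: "A1 \<ge> 1" using Aq r0 by (simp add: A1_def field_simps)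
  have E0: "E \<ge> 0" unfolding E_def using C2(1) D Cb(1) A by (intro add_nonneg_nonneg mult_nonneg_nonneg) auto
  have "norm (\<psi> r - (\<Sum>i<I. \<Sum>k\<in>{1..<q * N}. c i k * pterm \<tau> (of_real (real k / real q)) i r)) \<le> E * A1 ^ N * r ^ (N - 1) * (1 + r) ^ K"
    if N: "N \<ge> 1" and r: "r \<ge> 0" for N r
  proof -
    define t where "t = (\<lambda>i k. c i k * pterm \<tau> (of_real (real k / real q)) i r)"
    have t0: "t i 0 = 0" for i by (simp add: t_def c0)
    have sum1: "(\<Sum>k\<in>{1..<q * N}. t i k) = (\<Sum>k<q * N. t i k)" for i
      by (rule sum.mono_neutral_left) (auto simp: t0 Suc_le_eq)
    have AqN: "A ^ (q * N) * (1 / r0) ^ (N - 1) * real N \<le> A1 ^ N"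
    proof -
      have "(1 / r0) ^ (N - 1) \<le> (1 / r0) ^ N" using r0 by (intro power_increasing) auto
      moreover have "real N \<le> 2 ^ N" using of_nat_less_two_power[of N, where 'a = real] by simp
      ultimately have "A ^ (q * N) * (1 / r0) ^ (N - 1) * real N \<le> A ^ (q * N) * (1 / r0) ^ N * 2 ^ N"
        using A r0 by (intro mult_mono) auto
      also have "\<dots> = A1 ^ N" by (simp add: A1_def power_mult power_mult_distrib power_divide)
      finally show ?thesis .
    qed
    consider "r = 0" | "0 < r" "r \<le> r0" | "r > r0" using r by linarith
    thus ?thesis
    proof cases
      case 1
      thus ?thesis using \<psi>0 E0 A1 by (simp add: pterm_def)
    next
      case 2
      \<comment> \<open>The ratio of the geometric tail. Of the \<open>k\<close> factors
        \<open>r powr (1 / q)\<close> one is reserved for the logarithms, which leaves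
        \<open>u ^ (k - 1)\<close>.\<close>
      define u where "u = A * r powr (1 / real q)"
      have u: "0 \<le> u" "u \<le> 1 / 2"
      proof -
        have "A * r powr (1 / real q) \<le> A * r0 powr (1 / real q)" using 2 A q by (intro mult_left_mono powr_mono2) auto
        thus "u \<le> 1 / 2" using r0(3) by (simp add: u_def)
      qed (use A in \<open>auto simp: u_def\<close>)
      define B where "B = D * Cb * 2 ^ (I + 1) * A * (A ^ (q * N) * r ^ (N - 1))"
      have tail: "norm (t i (n + q * N)) \<le> B * (1 / 2) ^ n" if i: "i < I" for i n
      proof -
        define k where "k = n + q * N"
        have qN: "q * N \<ge> 1" using q N by (simp add: Suc_le_eq)
        hence k: "k \<ge> 1" "k - 1 = n + (q * N - 1)" "q * N \<ge> 1" unfolding k_def by linarith+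
        have "norm (t i k) \<le> (D * A ^ k) * (r powr (real k / real q) * (\<bar>ln r\<bar> + \<bar>\<tau>\<bar>) ^ i)"
          unfolding t_def norm_mult using norm_pterm_le[OF 2(1), of \<tau> "of_real (real k / real q)" i] D A
          by (intro mult_mono c) (auto simp del: of_real_divide)
        also have "r powr (real k / real q) = r powr (1 / real q) * (r powr (1 / real q)) ^ (k - 1)"
        proof -
          have "r powr (1 / real q) * (r powr (1 / real q)) ^ (k - 1) = (r powr (1 / real q)) ^ Suc (k - 1)" by simp
          also have "\<dots> = r powr (real k / real q)" using 2 k(1) by (simp add: powr_power mult.commute Suc_diff_le del: power_Suc)
          finally show ?thesis ..
        qed
        also have "D * A ^ k * (r powr (1 / real q) * (r powr (1 / real q)) ^ (k - 1) * (\<bar>ln r\<bar> + \<bar>\<tau>\<bar>) ^ i) =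
            (D * A * (r powr (1 / real q) * (\<bar>ln r\<bar> + \<bar>\<tau>\<bar>) ^ i)) * u ^ (k - 1)"
        proof -
          have "A ^ k = A * A ^ (k - 1)" using k by (simp add: power_eq_if)
          thus ?thesis by (simp add: u_def power_mult_distrib mult_ac)
        qed
        also have "\<dots> \<le> (D * A * (Cb * 2 ^ (I + 1))) * ((1 / 2) ^ n * (A ^ (q * N) * r ^ (N - 1)))"
        proof (rule mult_mono[OF mult_left_mono])
          have "r powr (1 / real q) * (\<bar>ln r\<bar> + \<bar>\<tau>\<bar>) ^ i \<le> Cb * (1 + r) ^ (i + 1)" by (rule Cb(2)[OF i 2(1)])
          also have "\<dots> \<le> Cb * 2 ^ (i + 1)" using 2 r0 Cb(1) by (intro mult_left_mono power_mono) auto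
          also have "\<dots> \<le> Cb * 2 ^ (I + 1)" using i Cb(1) by (intro mult_left_mono power_increasing) auto
          finally show "r powr (1 / real q) * (\<bar>ln r\<bar> + \<bar>\<tau>\<bar>) ^ i \<le> Cb * 2 ^ (I + 1)" .
          have "u ^ (k - 1) = u ^ n * u ^ (q * N - 1)" unfolding k(2) by (rule power_add)
          also have "\<dots> \<le> (1 / 2) ^ n * (A ^ (q * N) * r ^ (N - 1))"
          proof (intro mult_mono power_mono u)
            have "u ^ (q * N - 1) = A ^ (q * N - 1) * (r powr (1 / real q)) ^ (q * N - 1)" by (simp add: u_def power_mult_distrib)
            also have "(r powr (1 / real q)) ^ (q * N - 1) = r powr (real (q * N - 1) / real q)" using 2 by (simp add: powr_power mult.commute)
            also have "\<dots> \<le> r powr real (N - 1)"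
            proof (rule powr_mono')
              have "real (N - 1) * real q \<le> real (q * N - 1)"
              proof -
                have "(N - 1) * q = q * N - q" using diff_mult_distrib[of N 1 q] by (simp add: mult.commute[of q])
                also have "\<dots> \<le> q * N - 1" using q by simp
                finally show ?thesis by (metis of_nat_le_iff of_nat_mult)
              qed
              thus "real (N - 1) \<le> real (q * N - 1) / real q" using q by (simp add: pos_le_divide_eq)
            qed (use 2 r0 in auto)
            also have "\<dots> = r ^ (N - 1)" using 2 by (intro powr_realpow)
            finally have "u ^ (q * N - 1) \<le> A ^ (q * N - 1) * r ^ (N - 1)" using A by simp
            also have "\<dots> \<le> A ^ (q * N) * r ^ (N - 1)" using A 2 by (intro mult_right_mono power_increasing) auto
            finally show "u ^ (q * N - 1) \<le> A ^ (q * N) * r ^ (N - 1)" .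
          qed (use u in auto)
          finally show "u ^ (k - 1) \<le> (1 / 2) ^ n * (A ^ (q * N) * r ^ (N - 1))" .
        qed (use D A Cb(1) u 2 in auto)
        also have "\<dots> = B * (1 / 2) ^ n" by (simp add: B_def mult_ac)
        finally show ?thesis unfolding k_def .
      qed
      have gs: "(\<lambda>n. B * (1 / 2) ^ n) sums (B * 2)"
        using sums_mult[OF geometric_sums[of "1 / 2 :: real"], of B] by simp
      have B0: "B \<ge> 0" unfolding B_def using D Cb(1) A r by auto
      have "norm (\<psi> r - (\<Sum>i<I. \<Sum>k\<in>{1..<q * N}. t i k)) \<le> (\<Sum>i<I. B * 2)"
      proof -
        have sm: "summable (\<lambda>n. t i (n + q * N))" if "i < I" for i
          by (rule summable_comparison_test'[OF sums_summable[OF gs], of 0]) (use tail[OF that] in auto)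
        have "(\<Sum>k. t i k) - (\<Sum>k<q * N. t i k) = (\<Sum>n. t i (n + q * N))" if "i < I" for i
          using suminf_split_initial_segment[of "t i" "q * N"] sm[OF that] summable_iff_shift[of "t i" "q * N"] by simp
        moreover have "\<psi> r = (\<Sum>i<I. \<Sum>k. t i k)" unfolding t_def by (rule expand[OF 2])
        ultimately have "\<psi> r - (\<Sum>i<I. \<Sum>k\<in>{1..<q * N}. t i k) = (\<Sum>i<I. \<Sum>n. t i (n + q * N))"
          by (simp add: sum1 sum_subtractf[symmetric] del: One_nat_def)
        also have "norm \<dots> \<le> (\<Sum>i<I. B * 2)"
        proof (rule sum_norm_le)
          fix i assume "i \<in> {..<I}"
          hence i: "i < I" by simp
          have "norm (\<Sum>n. t i (n + q * N)) \<le> (\<Sum>n. B * (1 / 2) ^ n)"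
            by (rule norm_suminf_le[OF tail[OF i] sums_summable[OF gs]])
          thus "norm (\<Sum>n. t i (n + q * N)) \<le> B * 2" using gs by (simp add: sums_iff)
        qed
        finally show ?thesis .
      qed
      also have "\<dots> = real I * (D * Cb * 2 ^ (I + 1) * A * 2) * A ^ (q * N) * r ^ (N - 1)" by (simp add: B_def)
      also have "\<dots> \<le> E * A1 ^ N * r ^ (N - 1)"
      proof (intro mult_mono mult_right_mono)
        show "real I * (D * Cb * 2 ^ (I + 1) * A * 2) \<le> E" unfolding E_def using C2(1) D Cb(1) by simp
        have "A ^ (q * N) * 1 * 1 \<le> A ^ (q * N) * (1 / r0) ^ (N - 1) * real N"
          using A r0 N by (intro mult_mono one_le_power) auto
        thus "A ^ (q * N) \<le> A1 ^ N" using AqN by simp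
      qed (use E0 A A1 r in auto)
      also have "\<dots> \<le> E * A1 ^ N * r ^ (N - 1) * (1 + r) ^ K"
        using E0 A1 r mult_left_mono[of 1 "(1 + r) ^ K" "E * A1 ^ N * r ^ (N - 1)"] one_le_power[of "1 + r" K] by simp
      finally show ?thesis unfolding t_def .
    next
      case 3
      have rr: "(r / r0) ^ m \<le> (r / r0) ^ (N - 1)" if "m \<le> N - 1" for m
        using 3 r0 that by (intro power_increasing) auto
      have "norm (\<psi> r - (\<Sum>i<I. \<Sum>k\<in>{1..<q * N}. t i k)) \<le> norm (\<psi> r) + norm (\<Sum>i<I. \<Sum>k\<in>{1..<q * N}. t i k)"
        by (rule norm_triangle_ineq4)
      also have "norm (\<psi> r) \<le> C2 * (r / r0) ^ (N - 1) * (1 + r) ^ K"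
      proof -
        have "norm (\<psi> r) \<le> C2 * 1 * (1 + r) ^ K2" using C2(2)[OF r] by simp
        also have "\<dots> \<le> C2 * (r / r0) ^ (N - 1) * (1 + r) ^ K"
          using rr[of 0] C2(1) r by (intro mult_mono mult_left_mono power_increasing) (auto simp: K_def)
        finally show ?thesis .
      qed
      also have "norm (\<Sum>i<I. \<Sum>k\<in>{1..<q * N}. t i k) \<le> (\<Sum>i<I. \<Sum>k\<in>{1..<q * N}. D * A ^ (q * N) * (Cb * (r / r0) ^ (N - 1) * (1 + r) ^ K))"
      proof (intro sum_norm_le)
        fix i k assume ik: "i \<in> {..<I}" "k \<in> {1..<q * N}"
        have "k div q < N" using ik q by (simp add: div_less_iff_less_mult mult.commute)
        hence m: "k div q - 1 \<le> N - 1" by simp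
        have "r ^ (k div q - 1) \<le> (r / r0) ^ (k div q - 1)" using r0 r mult_right_mono[of r0 1 r] by (intro power_mono) (auto simp: field_simps)
        also have "\<dots> \<le> (r / r0) ^ (N - 1)" by (rule rr[OF m])
        finally have p: "r ^ (k div q - 1) \<le> (r / r0) ^ (N - 1)" .
        have "norm (t i k) \<le> (D * A ^ k) * (Cb * r ^ (k div q - 1) * (1 + r) ^ (I + 3))"
          unfolding t_def norm_mult using Cb(3)[of i k r] ik r D A by (intro mult_mono c) auto
        also have "\<dots> \<le> (D * A ^ (q * N)) * (Cb * (r / r0) ^ (N - 1) * (1 + r) ^ K)"
          using ik p D A Cb(1) r r0 by (intro mult_mono mult_left_mono power_increasing) (auto simp: K_def)
        finally show "norm (t i k) \<le> D * A ^ (q * N) * (Cb * (r / r0) ^ (N - 1) * (1 + r) ^ K)" .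
      qed
      also have "(\<Sum>i<I. \<Sum>k\<in>{1..<q * N}. D * A ^ (q * N) * (Cb * (r / r0) ^ (N - 1) * (1 + r) ^ K)) =
          real I * real (q * N - 1) * (D * A ^ (q * N) * (Cb * (r / r0) ^ (N - 1) * (1 + r) ^ K))" by simp
      also have "\<dots> \<le> real I * real (q * N) * (D * A ^ (q * N) * (Cb * (r / r0) ^ (N - 1) * (1 + r) ^ K))"
        using D A Cb(1) r r0 by (intro mult_right_mono mult_left_mono of_nat_mono) auto
      finally have "norm (\<psi> r - (\<Sum>i<I. \<Sum>k\<in>{1..<q * N}. t i k)) \<le>
        (C2 * (1 / r0) ^ (N - 1) + (real I * (real q * D * Cb)) * (A ^ (q * N) * (1 / r0) ^ (N - 1) * real N)) * (r ^ (N - 1) * (1 + r) ^ K)"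
        by (simp add: power_divide algebra_simps)
      also have "\<dots> \<le> (C2 * A1 ^ N + (real I * (real q * D * Cb)) * A1 ^ N) * (r ^ (N - 1) * (1 + r) ^ K)"
      proof (intro mult_right_mono add_mono mult_left_mono AqN)
        have "1 * (1 / r0) ^ (N - 1) * 1 \<le> A ^ (q * N) * (1 / r0) ^ (N - 1) * real N"
          using A r0 N by (intro mult_mono one_le_power) auto
        thus "(1 / r0) ^ (N - 1) \<le> A1 ^ N" using AqN by simp
      qed (use C2(1) D Cb(1) r in auto)
      also have "\<dots> = (C2 + real I * (real q * D * Cb)) * A1 ^ N * r ^ (N - 1) * (1 + r) ^ K" by (simp add: algebra_simps)
      also have "\<dots> \<le> E * A1 ^ N * r ^ (N - 1) * (1 + r) ^ K"
        unfolding E_def using A1 r A D Cb(1) by (intro mult_right_mono) auto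
      finally show ?thesis unfolding t_def .
    qed
  qed
  with E0 A1 show ?thesis by blast
qed

text \<open>The transform is applied to the remainder with \<open>m = N - 1\<close> in
  \<open>norm_lap_le\<close>. The plain bound on \<open>lap \<psi> z\<close> is recorded as the case
  of an empty sum, which becomes the case \<open>N = 1\<close> once all exponents are raised by
  one.\<close>

lemma watson:
  assumes q: "q > 0" and pg: "poly_growth \<psi>" and \<psi>0: "\<psi> 0 = 0"
    and c0: "\<And>i. c i 0 = 0" and c: "\<And>i k. norm (c i k) \<le> D * A ^ k" and D: "D \<ge> 0" and A: "A \<ge> 1"
    and r0: "0 < r0" "r0 < 1" "A * r0 powr (1 / real q) \<le> 1 / 2"
    and expand: "\<And>r. 0 < r \<Longrightarrow> r \<le> r0 \<Longrightarrow> \<psi> r = (\<Sum>i<I. \<Sum>k. c i k * pterm \<tau> (of_real (real k / real q)) i r)"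
    and \<delta>: "0 < \<delta>" "\<delta> \<le> 1"
  shows "\<exists>C\<ge>1. \<forall>z. Re z \<ge> \<delta> * norm z \<and> norm z \<ge> 1 \<longrightarrow> norm (lap \<psi> z) \<le> C \<and>
    (\<forall>N\<ge>1. norm (lap \<psi> z - (\<Sum>i<I. \<Sum>k<q * N. c i k * lap (pterm \<tau> (of_real (real k / real q)) i) z)) \<le> C ^ N * fact N * norm z powr (- real N))"
proof -
  have "\<exists>E\<ge>0. \<exists>A1\<ge>1. \<exists>K. \<forall>N\<ge>1. \<forall>r\<ge>0.
    norm (\<psi> r - (\<Sum>i<I. \<Sum>k\<in>{1..<q * N}. c i k * pterm \<tau> (of_real (real k / real q)) i r)) \<le> E * A1 ^ N * r ^ (N - 1) * (1 + r) ^ K"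
    by (rule watson_remainder[where c = c and \<psi> = \<psi> and D = D and A = A and ?r0.0 = r0]) (fact q pg \<psi>0 c0 c D A r0 expand)+
  then obtain E A1 K where EA: "E \<ge> 0" "A1 \<ge> 1" and EA3: "\<forall>N\<ge>1. \<forall>r\<ge>0.
    norm (\<psi> r - (\<Sum>i<I. \<Sum>k\<in>{1..<q * N}. c i k * pterm \<tau> (of_real (real k / real q)) i r)) \<le> E * A1 ^ N * r ^ (N - 1) * (1 + r) ^ K"
    by blast
  obtain C2 K2 where C2: "C2 \<ge> 0" "\<And>r. r \<ge> 0 \<Longrightarrow> norm (\<psi> r) \<le> C2 * (1 + r) ^ K2"
    using pg unfolding poly_growth_def by blast
  define H where "H = (1 + E * (fact K * (4 / \<delta>) ^ K * exp 1)) * (A1 * (4 / \<delta>))"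
  define H2 where "H2 = C2 * (fact K2 * (4 / \<delta>) ^ K2 * exp 1) * (fact 0 * (4 / \<delta>) ^ Suc 0)"
  have \<delta>4: "4 / \<delta> \<ge> 1" using \<delta> by (simp add: field_simps)
  have EK: "E * (fact K * (4 / \<delta>) ^ K * exp 1) \<ge> 0" using EA(1) \<delta> by simp
  have H0: "H \<ge> 0" unfolding H_def using EA(2) \<delta> by (intro mult_nonneg_nonneg[OF add_nonneg_nonneg[OF zero_le_one EK]]) auto
  have H20: "H2 \<ge> 0" unfolding H2_def using C2(1) \<delta> by simp
  have "norm (lap \<psi> z) \<le> 1 + H + H2 \<and> (\<forall>N\<ge>1. norm (lap \<psi> z - (\<Sum>i<I. \<Sum>k<q * N. c i k * lap (pterm \<tau> (of_real (real k / real q)) i) z))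
      \<le> (1 + H + H2) ^ N * fact N * norm z powr (- real N))" if z: "Re z \<ge> \<delta> * norm z" "norm z \<ge> 1" for z
  proof (intro conjI allI impI)
    have nz: "norm z > 0" using z(2) by linarith
    hence rz: "Re z > 0" using z(1) \<delta>(1) by (meson less_le_trans mult_pos_pos)
    have "norm (lap \<psi> z) \<le> H2 * norm z powr (- real (Suc 0))"
      unfolding H2_def by (rule norm_lap_le[OF pg C2(1) _ \<delta> z]) (use C2(2) in auto)
    also have "\<dots> \<le> H2 * 1" using z(2) H20 powr_mono[of "-1" 0 "norm z"] nz by (intro mult_left_mono) auto
    finally show "norm (lap \<psi> z) \<le> 1 + H + H2" using H0 by simp
    fix N :: nat assume N: "N \<ge> 1"
    define P where "P = (\<lambda>r. \<Sum>i<I. \<Sum>k\<in>{1..<q * N}. c i k * pterm \<tau> (of_real (real k / real q)) i r)"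
    have pgP: "poly_growth P" unfolding P_def by (rule poly_growth_lattice_sum[OF q])
    have pgR: "poly_growth (\<lambda>r. \<psi> r + (- 1) * P r)" by (intro poly_growth_add poly_growth_cmult pg pgP)
    have "lap \<psi> z - (\<Sum>i<I. \<Sum>k<q * N. c i k * lap (pterm \<tau> (of_real (real k / real q)) i) z) = lap (\<lambda>r. \<psi> r + (- 1) * P r) z"
      using lap_add[OF pg poly_growth_cmult[OF pgP, of "-1"] rz] lap_cmult[of "-1" P z]
        lap_lattice_sum[where c = c and I = I and n = "q * N" and \<tau> = \<tau>, OF q c0 rz, folded P_def] by simp
    also have "norm \<dots> \<le> (E * A1 ^ N) * (fact K * (4 / \<delta>) ^ K * exp 1) * (fact (N - 1) * (4 / \<delta>) ^ Suc (N - 1)) * norm z powr (- real (Suc (N - 1)))"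
      by (rule norm_lap_le[OF pgR _ _ \<delta> z]) (use EA EA3 N in \<open>auto simp: P_def\<close>)
    also have "\<dots> = (E * (fact K * (4 / \<delta>) ^ K * exp 1)) * (A1 * (4 / \<delta>)) ^ N * fact (N - 1) * norm z powr (- real N)"
    proof -
      have SN: "Suc (N - 1) = N" using N by simp
      show ?thesis unfolding power_mult_distrib[of A1] SN by (simp only: mult_ac)
    qed
    also have "\<dots> \<le> (1 + E * (fact K * (4 / \<delta>) ^ K * exp 1)) ^ N * (A1 * (4 / \<delta>)) ^ N * fact N * norm z powr (- real N)"
    proof (intro mult_mono mult_right_mono)
      have "E * (fact K * (4 / \<delta>) ^ K * exp 1) \<le> (1 + E * (fact K * (4 / \<delta>) ^ K * exp 1)) ^ 1" by simp
      also have "\<dots> \<le> (1 + E * (fact K * (4 / \<delta>) ^ K * exp 1)) ^ N" using EK N by (intro power_increasing) auto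
      finally show "E * (fact K * (4 / \<delta>) ^ K * exp 1) \<le> (1 + E * (fact K * (4 / \<delta>) ^ K * exp 1)) ^ N" .
      show "fact (N - 1) \<le> (fact N :: real)" by (intro fact_mono) auto
    qed (use EK EA(2) \<delta> in auto)
    also have "\<dots> = H ^ N * fact N * norm z powr (- real N)" unfolding H_def power_mult_distrib by (simp only: mult_ac)
    also have "\<dots> \<le> (1 + H + H2) ^ N * fact N * norm z powr (- real N)"
      using H0 H20 by (intro mult_right_mono power_mono) auto
    finally show "norm (lap \<psi> z - (\<Sum>i<I. \<Sum>k<q * N. c i k * lap (pterm \<tau> (of_real (real k / real q)) i) z))
      \<le> (1 + H + H2) ^ N * fact N * norm z powr (- real N)" .
  qed
  thus ?thesis using H0 H20 by (intro exI[of _ "1 + H + H2"]) auto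
qed

section \<open>Return to the variable x: determinations of the logarithm\<close>

definition branch_coeff :: "real \<Rightarrow> nat \<Rightarrow> nat \<Rightarrow> nat \<Rightarrow> nat \<Rightarrow> complex" where
  "branch_coeff \<omega> q i k l = fact i * exp (\<i> * of_real \<omega> * (of_real (real k / real q) + 1)) *
     (\<Sum>j\<le>i. (deriv ^^ j) Gamma (of_real (real k / real q) + 1) *
       (of_nat ((i - j) choose l) * (\<i> * of_real \<omega>) ^ (i - j - l) / (fact j * fact (i - j))))"

text \<open>For these \<omega> the exponential is a root of unity and \<open>\<i> * \<omega>\<close>
  is 0 or plus or minus \<open>\<i> * \<pi>\<close>; the rest consists of rational numbers and
  derivatives of Gamma at rational points to the right of the poles.\<close>

lemma branch_coeff_in_H_ring:
  assumes \<omega>: "\<omega> \<in> {0, pi, - pi}"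
  shows "branch_coeff \<omega> q i k l \<in> H_ring"
proof -
  have r: "of_real (real k / real q) + 1 \<in> (\<rat> :: complex set)" by (simp add: Rats_add Rats_divide)
  have "of_real (real k / real q) + 1 \<notin> (\<int>\<^sub>\<le>\<^sub>0 :: complex set)"
  proof
    assume "of_real (real k / real q) + 1 \<in> (\<int>\<^sub>\<le>\<^sub>0 :: complex set)"
    then obtain n :: nat where "of_real (real k / real q) + 1 = (- of_nat n :: complex)" by (auto elim!: nonpos_Ints_cases')
    hence "Re (of_real (real k / real q) + 1) = - real n" by (metis Re_complex_of_real of_real_of_nat_eq uminus_complex.sel(1))
    moreover have "real k / real q \<ge> 0" by simp
    ultimately show False by (simp del: of_real_divide)
  qed
  hence G: "(deriv ^^ j) Gamma (of_real (real k / real q) + 1) \<in> H_ring" for j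
    using r by (intro H_ring_Gamma_deriv) auto
  have E: "exp (\<i> * of_real \<omega> * (of_real (real k / real q) + 1)) \<in> H_ring"
  proof -
    have "exp (\<i> * of_real pi * (of_real (real k / real q) + 1)) \<in> H_ring"
      "exp (\<i> * of_real pi * - (of_real (real k / real q) + 1)) \<in> H_ring"
      by (rule H_ring_exp_pi_Rats[OF r], rule H_ring_exp_pi_Rats[OF Rats_minus_iff[THEN iffD2, OF r]])
    moreover have "\<i> * of_real (- pi) * (of_real (real k / real q) + 1) = \<i> * of_real pi * - (of_real (real k / real q) + 1)"
      unfolding of_real_minus by (simp only: mult_minus_left mult_minus_right)
    ultimately show ?thesis using \<omega> H_ring_one by (elim insertE emptyE) (simp_all del: of_real_divide)
  qed
  have W: "\<i> * of_real \<omega> \<in> H_ring"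
    using \<omega> H_ring_mult[OF H_ring_ii H_ring_pi] H_ring_uminus[OF H_ring_mult[OF H_ring_ii H_ring_pi]] H_ring_zero by auto
  have fR: "fact n \<in> (\<rat> :: complex set)" for n using Rats_of_nat[of "fact n", where 'a = complex] by (simp only: of_nat_fact)
  have "of_nat ((i - j) choose l) * (\<i> * of_real \<omega>) ^ (i - j - l) / (fact j * fact (i - j)) \<in> H_ring" for j
  proof -
    have "of_nat ((i - j) choose l) / (fact j * fact (i - j)) \<in> (\<rat> :: complex set)"
      by (intro Rats_divide Rats_mult Rats_of_nat fR)
    from H_ring_mult[OF H_ring_Rats[OF this] H_ring_power[OF W, of "i - j - l"]] show ?thesis by (simp only: times_divide_eq_left)
  qed
  moreover have "fact i \<in> H_ring" by (intro H_ring_Rats fR)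
  ultimately show ?thesis unfolding branch_coeff_def
    by (intro H_ring_mult H_ring_sum E G)
qed

text \<open>\<open>L\<close> is the logarithm of x, and \<open>L - \<i> * \<omega>\<close> that of
  the variable of the Laplace transform after undoing the rotation by \<tau>. Expanding the powers
  of the difference by the binomial theorem sorts the result by powers of
  \<open>- L\<close>.\<close>

lemma lap_pterm_branch:
  fixes \<tau> \<omega> :: real and z L :: complex
  assumes q: "q > 0" and k: "k \<ge> 1" and i: "i < I" and z: "Re z > 0" and L: "Ln z - \<i> * of_real \<tau> = L - \<i> * of_real \<omega>"
  shows "exp (\<i> * of_real \<tau>) * lap (pterm \<tau> (of_real (real k / real q)) i) z =
    (\<Sum>l<I. branch_coeff \<omega> q i k l * (exp (- (of_real (real k / real q) + 1) * L) * (- L) ^ l))"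
proof -
  define g where "g = complex_of_real (real k / real q)"
  define W where "W = \<i> * complex_of_real \<omega>"
  define G where "G = (\<lambda>j. (deriv ^^ j) Gamma (g + 1))"
  have pw: "(- (L - W)) ^ (i - j) = (\<Sum>l<I. of_nat ((i - j) choose l) * W ^ (i - j - l) * (- L) ^ l)" if "j \<le> i" for j
  proof -
    have "(- (L - W)) ^ (i - j) = (\<Sum>l\<le>i - j. of_nat ((i - j) choose l) * (- L) ^ l * W ^ (i - j - l))"
      using binomial_ring[of "- L" W "i - j"] by simp
    also have "\<dots> = (\<Sum>l<I. of_nat ((i - j) choose l) * (- L) ^ l * W ^ (i - j - l))"
      using i by (intro sum.mono_neutral_left) auto
    finally show ?thesis by (simp only: mult_ac)
  qed
  have "exp (\<i> * of_real \<tau>) * lap (pterm \<tau> g i) z = fact i * exp (- (g + 1) * (L - W)) *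
      (\<Sum>j\<le>i. G j / fact j * ((- (L - W)) ^ (i - j) / fact (i - j)))"
    using lap_pterm[of "real k / real q" z \<tau> i] q k z unfolding L g_def W_def G_def by simp
  also have "exp (- (g + 1) * (L - W)) = exp (W * (g + 1)) * exp (- (g + 1) * L)"
    by (simp add: exp_add[symmetric] algebra_simps)
  also have "(\<Sum>j\<le>i. G j / fact j * ((- (L - W)) ^ (i - j) / fact (i - j))) =
     (\<Sum>j\<le>i. \<Sum>l<I. G j * (of_nat ((i - j) choose l) * W ^ (i - j - l) / (fact j * fact (i - j))) * (- L) ^ l)"
  proof (rule sum.cong[OF refl])
    fix j assume "j \<in> {..i}"
    hence j: "j \<le> i" by simp
    show "G j / fact j * ((- (L - W)) ^ (i - j) / fact (i - j)) =
      (\<Sum>l<I. G j * (of_nat ((i - j) choose l) * W ^ (i - j - l) / (fact j * fact (i - j))) * (- L) ^ l)"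
      unfolding pw[OF j] by (simp add: sum_distrib_left sum_divide_distrib mult_ac)
  qed
  also have "\<dots> = (\<Sum>l<I. \<Sum>j\<le>i. G j * (of_nat ((i - j) choose l) * W ^ (i - j - l) / (fact j * fact (i - j))) * (- L) ^ l)"
    by (rule sum.swap)
  finally show ?thesis unfolding branch_coeff_def g_def[symmetric] W_def[symmetric]
    by (simp add: G_def sum_distrib_left sum_distrib_right mult_ac)
qed

text \<open>At z = 1 and \<tau> = 0 the logarithm \<open>\<Lambda>\<close> vanishes, and
  \<open>lap_pterm\<close> reduces to the single term with the derivative. The derivative is thus
  itself a Laplace transform and falls under \<open>norm_lap_le\<close>.\<close>

lemma norm_Gamma_deriv_lattice_le:
  assumes q: "q > 0"
  shows "\<exists>E\<ge>0. \<forall>j<I. \<forall>k\<ge>1. norm ((deriv ^^ j) Gamma (of_real (real k / real q) + 1 :: complex)) \<le> E * 4 ^ k * fact (k div q)"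
proof -
  obtain C where C: "C \<ge> 1" "\<And>i k r. i < I \<Longrightarrow> k \<ge> 1 \<Longrightarrow> r \<ge> 0 \<Longrightarrow>
     norm (pterm 0 (of_real (real k / real q)) i r) \<le> C * r ^ (k div q - 1) * (1 + r) ^ (I + 3)"
    using pterm_lattice_bound[OF q, of I 0] by blast
  define E where "E = C * (fact (I + 3) * 4 ^ (I + 3) * exp 1)"
  have "norm ((deriv ^^ j) Gamma (of_real (real k / real q) + 1 :: complex)) \<le> E * 4 ^ k * fact (k div q)" if j: "j < I" and k: "k \<ge> 1" for j k
  proof -
    have g: "real k / real q > 0" using q k by simp
    have pg: "poly_growth (pterm 0 (of_real (real k / real q)) j)" by (rule poly_growth_pterm) (use g in \<open>simp del: of_real_divide\<close>)
    have "(\<Sum>l\<le>j. (deriv ^^ l) Gamma (of_real (real k / real q) + 1) / fact l * ((- 0 :: complex) ^ (j - l) / fact (j - l))) =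
        (\<Sum>l\<in>{j}. (deriv ^^ l) Gamma (of_real (real k / real q) + 1) / fact l * ((- 0) ^ (j - l) / fact (j - l)))"
      by (rule sum.mono_neutral_right) auto
    hence "lap (pterm 0 (of_real (real k / real q)) j) 1 = (deriv ^^ j) Gamma (of_real (real k / real q) + 1)"
      using lap_pterm[OF g, of 1 0 j] by (simp del: of_real_divide)
    moreover have "norm (lap (pterm 0 (of_real (real k / real q)) j) 1) \<le>
        C * (fact (I + 3) * (4 / 1) ^ (I + 3) * exp 1) * (fact (k div q - 1) * (4 / 1) ^ Suc (k div q - 1)) * norm (1 :: complex) powr (- real (Suc (k div q - 1)))"
      by (rule norm_lap_le[OF pg]) (use C j k in auto)
    ultimately have "norm ((deriv ^^ j) Gamma (of_real (real k / real q) + 1 :: complex)) \<le> E * (fact (k div q - 1) * 4 ^ Suc (k div q - 1))"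
      by (simp add: E_def mult_ac del: of_real_divide)
    also have "\<dots> \<le> E * (fact (k div q) * 4 ^ k)"
    proof (intro mult_left_mono mult_mono fact_mono power_increasing)
      show "Suc (k div q - 1) \<le> k" using k div_le_dividend[of k q] by linarith
    qed (use C(1) in \<open>auto simp: E_def\<close>)
    finally show ?thesis by (simp add: mult_ac)
  qed
  moreover have "E \<ge> 0" using C(1) by (simp add: E_def)
  ultimately show ?thesis by blast
qed

lemma norm_branch_coeff_le:
  assumes q: "q > 0"
  shows "\<exists>M\<ge>0. \<forall>i<I. \<forall>l<I. \<forall>k\<ge>1. norm (branch_coeff \<omega> q i k l) \<le> M * 4 ^ k * fact (k div q)"
proof -
  obtain E where E: "E \<ge> 0" "\<And>j k. j < I \<Longrightarrow> k \<ge> 1 \<Longrightarrow> norm ((deriv ^^ j) Gamma (of_real (real k / real q) + 1 :: complex)) \<le> E * 4 ^ k * fact (k div q)"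
    using norm_Gamma_deriv_lattice_le[OF q, of I] by blast
  define m where "m = (\<lambda>i l. fact i * (\<Sum>j\<le>i. norm (of_nat ((i - j) choose l) * (\<i> * complex_of_real \<omega>) ^ (i - j - l) / (fact j * fact (i - j)))))"
  have m0: "m i l \<ge> 0" for i l unfolding m_def by (intro mult_nonneg_nonneg sum_nonneg) auto
  define M where "M = (\<Sum>i<I. \<Sum>l<I. m i l) * E"
  have "norm (branch_coeff \<omega> q i k l) \<le> M * 4 ^ k * fact (k div q)" if i: "i < I" and l: "l < I" and k: "k \<ge> 1" for i l k
  proof -
    have "\<i> * of_real \<omega> * (of_real (real k / real q) + 1) = \<i> * of_real (\<omega> * (real k / real q + 1))" by simp
    hence e1: "norm (exp (\<i> * of_real \<omega> * (of_real (real k / real q) + 1))) = 1" by (simp only: norm_exp_i_times)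
    have "norm (branch_coeff \<omega> q i k l) \<le> fact i * (\<Sum>j\<le>i. (E * 4 ^ k * fact (k div q)) *
        norm (of_nat ((i - j) choose l) * (\<i> * complex_of_real \<omega>) ^ (i - j - l) / (fact j * fact (i - j))))"
      unfolding branch_coeff_def norm_mult[of "fact i * _"] norm_mult[of "fact i"] e1 norm_fact mult_1_right
    proof (intro mult_left_mono sum_norm_le)
      fix j assume "j \<in> {..i}"
      hence "norm ((deriv ^^ j) Gamma (of_real (real k / real q) + 1 :: complex)) \<le> E * 4 ^ k * fact (k div q)" using i k by (intro E(2)) auto
      from mult_right_mono[OF this norm_ge_zero]
      show "norm ((deriv ^^ j) Gamma (of_real (real k / real q) + 1) * (of_nat ((i - j) choose l) * (\<i> * complex_of_real \<omega>) ^ (i - j - l) / (fact j * fact (i - j))))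
        \<le> (E * 4 ^ k * fact (k div q)) * norm (of_nat ((i - j) choose l) * (\<i> * complex_of_real \<omega>) ^ (i - j - l) / (fact j * fact (i - j)))"
        by (subst norm_mult)
    qed auto
    also have "\<dots> = m i l * (E * 4 ^ k * fact (k div q))" by (simp only: m_def sum_distrib_left[symmetric] mult_ac)
    also have "\<dots> \<le> (\<Sum>i<I. \<Sum>l<I. m i l) * (E * 4 ^ k * fact (k div q))"
    proof (rule mult_right_mono)
      have "m i l \<le> (\<Sum>l<I. m i l)" using l m0 by (intro member_le_sum) auto
      also have "\<dots> \<le> (\<Sum>i<I. \<Sum>l<I. m i l)" using i m0 by (intro member_le_sum[of i _ "\<lambda>i. \<Sum>l<I. m i l"] sum_nonneg) auto
      finally show "m i l \<le> (\<Sum>i<I. \<Sum>l<I. m i l)" .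
    qed (use E(1) in simp)
    finally show ?thesis by (simp only: M_def mult_ac)
  qed
  moreover have "M \<ge> 0" unfolding M_def using m0 E(1) by (intro mult_nonneg_nonneg sum_nonneg) auto
  ultimately show ?thesis by blast
qed

context sector begin

text \<open>Which ray is used may depend on x. The coefficients do not, because
  \<open>Ln z - \<i> * \<tau> b\<close> is the same function of x for both rays; hence a single
  expansion holds on the whole sector although each ray covers only part of it.\<close>

lemma gevrey_of_lap:
  fixes \<psi> :: "bool \<Rightarrow> real \<Rightarrow> complex" and \<tau> :: "bool \<Rightarrow> real" and c :: "nat \<Rightarrow> nat \<Rightarrow> complex"
  assumes F: "F analytic_on sec" and \<omega>: "\<omega> \<in> {0, pi, - pi}"
    and cH: "\<And>i k. c i k \<in> H_ring" and c0: "\<And>i. c i 0 = 0"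
    and c: "\<And>i k. norm (c i k) \<le> D * A ^ k" and D: "D \<ge> 0" and A: "A \<ge> 1"
    and r0: "0 < r0" "r0 < 1" "A * r0 powr (1 / real q) \<le> 1 / 2"
    and pg: "\<And>b. poly_growth (\<psi> b)" and \<psi>0: "\<And>b. \<psi> b 0 = 0"
    and expand: "\<And>b r. 0 < r \<Longrightarrow> r \<le> r0 \<Longrightarrow> \<psi> b r = (\<Sum>i<I. \<Sum>k. c i k * pterm (\<tau> b) (of_real (real k / real q)) i r)"
    and \<delta>: "0 < \<delta>" "\<delta> \<le> 1"
    and branch: "\<And>x. x \<in> sec \<Longrightarrow> \<exists>b z. norm z = norm x \<and> Re z \<ge> \<delta> * norm z \<and>
       Ln z - \<i> * of_real (\<tau> b) = log_about \<theta> x - \<i> * of_real \<omega> \<and> F x = exp (\<i> * of_real (\<tau> b)) * lap (\<psi> b) z"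
  shows "gevrey F"
proof -
  define Q where "Q = (\<lambda>b CC. (\<forall>z. Re z \<ge> \<delta> * norm z \<and> norm z \<ge> 1 \<longrightarrow> norm (lap (\<psi> b) z) \<le> CC \<and>
    (\<forall>N\<ge>1. norm (lap (\<psi> b) z - (\<Sum>i<I. \<Sum>k<q * N. c i k * lap (pterm (\<tau> b) (of_real (real k / real q)) i) z)) \<le> CC ^ N * fact N * norm z powr (- real N))))"
  have "\<exists>C\<ge>1. Q b C" for b
    unfolding Q_def by (rule watson[where c = c and \<psi> = "\<psi> b" and \<tau> = "\<tau> b" and D = D and A = A and ?r0.0 = r0]) (fact q pg \<psi>0 c0 c D A r0 expand \<delta>)+
  hence "\<exists>C0. \<forall>b. C0 b \<ge> 1 \<and> Q b (C0 b)" by (intro choice allI)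
  then obtain C0 where C0Q: "\<And>b. C0 b \<ge> 1" "\<And>b. Q b (C0 b)" by auto
  have C0: "\<And>b. C0 b \<ge> 1" "\<And>b z. Re z \<ge> \<delta> * norm z \<Longrightarrow> norm z \<ge> 1 \<Longrightarrow> norm (lap (\<psi> b) z) \<le> C0 b"
    "\<And>b z N. Re z \<ge> \<delta> * norm z \<Longrightarrow> norm z \<ge> 1 \<Longrightarrow> N \<ge> 1 \<Longrightarrow>
       norm (lap (\<psi> b) z - (\<Sum>i<I. \<Sum>k<q * N. c i k * lap (pterm (\<tau> b) (of_real (real k / real q)) i) z)) \<le> C0 b ^ N * fact N * norm z powr (- real N)"
    using C0Q unfolding Q_def by blast+
  obtain M where M: "M \<ge> 0" "\<And>i l k. i < I \<Longrightarrow> l < I \<Longrightarrow> k \<ge> 1 \<Longrightarrow> norm (branch_coeff \<omega> q i k l) \<le> M * 4 ^ k * fact (k div q)"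
    using norm_branch_coeff_le[OF q, of I \<omega>] by blast
  \<comment> \<open>The transform raises every exponent by one, that is every index by
    \<open>q\<close>. The first \<open>q\<close> coefficients are therefore zero.\<close>
  define e where "e = (\<lambda>l k. if l < I \<and> q \<le> k then \<Sum>i<I. c i (k - q) * branch_coeff \<omega> q i (k - q) l else 0)"
  define C where "C = C0 True + C0 False + 4 * A + real I * (D * M)"
  have IDM: "real I * (D * M) \<ge> 0" using D M(1) by simp
  have C1: "C \<ge> 1" and CA: "4 * A \<le> C" and CD: "real I * (D * M) \<le> C" and Cb: "C0 b \<le> C" for b
    using C0(1)[of True] C0(1)[of False] IDM A unfolding C_def by (simp_all, cases b, simp_all)
  have eH: "e l k \<in> H_ring" for l k
    unfolding e_def using H_ring_zero branch_coeff_in_H_ring[OF \<omega>] cH by (auto intro!: H_ring_sum H_ring_mult)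
  have eC: "norm (e l k) \<le> C ^ (k + 1) * fact (k div q)" for l k
  proof (cases "l < I \<and> q \<le> k")
    case False
    thus ?thesis using C1 by (auto simp: e_def)
  next
    case True
    define k' where "k' = k - q"
    have ek: "e l k = (\<Sum>i<I. c i k' * branch_coeff \<omega> q i k' l)" using True by (simp add: e_def k'_def)
    have "norm (e l k) \<le> (\<Sum>i<I. D * M * (4 * A) ^ k' * fact (k' div q))"
      unfolding ek
    proof (intro sum_norm_le)
      fix i assume i: "i \<in> {..<I}"
      show "norm (c i k' * branch_coeff \<omega> q i k' l) \<le> D * M * (4 * A) ^ k' * fact (k' div q)"
      proof (cases "k' = 0")
        case True
        thus ?thesis using c0 D M(1) by simp
      next
        case False
        have "norm (c i k' * branch_coeff \<omega> q i k' l) \<le> (D * A ^ k') * (M * 4 ^ k' * fact (k' div q))"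
          unfolding norm_mult by (rule mult_mono[OF c M(2)]) (use i True False D A in auto)
        thus ?thesis by (simp add: power_mult_distrib mult_ac)
      qed
    qed
    also have "\<dots> = (real I * (D * M)) * (4 * A) ^ k' * fact (k' div q)" by simp
    also have "\<dots> \<le> C * C ^ k * fact (k div q)"
    proof (intro mult_mono fact_mono div_le_mono CD)
      have "(4 * A) ^ k' \<le> C ^ k'" using CA A by (intro power_mono) auto
      also have "\<dots> \<le> C ^ k" using C1 by (intro power_increasing) (auto simp: k'_def)
      finally show "(4 * A) ^ k' \<le> C ^ k" .
    qed (use C1 A IDM in \<open>auto simp: k'_def\<close>)
    finally show ?thesis by simp
  qed
  have key: "norm (F x - (\<Sum>l<I. \<Sum>k<q * N. e l k * lterm 0 l k x)) \<le> C ^ N * fact N * norm x powr (1 - real N)"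
    if x: "x \<in> sec" and N: "N \<ge> 1" for x N
  proof -
    obtain b z where z: "norm z = norm x" "Re z \<ge> \<delta> * norm z"
       and L: "Ln z - \<i> * of_real (\<tau> b) = log_about \<theta> x - \<i> * of_real \<omega>" and Fx: "F x = exp (\<i> * of_real (\<tau> b)) * lap (\<psi> b) z"
      using branch[OF x] by blast
    have nz: "norm z \<ge> 1" using sec_norm[OF x] z by simp
    hence rz: "Re z > 0" using z(2) \<delta>(1) by (meson less_le_trans mult_pos_pos zero_less_one)
    have e1: "norm (exp (\<i> * of_real (\<tau> b))) = 1" by (rule norm_exp_i_times)
    show ?thesis
    \<comment> \<open>For \<open>N = 1\<close> the truncated sum is empty and the bound on the
      transform suffices; otherwise the remainder of index \<open>N - 1\<close> is used. The loss of
      one index accounts for the exponent \<open>1 - N\<close>.\<close>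
    proof (cases "N = 1")
      case True
      have "(\<Sum>l<I. \<Sum>k<q * N. e l k * lterm 0 l k x) = 0" using True by (intro sum.neutral) (auto simp: e_def)
      hence "norm (F x - (\<Sum>l<I. \<Sum>k<q * N. e l k * lterm 0 l k x)) = norm (lap (\<psi> b) z)" by (simp add: Fx norm_mult e1)
      also have "\<dots> \<le> C" using C0(2)[OF z(2) nz, of b] Cb[of b] by simp
      also have "\<dots> = C ^ N * fact N * norm x powr (1 - real N)" using True nz z(1) by (cases "x = 0") auto
      finally show ?thesis .
    next
      case False
      define N' where "N' = N - 1"
      have N': "N' \<ge> 1" "N = N' + 1" using N False by (auto simp: N'_def)
      have termE: "exp (\<i> * of_real (\<tau> b)) * (c i k * lap (pterm (\<tau> b) (of_real (real k / real q)) i) z) =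
          (\<Sum>l<I. c i k * branch_coeff \<omega> q i k l * lterm 0 l (k + q) x)" if i: "i < I" for i k
      proof (cases "k = 0")
        case True
        thus ?thesis using c0 by simp
      next
        case False
        have lt: "exp (- (of_real (real k / real q) + 1) * log_about \<theta> x) * (- log_about \<theta> x) ^ l = lterm 0 l (k + q) x" for l
          unfolding lterm_def using q by (simp add: add_divide_distrib)
        have "exp (\<i> * of_real (\<tau> b)) * lap (pterm (\<tau> b) (of_real (real k / real q)) i) z =
            (\<Sum>l<I. branch_coeff \<omega> q i k l * lterm 0 l (k + q) x)"
          using lap_pterm_branch[OF q _ i rz L, of k] False unfolding lt by simp
        hence "c i k * (exp (\<i> * of_real (\<tau> b)) * lap (pterm (\<tau> b) (of_real (real k / real q)) i) z) =
            c i k * (\<Sum>l<I. branch_coeff \<omega> q i k l * lterm 0 l (k + q) x)" by (rule arg_cong)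
        thus ?thesis unfolding sum_distrib_left by (simp only: mult_ac)
      qed
      have "exp (\<i> * of_real (\<tau> b)) * (\<Sum>i<I. \<Sum>k<q * N'. c i k * lap (pterm (\<tau> b) (of_real (real k / real q)) i) z) =
          (\<Sum>i<I. \<Sum>k<q * N'. \<Sum>l<I. c i k * branch_coeff \<omega> q i k l * lterm 0 l (k + q) x)"
        unfolding sum_distrib_left by (intro sum.cong refl termE) simp
      also have "\<dots> = (\<Sum>i<I. \<Sum>l<I. \<Sum>k<q * N'. c i k * branch_coeff \<omega> q i k l * lterm 0 l (k + q) x)"
        by (rule sum.cong[OF refl], rule sum.swap)
      also have "\<dots> = (\<Sum>l<I. \<Sum>i<I. \<Sum>k<q * N'. c i k * branch_coeff \<omega> q i k l * lterm 0 l (k + q) x)" by (rule sum.swap)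
      also have "\<dots> = (\<Sum>l<I. \<Sum>k<q * N'. \<Sum>i<I. c i k * branch_coeff \<omega> q i k l * lterm 0 l (k + q) x)"
        by (rule sum.cong[OF refl], rule sum.swap)
      also have "\<dots> = (\<Sum>l<I. \<Sum>k<q * N'. e l (k + q) * lterm 0 l (k + q) x)"
        by (intro sum.cong refl) (simp add: e_def sum_distrib_right)
      also have "\<dots> = (\<Sum>l<I. \<Sum>k<q * N. e l k * lterm 0 l k x)"
      proof (rule sum.cong[OF refl])
        fix l
        have "(\<Sum>k<q * N'. e l (k + q) * lterm 0 l (k + q) x) = (\<Sum>k\<in>{0 + q..<q * N' + q}. e l k * lterm 0 l k x)"
          unfolding lessThan_atLeast0 by (rule sum.shift_bounds_nat_ivl[symmetric])
        also have "\<dots> = (\<Sum>k<q * N. e l k * lterm 0 l k x)"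
          by (rule sum.mono_neutral_left) (auto simp: N'(2) e_def)
        finally show "(\<Sum>k<q * N'. e l (k + q) * lterm 0 l (k + q) x) = (\<Sum>k<q * N. e l k * lterm 0 l k x)" .
      qed
      finally have "F x - (\<Sum>l<I. \<Sum>k<q * N. e l k * lterm 0 l k x) = exp (\<i> * of_real (\<tau> b)) *
          (lap (\<psi> b) z - (\<Sum>i<I. \<Sum>k<q * N'. c i k * lap (pterm (\<tau> b) (of_real (real k / real q)) i) z))"
        unfolding Fx right_diff_distrib by simp
      hence "norm (F x - (\<Sum>l<I. \<Sum>k<q * N. e l k * lterm 0 l k x)) \<le> C0 b ^ N' * fact N' * norm z powr (- real N')"
        using C0(3)[OF z(2) nz N'(1), of b] by (simp add: norm_mult e1)
      also have "\<dots> \<le> C ^ N * fact N * norm z powr (1 - real N)"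
      proof (intro mult_mono fact_mono)
        have "C0 b ^ N' \<le> C ^ N'" using C0(1)[of b] Cb[of b] by (intro power_mono) auto
        also have "\<dots> \<le> C ^ N" using C1 N'(2) by (intro power_increasing) auto
        finally show "C0 b ^ N' \<le> C ^ N" .
      qed (use C1 N'(2) in auto)
      finally show ?thesis unfolding z(1) .
    qed
  qed
  have "gevrey_exp 0 I e 1 C F"
    unfolding gevrey_exp_def using F C1 eH eC key by (auto simp: e_def)
  thus ?thesis unfolding gevrey_def by blast
qed

end

section \<open>Turning the contour\<close>

lemma lap_LIMSEQ:
  assumes g: "poly_growth g" and z: "Re z > 0"
  shows "(\<lambda>n. integral {0..real n} (\<lambda>r. exp (- z * of_real r) * g r)) \<longlonglongrightarrow> lap g z"
proof -
  define \<delta> where "\<delta> = Re z / 2"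
  have \<delta>: "\<delta> > 0" "Re z \<ge> 2 * \<delta>" using z by (auto simp: \<delta>_def)
  obtain M where M: "\<And>r. r \<ge> 0 \<Longrightarrow> norm (g r) \<le> M * exp (\<delta> * r)"
    using poly_growth_exp[OF g \<delta>(1)] by auto
  define h where "h = (\<lambda>r. exp (- z * of_real r) * g r)"
  have hc: "continuous_on {0..} h" and hb: "\<And>r. r \<ge> 0 \<Longrightarrow> norm (h r) \<le> M * exp (- \<delta> * r)"
    unfolding h_def using lap_integrand[OF g \<delta>(2,1) M] by auto
  have "norm (integral {0..real n} h - lap g z) \<le> (M / \<delta>) * exp (- \<delta> * real n)" for n
  proof -
    have c1: "continuous_on {0..real n} h" by (rule continuous_on_subset[OF hc]) auto
    have c2: "continuous_on {real n..} h" by (rule continuous_on_subset[OF hc]) auto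
    have b2: "norm (h r) \<le> M * exp (- \<delta> * r)" if "r \<ge> real n" for r using hb[of r] that by linarith
    have "(h has_integral (integral {0..real n} h + integral {real n..} h)) ({0..real n} \<union> {real n..})"
    proof (rule has_integral_Un)
      show "(h has_integral integral {0..real n} h) {0..real n}"
        using integrable_continuous_real[OF c1] by (rule integrable_integral)
      show "(h has_integral integral {real n..} h) {real n..}"
        using half_line_integral(1)[OF c2 \<delta>(1) b2] by (rule integrable_integral)
      have "{0..real n} \<inter> {real n..} = {real n}" by auto
      thus "negligible ({0..real n} \<inter> {real n..})" by simp
    qed
    moreover have "{0..real n} \<union> {real n..} = {0..}" by auto
    ultimately have "lap g z = integral {0..real n} h + integral {real n..} h"
      unfolding lap_def h_def[symmetric] by (simp add: integral_unique)
    hence "norm (integral {0..real n} h - lap g z) = norm (integral {real n..} h)" by simp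
    also have "\<dots> \<le> M * exp (- \<delta> * real n) / \<delta>" by (rule half_line_integral(2)[OF c2 \<delta>(1) b2])
    finally show ?thesis by simp
  qed
  moreover have "(\<lambda>n. (M / \<delta>) * exp (- \<delta> * real n)) \<longlonglongrightarrow> 0"
    by (rule tendsto_mult_right_zero) (use \<delta>(1) in real_asymp)
  ultimately have "(\<lambda>n. integral {0..real n} h - lap g z) \<longlonglongrightarrow> 0"
    by (rule Lim_null_comparison[OF always_eventually[OF allI]])
  thus ?thesis unfolding h_def[symmetric] by (simp add: LIM_zero_iff)
qed

text \<open>The segment [0, 1] plus the cone spanned by the two directions: a convex set containing
  the segment and the four rays, so that one primitive serves all of them.\<close>

definition pencil :: "complex \<Rightarrow> complex \<Rightarrow> complex set" where
  "pencil d e = {of_real l + of_real s * d + of_real t * e | l s t. 0 \<le> l \<and> l \<le> 1 \<and> 0 \<le> s \<and> 0 \<le> t}"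

lemma pencil_ray:
  assumes "p \<in> {0, 1}" "e \<in> {e1, e2}" "r \<ge> 0"
  shows "p + of_real r * e \<in> pencil e1 e2"
proof -
  have "\<exists>l s t. p + of_real r * e = of_real l + of_real s * e1 + of_real t * e2 \<and> 0 \<le> l \<and> l \<le> 1 \<and> 0 \<le> s \<and> 0 \<le> t"
    using assms(2)
  proof (elim insertE emptyE)
    assume "e = e1"
    thus ?thesis using assms by (intro exI[of _ "Re p"] exI[of _ r] exI[of _ 0]) auto
  next
    assume "e = e2"
    thus ?thesis using assms by (intro exI[of _ "Re p"] exI[of _ 0] exI[of _ r]) auto
  qed
  thus ?thesis unfolding pencil_def by blast
qed

lemma pencil_convex: "convex (pencil e1 e2)"
proof (rule convexI)
  fix x y and u v :: real
  assume "x \<in> pencil e1 e2" "y \<in> pencil e1 e2" and uv: "0 \<le> u" "0 \<le> v" "u + v = 1"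
  then obtain l s t l' s' t' where x: "x = of_real l + of_real s * e1 + of_real t * e2" "0 \<le> l" "l \<le> 1" "0 \<le> s" "0 \<le> t"
    and y: "y = of_real l' + of_real s' * e1 + of_real t' * e2" "0 \<le> l'" "l' \<le> 1" "0 \<le> s'" "0 \<le> t'"
    unfolding pencil_def by blast
  have "u *\<^sub>R x + v *\<^sub>R y = of_real (u * l + v * l') + of_real (u * s + v * s') * e1 + of_real (u * t + v * t') * e2"
    by (simp add: x(1) y(1) scaleR_conv_of_real algebra_simps)
  moreover have "0 \<le> u * l + v * l'" "u * l + v * l' \<le> 1" "0 \<le> u * s + v * s'" "0 \<le> u * t + v * t'"
    using x y uv convex_bound_le[of l 1 l' u v] by auto
  ultimately show "u *\<^sub>R x + v *\<^sub>R y \<in> pencil e1 e2" unfolding pencil_def by blast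
qed

text \<open>The imaginary parts of both directions have the same sign, so a non-negative combination
  is real only if it is trivial. The pencil therefore avoids both cuts of the kernel.\<close>

lemma pencil_real:
  assumes "t \<in> pencil e1 e2" "Im e1 * Im e2 > 0" "Im t = 0"
  shows "0 \<le> Re t \<and> Re t \<le> 1"
proof -
  from assms(1) obtain l s r where t: "t = of_real l + of_real s * e1 + of_real r * e2" "0 \<le> l" "l \<le> 1" "0 \<le> s" "0 \<le> r"
    unfolding pencil_def by blast
  have "s * Im e1 + r * Im e2 = 0" using assms(3) t(1) by simp
  moreover have nn: "s = 0 \<and> r = 0" if "s * a + r * b = 0" "a > 0" "b > 0" for a b :: real
    using add_nonneg_eq_0_iff[of "s * a" "r * b"] that t by auto
  moreover have "Im e1 > 0 \<and> Im e2 > 0 \<or> - Im e1 > 0 \<and> - Im e2 > 0" using assms(2) by (auto simp: zero_less_mult_iff)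
  ultimately have "s = 0 \<and> r = 0"
    using nn[of "Im e1" "Im e2"] nn[of "- Im e1" "- Im e2"] by auto
  thus ?thesis using t by simp
qed

definition ray_integral :: "(complex \<Rightarrow> complex) \<Rightarrow> complex \<Rightarrow> complex \<Rightarrow> complex \<Rightarrow> complex" where
  "ray_integral \<phi> x p e = exp (x * p) * e * lap (\<lambda>r. \<phi> (p + of_real r * e)) (- (x * e))"

lemma poly_growth_ray:
  fixes p e :: complex
  assumes cont: "continuous_on W \<phi>" and bd: "\<And>t. t \<in> W \<Longrightarrow> norm (\<phi> t) \<le> C * (1 + norm t) ^ K" and C: "C \<ge> 0"
    and ray: "\<And>r. r \<ge> 0 \<Longrightarrow> p + of_real r * e \<in> W" and p: "norm p \<le> 1" and e: "norm e \<le> 1"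
  shows "poly_growth (\<lambda>r. \<phi> (p + of_real r * e))"
  unfolding poly_growth_def
proof (intro conjI exI allI impI)
  show "continuous_on {0..} (\<lambda>r. \<phi> (p + of_real r * e))"
    by (rule continuous_on_compose2[OF cont]) (auto intro!: continuous_intros ray)
  show "C * 2 ^ K \<ge> 0" using C by simp
  fix r :: real assume r: "r \<ge> 0"
  have "norm (\<phi> (p + of_real r * e)) \<le> C * (1 + norm (p + of_real r * e)) ^ K" by (rule bd[OF ray[OF r]])
  also have "\<dots> \<le> C * (2 * (1 + r)) ^ K"
  proof (intro mult_left_mono power_mono C)
    have "norm (p + of_real r * e) \<le> norm p + r * norm e" using norm_triangle_ineq[of p "of_real r * e"] r by (simp add: norm_mult)
    also have "\<dots> \<le> 1 + r * 1" using p e r by (intro add_mono mult_left_mono) auto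
    finally show "1 + norm (p + of_real r * e) \<le> 2 * (1 + r)" using r by simp
  qed auto
  finally show "norm (\<phi> (p + of_real r * e)) \<le> C * 2 ^ K * (1 + r) ^ K" by (simp only: power_mult_distrib mult.assoc)
qed

lemma has_integral_along_line:
  fixes p e :: complex and b :: real
  assumes df: "\<And>t. t \<in> W \<Longrightarrow> (\<Phi> has_field_derivative f t) (at t within W)"
    and line: "\<And>r. r \<in> {0..b} \<Longrightarrow> p + of_real r * e \<in> W" and b: "b \<ge> 0"
  shows "((\<lambda>r. e * f (p + of_real r * e)) has_integral \<Phi> (p + of_real b * e) - \<Phi> p) {0..b}"
proof -
  have "((\<lambda>r. e * f (p + of_real r * e)) has_integral (\<Phi> \<circ> (\<lambda>r. p + of_real r * e)) b - (\<Phi> \<circ> (\<lambda>r. p + of_real r * e)) 0) {0..b}"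
  proof (rule fundamental_theorem_of_calculus[OF b])
    fix r assume r: "r \<in> {0..b}"
    show "((\<Phi> \<circ> (\<lambda>r. p + of_real r * e)) has_vector_derivative e * f (p + of_real r * e)) (at r within {0..b})"
    proof (rule field_vector_diff_chain_within)
      show "((\<lambda>r. p + of_real r * e) has_vector_derivative e) (at r within {0..b})"
        by (auto intro!: derivative_eq_intros)
      show "(\<Phi> has_field_derivative f (p + of_real r * e)) (at (p + of_real r * e) within (\<lambda>r. p + of_real r * e) ` {0..b})"
        by (rule has_field_derivative_subset[OF df[OF line[OF r]]]) (use line in auto)
    qed
  qed
  thus ?thesis by simp
qed

lemma ray_limit:
  assumes df: "\<And>t. t \<in> W \<Longrightarrow> (\<Phi> has_field_derivative exp (x * t) * \<phi> t) (at t within W)"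
    and ray: "\<And>r. r \<ge> 0 \<Longrightarrow> p + of_real r * e \<in> W" and pg: "poly_growth (\<lambda>r. \<phi> (p + of_real r * e))"
    and x: "Re (x * e) < 0"
  shows "(\<lambda>n. \<Phi> (p + of_real (real n) * e)) \<longlonglongrightarrow> \<Phi> p + ray_integral \<phi> x p e"
proof -
  define h where "h = (\<lambda>r. exp (- (- (x * e)) * of_real r) * \<phi> (p + of_real r * e))"
  have "\<Phi> (p + of_real (real n) * e) = \<Phi> p + exp (x * p) * e * integral {0..real n} h" for n
  proof -
    have "integral {0..real n} (\<lambda>r. e * (exp (x * (p + of_real r * e)) * \<phi> (p + of_real r * e))) = \<Phi> (p + of_real (real n) * e) - \<Phi> p"
      by (rule integral_unique[OF has_integral_along_line[where W = W and f = "\<lambda>t. exp (x * t) * \<phi> t"]]) (use df ray in auto)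
    moreover have "(\<lambda>r. e * (exp (x * (p + of_real r * e)) * \<phi> (p + of_real r * e))) = (\<lambda>r. (exp (x * p) * e) * h r)"
    proof
      fix r :: real
      have "exp (x * (p + of_real r * e)) = exp (x * p) * exp (- (- (x * e)) * of_real r)"
        unfolding exp_add[symmetric] by (simp add: algebra_simps)
      thus "e * (exp (x * (p + of_real r * e)) * \<phi> (p + of_real r * e)) = (exp (x * p) * e) * h r"
        unfolding h_def by (simp only: mult_ac)
    qed
    ultimately have "exp (x * p) * e * integral {0..real n} h = \<Phi> (p + of_real (real n) * e) - \<Phi> p"
      by (simp only: integral_mult_right)
    thus ?thesis by simp
  qed
  moreover have "(\<lambda>n. \<Phi> p + exp (x * p) * e * integral {0..real n} h) \<longlonglongrightarrow> \<Phi> p + ray_integral \<phi> x p e"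
    unfolding ray_integral_def h_def by (intro tendsto_intros lap_LIMSEQ[OF pg]) (use x in simp)
  ultimately show ?thesis by simp
qed

text \<open>The points at parameter \<open>n\<close> on the two rays are joined by a segment of
  length linear in \<open>n\<close>. Since \<open>Re (x * t)\<close> is affine in t, the exponential
  decay at the two ends holds on the whole segment and beats all polynomial factors.\<close>

lemma ray_difference:
  assumes W: "convex W" and df: "\<And>t. t \<in> W \<Longrightarrow> (\<Phi> has_field_derivative exp (x * t) * \<phi> t) (at t within W)"
    and bd: "\<And>t. t \<in> W \<Longrightarrow> norm (\<phi> t) \<le> C * (1 + norm t) ^ K" and C: "C \<ge> 0"
    and ray: "\<And>r. r \<ge> 0 \<Longrightarrow> p + of_real r * e \<in> W" "\<And>r. r \<ge> 0 \<Longrightarrow> p' + of_real r * e' \<in> W"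
    and p: "norm p \<le> 1" "norm p' \<le> 1" and e: "norm e \<le> 1" "norm e' \<le> 1" and x: "Re (x * e) < 0" "Re (x * e') < 0"
  shows "(\<lambda>n. \<Phi> (p + of_real (real n) * e) - \<Phi> (p' + of_real (real n) * e')) \<longlonglongrightarrow> 0"
proof -
  define c where "c = min (- Re (x * e)) (- Re (x * e'))"
  have c: "c > 0" "Re (x * e) \<le> - c" "Re (x * e') \<le> - c" using x by (auto simp: c_def)
  define L where "L = fact (K + 1) / (c / 2) ^ (K + 1)"
  define A where "A = 2 * C * exp (norm x) * L * exp c"
  have bound: "norm (\<Phi> (p + of_real (real n) * e) - \<Phi> (p' + of_real (real n) * e')) \<le> A * exp (- (c / 2) * real n)" for n
  proof -
    define P where "P = p + of_real (real n) * e"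
    define P' where "P' = p' + of_real (real n) * e'"
    have PW: "P \<in> W" "P' \<in> W" unfolding P_def P'_def by (rule ray; simp)+
    have nP: "norm (p + of_real (real n) * e) \<le> 1 + real n" if "norm p \<le> 1" "norm e \<le> 1" for p e :: complex
    proof -
      have "norm (p + of_real (real n) * e) \<le> norm p + real n * norm e" using norm_triangle_ineq[of p "of_real (real n) * e"] by (simp add: norm_mult)
      also have "\<dots> \<le> 1 + real n * 1" using that by (intro add_mono mult_left_mono) auto
      finally show ?thesis by simp
    qed
    have P1: "norm P \<le> 1 + real n" "norm P' \<le> 1 + real n" unfolding P_def P'_def using nP p e by auto
    have rP: "Re (x * (p + of_real (real n) * e)) \<le> norm x - c * real n" if "norm p \<le> 1" "Re (x * e) \<le> - c" for p e
    proof -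
      have "Re (x * p) \<le> norm x * norm p" using complex_Re_le_cmod[of "x * p"] by (simp add: norm_mult)
      also have "\<dots> \<le> norm x" using that(1) by (simp add: mult_left_le)
      finally have "Re (x * p) \<le> norm x" .
      moreover have "real n * Re (x * e) \<le> real n * (- c)" using that(2) by (intro mult_left_mono) auto
      moreover have "x * (p + of_real (real n) * e) = x * p + of_real (real n) * (x * e)" by (simp add: algebra_simps)
      ultimately show ?thesis by (simp add: mult.commute)
    qed
    have P2: "Re (x * P) \<le> norm x - c * real n" "Re (x * P') \<le> norm x - c * real n" unfolding P_def P'_def using rP p c by auto
    have SW: "closed_segment P P' \<subseteq> W" by (rule closed_segment_subset[OF PW W])
    have "norm (\<Phi> P - \<Phi> P') \<le> (exp (norm x - c * real n) * (C * (2 + real n) ^ K)) * norm (P - P')"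
    proof (rule field_differentiable_bound[OF convex_closed_segment[of P P'], where f' = "\<lambda>t. exp (x * t) * \<phi> t"])
      fix t assume t: "t \<in> closed_segment P P'"
      show "(\<Phi> has_field_derivative exp (x * t) * \<phi> t) (at t within closed_segment P P')"
        by (rule has_field_derivative_subset[OF df SW]) (use t SW in auto)
      have nt: "norm t \<le> 1 + real n"
        using closed_segment_subset[of P "cball 0 (1 + real n)" P'] P1 t by auto
      obtain u where u: "0 \<le> u" "u \<le> 1" "t = (1 - u) *\<^sub>R P + u *\<^sub>R P'" using t by (auto simp: closed_segment_def)
      have "Re (x * t) = (1 - u) * Re (x * P) + u * Re (x * P')" unfolding u(3) by (simp add: algebra_simps)
      also have "\<dots> \<le> norm x - c * real n" using u P2 by (intro convex_bound_le) auto
      finally have rt: "Re (x * t) \<le> norm x - c * real n" .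
      have "norm (\<phi> t) \<le> C * (1 + norm t) ^ K" using bd t SW by auto
      also have "\<dots> \<le> C * (2 + real n) ^ K" using nt C by (intro mult_left_mono power_mono) auto
      finally show "norm (exp (x * t) * \<phi> t) \<le> exp (norm x - c * real n) * (C * (2 + real n) ^ K)"
        unfolding norm_mult norm_exp_eq_Re using rt by (intro mult_mono) auto
    qed auto
    also have "\<dots> \<le> (exp (norm x - c * real n) * (C * (2 + real n) ^ K)) * (2 * (2 + real n))"
    proof (rule mult_left_mono)
      show "norm (P - P') \<le> 2 * (2 + real n)" using norm_triangle_ineq4[of P P'] P1 by simp
    qed (use C in simp)
    also have "\<dots> = 2 * C * exp (norm x) * exp (- c * real n) * (2 + real n) ^ (K + 1)"
      by (simp add: exp_diff exp_minus field_simps)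
    also have "\<dots> \<le> 2 * C * exp (norm x) * exp (- c * real n) * (L * exp (c / 2 * (2 + real n)))"
      unfolding L_def using power_le_exp_scaled[of "2 + real n" "c / 2" "K + 1"] c C by (intro mult_left_mono) auto
    also have "\<dots> = A * exp (- (c / 2) * real n)"
    proof -
      have "exp (- c * real n) * exp (c / 2 * (2 + real n)) = exp c * exp (- (c / 2) * real n)"
        unfolding exp_add[symmetric] by (simp add: algebra_simps)
      thus ?thesis unfolding A_def by (simp only: mult_ac)
    qed
    finally show ?thesis unfolding P_def P'_def .
  qed
  have "(\<lambda>n. A * exp (- (c / 2) * real n)) \<longlonglongrightarrow> 0"
    by (rule tendsto_mult_right_zero) (use c(1) in real_asymp)
  with bound show ?thesis
    by (rule Lim_null_comparison[OF always_eventually[OF allI]])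
qed

text \<open>A primitive replaces closed contours: along every admissible ray it has the same limit
  at infinity, and each ray integral is this limit minus the value at the starting point.\<close>

lemma ray_integral_contour:
  assumes e: "norm e1 \<le> 1" "norm e2 \<le> 1" and cont: "continuous_on (pencil e1 e2) \<phi>"
    and fd: "\<And>t. t \<in> interior (pencil e1 e2) - {0, 1} \<Longrightarrow> \<phi> field_differentiable at t"
    and bd: "\<And>t. t \<in> pencil e1 e2 \<Longrightarrow> norm (\<phi> t) \<le> C * (1 + norm t) ^ K" and C: "C \<ge> 0"
  shows "e \<in> {e1, e2} \<Longrightarrow> Re (x * e) < 0 \<Longrightarrow>
      integral {0..1} (\<lambda>t. exp (x * of_real t) * \<phi> (of_real t)) = ray_integral \<phi> x 0 e - ray_integral \<phi> x 1 e"
    and "p \<in> {0, 1} \<Longrightarrow> Re (x * e1) < 0 \<Longrightarrow> Re (x * e2) < 0 \<Longrightarrow> ray_integral \<phi> x p e1 = ray_integral \<phi> x p e2"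
proof -
  \<comment> \<open>Continuity on the pencil together with differentiability in its interior is
    enough for a primitive. This matters because the kernel is only continuous at 0 and 1.\<close>
  obtain \<Phi> where \<Phi>: "\<And>t. t \<in> pencil e1 e2 \<Longrightarrow> (\<Phi> has_field_derivative exp (x * t) * \<phi> t) (at t within pencil e1 e2)"
  proof (rule holomorphic_convex_primitive[of "pencil e1 e2" "{0, 1}" "\<lambda>t. exp (x * t) * \<phi> t"])
    show "continuous_on (pencil e1 e2) (\<lambda>t. exp (x * t) * \<phi> t)" by (intro continuous_intros cont)
    show "(\<lambda>t. exp (x * t) * \<phi> t) field_differentiable at t" if "t \<in> interior (pencil e1 e2) - {0, 1}" for t
    proof (rule field_differentiable_mult[OF _ fd[OF that]])
      show "(\<lambda>t. exp (x * t)) field_differentiable at t"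
        by (rule holomorphic_on_imp_differentiable_at[of _ UNIV]) (auto intro!: holomorphic_intros)
    qed
  qed (use pencil_convex in auto)
  have n1: "norm p \<le> 1" if "p \<in> {0, 1 :: complex}" for p using that by auto
  have ne: "norm e \<le> 1" if "e \<in> {e1, e2}" for e using that e by auto
  have lim: "(\<lambda>n. \<Phi> (p + of_real (real n) * e)) \<longlonglongrightarrow> \<Phi> p + ray_integral \<phi> x p e"
    if "p \<in> {0, 1}" "e \<in> {e1, e2}" "Re (x * e) < 0" for p e
    by (rule ray_limit[OF \<Phi> pencil_ray[OF that(1,2)]
          poly_growth_ray[OF cont bd C pencil_ray[OF that(1,2)] n1[OF that(1)] ne[OF that(2)]] that(3)])
  have eq: "\<Phi> p + ray_integral \<phi> x p e = \<Phi> p' + ray_integral \<phi> x p' e'"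
    if p: "p \<in> {0, 1}" "p' \<in> {0, 1}" and e: "e \<in> {e1, e2}" "e' \<in> {e1, e2}" and x: "Re (x * e) < 0" "Re (x * e') < 0" for p p' e e'
  proof -
    have "(\<lambda>n. \<Phi> (p + of_real (real n) * e) - \<Phi> (p' + of_real (real n) * e')) \<longlonglongrightarrow>
        (\<Phi> p + ray_integral \<phi> x p e) - (\<Phi> p' + ray_integral \<phi> x p' e')"
      by (intro tendsto_diff lim p e x)
    from LIMSEQ_unique[OF this ray_difference[OF pencil_convex \<Phi> bd C pencil_ray[OF p(1) e(1)] pencil_ray[OF p(2) e(2)]
       n1[OF p(1)] n1[OF p(2)] ne[OF e(1)] ne[OF e(2)] x]]
    show ?thesis by simp
  qed
  have seg: "0 + of_real r * (1 :: complex) \<in> pencil e1 e2" if "r \<in> {0..1}" for r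
  proof -
    have "0 + of_real r * (1 :: complex) = of_real r + of_real 0 * e1 + of_real 0 * e2" by simp
    thus ?thesis using that unfolding pencil_def
      by - (rule CollectI, rule exI[of _ r], rule exI[of _ 0], rule exI[of _ 0], auto)
  qed
  have "((\<lambda>r. 1 * (exp (x * (0 + of_real r * 1)) * \<phi> (0 + of_real r * 1))) has_integral \<Phi> (0 + of_real 1 * 1) - \<Phi> 0) {0..1}"
    by (rule has_integral_along_line[where f = "\<lambda>t. exp (x * t) * \<phi> t", OF \<Phi> seg]) simp_all
  hence int: "integral {0..1} (\<lambda>t. exp (x * of_real t) * \<phi> (of_real t)) = \<Phi> 1 - \<Phi> 0"
    by (simp add: integral_unique)
  show "integral {0..1} (\<lambda>t. exp (x * of_real t) * \<phi> (of_real t)) = ray_integral \<phi> x 0 e - ray_integral \<phi> x 1 e"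
    if "e \<in> {e1, e2}" "Re (x * e) < 0"
    using eq[of 0 1 e e] that unfolding int by (simp add: algebra_simps)
  show "ray_integral \<phi> x p e1 = ray_integral \<phi> x p e2" if "p \<in> {0, 1}" "Re (x * e1) < 0" "Re (x * e2) < 0"
    using eq[of p p e1 e2] that by simp
qed

section \<open>The Borel transform\<close>

text \<open>The plane without \<open>t \<le> 0\<close> and \<open>t \<ge> 1\<close>. There
  \<open>- Ln t\<close> lies in the strip and off the cut of the outer power
  \<open>(- Ln t) powr (\<kappa> - 1)\<close>.\<close>

definition cut_plane :: "complex set" where "cut_plane = {t. Im t \<noteq> 0 \<or> 0 < Re t \<and> Re t < 1}"

text \<open>The case distinction is needed because \<open>Ln 0 = 0\<close>.\<close>

definition borel_fun :: "real \<Rightarrow> (complex \<Rightarrow> complex) \<Rightarrow> complex \<Rightarrow> complex" where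
  "borel_fun \<kappa> g t = (if t = 0 then 0 else (- Ln t) powr of_real (\<kappa> - 1) * g (- Ln t))"

lemma open_cut_plane: "open cut_plane"
proof -
  have eq: "cut_plane = {t. Im t > 0} \<union> {t. Im t < 0} \<union> ({t. Re t > 0} \<inter> {t. Re t < 1})" by (auto simp: cut_plane_def)
  show ?thesis unfolding eq by (intro open_Un open_Int open_halfspace_Im_gt open_halfspace_Im_lt open_halfspace_Re_gt open_halfspace_Re_lt)
qed

lemma cut_planeD:
  assumes "t \<in> cut_plane"
  shows "t \<noteq> 0" "t \<notin> \<real>\<^sub>\<le>\<^sub>0" "- Ln t \<in> strip" "- Ln t \<notin> \<real>\<^sub>\<le>\<^sub>0"
proof -
  show t0: "t \<noteq> 0" "t \<notin> \<real>\<^sub>\<le>\<^sub>0" using assms by (auto simp: cut_plane_def complex_nonpos_Reals_iff)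
  have "Im (Ln t) \<noteq> pi" using Im_Ln_eq_pi[OF t0(1)] t0(2) by (auto simp: complex_nonpos_Reals_iff)
  thus "- Ln t \<in> strip" using mpi_less_Im_Ln[OF t0(1)] Im_Ln_le_pi[OF t0(1)] by (auto simp: strip_def abs_if)
  show "- Ln t \<notin> \<real>\<^sub>\<le>\<^sub>0"
  proof
    assume "- Ln t \<in> \<real>\<^sub>\<le>\<^sub>0"
    hence L: "Im (Ln t) = 0" "Re (Ln t) \<ge> 0" by (auto simp: complex_nonpos_Reals_iff)
    have "Re t = exp (Re (Ln t)) * cos (Im (Ln t))" "Im t = exp (Re (Ln t)) * sin (Im (Ln t))"
      using Re_exp[of "Ln t"] Im_exp[of "Ln t"] t0(1) by simp_all
    hence "Im t = 0" "Re t \<ge> 1" using L by simp_all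
    thus False using assms by (auto simp: cut_plane_def)
  qed
qed

lemma borel_fun_holomorphic:
  assumes "g holomorphic_on strip"
  shows "borel_fun \<kappa> g holomorphic_on cut_plane"
proof -
  have L: "(\<lambda>t. - Ln t) holomorphic_on cut_plane" using cut_planeD(2) by (intro holomorphic_intros) auto
  have "(\<lambda>t. exp (of_real (\<kappa> - 1) * Ln (- Ln t)) * g (- Ln t)) holomorphic_on cut_plane"
    using cut_planeD(4) cut_planeD(3)
    by (intro holomorphic_intros L holomorphic_on_compose_gen[OF L assms, unfolded o_def]) auto
  thus ?thesis
  proof (rule holomorphic_transform)
    fix t assume t: "t \<in> cut_plane"
    have "- Ln t \<noteq> 0" using cut_planeD(4)[OF t] by auto
    thus "exp (of_real (\<kappa> - 1) * Ln (- Ln t)) * g (- Ln t) = borel_fun \<kappa> g t"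
      using cut_planeD(1)[OF t] by (simp add: borel_fun_def powr_def)
  qed
qed

lemma exp_series_row_summable:
  assumes "exp_series_coeffs I c" shows "summable (\<lambda>k. norm (c (i, k)))"
proof -
  have "(\<lambda>p. norm (c p)) summable_on Pair i ` UNIV"
    by (rule summable_on_subset_banach[of _ UNIV]) (use assms in \<open>auto simp: exp_series_coeffs_def\<close>)
  hence "((\<lambda>p. norm (c p)) \<circ> Pair i) summable_on UNIV"
    by (rule iffD1[OF summable_on_reindex, rotated]) (auto intro: inj_onI)
  hence "(\<lambda>k. norm (c (i, k))) summable_on UNIV" by (simp add: o_def)
  from has_sum_imp_sums[OF has_sum_infsum[OF this]] show ?thesis by (rule sums_summable)
qed

lemma exp_series_infsum:
  assumes c: "exp_series_coeffs I c" and e: "\<And>i k. i < I \<Longrightarrow> norm (e (i, k)) \<le> B"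
  shows "(\<Sum>\<^sub>\<infinity>p. c p * e p) = (\<Sum>i<I. \<Sum>k. c (i, k) * e (i, k))"
proof -
  have bd: "norm (c p * e p) \<le> norm (c p) * B" for p
  proof (cases "c p = 0")
    case False
    hence "fst p < I" using c unfolding exp_series_coeffs_def by (metis not_less prod.collapse)
    hence "norm (e (fst p, snd p)) \<le> B" by (rule e)
    thus ?thesis by (simp add: norm_mult mult_left_mono)
  qed simp
  have "(\<lambda>p. norm (c p) * B) summable_on UNIV"
    using c by (intro summable_on_cmult_left) (auto simp: exp_series_coeffs_def)
  hence "(\<lambda>p. norm (c p * e p)) summable_on UNIV"
    by (rule summable_on_comparison_test) (use bd in auto)
  hence s: "(\<lambda>p. c p * e p) summable_on UNIV" by (rule Infinite_Sum.abs_summable_summable)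
  hence sub: "(\<lambda>p. c p * e p) summable_on X" for X by (rule summable_on_subset_banach) auto
  have row: "(\<Sum>\<^sub>\<infinity>k. c (i, k) * e (i, k)) = (\<Sum>k. c (i, k) * e (i, k))" for i
  proof -
    have "((\<lambda>p. c p * e p) \<circ> Pair i) summable_on UNIV"
      by (rule iffD1[OF summable_on_reindex sub]) (auto intro: inj_onI)
    hence "(\<lambda>k. c (i, k) * e (i, k)) summable_on UNIV" by (simp add: o_def)
    from has_sum_imp_sums[OF has_sum_infsum[OF this]] show ?thesis by (rule sums_unique)
  qed
  have "(\<Sum>\<^sub>\<infinity>p. c p * e p) = (\<Sum>\<^sub>\<infinity>p\<in>Sigma {..<I} (\<lambda>_. UNIV). c p * e p)"
  proof (rule infsum_cong_neutral)
    fix p assume "p \<in> UNIV - Sigma {..<I} (\<lambda>_. UNIV :: nat set)"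
    thus "c p * e p = 0" using c by (cases p) (auto simp: exp_series_coeffs_def)
  qed auto
  also have "\<dots> = (\<Sum>\<^sub>\<infinity>i\<in>{..<I}. \<Sum>\<^sub>\<infinity>k. c (i, k) * e (i, k))"
    using infsum_Sigma'_banach[of "\<lambda>i k. c (i, k) * e (i, k)" "{..<I}" "\<lambda>_. UNIV"] sub[of "Sigma {..<I} (\<lambda>_. UNIV)"]
    by (simp add: case_prod_unfold)
  also have "\<dots> = (\<Sum>i<I. \<Sum>k. c (i, k) * e (i, k))" by (simp add: row)
  finally show ?thesis .
qed

lemma pterm_real: "r > 0 \<Longrightarrow> pterm 0 (of_real \<gamma>) i r = of_real (r powr \<gamma> * ln r ^ i)"
  by (simp add: pterm_def complex_of_real_def[symmetric] powr_def exp_of_real[symmetric])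

text \<open>Integration by parts lowers the power of the logarithm; the boundary term at 1 survives
  only when no logarithm is present.\<close>

lemma integral_pterm:
  assumes \<gamma>: "\<gamma> > 0"
  shows "integral {0..1} (pterm 0 (of_real \<gamma>) i) = (- 1) ^ i * fact i / (of_real \<gamma> + 1) ^ Suc i"
proof -
  have cont: "continuous_on {0..1} (pterm 0 (of_real a) i)" if "a > 0" for a i
    using poly_growth_pterm[of "of_real a" 0 i] that by (auto simp: poly_growth_def intro: continuous_on_subset)
  have int: "(pterm 0 (of_real \<gamma>) i has_integral integral {0..1} (pterm 0 (of_real \<gamma>) i)) {0..1}" for i
    by (intro integrable_integral integrable_continuous_real cont \<gamma>)
  have ftc: "of_real (\<gamma> + 1) * integral {0..1} (pterm 0 (of_real \<gamma>) i) + of_nat i * integral {0..1} (pterm 0 (of_real \<gamma>) (i - 1))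
      = (if i = 0 then 1 else 0)" for i
  proof -
    define D where "D = (\<lambda>t. of_real (\<gamma> + 1) * pterm 0 (of_real \<gamma>) i t + of_nat i * pterm 0 (of_real \<gamma>) (i - 1) t)"
    have "(D has_integral pterm 0 (of_real (\<gamma> + 1)) i 1 - pterm 0 (of_real (\<gamma> + 1)) i 0) {0..1}"
    proof (rule fundamental_theorem_of_calculus_interior)
      show "continuous_on {0..1} (pterm 0 (of_real (\<gamma> + 1)) i)" using \<gamma> by (intro cont) simp
      fix t :: real assume t: "t \<in> {0<..<1}"
      have "((\<lambda>t. t powr (\<gamma> + 1) * ln t ^ i) has_real_derivative ((\<gamma> + 1) * (t powr \<gamma> * ln t ^ i) + real i * (t powr \<gamma> * ln t ^ (i - 1)))) (at t)"
      proof -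
        have t0: "t > 0" using t by simp
        have p: "t powr (\<gamma> + 1) = t * t powr \<gamma>" using t0 by (simp add: powr_add)
        have "((\<lambda>t. t powr (\<gamma> + 1)) has_real_derivative (\<gamma> + 1) * t powr \<gamma>) (at t)"
          using has_real_derivative_powr[OF t0, of "\<gamma> + 1"] by simp
        from DERIV_mult[OF this DERIV_power[OF DERIV_ln_divide[OF t0], of i]]
        show ?thesis unfolding p using t0 by (simp add: mult_ac)
      qed
      hence "((\<lambda>t. t powr (\<gamma> + 1) * ln t ^ i) has_vector_derivative ((\<gamma> + 1) * (t powr \<gamma> * ln t ^ i) + real i * (t powr \<gamma> * ln t ^ (i - 1)))) (at t)"
        by (simp add: has_real_derivative_iff_has_vector_derivative)
      from bounded_linear.has_vector_derivative[OF bounded_linear_of_real this]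
      have "((\<lambda>t. of_real (t powr (\<gamma> + 1) * ln t ^ i)) has_vector_derivative D t) (at t)"
        unfolding D_def using t by (simp add: pterm_real)
      thus "(pterm 0 (of_real (\<gamma> + 1)) i has_vector_derivative D t) (at t)"
        by (rule has_vector_derivative_transform_within_open[of _ _ _ "{0<..}"]) (use t pterm_real[of _ "\<gamma> + 1" i] in auto)
    qed simp
    moreover have "(D has_integral of_real (\<gamma> + 1) * integral {0..1} (pterm 0 (of_real \<gamma>) i) + of_nat i * integral {0..1} (pterm 0 (of_real \<gamma>) (i - 1))) {0..1}"
      unfolding D_def by (intro has_integral_add has_integral_mult_right int)
    moreover have "pterm 0 (of_real (\<gamma> + 1)) i 1 = (if i = 0 then 1 else 0)" using pterm_real[of 1 "\<gamma> + 1" i] by simp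
    moreover have "pterm 0 (of_real (\<gamma> + 1)) i 0 = 0" by (simp add: pterm_def)
    ultimately show ?thesis by (metis diff_zero has_integral_unique)
  qed
  have nz: "complex_of_real \<gamma> + 1 \<noteq> 0" using \<gamma> by (auto simp: complex_eq_iff)
  show ?thesis
  proof (induction i)
    case 0
    show ?case using ftc[of 0] nz by (simp add: field_simps)
  next
    case (Suc i)
    have "(of_real \<gamma> + 1) * integral {0..1} (pterm 0 (of_real \<gamma>) (Suc i)) = - (of_nat (Suc i) * integral {0..1} (pterm 0 (of_real \<gamma>) i))"
      using ftc[of "Suc i"] by (simp add: eq_neg_iff_add_eq_0)
    hence "integral {0..1} (pterm 0 (of_real \<gamma>) (Suc i)) = - (of_nat (Suc i) * integral {0..1} (pterm 0 (of_real \<gamma>) i)) / (of_real \<gamma> + 1)"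
      using nz by (simp add: field_simps)
    thus ?case unfolding Suc.IH by (simp add: mult_ac)
  qed
qed

lemma powr_le_exp: "x \<ge> 0 \<Longrightarrow> a \<ge> 0 \<Longrightarrow> x powr a \<le> exp (a * x)" for x a :: real
  using ln_bound[of x] by (cases "x = 0") (auto simp: powr_def intro!: mult_left_mono)

section \<open>The convolved kernel as a function on the cut plane\<close>

locale borel =
  fixes q :: nat and \<kappa> :: real and g :: "complex \<Rightarrow> complex" and f :: "bool \<times> real \<Rightarrow> complex" and I :: nat
    and c :: "nat \<times> nat \<Rightarrow> complex"
  assumes q: "q > 0" and data: "borel_data q \<kappa> g f I" and c: "exp_series_coeffs I c"
    and fc: "\<And>z. snd z > 0 \<Longrightarrow> f z = (\<Sum>\<^sub>\<infinity>p. c p * exp_monom q z p)"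
begin

abbreviation \<phi> where "\<phi> \<equiv> borel_fun \<kappa> g"

lemma kappa: "\<kappa> \<ge> 2" and g_holomorphic: "g holomorphic_on strip"
  and f_True: "w > 0 \<Longrightarrow> f (True, w) = of_real w powr of_real (\<kappa> - 1) * g (of_real w)"
  using data by (auto simp: borel_data_def)

lemma c_0: "c (i, 0) = 0" and c_ge: "i \<ge> I \<Longrightarrow> c (i, k) = 0" using c by (auto simp: exp_series_coeffs_def)

text \<open>The right-hand side is a polynomial in w whose coefficients are power series in
  \<open>exp (- w / q)\<close>, convergent for \<open>Re w > 0\<close>. Both sides agree for
  positive w, and the identity theorem covers the right half of the strip.\<close>

lemma series:
  assumes w: "w \<in> strip" "Re w > 0"
  shows "w powr of_real (\<kappa> - 1) * g w = (\<Sum>i<I. \<Sum>k. c (i, k) * (w ^ i * exp (- (of_nat k / of_nat q) * w)))"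
proof -
  define P where "P = (\<lambda>i u. \<Sum>k. c (i, k) * u ^ k)"
  have sums: "(\<lambda>k. c (i, k) * u ^ k) sums P i u" if "norm u < 1" for i u
    unfolding P_def
  proof (rule summable_sums, rule summable_comparison_test'[OF exp_series_row_summable[OF c, of i], of 0])
    fix k
    show "norm (c (i, k) * u ^ k) \<le> norm (c (i, k))"
      using that by (simp add: norm_mult norm_power mult_left_le power_le_one)
  qed
  have Ph: "P i holomorphic_on ball 0 1" for i
    by (rule power_series_holomorphic[of 0 1 "\<lambda>k. c (i, k)"]) (use sums in auto)
  have row: "w ^ i * P i (exp (- w / of_nat q)) = (\<Sum>k. c (i, k) * (w ^ i * exp (- (of_nat k / of_nat q) * w)))" if "Re w > 0" for w i
  proof -
    have e1: "exp (- w / of_nat q) ^ k = exp (- (of_nat k / of_nat q) * w)" for k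
      by (simp add: exp_of_nat_mult[symmetric])
    have "norm (exp (- w / of_nat q)) < 1" using that q by (simp add: norm_exp_eq_Re Re_divide_of_nat)
    from sums_mult[OF sums[OF this], of "w ^ i" i] show ?thesis unfolding e1 by (simp add: sums_iff mult_ac)
  qed
  define D where "D = strip \<inter> {w. Re w > 0}"
  define F where "F = (\<lambda>w. exp (of_real (\<kappa> - 1) * Ln w) * g w - (\<Sum>i<I. w ^ i * P i (exp (- w / of_nat q))))"
  have "F w = 0"
  proof (rule analytic_continuation[of F D "of_real ` {0<..}" 1])
    have "(\<lambda>w. P i (exp (- w / of_nat q))) holomorphic_on D" for i
      by (rule holomorphic_on_compose_gen[OF _ Ph, unfolded o_def])
         (use q in \<open>auto intro!: holomorphic_intros simp: D_def norm_exp_eq_Re Re_divide_of_nat\<close>)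
    thus "F holomorphic_on D" unfolding F_def
      by (intro holomorphic_intros holomorphic_on_subset[OF g_holomorphic]) (auto simp: D_def complex_nonpos_Reals_iff)
    show "(1::complex) islimpt of_real ` {0<..}"
    proof (rule islimptI)
      fix T :: "complex set" assume T: "1 \<in> T" "open T"
      then obtain e where e: "e > 0" "ball 1 e \<subseteq> T" by (meson openE)
      have "complex_of_real (1 + e / 2) \<in> ball 1 e" using e(1) by (simp add: dist_norm)
      thus "\<exists>y\<in>complex_of_real ` {0<..}. y \<in> T \<and> y \<noteq> 1"
        using e by (intro bexI[of _ "of_real (1 + e / 2)"]) (auto simp: complex_eq_iff)
    qed
    show "open D" unfolding D_def by (intro open_Int strip_open open_halfspace_Re_gt)
    show "connected D" unfolding D_def by (intro convex_connected convex_Int strip_convex convex_halfspace_Re_gt)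
    show "complex_of_real ` {0<..} \<subseteq> D" using strip_of_real by (auto simp: D_def)
    show "1 \<in> D" using strip_of_real[of 1] by (simp add: D_def)
    show "w \<in> D" using w by (simp add: D_def)
    fix z :: complex assume "z \<in> of_real ` {0<..}"
    then obtain x where x: "x > 0" "z = of_real x" by auto
    have "of_real x powr of_real (\<kappa> - 1) * g (of_real x) = (\<Sum>\<^sub>\<infinity>p. c p * exp_monom q (True, x) p)"
      using f_True[OF x(1)] fc[of "(True, x)"] x(1) by simp
    also have "\<dots> = (\<Sum>i<I. \<Sum>k. c (i, k) * exp_monom q (True, x) (i, k))"
    proof (rule exp_series_infsum[OF c])
      fix i k assume i: "i < I"
      have "exp (- (real k / real q * x)) \<le> 1" using x(1) by simp
      hence "x ^ i * exp (- (real k / real q * x)) \<le> x ^ i * 1" using x(1) by (intro mult_left_mono) auto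
      also have "\<dots> \<le> (\<Sum>i<I. x ^ i)" using i x(1) member_le_sum[of i "{..<I}" "\<lambda>i. x ^ i"] by simp
      finally show "norm (exp_monom q (True, x) (i, k)) \<le> (\<Sum>i<I. x ^ i)"
        unfolding exp_monom_True norm_of_real using x(1) by simp
    qed
    also have "\<dots> = (\<Sum>i<I. z ^ i * P i (exp (- z / of_nat q)))"
      unfolding x(2) using x(1) by (intro sum.cong refl, subst row) (simp_all add: exp_monom_True exp_of_real[symmetric])
    finally show "F z = 0" using x by (simp add: F_def powr_def)
  qed
  hence "w powr of_real (\<kappa> - 1) * g w = (\<Sum>i<I. w ^ i * P i (exp (- w / of_nat q)))"
    using w(2) by (auto simp: F_def powr_def)
  thus ?thesis using row[OF w(2)] by simp
qed

text \<open>Only indices \<open>k \<ge> 1\<close> occur, so every term contains \<open>t\<close> to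
  a power of at least \<open>1/q\<close>. Half of it pays for the logarithms, uniformly in the
  argument because the imaginary part of \<open>Ln t\<close> is bounded by \<pi>.\<close>

lemma borel_fun_small: "\<exists>M\<ge>0. \<forall>t\<in>insert 0 cut_plane. norm t \<le> 1 / 2 \<longrightarrow> norm (\<phi> t) \<le> M * norm t powr (1 / (2 * real q))"
proof -
  define s where "s = 1 / (2 * real q)"
  have s: "0 < s" "s \<le> 1" "s + s = 1 / real q" using q by (auto simp: s_def field_simps)
  have "\<exists>C\<ge>1. \<forall>r>0. r powr s * (\<bar>ln r\<bar> + pi) ^ i \<le> C * (1 + r) ^ (i + 1)" for i
    by (rule log_power_bound[OF s(1,2)]) simp
  hence "\<exists>C. \<forall>i. C i \<ge> 1 \<and> (\<forall>r>0. r powr s * (\<bar>ln r\<bar> + pi) ^ i \<le> C i * (1 + r) ^ (i + 1))" by (intro choice allI)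
  then obtain C where C: "\<And>i. C i \<ge> 1" "\<And>i r. r > 0 \<Longrightarrow> r powr s * (\<bar>ln r\<bar> + pi) ^ i \<le> C i * (1 + r) ^ (i + 1)" by auto
  define S where "S = (\<lambda>i. \<Sum>k. norm (c (i, k)))"
  have S0: "S i \<ge> 0" for i unfolding S_def by (intro suminf_nonneg exp_series_row_summable[OF c]) auto
  define M where "M = (\<Sum>i<I. S i * (C i * 2 ^ (i + 1)))"
  have M0: "M \<ge> 0" unfolding M_def using S0 C(1) by (intro sum_nonneg mult_nonneg_nonneg) (auto intro: order_trans[OF zero_le_one])
  have "norm (\<phi> t) \<le> M * norm t powr s" if t: "t \<in> cut_plane" "norm t \<le> 1 / 2" for t
  proof -
    define r where "r = norm t"
    define w where "w = - Ln t"
    have t0: "t \<noteq> 0" and r: "r > 0" "r \<le> 1 / 2" using cut_planeD(1)[OF t(1)] t(2) by (auto simp: r_def)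
    have Rew: "Re w = - ln r" using t0 by (simp add: w_def r_def)
    have ln: "ln r < 0" using r by simp
    have nw: "norm w \<le> \<bar>ln r\<bar> + pi"
      using cmod_le[of w] Rew mpi_less_Im_Ln[OF t0] Im_Ln_le_pi[OF t0] by (simp add: w_def abs_if split: if_splits)
    have "\<phi> t = (\<Sum>i<I. \<Sum>k. c (i, k) * (w ^ i * exp (- (of_nat k / of_nat q) * w)))"
    proof -
      have "w \<in> strip" "Re w > 0" using cut_planeD(3)[OF t(1)] Rew ln by (auto simp: w_def)
      from series[OF this] show ?thesis using t0 unfolding borel_fun_def w_def[symmetric] by simp
    qed
    also have "norm \<dots> \<le> (\<Sum>i<I. S i * (C i * 2 ^ (i + 1)) * r powr s)"
    proof (rule sum_norm_le)
      fix i
      have "norm (c (i, k) * (w ^ i * exp (- (of_nat k / of_nat q) * w))) \<le> norm (c (i, k)) * (C i * 2 ^ (i + 1) * r powr s)" for k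
      proof (cases "k = 0")
        case False
        have "- (of_nat k / of_nat q) * w = - (of_real (real k / real q) * w)" by simp
        hence "Re (- (of_nat k / of_nat q) * w) = (real k / real q) * ln r" using Rew by (simp del: of_real_divide)
        also have "\<dots> \<le> (1 / real q) * ln r" using ln q False by (intro mult_right_mono_neg divide_right_mono) auto
        finally have "norm (exp (- (of_nat k / of_nat q) * w)) \<le> r powr (s + s)" using r s(3) by (simp add: norm_exp_eq_Re powr_def)
        hence "norm (w ^ i * exp (- (of_nat k / of_nat q) * w)) \<le> (\<bar>ln r\<bar> + pi) ^ i * r powr (s + s)"
          unfolding norm_mult norm_power using nw by (intro mult_mono power_mono) auto
        also have "\<dots> = r powr s * (\<bar>ln r\<bar> + pi) ^ i * r powr s" unfolding powr_add by (simp only: mult_ac)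
        also have "\<dots> \<le> C i * (1 + r) ^ (i + 1) * r powr s" using C(2)[OF r(1), of i] by (intro mult_right_mono) auto
        also have "\<dots> \<le> C i * 2 ^ (i + 1) * r powr s"
          using r order_trans[OF zero_le_one C(1)[of i]] by (intro mult_right_mono mult_left_mono power_mono) auto
        finally show ?thesis by (subst norm_mult) (intro mult_left_mono, auto)
      qed (simp add: c_0)
      hence "norm (\<Sum>k. c (i, k) * (w ^ i * exp (- (of_nat k / of_nat q) * w))) \<le> (\<Sum>k. norm (c (i, k)) * (C i * 2 ^ (i + 1) * r powr s))"
        by (intro norm_suminf_le summable_mult2 exp_series_row_summable[OF c])
      also have "\<dots> = S i * (C i * 2 ^ (i + 1)) * r powr s"
        unfolding S_def by (subst suminf_mult2[symmetric]) (auto intro: exp_series_row_summable[OF c])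
      finally show "norm (\<Sum>k. c (i, k) * (w ^ i * exp (- (of_nat k / of_nat q) * w))) \<le> S i * (C i * 2 ^ (i + 1)) * r powr s" .
    qed
    also have "\<dots> = M * r powr s" by (simp only: M_def sum_distrib_right)
    finally show ?thesis unfolding r_def .
  qed
  moreover have "norm (\<phi> 0) \<le> M * norm (0 :: complex) powr s" by (simp add: borel_fun_def)
  ultimately show ?thesis using M0 unfolding s_def by (intro exI[of _ M]) auto
qed

text \<open>Since \<open>\<kappa> \<ge> 2\<close> a full factor \<open>norm w\<close> can be split
  off, which forces the kernel to vanish at t = 1; the remaining power of w is absorbed by the
  exponential.\<close>

lemma strip_bound: "\<exists>K\<ge>0. \<forall>w\<in>strip. norm (w powr of_real (\<kappa> - 1) * g w) \<le> K * (norm w * exp (K * norm w))"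
proof -
  obtain K where K: "K \<ge> 0" "\<And>w. w \<in> strip \<Longrightarrow> norm (g w) \<le> K * exp (K * norm w)" using data by (auto simp: borel_data_def)
  define L where "L = K + (\<kappa> - 2)"
  have "norm (w powr of_real (\<kappa> - 1) * g w) \<le> L * (norm w * exp (L * norm w))" if w: "w \<in> strip" for w
  proof (cases "w = 0")
    case False
    have "norm (w powr of_real (\<kappa> - 1)) = norm w powr (1 + (\<kappa> - 2))" by (simp add: norm_powr_real_powr')
    also have "\<dots> = norm w * norm w powr (\<kappa> - 2)" using False by (subst powr_add) simp
    also have "\<dots> \<le> norm w * exp ((\<kappa> - 2) * norm w)" using kappa by (intro mult_left_mono powr_le_exp) auto
    finally have "norm (w powr of_real (\<kappa> - 1) * g w) \<le> (norm w * exp ((\<kappa> - 2) * norm w)) * (K * exp (K * norm w))"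
      unfolding norm_mult by (intro mult_mono K(2)[OF w]) auto
    also have "\<dots> = K * (norm w * exp (L * norm w))" unfolding L_def distrib_right exp_add by (simp only: mult_ac)
    also have "\<dots> \<le> L * (norm w * exp (L * norm w))" using kappa by (intro mult_right_mono) (auto simp: L_def)
    finally show ?thesis .
  qed simp
  thus ?thesis using K(1) kappa by (intro exI[of _ L]) (auto simp: L_def)
qed

lemma borel_fun_growth: "\<exists>C\<ge>0. \<exists>N. \<forall>t\<in>cut_plane \<union> {0, 1}. norm (\<phi> t) \<le> C * (1 + norm t) ^ N"
proof -
  obtain M where M: "M \<ge> 0" "\<And>t. t \<in> insert 0 cut_plane \<Longrightarrow> norm t \<le> 1 / 2 \<Longrightarrow> norm (\<phi> t) \<le> M * norm t powr (1 / (2 * real q))"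
    using borel_fun_small by blast
  obtain K where K: "K \<ge> 0" "\<And>w. w \<in> strip \<Longrightarrow> norm (w powr of_real (\<kappa> - 1) * g w) \<le> K * (norm w * exp (K * norm w))"
    using strip_bound by blast
  \<comment> \<open>The degree of growth in t. The additional 1 comes from estimating the factor
    \<open>norm w\<close> by \<open>exp (norm w)\<close>.\<close>
  define L where "L = nat \<lceil>K + 1\<rceil>"
  define C where "C = M + K * exp (real L * pi) * 2 ^ L"
  have C0: "C \<ge> 0" using M(1) K(1) by (simp add: C_def)
  have "norm (\<phi> t) \<le> C * (1 + norm t) ^ L" if t: "t \<in> cut_plane \<union> {0, 1}" for t
  proof (cases "norm t \<le> 1 / 2")
    case True
    hence "t \<in> insert 0 cut_plane" using t by auto
    hence "norm (\<phi> t) \<le> M * norm t powr (1 / (2 * real q))" using True by (rule M(2))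
    also have "\<dots> \<le> M * 1" using True M(1) by (intro mult_left_mono powr_le1) auto
    also have "\<dots> \<le> C * 1" using K(1) by (simp add: C_def)
    also have "\<dots> \<le> C * (1 + norm t) ^ L" using C0 by (intro mult_left_mono one_le_power) auto
    finally show ?thesis .
  next
    case False
    define r where "r = norm t"
    have r: "r > 1 / 2" using False by (simp add: r_def)
    hence t0: "t \<noteq> 0" by (auto simp: r_def)
    define w where "w = - Ln t"
    have ws: "w \<in> strip" using t t0 cut_planeD(3) strip_0 by (auto simp: w_def)
    have Rew: "Re w = - ln r" using t0 by (simp add: w_def r_def)
    have "\<bar>Im w\<bar> \<le> pi" using mpi_less_Im_Ln[OF t0] Im_Ln_le_pi[OF t0] by (simp add: w_def abs_if)
    hence nw: "norm w \<le> \<bar>ln r\<bar> + pi" using cmod_le[of w] unfolding Rew by simp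
    have el: "exp \<bar>ln r\<bar> \<le> 2 * (1 + r)"
    proof (cases "r \<ge> 1")
      case True
      thus ?thesis by simp
    next
      case False
      hence "exp \<bar>ln r\<bar> = 1 / r" using r by (simp add: abs_if exp_minus ln_less_zero_iff field_simps)
      also have "\<dots> \<le> 2" using r by (simp add: field_simps)
      finally show ?thesis using r by simp
    qed
    have "norm (\<phi> t) \<le> K * (norm w * exp (K * norm w))" using K(2)[OF ws] t0 by (simp add: borel_fun_def w_def)
    also have "\<dots> \<le> K * (exp (norm w) * exp (K * norm w))"
      using K(1) order_trans[OF _ exp_ge_add_one_self[of "norm w"], of "norm w"] by (intro mult_left_mono mult_right_mono) auto
    also have "\<dots> = K * exp ((K + 1) * norm w)" by (simp add: exp_add[symmetric] algebra_simps)
    also have "\<dots> \<le> K * exp (real L * (\<bar>ln r\<bar> + pi))"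
      using K(1) nw by (intro mult_left_mono iffD2[OF exp_le_cancel_iff] mult_mono) (auto simp: L_def intro: real_nat_ceiling_ge)
    also have "\<dots> = K * exp (real L * pi) * exp \<bar>ln r\<bar> ^ L" by (simp add: distrib_left exp_add exp_of_nat_mult mult_ac)
    also have "\<dots> \<le> K * exp (real L * pi) * (2 * (1 + r)) ^ L" using K(1) el by (intro mult_left_mono power_mono) auto
    also have "\<dots> = (K * exp (real L * pi) * 2 ^ L) * (1 + r) ^ L" by (simp only: power_mult_distrib mult.assoc)
    also have "\<dots> \<le> C * (1 + r) ^ L" using M(1) r by (intro mult_right_mono) (auto simp: C_def)
    finally show ?thesis unfolding r_def .
  qed
  thus ?thesis using C0 by blast
qed

text \<open>Holomorphy covers the cut plane; at 0 and at 1 the kernel is squeezed to 0 by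
  \<open>borel_fun_small\<close> and \<open>strip_bound\<close>.\<close>

lemma borel_fun_continuous: "continuous_on (cut_plane \<union> {0, 1}) \<phi>"
  unfolding continuous_on_eq_continuous_within
proof
  fix t assume t: "t \<in> cut_plane \<union> {0, 1}"
  obtain M where M: "M \<ge> 0" "\<And>t. t \<in> insert 0 cut_plane \<Longrightarrow> norm t \<le> 1 / 2 \<Longrightarrow> norm (\<phi> t) \<le> M * norm t powr (1 / (2 * real q))"
    using borel_fun_small by blast
  obtain K where K: "K \<ge> 0" "\<And>w. w \<in> strip \<Longrightarrow> norm (w powr of_real (\<kappa> - 1) * g w) \<le> K * (norm w * exp (K * norm w))"
    using strip_bound by blast
  consider "t \<in> cut_plane" | "t = 0" | "t = 1" using t by auto
  thus "continuous (at t within cut_plane \<union> {0, 1}) \<phi>"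
  proof cases
    case 1
    have "continuous_on cut_plane \<phi>"
      by (intro holomorphic_on_imp_continuous_on borel_fun_holomorphic g_holomorphic)
    hence "isCont \<phi> t" using 1 open_cut_plane by (simp add: continuous_on_eq_continuous_at)
    thus ?thesis by (rule continuous_at_imp_continuous_at_within)
  next
    case 2
    have "((\<lambda>t::complex. M * norm t powr (1 / (2 * real q))) \<longlongrightarrow> 0) (at 0 within cut_plane \<union> {0, 1})"
    proof (intro tendsto_mult_right_zero tendsto_zero_powrI[where b = "1 / (2 * real q)"])
      show "(norm \<longlongrightarrow> 0) (at (0 :: complex) within cut_plane \<union> {0, 1})"
        by (rule tendsto_norm_zero) (rule tendsto_ident_at)
    qed (use q in auto)
    moreover have "eventually (\<lambda>t. norm (\<phi> t) \<le> M * norm t powr (1 / (2 * real q))) (at 0 within cut_plane \<union> {0, 1})"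
      unfolding eventually_at using M(2) by (intro exI[of _ "1 / 2"]) (auto simp: dist_norm)
    ultimately have "(\<phi> \<longlongrightarrow> 0) (at 0 within cut_plane \<union> {0, 1})" by (rule Lim_null_comparison[rotated])
    thus ?thesis unfolding 2 continuous_within by (simp add: borel_fun_def)
  next
    case 3
    have "((\<lambda>t. K * (norm (- Ln t) * exp (K * norm (- Ln t)))) \<longlongrightarrow> K * (norm (- Ln 1) * exp (K * norm (- Ln 1)))) (at 1 within cut_plane \<union> {0, 1})"
      by (intro tendsto_intros) auto
    hence "((\<lambda>t. K * (norm (- Ln t) * exp (K * norm (- Ln t)))) \<longlongrightarrow> 0) (at 1 within cut_plane \<union> {0, 1})" by simp
    moreover have "eventually (\<lambda>t. norm (\<phi> t) \<le> K * (norm (- Ln t) * exp (K * norm (- Ln t)))) (at 1 within cut_plane \<union> {0, 1})"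
      unfolding eventually_at
    proof (intro exI[of _ 1] conjI ballI impI)
      fix t :: complex assume t: "t \<in> cut_plane \<union> {0, 1}" "t \<noteq> 1 \<and> dist t 1 < 1"
      hence "t \<in> cut_plane" by (auto simp: dist_norm)
      thus "norm (\<phi> t) \<le> K * (norm (- Ln t) * exp (K * norm (- Ln t)))"
        using K(2)[OF cut_planeD(3)] cut_planeD(1) by (simp add: borel_fun_def)
    qed simp
    ultimately have "(\<phi> \<longlongrightarrow> 0) (at 1 within cut_plane \<union> {0, 1})" by (rule Lim_null_comparison[rotated])
    thus ?thesis unfolding 3 continuous_within by (simp add: borel_fun_def)
  qed
qed

text \<open>Term by term: integrating \<open>t powr \<gamma> * ln t ^ i\<close> over [0, 1]
  reproduces the monomial of the transform at \<open>n + 1\<close>. The two families represented by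
  \<open>c\<close> are linked by an actual integral only here.\<close>

lemma moments: "((\<lambda>t. of_real t ^ n * \<phi> (of_real t)) has_integral f (False, real n + 1)) {0..1}"
proof -
  obtain C where C: "C \<ge> 1" "\<And>i r. i < I \<Longrightarrow> r > 0 \<Longrightarrow> r powr (1 / real q) * (\<bar>ln r\<bar> + \<bar>0\<bar>) ^ i \<le> C * (1 + r) ^ (i + 1)"
    using pterm_lattice_bound[OF q, of I 0] by blast
  define \<gamma> where "\<gamma> = (\<lambda>k::nat. real n + real k / real q)"
  define h where "h = (\<lambda>p t. c p * ((- 1) ^ fst p * pterm 0 (of_real (\<gamma> (snd p))) (fst p) t))"
  have \<gamma>0: "\<gamma> k > 0" if "c (i, k) \<noteq> 0" for i k
  proof -
    have "k \<noteq> 0" using that c_0 by (intro notI) auto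
    hence "0 < real k / real q" using q by simp
    thus ?thesis unfolding \<gamma>_def by linarith
  qed
  have H: "((\<lambda>t. \<Sum>\<^sub>\<infinity>p. h p t) has_integral (\<Sum>\<^sub>\<infinity>p. integral {0..1} (h p))) {0..1}"
  proof (rule has_integral_infsum(1)[where M = "\<lambda>p. norm (c p) * (C * 2 ^ (I + 1))"])
    show "(\<lambda>p. norm (c p) * (C * 2 ^ (I + 1))) summable_on UNIV"
      using c by (intro summable_on_cmult_left) (auto simp: exp_series_coeffs_def)
    fix p :: "nat \<times> nat"
    obtain i k where p: "p = (i, k)" by force
    show "continuous_on {0..1} (h p)"
    proof (cases "c p = 0")
      case False
      have "poly_growth (pterm 0 (of_real (\<gamma> k)) i)" by (rule poly_growth_pterm) (use \<gamma>0 False p in simp)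
      hence "continuous_on {0..1} (pterm 0 (of_real (\<gamma> k)) i)" by (auto simp: poly_growth_def intro: continuous_on_subset)
      thus ?thesis unfolding h_def p by (auto intro!: continuous_intros)
    qed (simp add: h_def)
    fix t :: real assume t: "t \<in> {0..1}"
    show "norm (h p t) \<le> norm (c p) * (C * 2 ^ (I + 1))"
    proof (cases "c p = 0 \<or> t = 0")
      case True
      thus ?thesis using C(1) by (auto simp: h_def pterm_def)
    next
      case False
      hence cp: "c (i, k) \<noteq> 0" and t0: "t > 0" "t \<le> 1" using p t by auto
      have i: "i < I" using cp c_ge by (meson not_less)
      have k: "k \<ge> 1" using cp c_0 by (cases k) auto
      have "norm (pterm 0 (of_real (\<gamma> k)) i t) = t powr \<gamma> k * \<bar>ln t\<bar> ^ i"
        unfolding pterm_real[OF t0(1)] norm_of_real abs_mult power_abs by simp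
      also have "\<dots> \<le> t powr (1 / real q) * \<bar>ln t\<bar> ^ i"
      proof (intro mult_right_mono powr_mono')
        have "1 / real q \<le> real k / real q" using k q by (intro divide_right_mono) auto
        thus "1 / real q \<le> \<gamma> k" by (simp add: \<gamma>_def)
      qed (use t0 in auto)
      also have "\<dots> \<le> C * (1 + t) ^ (i + 1)" using C(2)[OF i t0(1)] by simp
      also have "\<dots> \<le> C * 2 ^ (i + 1)" using t0 C(1) by (intro mult_left_mono power_mono) auto
      also have "\<dots> \<le> C * 2 ^ (I + 1)" using i C(1) by (intro mult_left_mono power_increasing) auto
      finally show ?thesis unfolding h_def p by (simp add: norm_mult norm_power mult_left_mono)
    qed
  qed
  moreover have "(\<Sum>\<^sub>\<infinity>p. integral {0..1} (h p)) = f (False, real n + 1)"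
  proof -
    have "integral {0..1} (h p) = c p * exp_monom q (False, real n + 1) p" for p
    proof (cases "c p = 0")
      case False
      obtain i k where p: "p = (i, k)" by force
      have "integral {0..1} (h p) = c p * ((- 1) ^ i * ((- 1) ^ i * fact i / (of_real (\<gamma> k) + 1) ^ Suc i))"
        unfolding h_def p fst_conv snd_conv using integral_pterm[OF \<gamma>0, of i k i] False p by simp
      also have "(- 1) ^ i * ((- 1) ^ i * fact i / (of_real (\<gamma> k) + 1) ^ Suc i) = fact i / (of_real (\<gamma> k) + 1 :: complex) ^ Suc i"
        by (simp add: power_mult_distrib[symmetric])
      also have "\<dots> = exp_monom q (False, real n + 1) p" unfolding p exp_monom_False \<gamma>_def by (simp add: add_ac)
      finally show ?thesis .
    qed (simp add: h_def)
    thus ?thesis using fc[of "(False, real n + 1)"] by simp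
  qed
  ultimately have "((\<lambda>t. \<Sum>\<^sub>\<infinity>p. h p t) has_integral f (False, real n + 1)) {0..1}" by simp
  thus ?thesis
  proof (rule has_integral_spike_finite[of "{0, 1}", rotated 2])
    fix t :: real assume "t \<in> {0..1} - {0, 1}"
    hence t: "0 < t" "t < 1" by auto
    define w where "w = - ln t"
    have w: "w > 0" using t by (simp add: w_def)
    have "\<phi> (of_real t) = f (True, w)" using f_True[OF w] t by (simp add: borel_fun_def w_def Ln_of_real)
    also have "\<dots> = (\<Sum>\<^sub>\<infinity>p. c p * exp_monom q (True, w) p)" by (rule fc) (use w in simp)
    finally have "of_real t ^ n * \<phi> (of_real t) = (\<Sum>\<^sub>\<infinity>p. of_real t ^ n * (c p * exp_monom q (True, w) p))"
      by (simp add: infsum_cmult_right')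
    also have "\<dots> = (\<Sum>\<^sub>\<infinity>p. h p t)"
    proof (rule infsum_cong)
      fix p :: "nat \<times> nat"
      obtain i k where p: "p = (i, k)" by force
      have "t ^ n * (w ^ i * exp (- (real k / real q * w))) = (- 1) ^ i * (t powr \<gamma> k * ln t ^ i)"
      proof -
        have "w ^ i = (- 1) ^ i * ln t ^ i" unfolding w_def by (rule power_minus)
        moreover have "t powr \<gamma> k = t ^ n * exp (- (real k / real q * w))"
          unfolding \<gamma>_def powr_add powr_realpow[OF t(1)] using t by (simp add: powr_def w_def)
        ultimately show ?thesis by (simp only: mult_ac)
      qed
      hence "of_real (t ^ n * (w ^ i * exp (- (real k / real q * w)))) = (of_real ((- 1) ^ i * (t powr \<gamma> k * ln t ^ i)) :: complex)" by (rule arg_cong)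
      hence "of_real t ^ n * exp_monom q (True, w) p = (- 1) ^ i * pterm 0 (of_real (\<gamma> k)) i t"
        unfolding p exp_monom_True pterm_real[OF t(1)] by simp
      hence "c p * (of_real t ^ n * exp_monom q (True, w) p) = h p t" unfolding h_def p by simp
      thus "of_real t ^ n * (c p * exp_monom q (True, w) p) = h p t" by (simp add: mult_ac)
    qed
    finally show "of_real t ^ n * \<phi> (of_real t) = (\<Sum>\<^sub>\<infinity>p. h p t)" .
  qed simp
qed

lemma exp_transform_sums:
  "(\<lambda>n. x ^ n / fact n * f (False, real n + 1)) sums integral {0..1} (\<lambda>t. exp (x * of_real t) * \<phi> (of_real t))"
proof -
  obtain C N where C: "C \<ge> 0" "\<And>t. t \<in> cut_plane \<union> {0, 1} \<Longrightarrow> norm (\<phi> t) \<le> C * (1 + norm t) ^ N"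
    using borel_fun_growth by blast
  have mem: "complex_of_real t \<in> cut_plane \<union> {0, 1}" if "t \<in> {0..1}" for t
    using that by (auto simp: cut_plane_def)
  define h where "h = (\<lambda>n t. x ^ n / fact n * (of_real t ^ n * \<phi> (of_real t)))"
  define M where "M = (\<lambda>n. norm x ^ n / fact n * (C * 2 ^ N))"
  have cont: "continuous_on {0..1} (h n)" for n
  proof -
    have "complex_of_real ` {0..1} \<subseteq> cut_plane \<union> {0, 1}" using mem by blast
    hence "continuous_on {0..1} (\<lambda>t. \<phi> (complex_of_real t))"
      by (intro continuous_on_compose2[OF borel_fun_continuous] continuous_on_of_real continuous_on_id)
    thus ?thesis unfolding h_def by (intro continuous_intros)
  qed
  have bd: "norm (h n t) \<le> M n" if t: "t \<in> {0..1}" for n t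
  proof -
    have "norm (\<phi> (of_real t)) \<le> C * (1 + norm (complex_of_real t)) ^ N" by (rule C(2)[OF mem[OF t]])
    also have "\<dots> \<le> C * 2 ^ N" using t C(1) by (intro mult_left_mono power_mono) auto
    finally have "norm (of_real t ^ n * \<phi> (of_real t)) \<le> 1 * (C * 2 ^ N)"
      unfolding norm_mult norm_power using t by (intro mult_mono power_le_one) auto
    hence "norm (x ^ n / fact n) * norm (of_real t ^ n * \<phi> (of_real t)) \<le> norm (x ^ n / fact n) * (1 * (C * 2 ^ N))"
      by (rule mult_left_mono) simp
    thus ?thesis unfolding h_def M_def norm_mult[of "x ^ n / fact n"] by (simp add: norm_divide norm_power)
  qed
  have M0: "M n \<ge> 0" for n using C(1) by (simp add: M_def)
  have "summable M" unfolding M_def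
    using summable_mult2[OF summable_exp[of "norm x"], of "C * 2 ^ N"] by (simp add: field_simps)
  hence sM: "summable (\<lambda>n. norm (M n))" using M0 by simp
  have Ms: "M summable_on UNIV" by (rule norm_summable_imp_summable_on[OF sM])
  have int: "integral {0..1} (h n) = x ^ n / fact n * f (False, real n + 1)" for n
    unfolding h_def using moments[of n] by (simp add: integral_unique)
  have "norm (integral {0..1} (h n)) \<le> M n * (1 - 0)" for n
    by (rule integral_bound) (use cont bd in auto)
  hence "summable (\<lambda>n. norm (integral {0..1} (h n)))"
    by (intro summable_comparison_test'[OF sM, of 0]) (use M0 in auto)
  hence "(\<lambda>n. integral {0..1} (h n)) summable_on UNIV" by (rule norm_summable_imp_summable_on)
  from has_sum_imp_sums[OF has_sum_infsum[OF this]]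
  have "(\<lambda>n. x ^ n / fact n * f (False, real n + 1)) sums (\<Sum>\<^sub>\<infinity>n. integral {0..1} (h n))" unfolding int .
  also have "(\<Sum>\<^sub>\<infinity>n. integral {0..1} (h n)) = integral {0..1} (\<lambda>t. \<Sum>\<^sub>\<infinity>n. h n t)"
    by (rule integral_unique[OF has_integral_infsum(1)[OF cont bd Ms], symmetric])
  also have "(\<lambda>t. \<Sum>\<^sub>\<infinity>n. h n t) = (\<lambda>t. exp (x * of_real t) * \<phi> (of_real t))"
  proof
    fix t
    have "(\<lambda>n. (x * of_real t) ^ n /\<^sub>R fact n) sums exp (x * of_real t)" by (rule exp_converges)
    hence "(\<lambda>n. (x * of_real t) ^ n / fact n) sums exp (x * of_real t)" by (simp add: scaleR_conv_of_real divide_inverse mult.commute)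
    from sums_mult2[OF this, of "\<phi> (of_real t)"]
    have s: "(\<lambda>n. h n t) sums (exp (x * of_real t) * \<phi> (of_real t))"
      by (simp add: h_def power_mult_distrib mult_ac)
    have "summable (\<lambda>n. norm ((x * of_real t) ^ n / fact n))"
      using summable_norm_exp[of "x * of_real t"] by (simp add: scaleR_conv_of_real divide_inverse mult.commute)
    hence "summable (\<lambda>n. norm ((x * of_real t) ^ n / fact n) * norm (\<phi> (of_real t)))" by (rule summable_mult2)
    hence "summable (\<lambda>n. norm (h n t))"
      by (simp add: h_def norm_mult norm_divide norm_power power_mult_distrib mult_ac)
    from norm_summable_imp_has_sum[OF this s] show "(\<Sum>\<^sub>\<infinity>n. h n t) = exp (x * of_real t) * \<phi> (of_real t)" by (rule infsumI)
  qed
  finally show ?thesis .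
qed

text \<open>For \<open>r < 1\<close> the number \<open>- Ln t\<close> has positive real part and the
  exponential series applies. There \<open>exp (- (k/q) * w)\<close> becomes the power of exponent
  \<open>k/q\<close> of t, and w = - log t accounts for the sign \<open>(- 1) ^ i\<close>.\<close>

lemma expansion_0:
  assumes \<tau>: "\<bar>\<tau>\<bar> < pi" and r: "0 < r" "r < 1"
  shows "\<phi> (of_real r * cis \<tau>) = (\<Sum>i<I. \<Sum>k. ((- 1) ^ i * c (i, k)) * pterm \<tau> (of_real (real k / real q)) i r)"
proof -
  define l where "l = Complex (ln r) \<tau>"
  have el: "of_real r * cis \<tau> = exp l" using r by (simp add: l_def exp_eq_polar exp_of_real)
  have Ll: "Ln (exp l) = l" using \<tau> by (intro Ln_exp) (auto simp: l_def)
  have "- l \<in> strip" "Re (- l) > 0" using \<tau> r by (auto simp: l_def strip_def)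
  from series[OF this] have "\<phi> (of_real r * cis \<tau>) = (\<Sum>i<I. \<Sum>k. c (i, k) * ((- l) ^ i * exp (- (of_nat k / of_nat q) * (- l))))"
    unfolding el borel_fun_def Ll by simp
  also have "\<dots> = (\<Sum>i<I. \<Sum>k. ((- 1) ^ i * c (i, k)) * pterm \<tau> (of_real (real k / real q)) i r)"
    using r by (intro sum.cong refl suminf_cong) (simp add: pterm_def l_def[symmetric] power_minus[of l] mult_ac)
  finally show ?thesis .
qed

text \<open>With y = 1 - t and w = - Ln (1 - y) one has \<open>1 - exp (- w) = y\<close>, so
  \<open>Ln_expq\<close> gives Ln w = Ln y - Ln (expq w). The power of w thus becomes the same power
  of y times a germ in y, without logarithms. A nonzero \<tau> keeps y off the real axis, where the
  cut at \<open>t \<ge> 1\<close> begins.\<close>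

lemma expansion_1:
  "\<exists>F D A \<rho>. (\<forall>n. F n \<in> H_ring) \<and> D \<ge> 0 \<and> A \<ge> 1 \<and> \<rho> > 0 \<and> (\<forall>n. norm (F n) \<le> D * A ^ n) \<and>
    (\<forall>\<tau> r. 0 < r \<and> r < \<rho> \<and> 0 < \<bar>\<tau>\<bar> \<and> \<bar>\<tau>\<bar> < pi \<longrightarrow>
      (\<lambda>n. F n * pterm \<tau> (of_real (\<kappa> - 1 + real n)) 0 r) sums \<phi> (1 - of_real r * cis \<tau>))"
proof -
  define a where "a = complex_of_real (\<kappa> - 1)"
  define W where "W = (\<lambda>y. - Ln (1 - y))"
  define G0 where "G0 = (\<lambda>w. exp (- (a * Ln (expq w))) * g w)"
  define G where "G = (\<lambda>y. G0 (W y))"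
  have aH: "a \<in> H_ring"
  proof -
    obtain m where "\<kappa> * real q = of_int m" using data by (auto simp: borel_data_def elim: Ints_cases)
    hence "\<kappa> = of_int m / of_nat q" using q by (simp add: field_simps)
    hence "a = of_int m / of_nat q - 1" by (simp add: a_def)
    also have "\<dots> \<in> \<rat>" by (intro Rats_diff Rats_divide) auto
    finally show ?thesis by (rule H_ring_Rats)
  qed
  have "H_germ (\<lambda>w. - (a * Ln (expq w))) 0" by (intro H_germ_uminus H_germ_mult H_germ_const aH H_germ_Ln_expq)
  hence "H_germ (\<lambda>w. exp (- (a * Ln (expq w)))) 0" by (rule H_germ_compose) (simp add: expq_def H_germ_exp)
  hence G0: "H_germ G0 0" unfolding G0_def using data by (intro H_germ_mult) (auto simp: borel_data_def)
  have "H_germ (\<lambda>y. 1 + - y) 0" by (intro H_germ_add H_germ_const H_ring_one H_germ_uminus H_germ_ident H_ring_zero)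
  hence "H_germ (\<lambda>y. Ln (1 + - y)) 0" by (rule H_germ_compose) (simp add: H_germ_Ln)
  hence "H_germ W 0" unfolding W_def by (intro H_germ_uminus) simp
  hence "H_germ G 0" unfolding G_def by (rule H_germ_compose) (simp add: W_def G0)
  then obtain Fp where Fp: "Fp \<in> H_fps" "(\<lambda>h. G (0 + h)) has_fps_expansion Fp" by (rule H_germE)
  have rad: "fps_conv_radius Fp > 0" and ev: "eventually (\<lambda>z. eval_fps Fp z = G z) (nhds 0)"
    using Fp(2) by (auto simp: has_fps_expansion_def)
  obtain \<rho>1 where \<rho>1: "\<rho>1 > 0" "\<And>z. norm z < \<rho>1 \<Longrightarrow> eval_fps Fp z = G z"
    using ev unfolding eventually_nhds_metric by (auto simp: dist_norm)
  obtain \<rho>2 :: real where \<rho>2: "\<rho>2 > 0" "ereal \<rho>2 < fps_conv_radius Fp"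
    using ereal_dense2[OF rad] by (auto simp: zero_ereal_def)
  have sums: "(\<lambda>n. fps_nth Fp n * z ^ n) sums eval_fps Fp z" if "norm z \<le> \<rho>2" for z
    by (rule sums_eval_fps) (use that \<rho>2(2) in \<open>auto intro: le_less_trans[of _ "ereal \<rho>2"]\<close>)
  \<comment> \<open>The terms of a convergent power series at radius \<open>\<rho>2\<close> are
    bounded; this is the geometric bound on the coefficients required by Watson's lemma.\<close>
  have "(\<lambda>n. fps_nth Fp n * of_real \<rho>2 ^ n) \<longlonglongrightarrow> 0"
    using sums[of "of_real \<rho>2"] \<rho>2(1) by (intro summable_LIMSEQ_zero sums_summable) auto
  hence "Bseq (\<lambda>n. fps_nth Fp n * of_real \<rho>2 ^ n)" by (intro convergent_imp_Bseq convergentI)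
  then obtain D where D: "D > 0" "\<And>n. norm (fps_nth Fp n * of_real \<rho>2 ^ n) \<le> D" by (auto elim!: BseqE)
  define A where "A = 1 + 1 / \<rho>2"
  have A: "A \<ge> 1" using \<rho>2(1) by (simp add: A_def)
  have FA: "norm (fps_nth Fp n) \<le> D * A ^ n" for n
  proof -
    have "norm (fps_nth Fp n) * \<rho>2 ^ n \<le> D" using D(2)[of n] \<rho>2(1) by (simp add: norm_mult norm_power)
    hence "norm (fps_nth Fp n) \<le> D * (1 / \<rho>2) ^ n" using \<rho>2(1) by (simp add: field_simps)
    also have "\<dots> \<le> D * A ^ n" using D(1) \<rho>2(1) by (intro mult_left_mono power_mono) (auto simp: A_def)
    finally show ?thesis .
  qed
  define \<rho> where "\<rho> = min \<rho>1 \<rho>2"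
  have \<rho>: "\<rho> > 0" using \<rho>1 \<rho>2 by (simp add: \<rho>_def)
  have "(\<lambda>n. fps_nth Fp n * pterm \<tau> (of_real (\<kappa> - 1 + real n)) 0 r) sums \<phi> (1 - of_real r * cis \<tau>)"
    if r: "0 < r" "r < \<rho>" and \<tau>: "0 < \<bar>\<tau>\<bar>" "\<bar>\<tau>\<bar> < pi" for \<tau> r
  proof -
    define l where "l = Complex (ln r) \<tau>"
    define y where "y = of_real r * cis \<tau>"
    have yl: "y = exp l" using r by (simp add: y_def l_def exp_eq_polar exp_of_real)
    have Ly: "Ln y = l" unfolding yl using \<tau> by (intro Ln_exp) (auto simp: l_def)
    have ny: "norm y = r" using r by (simp add: y_def norm_mult)
    have "sin \<tau> \<noteq> 0"
    proof (cases "\<tau> > 0")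
      case True
      thus ?thesis using sin_gt_zero[of \<tau>] \<tau> by simp
    next
      case False
      thus ?thesis using sin_gt_zero[of "- \<tau>"] \<tau> by simp
    qed
    hence Im: "Im y \<noteq> 0" using r by (simp add: y_def)
    hence cut: "1 - y \<in> cut_plane" by (simp add: cut_plane_def)
    define w where "w = W y"
    have ew: "exp (- w) = 1 - y" using cut_planeD(1)[OF cut] by (simp add: w_def W_def)
    have wR: "w \<notin> \<real>"
    proof
      assume "w \<in> \<real>"
      hence "exp (- w) \<in> \<real>" by (intro Reals_minus exp_in_Reals) (auto elim: Reals_cases)
      thus False unfolding ew using Im by (simp add: complex_is_Real_iff)
    qed
    hence w0: "w \<noteq> 0" by auto
    have ws: "w \<in> strip" using cut_planeD(3)[OF cut] by (simp add: w_def W_def)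
    have "l = Ln (expq w) + Ln w" using Ln_expq[OF ws w0] wR unfolding ew by (simp add: Ly)
    hence Lw: "Ln w = l - Ln (expq w)" by simp
    have "\<phi> (1 - y) = w powr a * g w" using cut_planeD(1)[OF cut] unfolding borel_fun_def w_def W_def a_def by simp
    also have "\<dots> = exp (a * l) * G y" using w0 unfolding powr_def Lw G_def G0_def w_def[symmetric]
      by (simp add: exp_add[symmetric] algebra_simps)
    finally have phi: "\<phi> (1 - y) = exp (a * l) * G y" .
    have "(\<lambda>n. fps_nth Fp n * y ^ n) sums G y" using sums[of y] \<rho>1(2)[of y] ny r by (simp add: \<rho>_def)
    from sums_mult[OF this, of "exp (a * l)"]
    have "(\<lambda>n. exp (a * l) * (fps_nth Fp n * y ^ n)) sums \<phi> (1 - y)" unfolding phi .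
    moreover have "exp (a * l) * (fps_nth Fp n * y ^ n) = fps_nth Fp n * pterm \<tau> (of_real (\<kappa> - 1 + real n)) 0 r" for n
    proof -
      have "pterm \<tau> (of_real (\<kappa> - 1 + real n)) 0 r = exp ((a + of_nat n) * l)" using r by (simp add: pterm_def a_def l_def)
      also have "\<dots> = exp (a * l) * y ^ n" by (simp add: yl distrib_right exp_add exp_of_nat_mult)
      finally show ?thesis by simp
    qed
    ultimately show ?thesis unfolding y_def by simp
  qed
  moreover have "fps_nth Fp n \<in> H_ring" for n using Fp(1) by (simp add: H_fps_def)
  ultimately show ?thesis using D(1) A \<rho> FA
    by (intro exI[of _ "fps_nth Fp"] exI[of _ D] exI[of _ A] exI[of _ \<rho>]) auto
qed

end

section \<open>The asymptotic expansion\<close>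

lemma small_radius:
  assumes "A \<ge> 1" "\<rho> > 0" "q > (0 :: nat)"
  shows "\<exists>r>0. r < 1 \<and> r < \<rho> \<and> A * r powr (1 / real q) \<le> (1 / 2 :: real)"
proof -
  define s where "s = 1 / (2 * A)"
  have s: "0 < s" "s \<le> 1 / 2" "A * s = 1 / 2" using assms(1) by (auto simp: s_def field_simps)
  define r where "r = min (\<rho> / 2) (s ^ q)"
  have r: "r > 0" using s assms(2) by (simp add: r_def)
  have "s ^ q \<le> s ^ 1" using s assms(3) by (intro power_decreasing) auto
  hence "s ^ q < 1" using s by simp
  hence "r < 1" by (simp add: r_def min_less_iff_disj)
  moreover have "r < \<rho>" using assms(2) by (simp add: r_def min_def)
  moreover have "A * r powr (1 / real q) \<le> A * (s ^ q) powr (1 / real q)"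
    using assms(1) r by (intro mult_left_mono powr_mono2) (auto simp: r_def)
  moreover have "(s ^ q) powr (1 / real q) = s"
    using s(1) assms(3) by (simp add: powr_realpow[symmetric] powr_powr)
  ultimately show ?thesis using s(3) r by (intro exI[of _ r]) auto
qed

section \<open>The normalising constant between moments and Pochhammer quotients\<close>

lemma Gamma_quotient_poch_ratio:
  assumes "\<forall>(a, b)\<in>set ps. a > 0 \<and> b > 0"
  shows "(\<Prod>(a, b)\<leftarrow>ps. Gamma (a + real n) / Gamma (b + real n)) = poch_ratio ps n * (\<Prod>(a, b)\<leftarrow>ps. Gamma a / Gamma b)"
  using assms
proof (induction ps)
  case (Cons p ps)
  obtain a b where p: "p = (a, b)" by force
  have ab: "a > 0" "b > 0" using Cons.prems p by auto
  have P: "Gamma (x + real n) = pochhammer x n * Gamma x" if "x > 0" for x :: real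
  proof -
    have "x \<notin> \<int>\<^sub>\<le>\<^sub>0" using that by (auto elim!: nonpos_Ints_cases')
    from pochhammer_Gamma[OF this, of n] show ?thesis using Gamma_real_pos[OF that] by simp
  qed
  show ?case using Cons P[OF ab(1)] P[OF ab(2)] by (simp add: p)
qed simp

lemma Gamma_quotient_in_H_ring:
  assumes "\<forall>(a, b)\<in>set ps. a > 0 \<and> b > 0 \<and> a \<in> \<rat> \<and> b \<in> \<rat>"
  shows "complex_of_real (\<Prod>(a, b)\<leftarrow>ps. Gamma b / Gamma a) \<in> H_ring"
  using assms
proof (induction ps)
  case (Cons p ps)
  obtain a b where p: "p = (a, b)" by force
  have ab: "a > 0" "b > 0" "a \<in> \<rat>" "b \<in> \<rat>" using Cons.prems p by auto
  have r: "complex_of_real x \<in> \<rat>" if "x \<in> \<rat>" for x using that by (auto elim!: Rats_cases')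
  have "of_real b \<notin> (\<int>\<^sub>\<le>\<^sub>0 :: complex set)" using ab(2) by (auto elim!: nonpos_Ints_cases' simp: complex_eq_iff)
  hence "Gamma (complex_of_real b) \<in> H_ring" using r[OF ab(4)] by (intro H_ring_Gamma_Rats) auto
  moreover have "rGamma (complex_of_real a) \<in> H_ring" using r[OF ab(3)] by (rule H_ring_rGamma_Rats)
  ultimately have "Gamma (complex_of_real b) * rGamma (complex_of_real a) \<in> H_ring" by (rule H_ring_mult)
  hence "complex_of_real (Gamma b / Gamma a) \<in> H_ring"
    by (simp add: rGamma_inverse_Gamma Gamma_complex_of_real divide_inverse)
  from H_ring_mult[OF this Cons.IH] show ?case using Cons.prems by (simp add: p)
qed (simp add: H_ring_one)

section \<open>Expandability of the hypergeometric series\<close>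

context sector begin

lemma gevrey_one: "gevrey (\<lambda>_. 1)"
proof -
  define d :: "nat \<Rightarrow> nat \<Rightarrow> complex" where "d = (\<lambda>i k. if i = 0 \<and> k = 0 then 1 else 0)"
  have one: "{..<1 :: nat} = {0}" by auto
  have "gevrey_exp 0 1 d 0 1 (\<lambda>_. 1)"
    unfolding gevrey_exp_def
  proof (intro conjI ballI allI impI)
    fix x and N :: nat assume "N \<ge> 1"
    hence "(\<Sum>k<q * N. d 0 k * lterm 0 0 k x) = (\<Sum>k\<in>{0}. lterm 0 0 k x)"
      using q by (intro sum.mono_neutral_cong_right) (auto simp: d_def)
    thus "norm (1 - (\<Sum>i<1. \<Sum>k<q * N. d i k * lterm 0 i k x)) \<le> 1 ^ N * fact N * norm x powr (0 - real N)"
      unfolding one by (simp add: lterm_def)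
  qed (auto intro: H_ring_one H_ring_zero simp: d_def)
  thus ?thesis unfolding gevrey_def by blast
qed

lemma expandable_exp: "expandable exp"
  unfolding expandable_def using gevrey_one gevrey_cmult[OF gevrey_one H_ring_zero]
  by - (rule exI[of _ "\<lambda>_. 0 * 1"], rule exI[of _ "\<lambda>_. 1"], auto)

text \<open>A ray belonging to the angle \<open>v b\<close> serves all x whose argument differs from
  \<open>v b\<close> by at most \<open>pi / 2 - \<epsilon>\<close>. The two angles
  \<open>\<theta> + 2 * \<epsilon>\<close> and \<open>\<theta> - 2 * \<epsilon>\<close> together
  reach \<open>pi / 2 + \<epsilon>\<close> on either side of \<theta>, and the assumptions on
  \<epsilon> keep both strictly between consecutive multiples of \<pi>.\<close>

lemma expandable_base:
  assumes \<theta>: "\<theta> \<noteq> 0" "4 * \<epsilon> \<le> \<bar>\<theta>\<bar>" "4 * \<epsilon> \<le> pi - \<bar>\<theta>\<bar>"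
    and ps: "ps \<noteq> []" "\<forall>(a, b)\<in>set ps. a * real q \<in> \<int> \<and> b * real q \<in> \<int> \<and> a \<ge> 2 \<and> b - a \<ge> 2"
  shows "expandable (hyp_pairs ps)"
proof -
  obtain \<kappa> g f I where data: "borel_data q \<kappa> g f I"
    and f: "\<And>s. s > 0 \<Longrightarrow> f (False, s) = of_real (\<Prod>(a, b)\<leftarrow>ps. Gamma (a - 1 + s) / Gamma (b - 1 + s))"
    using ex_borel_data[OF q ps] by blast
  obtain c where c: "exp_series_coeffs I c" and fc: "\<And>z. snd z > 0 \<Longrightarrow> f z = (\<Sum>\<^sub>\<infinity>p. c p * exp_monom q z p)"
    using data unfolding borel_data_def exp_rep_def by blast
  interpret B: borel q \<kappa> g f I c using q data c fc by unfold_locales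
  define \<phi> where "\<phi> = borel_fun \<kappa> g"
  have cH: "c (i, k) \<in> H_ring" for i k
    by (rule exp_series_coeffs_H_ring[OF q c]) (use ps(2) f fc in \<open>fastforce+\<close>)
  \<comment> \<open>The sign chooses the determination of the argument of -1 for which
    \<open>cis (\<omega> - v b)\<close> is the direction of the ray and
    \<open>\<omega> - v b\<close> lies strictly between -\<pi> and \<pi>.\<close>
  define \<omega> where "\<omega> = (if \<theta> > 0 then pi else - pi)"
  define v where "v = (\<lambda>b. if b then \<theta> + 2 * \<epsilon> else \<theta> - 2 * \<epsilon>)"
  \<comment> \<open>Chosen so that \<open>- (x * e b)\<close> is \<open>x\<close> rotated by
    \<open>- v b\<close>; its principal logarithm is then
    \<open>log_about \<theta> x - \<i> * v b\<close> on the part of the sector served by this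
    ray.\<close>
  define e where "e = (\<lambda>b. - cis (- v b))"
  have v: "\<theta> > 0 \<and> 0 < v b \<and> v b < pi \<or> \<theta> < 0 \<and> - pi < v b \<and> v b < 0" for b
    using \<theta> \<epsilon> by (cases "\<theta> > 0") (auto simp: v_def)
  have e_Im: "Im (e True) * Im (e False) > 0"
  proof (cases "\<theta> > 0")
    case True
    hence "sin (v b) > 0" for b using v[of b] by (intro sin_gt_zero) auto
    thus ?thesis by (simp add: e_def)
  next
    case False
    have "sin (v b) < 0" for b using v[of b] False sin_gt_zero[of "- v b"] by simp
    thus ?thesis by (simp add: e_def mult_neg_neg)
  qed
  have ne: "norm (e b) = 1" for b by (simp add: e_def)
  define W where "W = pencil (e True) (e False)"
  have W_cut: "W \<subseteq> cut_plane \<union> {0, 1}"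
  proof
    fix t assume t: "t \<in> W"
    show "t \<in> cut_plane \<union> {0, 1}"
    proof (cases "Im t = 0")
      case True
      hence "0 \<le> Re t \<and> Re t \<le> 1" using pencil_real[OF _ e_Im] t by (simp add: W_def)
      thus ?thesis using True by (auto simp: cut_plane_def complex_eq_iff)
    qed (simp add: cut_plane_def)
  qed
  obtain C N where C: "C \<ge> 0" "\<And>t. t \<in> cut_plane \<union> {0, 1} \<Longrightarrow> norm (\<phi> t) \<le> C * (1 + norm t) ^ N"
    using B.borel_fun_growth unfolding \<phi>_def by blast
  have bd: "norm (\<phi> t) \<le> C * (1 + norm t) ^ N" if "t \<in> W" for t using C(2) W_cut that by blast
  have cont: "continuous_on W \<phi>" unfolding \<phi>_def by (rule continuous_on_subset[OF B.borel_fun_continuous W_cut])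
  have fd: "\<phi> field_differentiable at t" if "t \<in> interior W - {0, 1}" for t
  proof -
    have "t \<in> cut_plane" using that W_cut interior_subset[of W] by blast
    thus ?thesis unfolding \<phi>_def
      by (rule holomorphic_on_imp_differentiable_at[OF borel_fun_holomorphic[OF B.g_holomorphic] open_cut_plane])
  qed
  have eb: "e b \<in> {e True, e False}" for b by (cases b) auto
  have pg: "poly_growth (\<lambda>r. \<phi> (p + of_real r * e b))" if p: "p \<in> {0, 1}" for p b
    by (rule poly_growth_ray[OF cont bd C(1) pencil_ray[OF p eb, folded W_def]]) (use p ne in auto)
  define J where "J = (\<lambda>x. integral {0..1} (\<lambda>t. exp (x * of_real t) * \<phi> (of_real t)))"
  define E where "E = (\<lambda>p b x. e b * lap (\<lambda>r. \<phi> (p + of_real r * e b)) (- (x * e b)))"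
  define U where "U = (\<lambda>b. {x. Re (x * e b) < 0})"
  have ray: "ray_integral \<phi> x p (e b) = exp (x * p) * E p b x" for x p b by (simp add: ray_integral_def E_def)
  have J: "J x = E 0 b x - exp x * E 1 b x" if "x \<in> U b" for x b
    using ray_integral_contour(1)[OF _ _ cont[unfolded W_def] fd[unfolded W_def] bd[unfolded W_def] C(1), of "e b" x] ne eb that
    by (simp add: J_def U_def ray)
  have EE: "E p True x = E p False x" if "p \<in> {0, 1}" "x \<in> U True" "x \<in> U False" for p x
    using ray_integral_contour(2)[OF _ _ cont[unfolded W_def] fd[unfolded W_def] bd[unfolded W_def] C(1), of p x] ne that
    by (simp add: U_def ray)
  \<comment> \<open>The two integrals agree where both converge, by rotating the contour, and so
    glue to one function on the union of the half-planes.\<close>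
  define G where "G = (\<lambda>p x. if x \<in> U True then E p True x else E p False x)"
  have G: "G p x = E p b x" if "p \<in> {0, 1}" "x \<in> U b" for p b x
    using EE[OF that(1)] that(2) by (cases b) (auto simp: G_def)
  have U_open: "open (U b)" for b
    unfolding U_def by (intro open_Collect_less continuous_intros)
  \<comment> \<open>This is \<open>cos (pi / 2 - \<epsilon>)\<close>, the smallest cosine of an
    argument that the chosen ray has to handle.\<close>
  define \<delta> where "\<delta> = sin \<epsilon>"
  have \<epsilon>8: "8 * \<epsilon> \<le> pi" using \<theta> by linarith
  have \<delta>: "0 < \<delta>" "\<delta> \<le> 1" using \<epsilon> \<epsilon>8 unfolding \<delta>_def by (auto intro!: sin_gt_zero)
  have branch: "\<exists>b z. norm z = norm x \<and> Re z \<ge> \<delta> * norm z \<and> Ln z = log_about \<theta> x - \<i> * of_real (v b) \<and> z = - (x * e b) \<and> x \<in> U b"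
    if x: "x \<in> sec" for x
  proof -
    have x0: "x \<noteq> 0" using sec_norm[OF x] by auto
    define a where "a = arg_about \<theta> x"
    have a: "\<theta> - pi / 2 - \<epsilon> \<le> a" "a \<le> \<theta> + pi / 2 + \<epsilon>" using x by (auto simp: sec_def large_sector_def a_def)
    \<comment> \<open>Each half of the sector uses the ray tilted towards it.\<close>
    define b where "b = (a \<ge> \<theta>)"
    define z where "z = - (x * e b)"
    have ab: "\<bar>a - v b\<bar> \<le> pi / 2 - \<epsilon>" using a \<epsilon> \<epsilon>8 unfolding v_def b_def abs_le_iff by (auto split: if_splits)
    have "z = exp (log_about \<theta> x - \<i> * of_real (v b))"
      unfolding exp_diff exp_log_about[OF x0] by (simp add: z_def e_def cis_conv_exp exp_minus divide_inverse)
    moreover have "Ln (exp (log_about \<theta> x - \<i> * of_real (v b))) = log_about \<theta> x - \<i> * of_real (v b)"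
      using ab \<epsilon> pi_gt_zero unfolding abs_le_iff by (intro Ln_exp) (auto simp: log_about_def a_def)
    ultimately have Lz: "Ln z = log_about \<theta> x - \<i> * of_real (v b)" and ze: "z = exp (log_about \<theta> x - \<i> * of_real (v b))" by simp_all
    have nz: "norm z = norm x" by (simp add: z_def norm_mult ne)
    have "Re z = exp (ln (norm x)) * cos (a - v b)" unfolding ze by (simp add: Re_exp log_about_def a_def)
    also have "\<dots> = norm z * cos \<bar>a - v b\<bar>" using x0 nz by simp
    finally have Rz: "Re z = norm z * cos \<bar>a - v b\<bar>" .
    have "\<delta> = cos (pi / 2 - \<epsilon>)" by (simp add: \<delta>_def cos_diff)
    also have "\<dots> \<le> cos \<bar>a - v b\<bar>" using ab \<epsilon> by (intro cos_monotone_0_pi_le) auto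
    finally have dc: "\<delta> \<le> cos \<bar>a - v b\<bar>" .
    have "\<delta> * norm z \<le> Re z" unfolding Rz mult.commute[of \<delta>] by (rule mult_left_mono[OF dc norm_ge_zero])
    moreover have "\<delta> * norm z > 0" using \<delta> nz x0 by simp
    ultimately have "x \<in> U b" by (simp add: U_def z_def)
    with \<open>\<delta> * norm z \<le> Re z\<close> nz Lz show ?thesis unfolding z_def by blast
  qed
  have an: "G p analytic_on sec" if p: "p \<in> {0, 1}" for p
  proof -
    have "G p holomorphic_on U b" for b
    proof -
      have "(\<lambda>x. lap (\<lambda>r. \<phi> (p + of_real r * e b)) (- (x * e b))) holomorphic_on U b"
        by (rule holomorphic_on_compose_gen[OF _ lap_holomorphic[OF pg[OF p, of b]], unfolded o_def])
           (auto intro!: holomorphic_intros simp: U_def)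
      hence "E p b holomorphic_on U b" unfolding E_def by (intro holomorphic_intros)
      thus ?thesis by (rule holomorphic_transform) (use G[OF p] in auto)
    qed
    hence "G p holomorphic_on (U True \<union> U False)" by (intro holomorphic_on_Un U_open)
    hence "G p analytic_on (U True \<union> U False)" using U_open by (subst analytic_on_open) auto
    moreover have "sec \<subseteq> U True \<union> U False"
    proof
      fix x assume "x \<in> sec"
      then obtain b where "x \<in> U b" using branch by blast
      thus "x \<in> U True \<union> U False" by (cases b) auto
    qed
    ultimately show ?thesis by (rule analytic_on_subset)
  qed
  have "gevrey (G 0)"
  proof -
    define D where "D = (\<Sum>i<I. \<Sum>k. norm (c (i, k)))"
    have row0: "(\<Sum>k. norm (c (i, k))) \<ge> 0" for i by (intro suminf_nonneg exp_series_row_summable[OF c]) auto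
    have D0: "D \<ge> 0" unfolding D_def using row0 by (intro sum_nonneg)
    have cD: "norm ((- 1) ^ i * c (i, k)) \<le> D * 1 ^ k" for i k
    proof (cases "i < I")
      case True
      have "norm (c (i, k)) \<le> (\<Sum>k. norm (c (i, k)))"
        using sum_le_suminf[OF exp_series_row_summable[OF c, of i], of "{k}"] by simp
      also have "\<dots> \<le> D" unfolding D_def using True row0 by (intro member_le_sum[of i _ "\<lambda>i. \<Sum>k. norm (c (i, k))"]) auto
      finally show ?thesis by (simp add: norm_mult norm_power)
    next
      case False
      thus ?thesis using B.c_ge D0 by simp
    qed
    obtain r0 where r0: "0 < r0" "r0 < 1" "1 * r0 powr (1 / real q) \<le> 1 / 2" using small_radius[of 1 1 q] q by auto
    \<comment> \<open>At the end point 0 the local variable is t itself, running along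
      \<open>cis (\<tau> b) = e b\<close>. The exponential is \<open>exp (x * t)\<close>, so the
      Laplace variable is \<open>- x\<close> and \<omega> records the step from its logarithm to
      that of x.\<close>
    define \<tau> where "\<tau> = (\<lambda>b. \<omega> - v b)"
    have \<tau>e: "cis (\<tau> b) = e b" for b by (simp add: \<tau>_def e_def \<omega>_def complex_eq_iff cos_diff sin_diff)
    show ?thesis
    proof (rule gevrey_of_lap[where \<psi> = "\<lambda>b r. \<phi> (0 + of_real r * e b)" and \<tau> = \<tau> and \<omega> = \<omega> and c = "\<lambda>i k. (- 1) ^ i * c (i, k)"
          and D = D and A = 1 and ?r0.0 = r0 and I = I and \<delta> = \<delta>])
      show "(- 1) ^ i * c (i, k) \<in> H_ring" for i k by (intro H_ring_mult H_ring_power H_ring_uminus H_ring_one cH)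
      show "\<phi> (0 + of_real r * e b) = (\<Sum>i<I. \<Sum>k. (- 1) ^ i * c (i, k) * pterm (\<tau> b) (of_real (real k / real q)) i r)"
        if "0 < r" "r \<le> r0" for b r
      proof -
        have "\<bar>\<tau> b\<bar> < pi" using v[of b] unfolding \<tau>_def \<omega>_def by auto
        from B.expansion_0[OF this, of r] that r0 show ?thesis by (simp add: \<tau>e \<phi>_def)
      qed
      show "\<exists>b z. norm z = norm x \<and> Re z \<ge> \<delta> * norm z \<and> Ln z - \<i> * of_real (\<tau> b) = log_about \<theta> x - \<i> * of_real \<omega> \<and>
          G 0 x = exp (\<i> * of_real (\<tau> b)) * lap (\<lambda>r. \<phi> (0 + of_real r * e b)) z" if x: "x \<in> sec" for x
      proof -
        obtain b z where bz: "norm z = norm x" "Re z \<ge> \<delta> * norm z" "Ln z = log_about \<theta> x - \<i> * of_real (v b)" "z = - (x * e b)" "x \<in> U b"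
          using branch[OF x] by blast
        have "Ln z - \<i> * of_real (\<tau> b) = log_about \<theta> x - \<i> * of_real \<omega>" unfolding bz(3) by (simp add: \<tau>_def algebra_simps)
        moreover have "G 0 x = exp (\<i> * of_real (\<tau> b)) * lap (\<lambda>r. \<phi> (0 + of_real r * e b)) z"
          using G[of 0 x b] bz(4,5) \<tau>e[of b] by (simp add: E_def cis_conv_exp)
        ultimately show ?thesis using bz(1,2) by blast
      qed
      show "poly_growth (\<lambda>r. \<phi> (0 + of_real r * e b))" for b by (rule pg) simp
      show "\<phi> (0 + of_real 0 * e b) = 0" for b by (simp add: \<phi>_def borel_fun_def)
      show "norm ((- 1) ^ i * c (i, k)) \<le> D * 1 ^ k" for i k by (rule cD)
    qed (use an D0 r0 \<delta> B.c_0 in \<open>auto simp: \<omega>_def\<close>)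
  qed
  moreover have "gevrey (\<lambda>x. - G 1 x)"
  proof -
    obtain F D A \<rho> where F: "\<And>n. F n \<in> H_ring" "D \<ge> 0" "A \<ge> 1" "\<rho> > 0" "\<And>n. norm (F n) \<le> D * A ^ n"
      and expand: "\<And>\<tau> r. 0 < r \<Longrightarrow> r < \<rho> \<Longrightarrow> 0 < \<bar>\<tau>\<bar> \<Longrightarrow> \<bar>\<tau>\<bar> < pi \<Longrightarrow>
        (\<lambda>n. F n * pterm \<tau> (of_real (\<kappa> - 1 + real n)) 0 r) sums \<phi> (1 - of_real r * cis \<tau>)"
      using B.expansion_1 unfolding \<phi>_def by blast
    obtain m where m: "\<kappa> * real q = of_int m" using data by (auto simp: borel_data_def elim: Ints_cases)
    \<comment> \<open>The index of the first exponent \<open>\<kappa> - 1\<close> in the lattice;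
      \<open>\<kappa> \<ge> 2\<close> makes it positive.\<close>
    define k0 where "k0 = nat (m - int q)"
    have "2 * real q \<le> of_int m" using B.kappa q unfolding m[symmetric] by (intro mult_right_mono) auto
    hence "2 * int q \<le> m" by linarith
    hence k0: "k0 \<ge> 1" "real k0 = of_int m - real q" using q by (auto simp: k0_def)
    have k0q: "real (k0 + q * n) / real q = \<kappa> - 1 + real n" for n
      using q k0(2) m by (simp add: field_simps)
    \<comment> \<open>At t = 1 the exponents advance by whole units from
      \<open>\<kappa> - 1\<close>, hence only every \<open>q\<close>-th index is occupied, and there
      are no logarithms.\<close>
    define d where "d = (\<lambda>i k. if i = (0 :: nat) \<and> k0 \<le> k \<and> q dvd (k - k0) then F ((k - k0) div q) else 0)"
    obtain r0 where r0: "0 < r0" "r0 < 1" "r0 < \<rho>" "A * r0 powr (1 / real q) \<le> 1 / 2" using small_radius[OF F(3,4) q] by auto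
    \<comment> \<open>At the end point 1 the local variable is 1 - t, which runs along
      \<open>- e b\<close>; this also explains the sign in \<open>- G 1\<close>. As
      \<open>exp (x * t)\<close> equals \<open>exp x * exp (- x * (1 - t))\<close>, the Laplace
      variable is x and \<open>\<omega> = 0\<close>.\<close>
    define \<tau> where "\<tau> = (\<lambda>b. - v b)"
    have \<tau>e: "cis (\<tau> b) = - e b" for b by (simp add: \<tau>_def e_def)
    show ?thesis
    proof (rule gevrey_of_lap[where \<psi> = "\<lambda>b r. \<phi> (1 + of_real r * e b)" and \<tau> = \<tau> and \<omega> = 0 and c = d
          and D = D and A = A and ?r0.0 = r0 and I = 1 and \<delta> = \<delta>])
      show "d i k \<in> H_ring" for i k using F(1) H_ring_zero by (simp add: d_def)
      show "norm (d i k) \<le> D * A ^ k" for i k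
      proof -
        have "D * A ^ ((k - k0) div q) \<le> D * A ^ k"
          using F(2,3) le_trans[OF div_le_dividend[of "k - k0" q] diff_le_self] by (intro mult_left_mono power_increasing) auto
        thus ?thesis using F(2,3) order_trans[OF F(5)[of "(k - k0) div q"]] by (auto simp: d_def)
      qed
      show "\<phi> (1 + of_real r * e b) = (\<Sum>i<1. \<Sum>k. d i k * pterm (\<tau> b) (of_real (real k / real q)) i r)"
        if r: "0 < r" "r \<le> r0" for b r
      proof -
        have "0 < \<bar>\<tau> b\<bar>" "\<bar>\<tau> b\<bar> < pi" using v[of b] unfolding \<tau>_def by auto
        hence "(\<lambda>n. F n * pterm (\<tau> b) (of_real (\<kappa> - 1 + real n)) 0 r) sums \<phi> (1 - of_real r * cis (\<tau> b))"
          using r r0 by (intro expand) auto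
        moreover have "F n * pterm (\<tau> b) (of_real (\<kappa> - 1 + real n)) 0 r = d 0 (k0 + q * n) * pterm (\<tau> b) (of_real (real (k0 + q * n) / real q)) 0 r" for n
          unfolding k0q using q by (simp add: d_def)
        ultimately have "(\<lambda>n. d 0 (k0 + q * n) * pterm (\<tau> b) (of_real (real (k0 + q * n) / real q)) 0 r) sums \<phi> (1 - of_real r * cis (\<tau> b))"
          by (simp only:)
        moreover have "strict_mono (\<lambda>n. k0 + q * n)" using q by (intro strict_monoI) auto
        moreover have "d 0 k * pterm (\<tau> b) (of_real (real k / real q)) 0 r = 0" if "k \<notin> range (\<lambda>n. k0 + q * n)" for k
        proof -
          have "\<not> (k0 \<le> k \<and> q dvd (k - k0))"
          proof
            assume *: "k0 \<le> k \<and> q dvd (k - k0)"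
            then obtain n where "k - k0 = q * n" by (auto elim: dvdE)
            hence "k = k0 + q * n" using * by linarith
            thus False using that by blast
          qed
          thus ?thesis by (auto simp: d_def)
        qed
        ultimately have "(\<lambda>k. d 0 k * pterm (\<tau> b) (of_real (real k / real q)) 0 r) sums \<phi> (1 - of_real r * cis (\<tau> b))"
          by (subst (asm) sums_mono_reindex[of "\<lambda>n. k0 + q * n" "\<lambda>k. d 0 k * pterm (\<tau> b) (of_real (real k / real q)) 0 r"]) auto
        thus ?thesis by (simp add: sums_iff \<tau>e)
      qed
      show "\<exists>b z. norm z = norm x \<and> Re z \<ge> \<delta> * norm z \<and> Ln z - \<i> * of_real (\<tau> b) = log_about \<theta> x - \<i> * of_real 0 \<and>
          - G 1 x = exp (\<i> * of_real (\<tau> b)) * lap (\<lambda>r. \<phi> (1 + of_real r * e b)) z" if x: "x \<in> sec" for x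
      proof -
        obtain b z where bz: "norm z = norm x" "Re z \<ge> \<delta> * norm z" "Ln z = log_about \<theta> x - \<i> * of_real (v b)" "z = - (x * e b)" "x \<in> U b"
          using branch[OF x] by blast
        have "Ln z - \<i> * of_real (\<tau> b) = log_about \<theta> x - \<i> * of_real 0" unfolding bz(3) by (simp add: \<tau>_def)
        moreover have "- G 1 x = exp (\<i> * of_real (\<tau> b)) * lap (\<lambda>r. \<phi> (1 + of_real r * e b)) z"
          using G[of 1 x b] bz(4,5) \<tau>e[of b] by (simp add: E_def cis_conv_exp)
        ultimately show ?thesis using bz(1,2) by blast
      qed
      show "(\<lambda>x. - G 1 x) analytic_on sec" using an[of 1] by (intro analytic_intros) auto
      show "d i 0 = 0" for i using k0(1) by (simp add: d_def)
      show "poly_growth (\<lambda>r. \<phi> (1 + of_real r * e b))" for b by (rule pg) simp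
      show "\<phi> (1 + of_real 0 * e b) = 0" for b by (simp add: \<phi>_def borel_fun_def)
    qed (use F r0 \<delta> in auto)
  qed
  \<comment> \<open>The moments are products of \<open>Gamma (a + n) / Gamma (b + n)\<close>.
    Dividing by their value \<open>Q\<close> at \<open>n = 0\<close> leaves the Pochhammer
    quotients, so \<open>K\<close> is the constant in front of the integral.\<close>
  moreover define Q where "Q = (\<Prod>(a, b)\<leftarrow>ps. Gamma a / Gamma b)"
  define K where "K = complex_of_real (\<Prod>(a, b)\<leftarrow>ps. Gamma b / Gamma a)"
  have pos: "\<forall>(a, b)\<in>set ps. a > 0 \<and> b > 0" using ps(2) by auto
  have KQ: "K * of_real Q = 1"
  proof -
    have "(\<Prod>(a, b)\<leftarrow>ps. Gamma b / Gamma a) * (\<Prod>(a, b)\<leftarrow>ps. Gamma a / Gamma b) = 1"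
      using pos
    proof (induction ps)
      case (Cons p ps)
      obtain a b where p: "p = (a, b)" by force
      have "Gamma a > 0" "Gamma b > 0" using Cons.prems p by (auto intro: Gamma_real_pos)
      moreover have "(\<Prod>(a, b)\<leftarrow>ps. Gamma b / Gamma a) * (\<Prod>(a, b)\<leftarrow>ps. Gamma a / Gamma b) = 1" using Cons by auto
      ultimately show ?case by (simp add: p)
    qed simp
    thus ?thesis unfolding K_def Q_def of_real_mult[symmetric] by (simp del: of_real_mult)
  qed
  have rat: "a \<in> \<rat>" if "a * real q \<in> \<int>" for a
  proof -
    obtain m where "a * real q = of_int m" using \<open>a * real q \<in> \<int>\<close> by (auto elim: Ints_cases)
    hence "a = of_int m / of_nat q" using q by (simp add: field_simps)
    thus ?thesis by simp
  qed
  have KH: "K \<in> H_ring" unfolding K_def by (rule Gamma_quotient_in_H_ring) (use ps(2) pos rat in fastforce)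
  have hyp: "hyp_pairs ps x = K * J x" for x
  proof -
    have "\<forall>(a, b)\<in>set ps. b \<notin> \<int>\<^sub>\<le>\<^sub>0" using pos by (auto elim!: nonpos_Ints_cases')
    from hyp_pairs_sums[OF this, of x]
    have hs: "(\<lambda>n. of_real (poch_ratio ps n) / fact n * x ^ n) sums hyp_pairs ps x" .
    have eq: "K * (x ^ n / fact n * f (False, real n + 1)) = of_real (poch_ratio ps n) / fact n * x ^ n" for n
    proof -
      have "f (False, real n + 1) = of_real (\<Prod>(a, b)\<leftarrow>ps. Gamma (a - 1 + (real n + 1)) / Gamma (b - 1 + (real n + 1)))"
        by (rule f) simp
      also have "(\<Prod>(a, b)\<leftarrow>ps. Gamma (a - 1 + (real n + 1)) / Gamma (b - 1 + (real n + 1))) = (\<Prod>(a, b)\<leftarrow>ps. Gamma (a + real n) / Gamma (b + real n))"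
        by (intro arg_cong[of _ _ prod_list] map_cong refl) auto
      also have "\<dots> = poch_ratio ps n * Q" unfolding Q_def by (rule Gamma_quotient_poch_ratio[OF pos])
      finally have "K * (x ^ n / fact n * f (False, real n + 1)) = (K * of_real Q) * (of_real (poch_ratio ps n) / fact n * x ^ n)" by simp
      thus ?thesis by (simp only: KQ mult_1_left)
    qed
    have "(\<lambda>n. K * (x ^ n / fact n * f (False, real n + 1))) sums (K * J x)"
      unfolding J_def \<phi>_def by (intro sums_mult B.exp_transform_sums)
    hence "(\<lambda>n. of_real (poch_ratio ps n) / fact n * x ^ n) sums (K * J x)" unfolding eq .
    with hs show ?thesis by (rule sums_unique2)
  qed
  have "hyp_pairs ps x = K * G 0 x + exp x * (K * - G 1 x)" if x: "x \<in> sec" for x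
  proof -
    obtain b where b: "x \<in> U b" using branch[OF x] by blast
    show ?thesis unfolding hyp J[OF b] using G[of 0 x b] G[of 1 x b] b by (simp add: algebra_simps)
  qed
  ultimately show ?thesis unfolding expandable_def using gevrey_cmult[OF _ KH]
    by - (rule exI[of _ "\<lambda>x. K * G 0 x"], rule exI[of _ "\<lambda>x. K * - G 1 x"], blast)
qed

lemma expandable_hyp_pairs:
  assumes \<theta>: "\<theta> \<noteq> 0" "4 * \<epsilon> \<le> \<bar>\<theta>\<bar>" "4 * \<epsilon> \<le> pi - \<bar>\<theta>\<bar>" and ps: "lattice_pairs q ps"
  shows "expandable (hyp_pairs ps)"
proof (rule hyp_pairs_raising_induct[where P = expandable, OF q _ _ ps])
  fix f g h :: "complex \<Rightarrow> complex" and K :: real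
  assume fg: "expandable f" "expandable g" and K: "K \<in> \<rat>" and h: "\<And>x. h x = f x + of_real K * (x * g x)"
  have "complex_of_real K \<in> H_ring" using K by (intro H_ring_Rats) (auto elim!: Rats_cases')
  from expandable_step[OF fg this h] show "expandable h" .
next
  fix ps assume ps: "lattice_pairs q ps" "\<forall>(a, b)\<in>set ps. a \<ge> 2 \<and> b - a \<ge> 2"
  show "expandable (hyp_pairs ps)"
  proof (cases "ps = []")
    case True
    have "hyp_pairs [] x = exp x" for x
      using exp_converges[of x] by (simp add: hyp_pairs_def sums_iff scaleR_conv_of_real divide_inverse)
    hence "hyp_pairs ps = exp" unfolding True by blast
    thus ?thesis by (simp add: expandable_exp)
  next
    case False
    show ?thesis by (rule expandable_base[OF \<theta> False]) (use ps in \<open>auto simp: lattice_pairs_def\<close>)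
  qed
qed

end

section \<open>Passage to the given parameters\<close>

lemma common_denominator:
  assumes "\<forall>x\<in>set xs. x \<in> (\<rat> :: real set)"
  shows "\<exists>q>0. \<forall>x\<in>set xs. x * real q \<in> \<int>"
  using assms
proof (induction xs)
  case (Cons x xs)
  then obtain q where q: "q > 0" "\<forall>y\<in>set xs. y * real q \<in> \<int>" by auto
  obtain m n where x: "x = of_int m / real n" "n > 0" using Cons.prems by (auto simp: Rats_eq_int_div_nat)
  have "x * real (q * n) \<in> \<int>" using x by simp
  moreover have "y * real (q * n) \<in> \<int>" if "y \<in> set xs" for y
    using Ints_mult[of "y * real q" "real n"] q(2) that by (simp add: mult_ac)
  ultimately show ?case using q(1) x(2) by (intro exI[of _ "q * n"]) auto
qed auto

lemma hypergeometric_eq_hyp_pairs: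
  assumes "length as = length bs" "set as \<subseteq> \<rat>" "set bs \<subseteq> \<rat>"
  shows "hypergeometric as bs x = hyp_pairs (zip (map Re as) (map Re bs)) x"
proof -
  have r: "a = of_real (Re a)" if "a \<in> (\<rat> :: complex set)" for a using that by (auto elim!: Rats_cases')
  have "(\<Prod>a\<leftarrow>as. pochhammer a n) / (\<Prod>b\<leftarrow>bs. pochhammer b n) = complex_of_real (poch_ratio (zip (map Re as) (map Re bs)) n)" for n
    using assms
  proof (induction as bs rule: list_induct2)
    case (Cons a as b bs)
    have "pochhammer a n = of_real (pochhammer (Re a) n)" "pochhammer b n = of_real (pochhammer (Re b) n)"
      using r[of a] r[of b] Cons.prems by (metis insert_subset list.simps(15) pochhammer_of_real)+
    thus ?case using Cons by (simp flip: times_divide_times_eq)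
  qed simp
  note quot = this
  have "(\<Prod>a\<leftarrow>as. pochhammer a n) / (pochhammer 1 n * (\<Prod>b\<leftarrow>bs. pochhammer b n)) =
     complex_of_real (poch_ratio (zip (map Re as) (map Re bs)) n) / fact n" for n
    unfolding quot[symmetric] by (simp add: pochhammer_fact[symmetric] mult.commute)
  thus ?thesis unfolding hypergeometric_altdef hyp_pairs_def by simp
qed

theorem proposition2:
  fixes p :: nat and \<theta> :: real and as bs :: "complex list"
  assumes "p \<ge> 1"
    and "\<theta> \<in> {-pi<..<pi} - {0}"
    and "length as = p" and "set as \<subseteq> \<rat>"
    and "length bs = p" and "set bs \<subseteq> \<rat> - \<int>\<^sub>\<le>\<^sub>0"
  shows "\<exists>\<Sigma> S T c.
    has_asymp_expansion (hypergeometric as bs) \<theta> \<Sigma> S T c \<and>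
    \<Sigma> \<subseteq> {0, 1} \<and> S \<subseteq> \<rat> \<and> finite S \<and> finite T \<and>
    (\<forall>\<rho>\<in>\<Sigma>. \<forall>\<alpha>\<in>S. \<forall>i\<in>T. \<forall>n. c \<rho> \<alpha> i n \<in> H_ring)"
proof -
  define ps where "ps = zip (map Re as) (map Re bs)"
  \<comment> \<open>A quarter of the distance from \<theta> to the nearest of 0, \<pi> and -\<pi>,
    so that the angles \<open>\<theta> + 2 * \<epsilon>\<close> and
    \<open>\<theta> - 2 * \<epsilon>\<close> stay on the same side of the real axis.\<close>
  define \<epsilon> where "\<epsilon> = min \<bar>\<theta>\<bar> (pi - \<bar>\<theta>\<bar>) / 4"
  have \<theta>: "\<theta> \<noteq> 0" "- pi < \<theta>" "\<theta> < pi" using assms(2) by auto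
  have eps: "0 < \<epsilon>" "\<epsilon> < pi / 2" "4 * \<epsilon> \<le> \<bar>\<theta>\<bar>" "4 * \<epsilon> \<le> pi - \<bar>\<theta>\<bar>" using \<theta> by (auto simp: \<epsilon>_def)
  have rat: "Re x \<in> \<rat>" if "x \<in> \<rat>" for x using that by (auto elim!: Rats_cases')
  have "\<forall>x\<in>set (map Re as @ map Re bs). x \<in> \<rat>" using rat assms(4,6) by auto
  then obtain q where den: "q > 0" "\<forall>x\<in>set (map Re as @ map Re bs). x * real q \<in> \<int>" using common_denominator by blast
  interpret sector \<theta> \<epsilon> q using eps den by unfold_locales
  have nonpos: "Re b \<notin> \<int>\<^sub>\<le>\<^sub>0" if "b \<in> \<rat> - \<int>\<^sub>\<le>\<^sub>0" for b
  proof
    assume "Re b \<in> \<int>\<^sub>\<le>\<^sub>0"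
    moreover have "b = of_real (Re b)" using that by (auto elim!: Rats_cases')
    ultimately have "b \<in> \<int>\<^sub>\<le>\<^sub>0" by (metis of_real_in_nonpos_Ints_iff)
    thus False using that by simp
  qed
  have mem: "a \<in> Re ` set as \<and> b \<in> Re ` set bs" if "(a, b) \<in> set ps" for a b
    using set_zip_leftD[OF that[unfolded ps_def]] set_zip_rightD[OF that[unfolded ps_def]] by simp
  have "a * real q \<in> \<int> \<and> b * real q \<in> \<int> \<and> b \<notin> \<int>\<^sub>\<le>\<^sub>0" if "(a, b) \<in> set ps" for a b
    using mem[OF that] den(2) nonpos assms(6) by (auto simp del: of_nat_mult)
  hence "lattice_pairs q ps" unfolding lattice_pairs_def by blast
  hence "expandable (hyp_pairs ps)" by (rule expandable_hyp_pairs[OF \<theta>(1) eps(3,4)])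
  moreover have "hypergeometric as bs = hyp_pairs ps"
    unfolding ps_def using assms by (intro ext hypergeometric_eq_hyp_pairs) auto
  ultimately show ?thesis using expandable_imp_asymp_expansion[of "hyp_pairs ps"] by simp
qed

end
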